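(* Let $m>\frac{5}{2}$ be an integer and let $(u^{\mathrm{in}},b^{\mathrm{in}})\in H^{m}(\mathbb{R}^{3})\times H^{m}(\mathbb{R}^{3})$ with $\nabla\cdot u^{\mathrm{in}}=\nabla\cdot b^{\mathrm{in}}=0$. Suppose $(u,b)$ is a local smooth solution over $[0,T)$ of the 3-D Hall-MHD system \[ \partial_t u+(u\cdot\nabla)u+\nabla\pi=\Delta u+(b\cdot\nabla)b,\qquad \partial_t b+(u\cdot\nabla)b+\nabla\times(j\times b)=\Delta b+(b\cdot\nabla)u,\qquad \nabla\cdot u=0, \] where $j=\nabla\times b$, emanating from $(u^{\mathrm{in}},b^{\mathrm{in}})$. If \[ u_h\in L^{r_1}_T L^{p_1}_x \ \text{ with } \frac{3}{p_1}+\frac{2}{r_1}\le 1,\ 3<p_1\le\infty, \qquad \nabla^2 b_h\in L^{r_2}_T L^{p_2}_x \ \text{ with } \frac{3}{p_2}+\frac{2}{r_2}\le 2,\ 2\le p_2\le 3, \] then for all $t\in[0,T]$, $\|u(t)\|_{H^m}+\|b(t)\|_{H^m}<\infty$.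
   Context: Here $u:\mathbb{R}_{\ge0}\times\mathbb{R}^3\to\mathbb{R}^3$ is the velocity, $b:\mathbb{R}_{\ge0}\times\mathbb{R}^3\to\mathbb{R}^3$ the magnetic field, $\pi$ the pressure. For a vector $f=(f_1,f_2,f_3)$, $f_h\triangleq(f_1,f_2,0)$ and $f_v\triangleq(0,0,f_3)$. $L^r_TL^p_x$ denotes $L^r(0,T;L^p(\mathbb{R}^3))$. *)

theory Defs
  imports "HOL-Analysis.Analysis" "HOL-Analysis.Cross3" "HOL-Probability.Essential_Supremum"
begin

type_synonym R3 = "real^3"

definition pd :: "3 \<Rightarrow> (R3 \<Rightarrow> 'a::real_normed_vector) \<Rightarrow> R3 \<Rightarrow> 'a" where
  "pd i f x = vector_derivative (\<lambda>s. f (x + s *\<^sub>R axis i 1)) (at 0)"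

definition pds :: "3 list \<Rightarrow> (R3 \<Rightarrow> 'a::real_normed_vector) \<Rightarrow> R3 \<Rightarrow> 'a" where
  "pds is f = foldr pd is f"

definition dalpha :: "(3 \<Rightarrow> nat) \<Rightarrow> (R3 \<Rightarrow> 'a::real_normed_vector) \<Rightarrow> R3 \<Rightarrow> 'a" where
  "dalpha \<alpha> f = pds (replicate (\<alpha> 1) 1 @ replicate (\<alpha> 2) 2 @ replicate (\<alpha> 3) 3) f"

definition C_inf :: "(R3 \<Rightarrow> 'a::real_normed_vector) \<Rightarrow> bool" where
  "C_inf f \<longleftrightarrow> (\<forall>is. continuous_on UNIV (pds is f) \<and>
      (\<forall>i x. (\<lambda>s. pds is f (x + s *\<^sub>R axis i 1)) differentiable (at 0)))"

definition test_fun :: "(R3 \<Rightarrow> real) \<Rightarrow> bool" where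
  "test_fun \<phi> \<longleftrightarrow> C_inf \<phi> \<and> (\<exists>R. \<forall>x. norm x > R \<longrightarrow> \<phi> x = 0)"

definition dst :: "3 option \<Rightarrow> (real \<Rightarrow> R3 \<Rightarrow> 'a::real_normed_vector) \<Rightarrow> real \<Rightarrow> R3 \<Rightarrow> 'a" where
  "dst d u t x = (case d of None \<Rightarrow> vector_derivative (\<lambda>s. u s x) (at t)
                           | Some i \<Rightarrow> pd i (u t) x)"

definition dsts :: "3 option list \<Rightarrow> (real \<Rightarrow> R3 \<Rightarrow> 'a::real_normed_vector) \<Rightarrow> real \<Rightarrow> R3 \<Rightarrow> 'a" where
  "dsts ds u = foldr dst ds u"

definition smooth_slab :: "real \<Rightarrow> (real \<Rightarrow> R3 \<Rightarrow> 'a::real_normed_vector) \<Rightarrow> bool" where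
  "smooth_slab T u \<longleftrightarrow> (\<forall>ds.
     continuous_on ({0<..<T} \<times> UNIV) (\<lambda>(t,x). dsts ds u t x) \<and>
     (\<forall>t\<in>{0<..<T}. \<forall>x. (\<lambda>s. dsts ds u s x) differentiable (at t) \<and>
        (\<forall>i. (\<lambda>s. dsts ds u t (x + s *\<^sub>R axis i 1)) differentiable (at 0))))"

text \<open>L^p(M) with p in [1,infinity] (as ereal); vector-valued functions use the Euclidean norm.\<close>
definition in_Lp :: "'a measure \<Rightarrow> ereal \<Rightarrow> ('a \<Rightarrow> 'b::real_normed_vector) \<Rightarrow> bool" where
  "in_Lp M p g \<longleftrightarrow> g \<in> borel_measurable M \<and>
     (if p = \<infinity> then (\<exists>C. AE x in M. norm (g x) \<le> C)
      else integrable M (\<lambda>x. norm (g x) powr real_of_ereal p))"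

definition Lp_norm :: "'a measure \<Rightarrow> ereal \<Rightarrow> ('a \<Rightarrow> 'b::real_normed_vector) \<Rightarrow> real" where
  "Lp_norm M p g = (if p = \<infinity> then real_of_ereal (esssup M (\<lambda>x. ereal (norm (g x))))
      else (\<integral>x. norm (g x) powr real_of_ereal p \<partial>M) powr (1 / real_of_ereal p))"

definition L2 :: "(R3 \<Rightarrow> 'a::{real_normed_vector,second_countable_topology}) \<Rightarrow> bool" where
  "L2 f \<longleftrightarrow> f \<in> borel_measurable lborel \<and> integrable lborel (\<lambda>x. (norm (f x))\<^sup>2)"

definition weak_deriv :: "(3 \<Rightarrow> nat) \<Rightarrow> (R3 \<Rightarrow> R3) \<Rightarrow> (R3 \<Rightarrow> R3) \<Rightarrow> bool" where
  "weak_deriv \<alpha> f g \<longleftrightarrow> (\<forall>\<phi>. test_fun \<phi> \<longrightarrow>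
     (\<integral>x. dalpha \<alpha> \<phi> x *\<^sub>R f x \<partial>lborel) = (-1) ^ (sum \<alpha> UNIV) *\<^sub>R (\<integral>x. \<phi> x *\<^sub>R g x \<partial>lborel))"

definition in_Hm :: "nat \<Rightarrow> (R3 \<Rightarrow> R3) \<Rightarrow> bool" where
  "in_Hm m f \<longleftrightarrow> L2 f \<and> (\<forall>\<alpha>::3\<Rightarrow>nat. sum \<alpha> UNIV \<le> m \<longrightarrow> (\<exists>g. L2 g \<and> weak_deriv \<alpha> f g))"

definition wd :: "(3 \<Rightarrow> nat) \<Rightarrow> (R3 \<Rightarrow> R3) \<Rightarrow> R3 \<Rightarrow> R3" where
  "wd \<alpha> f = (SOME g. L2 g \<and> weak_deriv \<alpha> f g)"

definition Hm_norm :: "nat \<Rightarrow> (R3 \<Rightarrow> R3) \<Rightarrow> real" where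
  "Hm_norm m f = sqrt (\<Sum>\<alpha>\<in>{\<alpha>::3\<Rightarrow>nat. sum \<alpha> UNIV \<le> m}. \<integral>x. (norm (wd \<alpha> f x))\<^sup>2 \<partial>lborel)"

definition weakly_div_free :: "(R3 \<Rightarrow> R3) \<Rightarrow> bool" where
  "weakly_div_free f \<longleftrightarrow> (\<forall>\<phi>. test_fun \<phi> \<longrightarrow>
     (\<integral>x. (\<Sum>i\<in>UNIV. pd i \<phi> x * f x $ i) \<partial>lborel) = 0)"

definition LrLp :: "ereal \<Rightarrow> ereal \<Rightarrow> real \<Rightarrow> (real \<Rightarrow> R3 \<Rightarrow> 'b::real_normed_vector) \<Rightarrow> bool" where
  "LrLp r p T f \<longleftrightarrow> (AE t in restrict_space lborel {0<..<T}. in_Lp lborel p (f t)) \<and>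
     in_Lp (restrict_space lborel {0<..<T}) r (\<lambda>t. Lp_norm lborel p (f t))"

definition grad :: "(R3 \<Rightarrow> real) \<Rightarrow> R3 \<Rightarrow> R3" where
  "grad f x = (\<chi> i. pd i f x)"

definition div3 :: "(R3 \<Rightarrow> R3) \<Rightarrow> R3 \<Rightarrow> real" where
  "div3 f x = (\<Sum>i\<in>UNIV. pd i (\<lambda>y. f y $ i) x)"

definition curl :: "(R3 \<Rightarrow> R3) \<Rightarrow> R3 \<Rightarrow> R3" where
  "curl f x = vector [pd 2 (\<lambda>y. f y $ 3) x - pd 3 (\<lambda>y. f y $ 2) x,
                      pd 3 (\<lambda>y. f y $ 1) x - pd 1 (\<lambda>y. f y $ 3) x,
                      pd 1 (\<lambda>y. f y $ 2) x - pd 2 (\<lambda>y. f y $ 1) x]"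

definition lap :: "(R3 \<Rightarrow> R3) \<Rightarrow> R3 \<Rightarrow> R3" where
  "lap f x = (\<Sum>i\<in>UNIV. pd i (pd i f) x)"

definition conv :: "(R3 \<Rightarrow> R3) \<Rightarrow> (R3 \<Rightarrow> R3) \<Rightarrow> R3 \<Rightarrow> R3" where
  "conv v w x = (\<Sum>i\<in>UNIV. v x $ i *\<^sub>R pd i w x)"

text \<open>Full Hessian nabla^2 f, as a 3x3 array of vectors (norm = Frobenius-type Euclidean norm).\<close>
definition hess :: "(R3 \<Rightarrow> R3) \<Rightarrow> R3 \<Rightarrow> R3^3^3" where
  "hess f x = (\<chi> i j. pd i (pd j f) x)"

definition horiz :: "R3 \<Rightarrow> R3" where
  "horiz v = vector [v $ 1, v $ 2, 0]"

definition time_deriv :: "(real \<Rightarrow> R3 \<Rightarrow> R3) \<Rightarrow> real \<Rightarrow> R3 \<Rightarrow> R3" where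
  "time_deriv u t x = vector_derivative (\<lambda>s. u s x) (at t)"

definition hall_mhd_local_smooth_solution ::
  "nat \<Rightarrow> real \<Rightarrow> (R3 \<Rightarrow> R3) \<Rightarrow> (R3 \<Rightarrow> R3) \<Rightarrow> (real \<Rightarrow> R3 \<Rightarrow> R3) \<Rightarrow> (real \<Rightarrow> R3 \<Rightarrow> R3)
     \<Rightarrow> (real \<Rightarrow> R3 \<Rightarrow> real) \<Rightarrow> bool" where
  "hall_mhd_local_smooth_solution m T uin bin u b \<pi> \<longleftrightarrow>
     smooth_slab T u \<and> smooth_slab T b \<and> smooth_slab T \<pi> \<and>
     u 0 = uin \<and> b 0 = bin \<and>
     (\<forall>t\<in>{0..<T}. in_Hm m (u t) \<and> in_Hm m (b t)) \<and>
     (\<forall>t\<in>{0..<T}. ((\<lambda>s. Hm_norm m (\<lambda>x. u s x - u t x)) \<longlongrightarrow> 0) (at t within {0..<T}) \<and>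
                  ((\<lambda>s. Hm_norm m (\<lambda>x. b s x - b t x)) \<longlongrightarrow> 0) (at t within {0..<T})) \<and>
     (\<forall>t\<in>{0<..<T}. \<forall>x.
        time_deriv u t x + conv (u t) (u t) x + grad (\<pi> t) x
          = lap (u t) x + conv (b t) (b t) x \<and>
        time_deriv b t x + conv (u t) (b t) x
          + curl (\<lambda>y. cross3 (curl (b t) y) (b t y)) x
          = lap (b t) x + conv (b t) (u t) x \<and>
        div3 (u t) x = 0)"

end

theory Submission
imports Defs
begin

text \<open>Energy method. The \<open>L\<^sup>2\<close> law holds level by level: the velocity enters level \<open>k + 1\<close> through its curl, which
removes the pressure, and the Hall term loses its top order because \<open>j \<times> b\<close> is orthogonal to \<open>j\<close>. At levels 1 and 2 every
remaining term contains a horizontal factor controlled by \<open>u\<^sub>h\<close> or \<open>\<nabla>\<^sup>2 b\<^sub>h\<close>; at higher levels the lower ones suffice.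
The growth rate is integrable in time, so every level stays bounded up to \<open>T\<close>.\<close>

type_synonym scalar = "R3 => real"
type_synonym label = "bool\<times>3 list\<times>3\<times>3"

abbreviation lborel_integral :: "('a::euclidean_space => real) => real" (binder "LI " 10) where "lborel_integral f == integral\<^sup>L lborel f"
abbreviation lborel_nn_integral :: "('a::euclidean_space => ennreal) => ennreal" (binder "NI " 10) where "lborel_nn_integral f == nn_integral lborel f"
abbreviation sum_UNIV :: "('a => 'b::comm_monoid_add) => 'b" (binder "SU " 10) where "sum_UNIV f == sum f UNIV"
abbreviation IB :: "('a::euclidean_space => 'b::{banach,second_countable_topology}) => bool" where "IB f == integrable lborel f"
abbreviation BM :: "('a::topological_space => 'b::topological_space) => bool" where "BM f == f : borel_measurable borel"
abbreviation SI :: "'a::euclidean_space set => ('a => real) => real" where "SI A f == LI x. indicator A x*f x"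
abbreviation SIB :: "'a::euclidean_space set => ('a => real) => bool" where "SIB A f == IB (%x. indicator A x*f x)"
abbreviation LIMSEQ :: "(nat => 'a::topological_space) => 'a => bool" (infixr "---->" 60) where "LIMSEQ X L == (X \<longlongrightarrow> L) sequentially"
abbreviation slab :: "real => (real\<times>R3) set" where "slab T == {0<..<T}\<times>UNIV"
notation abs ("<|_|>")

lemmas integral_sum = Bochner_Integration.integral_sum and integrable_sum = Bochner_Integration.integrable_sum
 and integrable_bound = Bochner_Integration.integrable_bound and integral_cong = Bochner_Integration.integral_cong
 and integral_add = Bochner_Integration.integral_add and integral_diff = Bochner_Integration.integral_diff
 and integrable_add = Bochner_Integration.integrable_add and integrable_diff = Bochner_Integration.integrable_diff

definition C1 :: "scalar => bool" where
 "C1 f \<longleftrightarrow> continuous_on UNIV f & (ALL i. continuous_on UNIV (pd i f) &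
 (ALL x. (%s. f (x+s *\<^sub>R axis i 1)) differentiable (at 0)))"

lemma pdI:
 fixes f :: "scalar"
 assumes "((%s. f (x+s *\<^sub>R axis i 1)) has_real_derivative D) (at 0)"
 shows "pd i f x = D"
 unfolding pd_def using assms by (intro vector_derivative_at) (simp add: has_real_derivative_iff_has_vector_derivative)

lemma C1_has_pd0:
 assumes "C1 f"
 shows "((%s. f (x+s *\<^sub>R axis i 1)) has_real_derivative pd i f x) (at 0)"
 using assms unfolding C1_def pd_def has_real_derivative_iff_has_vector_derivative by (metis vector_derivative_works)

lemma C1_has_pd:
 assumes "C1 f"
 shows "((%s. f (x+s *\<^sub>R axis i 1)) has_real_derivative pd i f (x+s0 *\<^sub>R axis i 1)) (at s0)"
proof -
 have "((%s. f ((x+s0 *\<^sub>R axis i 1)+s *\<^sub>R axis i 1)) has_real_derivative pd i f (x+s0 *\<^sub>R axis i 1)) (at 0)"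
  by (rule C1_has_pd0[OF assms])
 moreover have "(%s. f ((x+s0 *\<^sub>R axis i 1)+s *\<^sub>R axis i 1)) = (%s. f (x+(s+s0) *\<^sub>R axis i 1))"
  by (simp add: scaleR_add_left algebra_simps)
 ultimately show ?thesis using DERIV_shift[of "%s. f (x+s *\<^sub>R axis i 1)" "pd i f (x+s0 *\<^sub>R axis i 1)" 0 s0] by simp
qed

lemma C1I:
 assumes "continuous_on UNIV f" "!!i. continuous_on UNIV (g i)"
 and "!!i x. ((%s. f (x+s *\<^sub>R axis i 1)) has_real_derivative g i x) (at 0)"
 shows "C1 f" "pd i f = g i"
proof -
 show *: "pd i f = g i" for i using pdI[OF assms(3)] by auto
 show "C1 f" unfolding C1_def using assms * by (auto intro!: differentiableI simp: has_field_derivative_def)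
qed

lemma C1_cont: "C1 f ==> continuous_on UNIV f"
 and C1_cont_pd: "C1 f ==> continuous_on UNIV (pd i f)"
 by (auto simp: C1_def)

lemma C1_add: "C1 f ==> C1 g ==> C1 (%x. f x+g x)"
 and pd_add: "C1 f ==> C1 g ==> pd i (%x. f x+g x) = (%x. pd i f x+pd i g x)"
 by (rule C1I[where g="%i x. pd i f x+pd i g x"];
 auto intro!: continuous_intros derivative_eq_intros C1_has_pd0 simp: C1_cont C1_cont_pd)+

lemma C1_diff: "C1 f ==> C1 g ==> C1 (%x. f x-g x)"
 and pd_diff: "C1 f ==> C1 g ==> pd i (%x. f x-g x) = (%x. pd i f x-pd i g x)"
 by (rule C1I[where g="%i x. pd i f x-pd i g x"];
 auto intro!: continuous_intros derivative_eq_intros C1_has_pd0 simp: C1_cont C1_cont_pd)+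

lemma C1_const: "C1 (%x. c)"
 and pd_const: "pd i (%x. c::real) = (%x. 0)"
 by (rule C1I[where g="%i x. 0"]; auto)+

lemma C1_mult: "C1 f ==> C1 g ==> C1 (%x. f x*g x)"
 and pd_mult: "C1 f ==> C1 g ==> pd i (%x. f x*g x) = (%x. pd i f x*g x+f x*pd i g x)"
proof -
 assume *: "C1 f" "C1 g"
 have "((%s. f (x+s *\<^sub>R axis i 1)*g (x+s *\<^sub>R axis i 1)) has_real_derivative
  pd i f x*g x+f x*pd i g x) (at 0)" for i x
  using DERIV_mult[OF C1_has_pd0[OF *(1), of x i] C1_has_pd0[OF *(2), of x i]] by (simp add: algebra_simps)
 note R = C1I[where f="%x. f x*g x" and g="%i x. pd i f x*g x+f x*pd i g x", OF _ _ this]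
 show "C1 (%x. f x*g x)"
  by (rule R) (auto intro!: continuous_intros C1_cont[OF *(1)] C1_cont[OF *(2)] C1_cont_pd[OF *(1)] C1_cont_pd[OF *(2)])
 show "pd i (%x. f x*g x) = (%x. pd i f x*g x+f x*pd i g x)"
  by (rule R(2)) (auto intro!: continuous_intros C1_cont[OF *(1)] C1_cont[OF *(2)] C1_cont_pd[OF *(1)] C1_cont_pd[OF *(2)])
qed

lemma C1_compose:
 assumes f: "C1 f" and h: "!!y. (h has_real_derivative h' y) (at y)" "continuous_on UNIV h'"
 shows "C1 (%x. h (f x))" "pd i (%x. h (f x)) = (%x. h' (f x)*pd i f x)"
proof -
 have hc: "continuous_on UNIV h" using h(1) by (meson DERIV_isCont continuous_at_imp_continuous_on)
 have "((%s. h (f (x+s *\<^sub>R axis i 1))) has_real_derivative h' (f x)*pd i f x) (at 0)" for i x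
  using DERIV_chain2[where f=h and g="%s. f (x+s *\<^sub>R axis i 1)", OF _ C1_has_pd0[OF f, of x i]] h(1)[of "f x"] by simp
 note R = C1I[where f="%x. h (f x)" and g="%i x. h' (f x)*pd i f x", OF _ _ this]
 show "C1 (%x. h (f x))" by (rule R) (auto intro!: continuous_intros C1_cont[OF f] C1_cont_pd[OF f]
  continuous_on_compose2[OF hc] continuous_on_compose2[OF h(2)])
 show "pd i (%x. h (f x)) = (%x. h' (f x)*pd i f x)"
  by (rule R(2)) (auto intro!: continuous_intros C1_cont[OF f] C1_cont_pd[OF f]
  continuous_on_compose2[OF hc] continuous_on_compose2[OF h(2)])
qed

lemma C1_cmult: "C1 f ==> C1 (%x. c*f x)"
 and pd_cmult: "C1 f ==> pd i (%x. c*f x) = (%x. c*pd i f x)"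
 using C1_mult[OF C1_const, of f c] pd_mult[OF C1_const, of f i c] by (auto simp: pd_const)

lemma C1_uminus: "C1 f ==> C1 (%x. - f x)"
 and pd_uminus: "C1 f ==> pd i (%x. - f x) = (%x. - pd i f x)"
 using C1_cmult[of f "-1"] pd_cmult[of f i "-1"] by auto

lemma C1_sum: "(!!a. a:A ==> C1 (f a)) ==> C1 (%x. SUM a:A. f a x)"
 and pd_sum: "(!!a. a:A ==> C1 (f a)) ==> pd i (%x. SUM a:A. f a x) = (%x. SUM a:A. pd i (f a) x)"
proof (induction A rule: infinite_finite_induct)
 case (insert a A)
 { case 1 thus ?case using insert by (auto intro!: C1_add) }
 { case 2 thus ?case using insert by (simp add: pd_add) }
qed (auto simp: C1_const pd_const)

lemma C1_power: "C1 f ==> C1 (%x. f x^n)"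
 and pd_power: "C1 f ==> pd i (%x. f x^n) = (%x. real n*f x^(n-1)*pd i f x)"
 by (rule C1_compose[where h="%y. y^n" and h'="%y. real n*y^(n-1)"];
 auto intro!: derivative_eq_intros continuous_intros)+

lemma pds_Nil [simp]: "pds [] f = f"
 and pds_Cons: "pds (i # is) f = pd i (pds is f)"
 and pds_append: "pds (is @ js) f = pds is (pds js f)"
 by (auto simp: pds_def)

lemma C_inf_C1s: "C_inf f ==> C1 (pds is f)" unfolding C_inf_def C1_def by (metis pds_Cons)

lemma C_inf_C1: "C_inf f ==> C1 f" using C_inf_C1s[of f "[]"] by simp

lemma C_inf_iff: "C_inf f \<longleftrightarrow> (ALL is. C1 (pds is f))" unfolding C_inf_def C1_def by (metis pds_Cons)

lemma C_inf_pds: "C_inf f ==> C_inf (pds is f::scalar)" by (simp add: C_inf_iff pds_append[symmetric])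

lemma C_inf_pd: "C_inf f ==> C_inf (pd i f::scalar)" using C_inf_pds[of f "[i]"] by (simp add: pds_Cons)

lemma C_inf_coinduct:
 assumes "P f" "!!g. P g ==> C1 g" "!!g i. P g ==> P (pd i g)"
 shows "C_inf f"
proof -
 have "P (pds is f)" for "is" by (induction "is") (auto simp: assms pds_Cons)
 thus ?thesis using assms(2) by (simp add: C_inf_iff)
qed

 inductive pd_algebra :: "(scalar => bool) => scalar => bool" for P where
 generator: "P f ==> pd_algebra P f"
 | const: "pd_algebra P (%x. c)"
 | add: "pd_algebra P f ==> pd_algebra P g ==> pd_algebra P (%x. f x+g x)"
 | mult: "pd_algebra P f ==> pd_algebra P g ==> pd_algebra P (%x. f x*g x)"

lemma pd_algebra_C_inf:
 assumes f: "pd_algebra P f" and gen: "!!f. P f ==> C1 f & (ALL i. pd_algebra P (pd i f))"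
 shows "C_inf f"
proof (rule C_inf_coinduct[where P="pd_algebra P", OF f])
 have "C1 g & (ALL i. pd_algebra P (pd i g))" if "pd_algebra P g" for g using that
 proof induction
  case (const c)
  show ?case by (simp add: C1_const pd_const pd_algebra.const)
 next
  case (add f g)
  hence "pd_algebra P (%x. pd i f x+pd i g x)" for i by (intro pd_algebra.add) auto
  thus ?case using add by (simp add: pd_add C1_add)
 next
  case (mult f g)
  hence "pd_algebra P (%x. pd i f x*g x+f x*pd i g x)" for i by (intro pd_algebra.add pd_algebra.mult) auto
  thus ?case using mult by (simp add: pd_mult C1_mult)
 qed (rule gen)
 thus "C1 g" "pd_algebra P (pd i g)" if "pd_algebra P g" for g i using that by auto
qed

lemma C_inf_add: "C_inf (f::scalar) ==> C_inf g ==> C_inf (%x. f x+g x)"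
 and C_inf_mult: "C_inf f ==> C_inf g ==> C_inf (%x. f x*g x)"
 by (rule pd_algebra_C_inf[where P=C_inf]; auto intro: pd_algebra.intros C_inf_C1 C_inf_pd)+

lemma C_inf_const: "C_inf (%x. c::real)"
 by (rule C_inf_coinduct[where P="%f. EX c. f = (%x. c)"]) (auto simp: C1_const pd_const)

lemma C_inf_cmult: "C_inf (f::scalar) ==> C_inf (%x. (c::real)*f x)" by (rule C_inf_mult[OF C_inf_const])

lemma C_inf_uminus: "C_inf f ==> C_inf (%x. - (f x::real))" using C_inf_cmult[of f "-1"] by simp

lemma C_inf_diff: "C_inf f ==> C_inf g ==> C_inf (%x. f x-(g x::real))" using C_inf_add[OF _ C_inf_uminus, of f g] by simp

lemma C_inf_sum: "(!!a. a:A ==> C_inf (f a)) ==> C_inf (%x. SUM a:A. f a x::real)"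
 by (induction A rule: infinite_finite_induct) (auto intro!: C_inf_add C_inf_const)


lemma pds_add: "C_inf (f::scalar) ==> C_inf g ==> pds is (%x. f x+g x) = (%x. pds is f x+pds is g x)"
 by (induction "is") (auto simp: pds_Cons pd_add C_inf_C1s)

lemma pds_diff: "C_inf (f::scalar) ==> C_inf g ==> pds is (%x. f x-g x) = (%x. pds is f x-pds is g x)"
 by (induction "is") (auto simp: pds_Cons pd_diff C_inf_C1s)

lemma pds_cmult: "C_inf (f::scalar) ==> pds is (%x. c*f x) = (%x. c*pds is f x)"
 by (induction "is") (auto simp: pds_Cons pd_cmult C_inf_C1s)

lemma pds_sum: "(!!a. a:A ==> C_inf (f a::scalar)) ==> pds is (%x. SUM a:A. f a x) = (%x. SUM a:A. pds is (f a) x)"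
 by (induction "is") (auto simp: pds_Cons pd_sum C_inf_C1s)

lemma mixed_difference_mean_value:
 fixes g :: "real => real => real"
 assumes h: "h > 0"
 and g1: "!!s r. s:{0..h} ==> r:{0..h} ==> ((%s. g s r) has_real_derivative g1 s r) (at s)"
 and g12: "!!s r. s:{0..h} ==> r:{0..h} ==> ((%r. g1 s r) has_real_derivative g12 s r) (at r)"
 obtains x y where "0 < x" "x < h" "0 < y" "y < h" "g h h-g h 0-(g 0 h-g 0 0) = h*(h*g12 x y)"
proof -
 have "((%s. g s h-g s 0) has_real_derivative (g1 s h-g1 s 0)) (at s)" if "0 <= s" "s <= h" for s
  using that h by (intro DERIV_diff g1) auto
 from MVT2[OF h this] obtain x where x: "0 < x" "x < h" "g h h-g h 0-(g 0 h-g 0 0) = (h-0)*(g1 x h-g1 x 0)" by blast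
 have "((%r. g1 x r) has_real_derivative g12 x r) (at r)" if "0 <= r" "r <= h" for r using that h x by (intro g12) auto
 from MVT2[OF h this] obtain y where "0 < y" "y < h" "g1 x h-g1 x 0 = (h-0)*g12 x y" by blast
 thus thesis using x that[of x y] by simp
qed

lemma mixed_derivatives_eq:
 fixes g :: "real => real => real"
 assumes d: "\<delta> > 0"
 and g1: "!!s r. <|s|> < \<delta> ==> <|r|> < \<delta> ==> ((%s. g s r) has_real_derivative g1 s r) (at s)"
 and g2: "!!s r. <|s|> < \<delta> ==> <|r|> < \<delta> ==> ((%r. g s r) has_real_derivative g2 s r) (at r)"
 and g12: "!!s r. <|s|> < \<delta> ==> <|r|> < \<delta> ==> ((%r. g1 s r) has_real_derivative g12 s r) (at r)"
 and g21: "!!s r. <|s|> < \<delta> ==> <|r|> < \<delta> ==> ((%s. g2 s r) has_real_derivative g21 s r) (at s)"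
 and c12: "isCont (%(s, r). g12 s r) (0, 0)" and c21: "isCont (%(s, r). g21 s r) (0, 0)"
 shows "g12 0 0 = g21 0 0"
proof -
 have near: "dist (s, r) (0, 0) < 2*h" if "0 < s" "s < h" "0 < r" "r < h" for s r h :: real
  using sqrt_sum_squares_le_sum[of s r] that by (simp add: dist_Pair_Pair)
 have "<|g12 0 0-g21 0 0|> <= \<epsilon>" if e: "\<epsilon> > 0" for \<epsilon>
 proof -
  obtain a where a: "a > 0" "!!s r. dist (s, r) (0, 0) < a ==> dist (g12 s r) (g12 0 0) < \<epsilon>/2"
   using c12[unfolded continuous_at_eps_delta, rule_format, of "\<epsilon>/2"] e by (metis case_prod_conv half_gt_zero)
  obtain b where b: "b > 0" "!!s r. dist (s, r) (0, 0) < b ==> dist (g21 s r) (g21 0 0) < \<epsilon>/2"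
   using c21[unfolded continuous_at_eps_delta, rule_format, of "\<epsilon>/2"] e by (metis case_prod_conv half_gt_zero)
  define h where "h = min (\<delta>/2) (min (a/2) (b/2))"
  have h: "0 < h" "h < \<delta>" "2*h <= a" "2*h <= b" using d a(1) b(1) by (auto simp: h_def)
  obtain x y where xy: "0 < x" "x < h" "0 < y" "y < h" "g h h-g h 0-(g 0 h-g 0 0) = h*(h*g12 x y)"
   by (rule mixed_difference_mean_value[OF h(1), of g g1 g12]) (use h g1 g12 in auto)
  obtain y' x' where xy': "0 < y'" "y' < h" "0 < x'" "x' < h" "g h h-g 0 h-(g h 0-g 0 0) = h*(h*g21 x' y')"
   by (rule mixed_difference_mean_value[OF h(1), of "%r s. g s r" "%r s. g2 s r" "%r s. g21 s r"]) (use h g2 g21 in auto)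
  have "h*(h*g12 x y) = h*(h*g21 x' y')" using xy(5) xy'(5) by linarith
  hence "g12 x y = g21 x' y'" using h by simp
  moreover have "dist (g12 x y) (g12 0 0) < \<epsilon>/2" "dist (g21 x' y') (g21 0 0) < \<epsilon>/2"
   using a(2)[of x y] b(2)[of x' y'] near[OF xy(1-4)] near[OF xy'(3,4,1,2)] h by linarith+
  ultimately show ?thesis unfolding dist_real_def by linarith
 qed
 from this[of "<|g12 0 0-g21 0 0|>/2"] show ?thesis by (cases "g12 0 0 = g21 0 0") auto
qed

lemma pd_commute:
 assumes f: "C_inf (f::scalar)"
 shows "pd i (pd j f) = pd j (pd i f)"
proof
 fix x
 let ?p = "%s r. x+s *\<^sub>R axis i 1+r *\<^sub>R axis j (1::real)"
 have C: "C1 f" "C1 (pd i f)" "C1 (pd j f)" using f by (auto intro: C_inf_C1 C_inf_pd)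
 have cont: "isCont (%(s, r). h (?p s r)) (0, 0)" if "continuous_on UNIV h" for h :: "scalar" unfolding split_beta
  by (rule continuous_at_compose[unfolded o_def, where g=h])
  (use that in "auto intro!: continuous_intros simp: continuous_on_eq_continuous_at")
 have "pd j (pd i f) (?p 0 0) = pd i (pd j f) (?p 0 0)"
 proof (rule mixed_derivatives_eq[where \<delta>=1 and g="%s r. f (?p s r)"
   and ?g1.0="%s r. pd i f (?p s r)" and ?g2.0="%s r. pd j f (?p s r)"
   and ?g12.0="%s r. pd j (pd i f) (?p s r)" and ?g21.0="%s r. pd i (pd j f) (?p s r)"])
  show "((%s. f (?p s r)) has_real_derivative pd i f (?p s r)) (at s)" for s r
   using C1_has_pd[OF C(1), of "x+r *\<^sub>R axis j 1" i s] by (simp add: add_ac)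
  show "((%r. f (?p s r)) has_real_derivative pd j f (?p s r)) (at r)" for s r by (rule C1_has_pd[OF C(1)])
  show "((%r. pd i f (?p s r)) has_real_derivative pd j (pd i f) (?p s r)) (at r)" for s r by (rule C1_has_pd[OF C(2)])
  show "((%s. pd j f (?p s r)) has_real_derivative pd i (pd j f) (?p s r)) (at s)" for s r
   using C1_has_pd[OF C(3), of "x+r *\<^sub>R axis j 1" i s] by (simp add: add_ac)
  show "isCont (%(s, r). pd j (pd i f) (?p s r)) (0, 0)" by (rule cont[OF C1_cont_pd[OF C(2)]])
  show "isCont (%(s, r). pd i (pd j f) (?p s r)) (0, 0)" by (rule cont[OF C1_cont_pd[OF C(3)]])
 qed simp
 thus "pd i (pd j f) x = pd j (pd i f) x" by simp
qed

lemma pds_pd_commute: "C_inf (f::scalar) ==> pds is (pd i f) = pd i (pds is f)"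
proof (induction "is")
 case (Cons j "is")
 thus ?case using pd_commute[OF C_inf_pds[OF Cons.prems, of "is"], of j i] by (simp add: pds_Cons)
qed simp

lemma pds_remove1:
 "C_inf (f::scalar) ==> i:set is ==> pds is f = pd i (pds (remove1 i is) f)"
proof (induction "is")
 case (Cons j "is")
 show ?case
 proof (cases "j = i")
  case False
  hence "pds is f = pd i (pds (remove1 i is) f)" using Cons by auto
  thus ?thesis using pd_commute[OF C_inf_pds[OF Cons.prems(1), of "remove1 i is"], of j i] False by (simp add: pds_Cons)
 qed (simp add: pds_Cons)
qed simp

lemma pds_mset: "C_inf (f::scalar) ==> mset is = mset js ==> pds is f = pds js f"
proof (induction "is" arbitrary: js)
 case (Cons i "is")
 have i: "i:set js" using Cons.prems(2) by (metis list.set_intros(1) set_mset_mset)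
 have m: "mset is = mset (remove1 i js)" using Cons.prems(2)[symmetric] by simp
 from Cons.IH[OF Cons.prems(1) m] show ?case using pds_remove1[OF Cons.prems(1) i] by (simp add: pds_Cons)
qed simp

definition expinv :: "nat => real => real" where
 "expinv n t = (if t > 0 then exp (- (1/t))/t^n else 0)"

lemma expinv_nonneg: "0 <= expinv n t" by (simp add: expinv_def)

lemma expinv_0_le_1: "expinv 0 t <= 1" by (simp add: expinv_def)

lemma expinv_tendsto_0: "(expinv n \<longlongrightarrow> 0) (at 0)"
proof -
 have "((%t. (inverse t)^n/exp (inverse t)) \<longlongrightarrow> (0::real)) (at_right 0)"
  by (rule filterlim_compose[OF tendsto_power_div_exp_0 filterlim_inverse_at_top_right])
 moreover have "eventually (%t. (inverse t)^n/exp (inverse t) = expinv n t) (at_right (0::real))"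
  by (auto simp: eventually_at_filter expinv_def exp_minus field_simps)
 ultimately have "(expinv n \<longlongrightarrow> 0) (at_right 0)" by (rule Lim_transform_eventually)
 moreover have "(expinv n \<longlongrightarrow> 0) (at_left 0)" by (rule tendsto_eventually) (auto simp: eventually_at_filter expinv_def)
 ultimately show ?thesis by (simp add: filterlim_at_split)
qed

lemma expinv_DERIV:
 "(expinv n has_real_derivative expinv (n+2) t-real n*expinv (n+1) t) (at t)"
proof -
 consider "t > 0" | "t < 0" | "t = 0" by linarith
 thus ?thesis
 proof cases
  case 1
  have "((%t. exp (- (1/t))/t^n) has_real_derivative expinv (n+2) t-real n*expinv (n+1) t) (at t)"
   using 1 by (cases n) (auto intro!: derivative_eq_intros simp: expinv_def field_simps power2_eq_square,
   metis One_nat_def power_eq_if mult.commute)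
  thus ?thesis by (rule has_field_derivative_transform_within_open[where S="{0<..}"]) (use 1 in "auto simp: expinv_def")
 next
  case 2
  have "((%t. 0::real) has_real_derivative 0) (at t)" by simp
  hence "(expinv n has_real_derivative 0) (at t)"
   by (rule has_field_derivative_transform_within_open[where S="{..<0}"]) (use 2 in "auto simp: expinv_def")
  thus ?thesis using 2 by (simp add: expinv_def)
 next
  case 3
  have "((%h. (expinv n (0+h)-expinv n 0)/h) \<longlongrightarrow> 0) (at 0)"
  proof (rule Lim_transform_eventually[OF expinv_tendsto_0[of "n+1"]])
   show "\<forall>\<^sub>F x in at 0. expinv (n+1) x = (expinv n (0+x)-expinv n 0)/x"
    by (auto simp: eventually_at_filter expinv_def field_simps)
  qed
  thus ?thesis using 3 unfolding DERIV_def by (simp add: expinv_def)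
 qed
qed

lemma continuous_on_expinv: "continuous_on UNIV (expinv n)"
 using expinv_DERIV by (meson DERIV_isCont continuous_at_imp_continuous_on)

lemma C1_affine_component: "C1 (%x. c+a*x $ i)"
 and pd_affine_component: "pd j (%x. c+a*x $ i) = (%x. if i = j then a else 0)"
proof -
 have "((%s. c+a*(x+s *\<^sub>R axis j 1) $ i) has_real_derivative (if i = j then a else 0)) (at 0)" for j x
  by (auto intro!: derivative_eq_intros simp: axis_def)
 note R = C1I[where f="%x. c+a*x $ i" and g="%j x. if i = j then a else 0", OF _ _ this]
 show "C1 (%x. c+a*x $ i)" by (rule R) (auto intro!: continuous_intros)
 show "pd j (%x. c+a*x $ i) = (%x. if i = j then a else 0)" by (rule R(2)) (auto intro!: continuous_intros)
qed

definition profile :: "scalar => bool" where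
 "profile f \<longleftrightarrow> (EX n c a i. f = (%x. expinv n (c+a*x $ i)))"

lemma profile_closed: assumes "profile f" shows "C1 f & (ALL j. pd_algebra profile (pd j f))"
proof -
 obtain n c a i where f: "f = (%x. expinv n (c+a*x $ i))" using assms by (auto simp: profile_def)
 have "continuous_on UNIV (%t. expinv (n+2) t-real n*expinv (n+1) t)" by (intro continuous_intros continuous_on_expinv)
 note R = C1_compose[where h="expinv n", OF C1_affine_component[of c a i] expinv_DERIV this]
 have g: "pd_algebra profile (%x. expinv k (c+a*x $ i))" for k by (rule pd_algebra.generator) (auto simp: profile_def)
 have "pd_algebra profile (%x. (expinv (n+2) (c+a*x $ i)+(- real n)*expinv (n+1) (c+a*x $ i))*(if i = j then a else 0))" for j
  by (intro pd_algebra.add pd_algebra.mult pd_algebra.const g)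
 thus ?thesis using R by (simp add: f pd_affine_component)
qed

lemma pd_algebra_profile: "pd_algebra profile (%x. expinv n (c+a*x $ i))"
 by (rule pd_algebra.generator) (auto simp: profile_def)

lemma C_inf_prod_profile:
 assumes "!!i. i:A ==> pd_algebra profile (f i)" shows "C_inf (%x. PROD i:A. f i x)"
proof -
 have "pd_algebra profile (%x. PROD i:A. f i x)" using assms
  by (induction A rule: infinite_finite_induct) (auto intro: pd_algebra.const pd_algebra.mult)
 thus ?thesis by (rule pd_algebra_C_inf) (rule profile_closed)
qed

definition box_bump :: "nat => R3 => R3 => scalar" where
 "box_bump n a b x = (PROD i:UNIV. expinv 0 (- real n*a $ i+real n*x $ i)*expinv 0 (real n*b $ i+- real n*x $ i))"

lemma C_inf_box_bump: "C_inf (box_bump n a b)"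
 unfolding box_bump_def by (intro C_inf_prod_profile pd_algebra.mult pd_algebra_profile)

lemma box_bump_bounds: "0 <= box_bump n a b x" "box_bump n a b x <= 1" unfolding box_bump_def
 by (auto intro!: prod_nonneg prod_le_1 mult_nonneg_nonneg mult_le_one simp: expinv_nonneg expinv_0_le_1)

lemma box_bump_support: "x ~: box a b ==> box_bump n a b x = 0"
proof -
 assume "x ~: box a b"
 then obtain i where "~(a $ i < x $ i & x $ i < b $ i)" by (auto simp: mem_box_cart)
 hence "- real n*a $ i+real n*x $ i <= 0 | real n*b $ i+- real n*x $ i <= 0" by (auto simp: not_less mult_left_mono)
 hence "EX i:UNIV. expinv 0 (- real n*a $ i+real n*x $ i)*expinv 0 (real n*b $ i+- real n*x $ i) = 0"
  by (intro bexI[of _ i]) (auto simp: expinv_def)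
 thus ?thesis unfolding box_bump_def by (intro prod_zero) auto
qed

lemma test_fun_box_bump: "test_fun (box_bump n a b)"
proof -
 obtain R where R: "!!x. x:box a b ==> norm x <= R" using bounded_box[of a b] unfolding bounded_iff by auto
 hence "ALL x. norm x > R --> box_bump n a b x = 0" using box_bump_support by (meson not_less)
 thus ?thesis unfolding test_fun_def using C_inf_box_bump by auto
qed

lemma expinv_scaled_tendsto: "(%n. expinv 0 (real n*t)) ----> (if t > 0 then 1 else 0)"
proof (cases "t > 0")
 case True
 have "(%n. 1/real n*(1/t)) ----> 0*(1/t)" by (intro tendsto_intros lim_1_over_n)
 hence "(%n. exp (- (1/real n*(1/t)))) ----> exp (- 0)" by (intro tendsto_intros) auto
 moreover have "\<forall>\<^sub>F n in sequentially. exp (- (1/real n*(1/t))) = expinv 0 (real n*t)"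
  using eventually_gt_at_top[of 0] by eventually_elim (use True in "auto simp: expinv_def")
 ultimately have "(%n. expinv 0 (real n*t)) ----> exp (- 0)" by (rule Lim_transform_eventually)
 thus ?thesis using True by simp
next
 case False
 hence "expinv 0 (real n*t) = 0" for n by (auto simp: expinv_def zero_less_mult_iff)
 thus ?thesis using False by simp
qed

lemma box_bump_tendsto: "(%n. box_bump n a b x) ----> indicator (box a b) x"
proof -
 let ?signs = "PROD i:UNIV. (if x $ i-a $ i > 0 then 1 else 0)*(if b $ i-x $ i > 0 then 1 else 0)"
 have "(%n. PROD i:UNIV. expinv 0 (real n*(x $ i-a $ i))*expinv 0 (real n*(b $ i-x $ i)))
  ----> ?signs"
  by (intro tendsto_intros expinv_scaled_tendsto)
 moreover have "?signs = (indicator (box a b) x::real)"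
 proof (cases "x:box a b")
  case False
  then obtain i where "~(a $ i < x $ i & x $ i < b $ i)" by (auto simp: mem_box_cart)
  thus ?thesis using False by (subst prod_zero) (auto intro!: bexI[of _ i])
 qed (auto simp: mem_box_cart indicator_def)
 ultimately show ?thesis unfolding box_bump_def by (simp add: algebra_simps)
qed

definition cutoff :: "real => scalar" where
 "cutoff R x = (PROD i:UNIV. exp 2*(expinv 0 (1+(1/R)*x $ i)*expinv 0 (1+(- (1/R))*x $ i)))"

lemma C_inf_cutoff: "C_inf (cutoff R)"
 unfolding cutoff_def by (intro C_inf_prod_profile pd_algebra.mult pd_algebra.const pd_algebra_profile)

lemma cutoff_scale_le_1: "exp 2*(expinv 0 (1+t)*expinv 0 (1+- t)) <= 1"
proof (cases "1+t > 0 & 1+- t > 0")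
 case True
 hence p: "(1+t)*(1-t) > 0" by simp
 have "1/(1+t)+1/(1-t) = 2/((1+t)*(1-t))" using True by (simp add: field_simps)
 also have "... >= 2" using p by (simp add: field_simps)
 finally have "2-1/(1+t)-1/(1-t) <= 0" by simp
 hence "exp (2-1/(1+t)-1/(1-t)) <= 1" by simp
 thus ?thesis using True by (simp add: expinv_def exp_diff exp_minus divide_inverse mult.assoc)
next
 case False
 hence "expinv 0 (1+t)*expinv 0 (1+- t) = 0" by (auto simp: expinv_def)
 thus ?thesis by (simp only: mult_zero_right zero_le_one)
qed

lemma cutoff_bounds: "0 <= cutoff R x" "cutoff R x <= 1"
proof -
 show "0 <= cutoff R x" unfolding cutoff_def by (auto intro!: prod_nonneg simp: expinv_nonneg)
 show "cutoff R x <= 1" unfolding cutoff_def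
  using cutoff_scale_le_1[of "1/R*x $ i" for i] by (auto intro!: prod_le_1 simp: expinv_nonneg)
qed

lemma cutoff_support: assumes "R > 0" "norm x > 3*R" shows "cutoff R x = 0"
proof -
 have "EX i. <|x $ i|> >= R"
 proof (rule ccontr)
  assume "~?thesis"
  hence "(SU i. <|x $ i|>) <= (SU i::3. R)" by (intro sum_mono) (simp add: not_le less_imp_le)
  thus False using norm_le_l1_cart[of x] assms by simp
 qed
 then obtain i where i: "<|x $ i|> >= R" ..
 have "1+(1/R)*x $ i <= 0 | 1+(- (1/R))*x $ i <= 0" using i assms(1) by (auto simp: field_simps abs_if split: if_splits)
 hence "EX i:UNIV. exp 2*(expinv 0 (1+(1/R)*x $ i)*expinv 0 (1+(- (1/R))*x $ i)) = 0"
  by (intro bexI[of _ i]) (auto simp: expinv_def)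
 thus ?thesis unfolding cutoff_def by (intro prod_zero) auto
qed

lemma test_fun_cutoff: "R > 0 ==> test_fun (cutoff R)" unfolding test_fun_def using C_inf_cutoff cutoff_support by blast

lemma cutoff_scale: "cutoff R x = cutoff 1 (x /\<^sub>R R)" by (simp add: cutoff_def divide_inverse)

lemma pd_scale:
 assumes "C1 f" shows "C1 (%x. f (c *\<^sub>R x))" "pd i (%x. f (c *\<^sub>R x)) = (%x. c*pd i f (c *\<^sub>R x))"
proof -
 let ?q0 = "%x. c *\<^sub>R x"
 have "((%s. f (c *\<^sub>R x+(c * s) *\<^sub>R axis i 1)) has_real_derivative pd i f (c *\<^sub>R x+(c*0) *\<^sub>R axis i 1)*c) (at 0)" for i x
  by (rule DERIV_chain2[where f="%s. f (c *\<^sub>R x+s *\<^sub>R axis i 1)" and g="%s. c * s", OF C1_has_pd[OF assms]])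
  (auto intro!: derivative_eq_intros)
 hence "((%s. f (c *\<^sub>R (x+s *\<^sub>R axis i 1))) has_real_derivative c*pd i f (?q0 x)) (at 0)" for i x
  by (simp add: scaleR_add_right mult.commute)
 note R = C1I[where f="%x. f (?q0 x)" and g="%i x. c*pd i f (?q0 x)", OF _ _ this]
 note c = continuous_on_compose2[OF C1_cont[OF assms]] continuous_on_compose2[OF C1_cont_pd[OF assms]]
 show "C1 (%x. f (?q0 x))" by (rule R) (auto intro!: continuous_intros c)
 show "pd i (%x. f (?q0 x)) = (%x. c*pd i f (?q0 x))" by (rule R(2)) (auto intro!: continuous_intros c)
qed

lemma pd_cutoff: "pd i (cutoff R) x = pd i (cutoff 1) (x /\<^sub>R R)/R"
proof -
 have "cutoff R = (%x. cutoff 1 (inverse R *\<^sub>R x))" using cutoff_scale by auto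
 thus ?thesis using pd_scale(2)[OF C_inf_C1[OF C_inf_cutoff[of 1]], of i "inverse R"]
  by (simp add: divide_inverse mult.commute)
qed

lemma pd_outside:
 fixes f :: "scalar"
 assumes "!!x. norm x > R ==> f x = 0" "norm x > R"
 shows "pd i f x = 0"
proof (rule pdI)
 have "\<forall>\<^sub>F s in nhds (0::real). norm (x+s *\<^sub>R axis i 1) > R"
 proof (rule order_tendstoD(1)[where y="norm (x+0 *\<^sub>R axis i (1::real))"])
  show "((%s. norm (x+s *\<^sub>R axis i 1)) \<longlongrightarrow> norm (x+0 *\<^sub>R axis i (1::real))) (nhds 0)"
   by (intro tendsto_intros) (simp add: tendsto_ident_at filterlim_ident)
 qed (use assms in simp)
 hence "\<forall>\<^sub>F s in nhds (0::real). f (x+s *\<^sub>R axis i 1) = 0" by eventually_elim (use assms in auto)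
 thus "((%s. f (x+s *\<^sub>R axis i 1)) has_real_derivative 0) (at 0)"
  by (subst DERIV_cong_ev[OF refl _ refl, where g="%_. 0"]) auto
qed

lemma compact_support_bounded:
 fixes f :: "scalar"
 assumes "continuous_on UNIV f" "!!x. norm x > R ==> f x = 0"
 obtains K where "K >= 0" "!!x. <|f x|> <= K"
proof -
 have "bounded (f ` cball 0 R)"
  by (intro compact_imp_bounded compact_continuous_image) (use assms in "auto intro: continuous_on_subset")
 then obtain K where "ALL x:cball 0 R. <|f x|> <= K" by (auto simp: bounded_iff)
 hence K: "!!x. norm x <= R ==> <|f x|> <= K" by simp
 have "<|f x|> <= max K 0" for x using K[of x] assms(2)[of x] by (cases "norm x <= R") auto
 thus thesis using that[of "max K 0"] by auto
qed

lemma pd_cutoff_bound: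
 obtains K where "K >= 0" "!!R i x. R > 0 ==> <|pd i (cutoff R) x|> <= K/R" "!!R i x. R > 0 ==> norm x*<|pd i (cutoff R) x|> <= K"
proof -
 have z: "pd i (cutoff 1) x = 0" if "norm x > 3" for i x by (rule pd_outside[OF _ that]) (use cutoff_support[of 1] in auto)
 have "EX K>=0. ALL x. <|pd i (cutoff 1) x|> <= K" for i by (rule compact_support_bounded[where f="pd i (cutoff 1)" and R=3])
  (use z C1_cont_pd[OF C_inf_C1[OF C_inf_cutoff]] in auto)
 then obtain K where K: "!!i. K i >= 0" "!!i x. <|pd i (cutoff 1) x|> <= K i" by metis
 define L where "L = sum K UNIV"
 have L: "<|pd i (cutoff 1) x|> <= L" "L >= 0" for i x
  using K(2)[of i x] member_le_sum[of i UNIV K] K(1) by (auto simp: L_def intro: sum_nonneg order_trans)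
 have "<|pd i (cutoff R) x|> <= 3*L/R" if "R > 0" for R i x
  unfolding pd_cutoff[of i R] using L(1)[of i "x /\<^sub>R R"] L(2) that by (simp add: field_simps)
 moreover have "norm x*<|pd i (cutoff R) x|> <= 3*L" if R: "R > 0" for R i x
 proof (cases "norm (x /\<^sub>R R) <= 3")
  case True
  hence "norm x/R*<|pd i (cutoff 1) (x /\<^sub>R R)|> <= 3*L" using L R by (intro mult_mono) (auto simp: divide_inverse mult.commute)
  thus ?thesis unfolding pd_cutoff[of i R] using R by simp
 qed (use z L in "simp add: pd_cutoff[of i R]")
 ultimately show thesis using L by (intro that[of "3*L"]) auto
qed

lemma C1_cutoff: "C1 (cutoff R)" by (rule C_inf_C1[OF C_inf_cutoff])

definition chi :: "nat => scalar" where "chi n = cutoff (real (Suc n))"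

lemma chi_bounds: "0 <= chi n x" "chi n x <= 1" by (simp_all add: chi_def cutoff_bounds)

lemma chi_support: "norm x > 3*real (Suc n) ==> chi n x = 0" unfolding chi_def by (rule cutoff_support) auto

lemma C1_chi: "C1 (chi n)" and test_fun_chi: "test_fun (chi n)"
 by (simp_all add: chi_def C1_cutoff test_fun_cutoff del: of_nat_Suc)

lemma chi_tendsto: "(%n. chi n x) ----> 1"
proof -
 have "(%n. x /\<^sub>R real (Suc n)) ----> 0 *\<^sub>R x" by (intro tendsto_intros LIMSEQ_inverse_real_of_nat)
 hence "(%n. cutoff 1 (x /\<^sub>R real (Suc n))) ----> cutoff 1 0"
  using C1_cont[OF C1_cutoff] continuous_on_tendsto_compose[of UNIV "cutoff 1"] by auto
 moreover have "cutoff 1 0 = 1" by (simp add: cutoff_def expinv_def exp_add[symmetric] flip: exp_of_nat_mult)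
 ultimately show ?thesis by (simp add: chi_def cutoff_scale[of "real (Suc n)" for n] del: of_nat_Suc)
qed

lemma pd_chi_bound:
 obtains K where "K >= 0" "!!n i x. <|pd i (chi n) x|> <= K*inverse (real (Suc n))"
 "!!n i x. <|pd i (chi n) x|> <= K" "!!n i x. norm x*<|pd i (chi n) x|> <= K"
proof -
 obtain K where K: "K >= 0" "!!R i x. R > 0 ==> <|pd i (cutoff R) x|> <= K/R" "!!R i x. R > 0 ==> norm x*<|pd i (cutoff R) x|> <= K"
  using pd_cutoff_bound by blast
 have b: "<|pd i (chi n) x|> <= K*inverse (real (Suc n))" for n i x
  using K(2)[of "real (Suc n)" i x] by (simp add: chi_def divide_inverse del: of_nat_Suc)
 have "K*inverse (real (Suc n)) <= K*1" for n using K(1) by (intro mult_left_mono) (auto simp: inverse_le_1_iff)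
 hence "<|pd i (chi n) x|> <= K" for n i x using b[of i n x] order_trans by (metis mult.right_neutral)
 thus thesis using K(3)[of "real (Suc _)", folded chi_def] by (intro that[OF K(1) b]) (auto simp del: of_nat_Suc)
qed

lemma pd_chi_tendsto: "(%n. pd i (chi n) x) ----> 0"
proof -
 obtain K where K: "K >= 0" "!!n i x. <|pd i (chi n) x|> <= K*inverse (real (Suc n))" by (rule pd_chi_bound) blast
 show ?thesis
 proof (rule Lim_null_comparison[OF always_eventually])
  show "ALL n. norm (pd i (chi n) x) <= K*inverse (real (Suc n))" using K(2) by simp
  show "(%n. K*inverse (real (Suc n))) ----> 0" using tendsto_mult[OF tendsto_const LIMSEQ_inverse_real_of_nat, of K] by simp
 qed
qed

lemma integral_bounded_mult_tendsto:
 fixes f :: "'a => real"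
 assumes [measurable]: "!!n. w n:borel_measurable M" and b: "!!n x. <|w n x|> <= C"
 and l: "!!x. (%n. w n x) ----> c" and f: "integrable M f"
 shows "integrable M (%x. w n x*f x)" "(%n. \<integral>x. w n x*f x \<partial>M) ----> c*(\<integral>x. f x \<partial>M)" (is ?A)
proof -
 have [measurable]: "f:borel_measurable M" using f by auto
 have i: "integrable M (%x. C*<|f x|>)" using f by auto
 have bound: "norm (w n x*f x) <= C*<|f x|>" for n x using b by (simp add: abs_mult mult_right_mono)
 show "integrable M (%x. w n x*f x)"
  by (rule integrable_bound[OF i]) (use bound in "auto intro: order_trans[OF _ abs_ge_self]")
 have "(%n. \<integral>x. w n x*f x \<partial>M) ----> (\<integral>x. c*f x \<partial>M)"
  by (rule integral_dominated_convergence[OF _ _ i]) (auto intro!: AE_I2 tendsto_intros l bound[unfolded real_norm_def])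
 thus ?A by simp
qed

lemma integral_chi_tendsto:
 assumes "IB f"
 shows "(%n. LI x. chi n x*f x) ----> (LI x. f x)" "(%n. LI x. (chi n x)^2*f x) ----> (LI x. f x)"
proof -
 have [measurable]: "BM (chi n)" for n using borel_measurable_continuous_onI[OF C1_cont[OF C1_chi]] .
 have "<|chi n x|> <= 1" "<|(chi n x)^2|> <= 1" for n x using chi_bounds[of n x] by (auto simp: power_le_one)
 moreover have "(%n. (chi n x)^2) ----> 1" for x using tendsto_power[OF chi_tendsto[of x], of 2] by simp
 ultimately show "(%n. LI x. chi n x*f x) ----> (LI x. f x)" "(%n. LI x. (chi n x)^2*f x) ----> (LI x. f x)"
  using integral_bounded_mult_tendsto(2)[OF _ _ chi_tendsto assms, of "%x. x" 1] integral_bounded_mult_tendsto(2)[OF _ _ _ assms, of "%n x. (chi n x)^2" 1 1] by auto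
qed

lemma integral_pd_chi_tendsto:
 assumes "IB f"
 shows "IB (%x. pd i (chi n) x*f x)" "(%n. LI x. pd i (chi n) x*f x) ----> 0"
proof -
 obtain K where K: "K >= 0" "!!n i x. <|pd i (chi n) x|> <= K" by (rule pd_chi_bound) blast
 have m: "pd i (chi n):borel_measurable lborel" for n using borel_measurable_continuous_onI[OF C1_cont_pd[OF C1_chi]] by simp
 note R = integral_bounded_mult_tendsto[OF m K(2) pd_chi_tendsto assms]
 show "IB (%x. pd i (chi n) x*f x)" "(%n. LI x. pd i (chi n) x*f x) ----> 0" using R by auto
qed

lemma integrable_compact_support:
 fixes f :: "'a::euclidean_space => 'b::{banach,second_countable_topology}"
 assumes "continuous_on UNIV f" "!!x. norm x > R ==> f x = 0"
 shows "IB f"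
proof -
 have "IB (%x. indicator (cball 0 R) x *\<^sub>R f x)"
  by (rule borel_integrable_compact) (use assms in "auto intro: continuous_on_subset")
 moreover have "(%x. indicator (cball 0 R) x *\<^sub>R f x) = f" using assms(2) by (auto simp: indicator_def fun_eq_iff not_le)
 ultimately show ?thesis by simp
qed

lemma nn_integral_affine:
 fixes f :: "'a::euclidean_space => ennreal"
 assumes [measurable]: "BM f" and c: "c > 0"
 shows "ennreal (c^DIM('a))*(NI x. f (a+c *\<^sub>R x)) = (NI x. f x)"
proof -
 have "(NI x. f x) = (\<integral>\<^sup>+x. f x \<partial>density (distr lborel borel (%x. a+c *\<^sub>R x)) (%_. <|c|>^DIM('a)))"
  using lborel_affine[of c a] c by simp
 also have "... = ennreal (c^DIM('a))*(NI x. f (a+c *\<^sub>R x))"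
  using c by (simp add: nn_integral_density nn_integral_distr nn_integral_cmult)
 finally show ?thesis by simp
qed

lemma lborel_integral_affine:
 fixes f :: "'a::euclidean_space => real"
 assumes f: "IB f" and c: "c > 0"
 shows "IB (%x. f (a+c *\<^sub>R x))" "c^DIM('a)*(LI x. f (a+c *\<^sub>R x)) = (LI x. f x)" (is ?A)
proof -
 have [measurable]: "BM f" using f by auto
 have "integrable (density (distr lborel borel (%x. a+c *\<^sub>R x)) (%_. <|c|>^DIM('a))) f"  using f lborel_affine[of c a] c by simp
 thus "IB (%x. f (a+c *\<^sub>R x))" using c by (simp add: integrable_density integrable_distr_eq)
 have "(LI x. f x) = (\<integral>x. f x \<partial>density (distr lborel borel (%x. a+c *\<^sub>R x)) (%_. <|c|>^DIM('a)))"
  using lborel_affine[of c a] c by simp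
 thus ?A using c by (simp add: integral_density integral_distr)
qed

definition has_time_deriv :: "real => (real => scalar) => (real => scalar) => bool" where
 "has_time_deriv T v v' \<longleftrightarrow> (ALL t:{0<..<T}. ALL x. ((%s. v s x) has_real_derivative v' t x) (at t)) &
 continuous_on (slab T) (%(t, x). v t x) & continuous_on (slab T) (%(t, x). v' t x)"

lemma slab_continuous_slice:
 assumes G: "continuous_on (slab T) (%(t, x). G t x)" and t: "t:{0<..<T}"
 shows "continuous_on UNIV (G t)"
proof -
 have "continuous_on UNIV (%x. (%(t, x). G t x) (t, x))"
  by (rule continuous_on_compose2[OF G]) (use t in "auto intro!: continuous_intros")
 thus ?thesis by simp
qed

definition sym_cube :: "real => R3 set" where "sym_cube R = cbox (- (\<chi> i. <|R|>)) (\<chi> i. <|R|>)"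

lemma integral_sym_cube:
 fixes f :: "scalar"
 assumes "continuous_on UNIV f" "!!x. norm x > R ==> f x = 0"
 shows "(LI x. f x) = integral (sym_cube R) f"
proof -
 have z: "f x = 0" if "x ~: sym_cube R" for x
 proof (rule assms(2))
  from that obtain i where "~(- <|R|> <= x $ i & x $ i <= <|R|>)" unfolding sym_cube_def mem_box_cart by auto
  thus "norm x > R" using component_le_norm_cart[of x i] by linarith
 qed
 have I: "(f has_integral (LI x. f x)) UNIV" by (rule has_integral_integral_lborel[OF integrable_compact_support[OF assms]])
 have e: "(%x. if x:sym_cube R then f x else 0) = f" using z by auto
 have "(f has_integral (LI x. f x)) (sym_cube R)" by (subst has_integral_restrict_UNIV[symmetric], unfold e, rule I)
 thus ?thesis by (simp add: integral_unique)
qed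

lemma param_integral_continuous:
 assumes G: "continuous_on (slab T) (%(t, x). G t x)" and z: "!!t x. t:{0<..<T} ==> norm x > R ==> G t x = 0"
 shows "continuous_on {0<..<T} (%t. LI x. G t (x::R3))"
proof -
 have "continuous_on {0<..<T} (%t. integral (sym_cube R) (G t))" unfolding sym_cube_def
  by (rule integral_continuous_on_param) (rule continuous_on_subset[OF G], auto)
 thus ?thesis by (rule continuous_on_eq) (use integral_sym_cube[OF slab_continuous_slice[OF G] z] in auto)
qed

lemma param_integral_DERIV:
 assumes v: "has_time_deriv T v v'" and z: "!!t x. t:{0<..<T} ==> norm x > R ==> v t x = 0" "!!t x. t:{0<..<T} ==> norm x > R ==> v' t x = 0"
 and t: "t:{0<..<T}"
 shows "((%t. LI x. v t x) has_real_derivative (LI x. v' t x)) (at t)"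
proof -
 have c: "continuous_on (slab T) (%(t, x). v t x)" "continuous_on (slab T) (%(t, x). v' t x)"
  using v by (auto simp: has_time_deriv_def)
 have "((%t. integral (sym_cube R) (v t)) has_real_derivative integral (sym_cube R) (v' t)) (at t within {0<..<T})"
  unfolding sym_cube_def
 proof (rule leibniz_rule_field_derivative)
  show "((%t. v t x) has_real_derivative v' t x) (at t within {0<..<T})" if "t:{0<..<T}" for t x
   using v that by (auto simp: has_time_deriv_def intro: has_field_derivative_at_within)
  show "v t integrable_on cbox a b" if "t:{0<..<T}" for t a b
   by (rule integrable_continuous) (rule continuous_on_subset[OF slab_continuous_slice[OF c(1) that]], simp)
  show "continuous_on ({0<..<T}\<times>cbox a b) (%(t, x). v' t x)" for a b by (rule continuous_on_subset[OF c(2)]) auto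
 qed (use t in auto)
 hence "((%t. integral (sym_cube R) (v t)) has_real_derivative integral (sym_cube R) (v' t)) (at t)"
  using t by (simp add: at_within_open[of t "{0<..<T}"])
 hence "((%t. LI x. v t x) has_real_derivative integral (sym_cube R) (v' t)) (at t)"
  by (rule has_field_derivative_transform_within_open[where S="{0<..<T}"])
  (use t integral_sym_cube[OF slab_continuous_slice[OF c(1)] z(1)] in auto)
 thus ?thesis using integral_sym_cube[OF slab_continuous_slice[OF c(2) t] z(2)[OF t]] by simp
qed

lemma integral_pd_compact_support:
 assumes f: "C1 f" and s: "!!x. norm x > R ==> f x = 0"
 shows "(LI x. pd i f x) = 0"
proof -
 let ?e = "axis i 1::R3"
 have far: "norm (x+t *\<^sub>R ?e) > R" if "norm x > R+2" "0 < t" "t < 2" for x t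
  using norm_triangle_ineq4[of "x+t *\<^sub>R ?e" "t *\<^sub>R ?e"] that by (simp add: norm_axis_1)
 have v: "has_time_deriv 2 (%t x. f (x+t *\<^sub>R ?e)) (%t x. pd i f (x+t *\<^sub>R ?e))" unfolding has_time_deriv_def case_prod_unfold
  by (intro conjI ballI allI C1_has_pd[OF f] continuous_on_compose2[OF C1_cont[OF f]] continuous_on_compose2[OF C1_cont_pd[OF f]]) (auto intro!: continuous_intros)
 have t: "(LI x. g (x+t *\<^sub>R ?e)) = (LI x. g x)" if "IB g" for g :: "scalar" and t
  using lborel_integral_affine(2)[OF that, of 1 "t *\<^sub>R ?e"] by (simp add: add.commute)
 have "((%t. LI x. f (x+t *\<^sub>R ?e)) has_real_derivative (LI x. pd i f (x+1 *\<^sub>R ?e))) (at 1)"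
  by (rule param_integral_DERIV[OF v, of "R+2"]) (use far s pd_outside[OF s] in auto)
 hence "((%t. LI x. f x) has_real_derivative (LI x. pd i f x)) (at 1)"
  by (simp only: t[OF integrable_compact_support[OF C1_cont[OF f] s]] t[OF integrable_compact_support[OF C1_cont_pd[OF f] pd_outside[OF s]]])
 from DERIV_unique[OF this DERIV_const] show ?thesis .
qed

lemma test_fun_C1: "test_fun \<phi> ==> C1 \<phi>" by (simp add: test_fun_def C_inf_C1)

lemma integral_by_parts_test:
 assumes phi: "test_fun \<phi>" and f: "C1 f"
 shows "(LI x. \<phi> x*pd i f x) = - (LI x. pd i \<phi> x*f x)"
proof -
 obtain R where R: "!!x. norm x > R ==> \<phi> x = 0" using phi by (auto simp: test_fun_def)
 have C: "C1 \<phi>" using phi by (rule test_fun_C1)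
 have "(LI x. pd i (%x. \<phi> x*f x) x) = 0" by (rule integral_pd_compact_support[OF C1_mult[OF C f], of R]) (simp add: R)
 moreover have "IB (%x. pd i \<phi> x*f x)" "IB (%x. \<phi> x*pd i f x)" by (rule integrable_compact_support[where R=R];
  auto intro!: continuous_intros C1_cont[OF f] C1_cont[OF C] C1_cont_pd[OF C] C1_cont_pd[OF f]
  simp: R pd_outside[OF R])+
 ultimately show ?thesis by (simp add: pd_mult[OF C f])
qed

lemma integral_divergence_zero:
 assumes F: "!!i. C1 (F i)" "!!i::3. IB (F i)"
 and div: "IB (%x. SU i. pd i (F i) x)"
 shows "(LI x. (SU i. pd i (F i) x)) = 0"
proof -
 have "(LI x. chi n x*(SU i. pd i (F i) x)) = - (SU i. LI x. pd i (chi n) x*F i x)" for n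
 proof -
  have "IB (%x. chi n x*pd i (F i) x)" for i
   by (rule integrable_compact_support[where R="3*real (Suc n)"]) (auto intro!: continuous_intros C1_cont_pd[OF F(1)] C1_cont[OF C1_chi] simp: chi_support)
  hence "(LI x. chi n x*(SU i. pd i (F i) x)) = (SU i. LI x. chi n x*pd i (F i) x)" by (simp add: sum_distrib_left)
  thus ?thesis using integral_by_parts_test[OF test_fun_chi F(1)] by (simp add: sum_negf)
 qed
 moreover have "(%n. - (SU i. LI x. pd i (chi n) x*F i x)) ----> -(SU i::3. 0)"
  by (intro tendsto_intros integral_pd_chi_tendsto(2) F)
 ultimately show ?thesis using LIMSEQ_unique[OF integral_chi_tendsto(1)[OF div]] by simp
qed

lemma AE_box_zero:
 fixes g :: "'a::euclidean_space => real"
 assumes [measurable]: "g:borel_measurable lborel"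
 and loc: "!!a b. IB (%x. indicator (box a b) x*g x)"
 and z: "!!a b. (LI x. indicator (box a b) x*g x) = 0"
 shows "AE x in lborel. g x = 0"
proof -
 let ?D = "%s. density lborel (%x. ennreal (max 0 (s*g x)))" and ?E = "range (%(a, b). box a b)::'a set set"
 have i: "IB (%x. max 0 (s*(indicator (box a b) x*g x)))" for s a b using loc[of a b] by auto
 have e: "emeasure (?D s) (box a b) = ennreal (LI x. max 0 (s*(indicator (box a b) x*g x)))" for s a b
 proof -
  have "emeasure (?D s) (box a b) = (NI x. ennreal (max 0 (s*(indicator (box a b) x*g x))))"
   by (subst emeasure_density) (auto intro!: nn_integral_cong simp: indicator_def)
  thus ?thesis using nn_integral_eq_integral[OF i] by simp
 qed
 have pm: "(LI x. max 0 (1*(indicator (box a b) x*g x))) = (LI x. max 0 (-1*(indicator (box a b) x*g x)))" for a b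
 proof -
  have "(LI x. max 0 (1*(indicator (box a b) x*g x)))-(LI x. max 0 (-1*(indicator (box a b) x*g x))) = (LI x. indicator (box a b) x*g x)"
   unfolding integral_diff[OF i i, symmetric] by (intro integral_cong) auto
  thus ?thesis using z[of a b] by simp
 qed
 have s: "sets (?D s) = sigma_sets UNIV ?E" for s by (simp add: borel_eq_box sets_measure_of)
 have "?D 1 = ?D (-1)"
 proof (rule measure_eqI_generator_eq[of ?E UNIV _ _ "%n. box (- (real n *\<^sub>R One)) (real n *\<^sub>R One)"])
  show "Int_stable ?E" unfolding Int_stable_def by (auto simp: box_Int_box)
  show "emeasure (?D 1) X = emeasure (?D (-1)) X" if "X:?E" for X using that by (auto simp only: e pm)
  show "emeasure (?D 1) (box (- (real n *\<^sub>R One)) (real n *\<^sub>R One)) ~= \<infinity>" for n unfolding e by simp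
 qed (use s UN_box_eq_UNIV in auto)
 hence "AE x in lborel. ennreal (max 0 (1*g x)) = ennreal (max 0 (-1*g x))" by (intro sigma_finite_measure.density_unique[OF sigma_finite_lborel]) auto
 thus ?thesis by eventually_elim (auto simp: max_def split: if_splits)
qed

lemma Cauchy_Schwarz_dominated:
 fixes A B t :: "'a => ennreal"
 assumes [measurable]: "A:borel_measurable M" "B:borel_measurable M" "t:borel_measurable M"
 and bound: "!!x. (t x)^2 <= A x*B x"
 shows "(\<integral>\<^sup>+x. t x \<partial>M)^2 <= (\<integral>\<^sup>+x. A x \<partial>M)*(\<integral>\<^sup>+x. B x \<partial>M)"
proof -
 define r where "r a = (if a = \<infinity> then \<infinity> else ennreal (sqrt (enn2real a)))" for a :: ennreal
 have [measurable]: "BM r" unfolding r_def by measurable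
 have r: "(r a)^2 = a" for a by (cases a) (auto simp: r_def ennreal_power)
 have "x <= y" if "x^2 <= y^2" for x y :: ennreal
  using that by (cases x; cases y) (auto simp: ennreal_power top_unique dest: power2_le_imp_le)
 hence "t x <= r (A x)*r (B x)" for x using bound[of x] by (simp add: r power_mult_distrib)
 hence "(\<integral>\<^sup>+x. t x \<partial>M)^2 <= (\<integral>\<^sup>+x. r (A x)*r (B x) \<partial>M)^2" by (intro power_mono nn_integral_mono) auto
 also have "... <= (\<integral>\<^sup>+x. (r (A x))^2 \<partial>M)*(\<integral>\<^sup>+x. (r (B x))^2 \<partial>M)" by (intro Cauchy_Schwarz_nn_integral) auto
 finally show ?thesis by (simp add: r)
qed

lemma Cauchy_Schwarz_integral:
 fixes A B t :: "'a => real"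
 assumes iA: "integrable M A" and iB: "integrable M B" and t: "t:borel_measurable M"
 and A0: "!!x. 0 <= A x" and B0: "!!x. 0 <= B x" and bound: "!!x. (t x)^2 <= A x*B x"
 shows "integrable M t" "(\<integral>x. t x \<partial>M)^2 <= (\<integral>x. A x \<partial>M)*(\<integral>x. B x \<partial>M)" (is ?A)
proof -
 have "(t x)^2 <= (A x+B x)^2" for x
  using bound[of x] mult_nonneg_nonneg[OF A0 B0, of x x] zero_le_power2[of "A x"] zero_le_power2[of "B x"] unfolding power2_sum by linarith
 hence "<|t x|> <= <|A x+B x|>" for x by (simp add: abs_le_square_iff)
 thus it: "integrable M t" using integrable_bound[OF integrable_add[OF iA iB] t] by auto
 have "(\<integral>\<^sup>+x. ennreal <|t x|> \<partial>M)^2 <= (\<integral>\<^sup>+x. ennreal (A x) \<partial>M)*(\<integral>\<^sup>+x. ennreal (B x) \<partial>M)"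
  by (rule Cauchy_Schwarz_dominated) (use t iA iB bound A0 B0 in "auto simp: ennreal_power simp flip: ennreal_mult intro!: ennreal_leI")
 hence "(\<integral>x. <|t x|> \<partial>M)^2 <= (\<integral>x. A x \<partial>M)*(\<integral>x. B x \<partial>M)"
  using A0 B0 by (simp add: nn_integral_eq_integral it iA iB ennreal_power flip: ennreal_mult)
 moreover have "(\<integral>x. t x \<partial>M)^2 <= (\<integral>x. <|t x|> \<partial>M)^2"
  using integral_abs_bound[of M t] by (simp add: abs_le_square_iff[symmetric])
 ultimately show ?A by linarith
qed

lemma Cauchy_Schwarz_mult:
 fixes f g :: "'a => real"
 assumes "f:borel_measurable M" "g:borel_measurable M"
 and "integrable M (%x. (f x)^2)" "integrable M (%x. (g x)^2)"
 shows "integrable M (%x. f x*g x)"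
 "(\<integral>x. f x*g x \<partial>M)^2 <= (\<integral>x. (f x)^2 \<partial>M)*(\<integral>x. (g x)^2 \<partial>M)"
 using Cauchy_Schwarz_integral[of M "%x. (f x)^2" "%x. (g x)^2" "%x. f x*g x"] assms by (auto simp: power_mult_distrib)

lemma square_mult_square_le:
 fixes x y :: real assumes "0 <= x" shows "x^2*y^2 <= x^3+y^6" "x*y^4 <= x^3+y^6"
proof -
 define z where "z = max x (y^2)"
 have z: "x <= z" "y^2 <= z" "0 <= z" using assms by (auto simp: z_def)
 have "z^3 <= x^3+(y^2)^3" using assms by (simp add: z_def max_def)
 moreover have "x^2*y^2 <= z^2*z" "x*(y^2)^2 <= z*z^2" using z assms by (intro mult_mono power_mono; simp)+
 ultimately show "x^2*y^2 <= x^3+y^6" "x*y^4 <= x^3+y^6"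
  by (simp_all add: power3_eq_cube power2_eq_square mult.assoc eval_nat_numeral)
qed

lemma Hoelder_3_6:
 fixes w f :: "'a => real"
 assumes [measurable]: "w:borel_measurable M" "f:borel_measurable M" and w0: "!!x. 0 <= w x"
 and iw: "integrable M (%x. w x^3)" and i6: "integrable M (%x. f x^6)"
 shows "integrable M (%x. (w x)^2*(f x)^2)"
 "(\<integral>x. (w x)^2*(f x)^2 \<partial>M)^3 <= (\<integral>x. w x^3 \<partial>M)^2*(\<integral>x. f x^6 \<partial>M)" (is ?A)
proof -
 have i: "integrable M (%x. w x^3+f x^6)" using iw i6 by auto
 show iX: "integrable M (%x. (w x)^2*(f x)^2)" by (rule integrable_bound[OF i]) (use square_mult_square_le[OF w0] w0 in auto)
 have iY: "integrable M (%x. w x*f x^4)"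
  by (rule integrable_bound[OF i]) (use square_mult_square_le[OF w0] w0 in "auto simp: abs_mult")
 define X Y W F where "X = (\<integral>x. (w x)^2*(f x)^2 \<partial>M)" and "Y = (\<integral>x. w x*f x^4 \<partial>M)"
  and "W = (\<integral>x. w x^3 \<partial>M)" and "F = (\<integral>x. f x^6 \<partial>M)"
 have n: "X >= 0" "Y >= 0" "W >= 0" "F >= 0" unfolding X_def Y_def W_def F_def using w0 by auto
 have e: "((w x)^2*(f x)^2)^2 = w x^3*(w x*f x^4)" "(w x*f x^4)^2 = (w x)^2*(f x)^2*f x^6" for x
  by (simp_all add: eval_nat_numeral mult_ac)
 have XW: "X^2 <= W*Y" unfolding X_def Y_def W_def by (rule Cauchy_Schwarz_integral(2)[OF iw iY]) (use w0 in "auto simp: e")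
 have YX: "Y^2 <= X*F" unfolding X_def Y_def F_def by (rule Cauchy_Schwarz_integral(2)[OF iX i6]) (use w0 in "auto simp: e")
 have "X*X^3 = (X^2)^2" by (simp add: eval_nat_numeral)
 also have "... <= (W*Y)^2" using XW by (intro power_mono) auto
 also have "... = W^2*Y^2" by (simp add: power_mult_distrib)
 also have "... <= W^2*(X*F)" using YX by (intro mult_left_mono) auto
 finally have "X*X^3 <= X*(W^2*F)" by (simp add: algebra_simps)
 hence "X^3 <= W^2*F" using n by (cases "X = 0") auto
 thus ?A by (simp add: X_def W_def F_def)
qed

lemma sigma_finite_lborel2: "sigma_finite_measure (lborel \<Otimes>\<^sub>M lborel::(real\<times>real) measure)"
 by (simp add: lborel_prod sigma_finite_lborel)

lemma Loomis_Whitney: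
 fixes F1 F2 F3 :: "real\<times>real => ennreal" and t :: "real => real => real => ennreal"
 assumes [measurable]: "F1:borel_measurable (lborel \<Otimes>\<^sub>M lborel)" "F2:borel_measurable (lborel \<Otimes>\<^sub>M lborel)" "F3:borel_measurable (lborel \<Otimes>\<^sub>M lborel)"
 and t: "(%(x, y, z). t x y z):borel_measurable (lborel \<Otimes>\<^sub>M lborel \<Otimes>\<^sub>M lborel)"
 and bound: "!!x y z. (t x y z)^2 <= F1 (y, z)*(F2 (x, z)*F3 (x, y))"
 shows "(NI x. NI y. NI z. t x y z)^2
 <= (NI y. NI z. F1 (y, z))*((NI x. NI z. F2 (x, z))*(NI x. NI y. F3 (x, y)))"
proof -
 let ?P = "lborel \<Otimes>\<^sub>M lborel::(real\<times>real) measure"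
 let ?K = "NI y. NI z. F1 (y, z)" and ?G = "%x. NI z. F2 (x, z)" and ?H = "%x. NI y. F3 (x, y)"
 note iterate = lborel.nn_integral_fst[symmetric]
 have m [measurable]: "(%p. t x (fst p) (snd p)):borel_measurable ?P" for x
  using measurable_compose[OF _ t, of "%p. (x, fst p, snd p)" ?P] by simp
 have inner: "(NI y. NI z. t x y z)^2 <= (?K*?G x)*?H x" for x
 proof -
  have "(\<integral>\<^sup>+p. t x (fst p) (snd p) \<partial>?P)^2 <= (\<integral>\<^sup>+p. F1 p \<partial>?P)*(\<integral>\<^sup>+p. F2 (x, snd p)*F3 (x, fst p) \<partial>?P)"
   by (rule Cauchy_Schwarz_dominated) (use bound in auto)
  thus ?thesis by (simp add: iterate nn_integral_multc nn_integral_cmult mult.assoc)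
 qed
 have "(%x. \<integral>\<^sup>+p. t x (fst p) (snd p) \<partial>?P):borel_measurable lborel"
  by (rule sigma_finite_measure.borel_measurable_nn_integral[OF sigma_finite_lborel2]) (use t in "simp add: split_beta'")
 hence [measurable]: "(%x. NI y. NI z. t x y z):borel_measurable lborel" by (simp add: iterate)
 have "(NI x. NI y. NI z. t x y z)^2 <= (NI x. ?K*?G x)*(NI x. ?H x)" by (rule Cauchy_Schwarz_dominated) (use inner in auto)
 thus ?thesis by (simp add: nn_integral_cmult mult.assoc)
qed

definition vec3 :: "real => real => real => R3" where "vec3 x y z = vector [x, y, z]"

lemma vec3_nth [simp]: "vec3 x y z $ 1 = x" "vec3 x y z $ 2 = y" "vec3 x y z $ 3 = z" by (auto simp: vec3_def)

lemma continuous_on_vec3: "continuous_on UNIV (%(x, y, z). vec3 x y z)"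
proof -
 have "(%(x, y, z). vec3 x y z) = (%p. fst p *\<^sub>R axis 1 1+fst (snd p) *\<^sub>R axis 2 1+snd (snd p) *\<^sub>R axis 3 1)"
  by (auto simp: vec_eq_iff forall_3 axis_def)
 thus ?thesis by (auto intro!: continuous_intros)
qed

lemma lborel_R3: "(lborel::R3 measure) = distr (lborel \<Otimes>\<^sub>M lborel \<Otimes>\<^sub>M lborel) borel (%(x, y, z). vec3 x y z)"
proof (rule lborel_eqI)
 let ?L3 = "lborel \<Otimes>\<^sub>M lborel \<Otimes>\<^sub>M lborel"
 have m: "(%(x, y, z). vec3 x y z):borel_measurable ?L3"
  using continuous_on_vec3 by (simp add: lborel_prod borel_measurable_continuous_onI)
 fix l u :: R3
 assume lu: "!!b. b:Basis ==> l \<bullet> b <= u \<bullet> b"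
 have bound: "l $ i <= u $ i" for i using lu[of "axis i 1"] by (simp add: inner_axis axis_in_Basis_iff)
 have "(%(x, y, z). vec3 x y z) -` box l u \<inter> space ?L3 = {l$1<..<u$1}\<times>{l$2<..<u$2}\<times>{l$3<..<u$3}"
  by (auto simp: mem_box_cart forall_3 space_pair_measure)
 hence "emeasure (distr ?L3 borel (%(x, y, z). vec3 x y z)) (box l u)
  = ennreal (u $ 1-l $ 1)*(ennreal (u $ 2-l $ 2)*ennreal (u $ 3-l $ 3))"
  using m bound by (simp add: emeasure_distr sigma_finite_measure.emeasure_pair_measure_Times[OF sigma_finite_lborel2] lborel.emeasure_pair_measure_Times)
 also have "... = ennreal ((u $ 1-l $ 1)*((u $ 2-l $ 2)*(u $ 3-l $ 3)))"
  using bound by (simp only: ennreal_mult mult_nonneg_nonneg diff_ge_0_iff_ge)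
 also have "(u $ 1-l $ 1)*((u $ 2-l $ 2)*(u $ 3-l $ 3)) = (PROD i:UNIV. u $ i-l $ i)" unfolding UNIV_3 by simp
 also have "(PROD i:UNIV. u $ i-l $ i) = (PROD b:Basis. (u-l) \<bullet> b)"
 proof -
  have B: "(Basis::R3 set) = range (%i. axis i (1::real))" by (auto simp: Basis_vec_def)
  have inj: "inj (%i. axis i (1::real)::R3)" by (auto simp: inj_def axis_eq_axis)
  show ?thesis unfolding B by (subst prod.reindex[OF inj]) (simp add: inner_axis o_def)
 qed
 finally show "emeasure (distr ?L3 borel (%(x, y, z). vec3 x y z)) (box l u) = ennreal (PROD b:Basis. (u-l) \<bullet> b)" .
qed simp

lemma nn_integral_R3:
 fixes f :: "R3 => ennreal"
 assumes f: "BM f"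
 shows "(NI v. f v) = (NI x. NI y. NI z. f (vec3 x y z))"
proof -
 let ?vec = "%x p. case (x, p) of (x, y, z) => vec3 x y z"
 have m: "(%(x, y, z). vec3 x y z):measurable (lborel \<Otimes>\<^sub>M lborel \<Otimes>\<^sub>M lborel) borel"
  using continuous_on_vec3 by (simp add: lborel_prod borel_measurable_continuous_onI)
 have m3: "(%p. f (case p of (x, y, z) => vec3 x y z)):borel_measurable (lborel \<Otimes>\<^sub>M lborel \<Otimes>\<^sub>M lborel)"
  by (rule measurable_compose[OF m f])
 have "(NI v. f v) = (\<integral>\<^sup>+p. f (case p of (x, y, z) => vec3 x y z) \<partial>(lborel \<Otimes>\<^sub>M lborel \<Otimes>\<^sub>M lborel))"
  by (subst lborel_R3) (rule nn_integral_distr[OF m], simp add: f)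
 also have "... = (NI x. \<integral>\<^sup>+p. f (?vec x p) \<partial>(lborel \<Otimes>\<^sub>M lborel))"
  by (rule sigma_finite_measure.nn_integral_fst[symmetric]) (use m3 in "auto simp: lborel_prod sigma_finite_lborel")
 also have "... = (NI x. NI y. NI z. f (vec3 x y z))"
 proof (rule nn_integral_cong)
  fix x :: real
  have "(%p. f (?vec x p)):borel_measurable (lborel \<Otimes>\<^sub>M lborel)" using measurable_compose[OF measurable_Pair1' m3, of x] by simp
  from lborel.nn_integral_fst[OF this]
  show "(\<integral>\<^sup>+p. f (?vec x p) \<partial>(lborel \<Otimes>\<^sub>M lborel)) = (NI y. NI z. f (vec3 x y z))" by simp
 qed
 finally show ?thesis .
qed

lemma vec3_eq: "vec3 x y z = x *\<^sub>R axis 1 1+y *\<^sub>R axis 2 1+z *\<^sub>R axis 3 1" by (auto simp: vec_eq_iff forall_3 axis_def)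

lemma measurable_vec3 [measurable (raw)]:
 "f:borel_measurable M ==> g:borel_measurable M ==> h:borel_measurable M ==> (%w. vec3 (f w) (g w) (h w)):borel_measurable M"
 unfolding vec3_eq by (intro borel_measurable_add borel_measurable_scaleR borel_measurable_const)

lemma nn_integral_R3_perms:
 fixes f :: "R3 => ennreal"
 assumes [measurable]: "BM f"
 shows "(NI y. NI z. NI x. f (vec3 x y z)) = (NI v. f v)"
 and "(NI x. NI z. NI y. f (vec3 x y z)) = (NI v. f v)"
proof -
 let ?yzx = "NI y. NI z. NI x. f (vec3 x y z)"
 let ?xyz = "NI x. NI y. NI z. f (vec3 x y z)"
 let ?xzy = "NI x. NI z. NI y. f (vec3 x y z)"
 have sw: "(NI z. NI x. g x z) = (NI x. NI z. g x z)"
  if "(%(x, z). g x z):borel_measurable (lborel \<Otimes>\<^sub>M lborel)" for g :: "real => real => ennreal"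
  using pair_sigma_finite.Fubini'[OF _ that] by (simp add: pair_sigma_finite_def sigma_finite_lborel)
 have "?yzx = (NI y. NI x. NI z. f (vec3 x y z))" by (intro nn_integral_cong sw) measurable
 also have "... = ?xyz" by (rule sw) measurable
 finally show "?yzx = (NI v. f v)" by (simp add: nn_integral_R3)
 have "?xzy = ?xyz" by (intro nn_integral_cong sw) measurable
 thus "?xzy = (NI v. f v)" by (simp add: nn_integral_R3)
qed

definition L2sq :: "scalar => real" where "L2sq f = (LI x. (f x)^2)"
definition D1sq :: "scalar => real" where "D1sq f = (SU i. L2sq (pd i f))"

lemma L2sq_nonneg: "0 <= L2sq f" by (simp add: L2sq_def)
lemma D1sq_nonneg: "0 <= D1sq f" by (simp add: D1sq_def L2sq_nonneg sum_nonneg)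
lemma L2sq_pd_le_D1sq: "L2sq (pd i f) <= D1sq f" unfolding D1sq_def by (rule member_le_sum) (auto simp: L2sq_nonneg)

lemma C1_meas: "C1 f ==> f:borel_measurable borel" "C1 f ==> pd i f:borel_measurable borel"
 by (auto intro!: borel_measurable_continuous_onI C1_cont C1_cont_pd)

lemma line_integral_bound:
 assumes v: "C1 v" and s: "!!x. norm x > R ==> v x = 0"
 shows "ennreal <|v p|> <= (NI s. ennreal <|pd i v (p+s *\<^sub>R axis i 1)|>)"
proof -
 let ?line = "%s. p+s *\<^sub>R axis i 1"
 define L where "L = <|R|>+norm p+1"
 have L: "L >= 0" by (simp add: L_def)
 have "norm (p+(- L) *\<^sub>R axis i (1::real)) > R"
 proof -
  have "norm (L *\<^sub>R axis i (1::real)) = L" using L by simp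
  moreover have "norm (p+(- L) *\<^sub>R axis i (1::real)) = norm (L *\<^sub>R axis i (1::real)-p)" by (simp add: norm_minus_commute)
  ultimately show ?thesis using norm_triangle_ineq2[of "L *\<^sub>R axis i (1::real)" p] abs_ge_self[of R] unfolding L_def by linarith
 qed
 hence v0: "v (p+(- L) *\<^sub>R axis i 1) = 0" by (rule s)
 have cont: "continuous_on UNIV (%s. pd i v (?line s))"
  by (rule continuous_on_compose2[OF C1_cont_pd[OF v]]) (auto intro!: continuous_intros)
 have ftc: "(LI s. pd i v (?line s)*indicator {-L..0} s) = v (p+0 *\<^sub>R axis i 1)-v (p+(- L) *\<^sub>R axis i 1)"
  by (rule integral_FTC_Icc_real) (use L cont C1_has_pd[OF v] in "auto simp: continuous_on_eq_continuous_at")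
 have "IB (%s. indicator {-L..0} s *\<^sub>R pd i v (?line s))"
  by (rule borel_integrable_compact) (auto intro: continuous_on_subset[OF cont])
 hence int: "IB (%s. pd i v (?line s)*indicator {-L..0} s)" by (simp add: mult.commute)
 have "ennreal <|v p|> = ennreal (norm (LI s. pd i v (?line s)*indicator {-L..0} s))" using ftc v0 by simp
 also have "... <= (NI s. ennreal (norm (pd i v (?line s)*indicator {-L..0} s)))" by (rule integral_norm_bound_ennreal[OF int])
 also have "... <= (NI s. ennreal <|pd i v (?line s)|>)" by (intro nn_integral_mono) (auto simp: indicator_def abs_mult)
 finally show ?thesis .
qed

lemma Gagliardo_Nirenberg:
 assumes v: "C1 v" and s: "!!x. norm x > R ==> v x = 0"
 shows "(NI p. ennreal (sqrt (<|v p|>^3)))^2 <= (NI p. ennreal <|pd 1 v p|>)*((NI p. ennreal <|pd 2 v p|>)*(NI p. ennreal <|pd 3 v p|>))"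
proof -
 define g where "g i x = ennreal <|pd i v x|>" for i x
 have [measurable]: "BM v" "BM (g i)" for i unfolding g_def using C1_meas[OF v] by measurable
 have line: "ennreal <|v p|> <= (NI s. g i (p+(s-p $ i) *\<^sub>R axis i 1))" for p i
 proof -
  have "BM (%s. g i (p+(s-p $ i) *\<^sub>R axis i 1))" by measurable
  from nn_integral_real_affine[OF this, of 1 "p $ i"] show ?thesis
   using line_integral_bound[OF v s, of R p i] by (simp add: g_def)
 qed
 have ax: "vec3 x y z+(s-x) *\<^sub>R axis 1 1 = vec3 s y z" "vec3 x y z+(s-y) *\<^sub>R axis 2 1 = vec3 x s z"
  "vec3 x y z+(s-z) *\<^sub>R axis 3 1 = vec3 x y s" for x y z s
  by (auto simp: vec3_eq algebra_simps)
 define F1 F2 F3 where "F1 = (%(y, z). NI x. g 1 (vec3 x y z))" and "F2 = (%(x, z). NI y. g 2 (vec3 x y z))"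
  and "F3 = (%(x, y). NI z. g 3 (vec3 x y z))"
 have [measurable]: "F1:borel_measurable (lborel \<Otimes>\<^sub>M lborel)" "F2:borel_measurable (lborel \<Otimes>\<^sub>M lborel)" "F3:borel_measurable (lborel \<Otimes>\<^sub>M lborel)"
  unfolding F1_def F2_def F3_def by measurable
 have b: "ennreal <|v (vec3 x y z)|> <= F1 (y, z)" "ennreal <|v (vec3 x y z)|> <= F2 (x, z)" "ennreal <|v (vec3 x y z)|> <= F3 (x, y)" for x y z
  unfolding F1_def F2_def F3_def using line[of "vec3 x y z" 1] line[of "vec3 x y z" 2] line[of "vec3 x y z" 3] by (simp_all add: ax)
 have "(ennreal (sqrt (<|v p|>^3)))^2 = ennreal <|v p|>*(ennreal <|v p|>*ennreal <|v p|>)" for p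
  by (simp add: ennreal_power power3_eq_cube flip: ennreal_mult)
 hence "(ennreal (sqrt (<|v (vec3 x y z)|>^3)))^2 <= F1 (y, z)*(F2 (x, z)*F3 (x, y))" for x y z
  by (simp only:) (intro mult_mono b; simp)
 hence "(NI x. NI y. NI z. ennreal (sqrt (<|v (vec3 x y z)|>^3)))^2
  <= (NI y. NI z. F1 (y, z))*((NI x. NI z. F2 (x, z))*(NI x. NI y. F3 (x, y)))"
  by (intro Loomis_Whitney) measurable
 thus ?thesis unfolding F1_def F2_def F3_def g_def[symmetric] using nn_integral_R3[of "%p. ennreal (sqrt (<|v p|>^3))"]
  by (simp add: nn_integral_R3_perms nn_integral_R3[symmetric])
qed

lemma Sobolev_compact_support:
 assumes C: "C1 \<phi>" and s: "!!x. norm x > R ==> \<phi> x = 0"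
 shows "(LI x. \<phi> x^6) <= 4096*D1sq \<phi>^3"
proof -
 define v where "v x = \<phi> x^4" for x
 have v: "C1 v" "pd i v = (%x. 4*\<phi> x^3*pd i \<phi> x)" for i
  unfolding v_def using C1_power[OF C, of 4] pd_power[OF C, of i 4] by auto
 have vs: "v x = 0" if "norm x > R" for x using s[OF that] by (simp add: v_def)
 have v6: "sqrt (<|v x|>^3) = \<phi> x^6" for x unfolding v_def by (rule real_sqrt_unique) (simp_all flip: power_mult)
 have cI: "IB h" if "continuous_on UNIV h" "!!x. \<phi> x = 0 ==> pd i \<phi> x = 0 ==> h x = 0" for h :: "scalar" and i
  by (rule integrable_compact_support[OF that(1), of R]) (use s pd_outside[OF s] that(2) in auto)
 note co [continuous_intros] = C1_cont[OF C] C1_cont_pd[OF C]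
 define S J where "S = (LI x. \<phi> x^6)" and "J i = (LI x. <|pd i v x|>)" for i
 have S0: "S >= 0" and J0: "J i >= 0" for i by (auto simp: S_def J_def)
 have i6: "IB (%x. \<phi> x^6)" and iv: "IB (%x. <|pd i v x|>)" for i unfolding v(2) by (rule cI; auto intro!: continuous_intros)+
 have "ennreal (S^2) <= ennreal (J 1*(J 2*J 3))" using Gagliardo_Nirenberg[OF v(1) vs] S0 J0
  by (simp add: v6 nn_integral_eq_integral[OF iv] nn_integral_eq_integral[OF i6] ennreal_power ennreal_mult S_def J_def)
 hence SJ: "S^2 <= J 1*(J 2*J 3)" using J0 by (simp add: ennreal_le_iff)
 have J2: "(J i)^2 <= 16*(S * L2sq (pd i \<phi>))" for i
 proof -
  have "(LI x. <|\<phi> x^3|>*<|pd i \<phi> x|>)^2 <= (LI x. <|\<phi> x^3|>^2)*(LI x. <|pd i \<phi> x|>^2)"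
   by (rule Cauchy_Schwarz_mult(2)) (auto intro!: borel_measurable_continuous_onI continuous_intros cI[where i=i])
  moreover have "J i = 4*(LI x. <|\<phi> x^3|>*<|pd i \<phi> x|>)" unfolding J_def v(2) by (simp add: abs_mult mult.assoc)
  ultimately show ?thesis by (simp add: S_def L2sq_def power_mult_distrib flip: power_mult)
 qed
 have "S*S^3 = (S^2)^2" by (simp add: eval_nat_numeral)
 also have "... <= (J 1*(J 2*J 3))^2" using SJ by (intro power_mono) auto
 also have "... = (J 1)^2*((J 2)^2*(J 3)^2)" by (simp add: power_mult_distrib)
 also have "... <= (16*(S * D1sq \<phi>))*((16*(S * D1sq \<phi>))*(16*(S * D1sq \<phi>)))"
  by (intro mult_mono order_trans[OF J2] mult_left_mono L2sq_pd_le_D1sq) (auto simp: S0 L2sq_nonneg D1sq_nonneg)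
 finally have "S*S^3 <= 4096*D1sq \<phi>^3*S^3" by (simp add: power3_eq_cube mult_ac)
 moreover have "S = 0 | S^3 > 0" using S0 by auto
 ultimately show ?thesis unfolding S_def[symmetric] by (auto simp: D1sq_nonneg)
qed

lemma integral_Fatou_bound:
 fixes u :: "nat => 'a => real"
 assumes i: "!!n. integrable M (u n)" and nn: "!!n x. 0 <= u n x" and lim: "!!x. (%n. u n x) ----> v x"
 and bound: "!!n. (\<integral>x. u n x \<partial>M) <= c n" and c: "c ----> C"
 shows "integrable M v" "(\<integral>x. v x \<partial>M) <= C"
proof -
 have v0: "0 <= v x" for x using LIMSEQ_le_const[OF lim] nn by blast
 have vm [measurable]: "v:borel_measurable M" by (rule borel_measurable_LIMSEQ_real[OF lim]) (use i in auto)
 have "(\<integral>\<^sup>+x. ennreal (v x) \<partial>M) = (\<integral>\<^sup>+x. liminf (%n. ennreal (u n x)) \<partial>M)"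
 proof (rule nn_integral_cong)
  fix x
  have "(%n. ennreal (u n x)) ----> ennreal (v x)" using lim by (intro tendsto_ennrealI)
  thus "ennreal (v x) = liminf (%n. ennreal (u n x))" by (simp add: lim_imp_Liminf)
 qed
 also have "... <= liminf (%n. \<integral>\<^sup>+x. ennreal (u n x) \<partial>M)" by (rule nn_integral_liminf) (use i in auto)
 also have "... = liminf (%n. ennreal (\<integral>x. u n x \<partial>M))" by (simp add: nn_integral_eq_integral[OF i] nn)
 also have "... <= liminf (%n. ennreal (c n))" by (intro Liminf_mono always_eventually) (auto intro!: ennreal_leI bound)
 also have "... = ennreal C" using tendsto_ennrealI[OF c] by (intro lim_imp_Liminf) auto
 finally have fin: "(\<integral>\<^sup>+x. ennreal (v x) \<partial>M) <= ennreal C" .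
 thus iv: "integrable M v" using v0 by (intro integrableI_nonneg) (auto intro: le_less_trans)
 have "0 <= c n" for n using order_trans[OF integral_nonneg_AE bound[of n]] nn by simp
 hence "C >= 0" by (intro LIMSEQ_le_const[OF c]) auto
 thus "(\<integral>x. v x \<partial>M) <= C" using fin v0 by (simp add: nn_integral_eq_integral[OF iv])
qed

definition H1 :: "scalar => bool" where
 "H1 f \<longleftrightarrow> C1 f & IB (%x. (f x)^2) & (ALL i. IB (%x. (pd i f x)^2))"

theorem Sobolev_L6:
 assumes "H1 f"
 shows "IB (%x. f x^6)" "(LI x. f x^6) <= 4096*D1sq f^3"
proof -
 have C: "C1 f" and i0: "IB (%x. (f x)^2)" and i1: "IB (%x. (pd i f x)^2)" for i using assms by (auto simp: H1_def)
 have [measurable]: "BM f" "BM (pd i f)" "BM (chi n)" "BM (pd i (chi n))" for i n using C1_meas C C1_chi by blast+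
 define \<phi> where "\<phi> n x = chi n x*f x" for n x
 have p: "C1 (\<phi> n)" "pd i (\<phi> n) = (%x. pd i (chi n) x*f x+chi n x*pd i f x)" for n i
  unfolding \<phi>_def using C1_mult[OF C1_chi C] pd_mult[OF C1_chi C] by auto
 have s: "\<phi> n x = 0" if "norm x > 3*real (Suc n)" for n x using chi_support[OF that] by (simp add: \<phi>_def)
 have "(%n. L2sq (pd i (\<phi> n))) ----> L2sq (pd i f)" for i
 proof -
  obtain K where K: "K >= 0" "!!n i x. <|pd i (chi n) x|> <= K" by (rule pd_chi_bound) blast
  have b: "<|(pd i (chi n) x)^2|> <= K^2" "<|2*pd i (chi n) x*chi n x|> <= 2*K" "<|(chi n x)^2|> <= 1" for n x
   using K(2)[of i n x] K(1) chi_bounds[of n x] mult_mono[OF K(2)[of i n x], of "chi n x" 1] by (auto simp: abs_mult power_le_one abs_le_square_iff[symmetric])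
  have l: "(%n. (pd i (chi n) x)^2) ----> 0^2" "(%n. 2*pd i (chi n) x*chi n x) ----> 2*0*1" "(%n. (chi n x)^2) ----> 1^2" for x
   by (intro tendsto_intros pd_chi_tendsto chi_tendsto)+
  note i01 = Cauchy_Schwarz_mult(1)[OF _ _ i0 i1[of i]]
  note L = integral_bounded_mult_tendsto[OF _ b(1) l(1) i0] integral_bounded_mult_tendsto[OF _ b(2) l(2) i01] integral_bounded_mult_tendsto[OF _ b(3) l(3) i1[of i]]
  have "(pd i (\<phi> n) x)^2 = (pd i (chi n) x)^2*(f x)^2+2*pd i (chi n) x*chi n x*(f x*pd i f x)+(chi n x)^2*(pd i f x)^2" for n x
   unfolding p by (simp add: power2_eq_square algebra_simps)
  hence "L2sq (pd i (\<phi> n)) = (LI x. (pd i (chi n) x)^2*(f x)^2)+(LI x. 2*pd i (chi n) x*chi n x*(f x*pd i f x))+(LI x. (chi n x)^2*(pd i f x)^2)" for n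
   unfolding L2sq_def using L(1,3,5) by simp
  thus ?thesis using tendsto_add[OF tendsto_add[OF L(2,4)] L(6)] by (simp add: L2sq_def)
 qed
 hence "(%n. 4096*D1sq (\<phi> n)^3) ----> 4096*D1sq f^3" unfolding D1sq_def by (intro tendsto_intros)
 note F = integral_Fatou_bound[OF _ _ _ Sobolev_compact_support[OF p(1) s] this, where v="%x. f x^6"]
 have I: "IB (%x. \<phi> n x^6)" for n
  by (rule integrable_compact_support[of _ "3*real (Suc n)"]) (auto intro!: continuous_intros C1_cont[OF p(1)] simp: s)
 have Lm: "(%n. \<phi> n x^6) ----> f x^6" for x
  using tendsto_power[OF tendsto_mult[OF chi_tendsto[of x] tendsto_const[of "f x"]], of 6] by (simp add: \<phi>_def)
 show "IB (%x. f x^6)" "(LI x. f x^6) <= 4096*D1sq f^3" using F[OF I _ Lm] by auto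
qed

lemma cube_le: "a^3 <= b^3 ==> 0 <= b ==> a <= (b::real)" using power_le_imp_le_base[of a 2 b] by (simp add: eval_nat_numeral)

lemma H1_product_L2:
 assumes f: "H1 f" and g: "H1 g"
 shows "IB (%x. (f x)^2*(g x)^2)"
 "(LI x. (f x)^2*(g x)^2)^2 <= 4096*(D1sq f)^2*(L2sq g*D1sq g)" (is ?A)
proof -
 have m [measurable]: "BM f" "BM g" using f g C1_meas by (auto simp: H1_def)
 note F = Sobolev_L6[OF f] and G = Sobolev_L6[OF g]
 have w: "IB (%x. ((f x)^2)^3)" using F(1) by (simp flip: power_mult)
 define Y where "Y = (LI x. ((f x)^2)^2*(g x)^2)"
 have iY: "IB (%x. ((f x)^2)^2*(g x)^2)" by (rule Hoelder_3_6(1)[OF _ _ _ w G(1)]) auto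
 have "Y^3 <= (LI x. ((f x)^2)^3)^2*(LI x. g x^6)" unfolding Y_def by (rule Hoelder_3_6(2)[OF _ _ _ w G(1)]) auto
 also have "... <= (4096*D1sq f^3)^2*(4096*D1sq g^3)"
  using F G by (intro mult_mono power_mono) (auto simp: D1sq_nonneg simp flip: power_mult)
 also have "... = (4096*(D1sq f)^2*D1sq g)^3" by (simp add: power_mult_distrib flip: power_mult)
 finally have Y: "Y <= 4096*(D1sq f)^2*D1sq g" by (rule cube_le) (simp add: D1sq_nonneg)
 have g2: "IB (%x. (g x)^2)" using g by (simp add: H1_def)
 have bound: "((f x)^2*(g x)^2)^2 <= (((f x)^2)^2*(g x)^2)*(g x)^2" for x
  by (simp add: power_mult_distrib eval_nat_numeral mult_ac)
 note CS = Cauchy_Schwarz_integral[OF iY g2, of "%x. (f x)^2*(g x)^2"]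
 show "IB (%x. (f x)^2*(g x)^2)" by (rule CS(1)) (use bound in auto)
 have "(LI x. (f x)^2*(g x)^2)^2 <= Y * L2sq g" unfolding Y_def L2sq_def by (rule CS(2)) (use bound in auto)
 also have "... <= (4096*(D1sq f)^2*D1sq g) * L2sq g" using Y by (intro mult_right_mono) (auto simp: L2sq_nonneg)
 finally show ?A by (simp add: mult_ac)
qed

definition D2sq :: "scalar => real" where "D2sq f = (SU i. D1sq (pd i f))"

lemma D2sq_nonneg: "0 <= D2sq f" by (simp add: D2sq_def D1sq_nonneg sum_nonneg)

lemma D1sq_pd_le_D2sq: "D1sq (pd i f) <= D2sq f" unfolding D2sq_def by (rule member_le_sum) (auto simp: D1sq_nonneg)

lemma vec3_add_axis: "vec3 a b c+s *\<^sub>R axis 1 1 = vec3 (a+s) b c" "vec3 a b c+s *\<^sub>R axis 2 1 = vec3 a (b+s) c"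
 "vec3 a b c+s *\<^sub>R axis 3 1 = vec3 a b (c+s)"
 by (simp_all add: vec3_eq algebra_simps)

lemma C1_increment_bound:
 assumes f: "C1 f" and e: "!!\<theta>. <|\<theta>|> <= <|s|> ==> <|pd i f (y+\<theta> *\<^sub>R axis i 1)-p|> <= e"
 shows "<|f (y+s *\<^sub>R axis i 1)-f y-s*p|> <= e*<|s|>"
proof -
 define g where "g \<theta> = f (y+\<theta> *\<^sub>R axis i 1)-\<theta>*p" for \<theta>
 have "norm (g s-g 0) <= e*norm (s-0)"
 proof (rule field_differentiable_bound[of "{- <|s|> .. <|s|>}"])
  show "(g has_field_derivative pd i f (y+\<theta> *\<^sub>R axis i 1)-p) (at \<theta> within {- <|s|> .. <|s|>})" for \<theta>
   unfolding g_def by (rule has_field_derivative_at_within) (auto intro!: derivative_eq_intros C1_has_pd[OF f])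
 qed (use e in auto)
 thus ?thesis by (simp add: g_def algebra_simps)
qed

lemma C1_has_derivative:
 assumes f: "C1 f" shows "(f has_derivative (%h. SU j. h $ j*pd j f x)) (at x)"
 unfolding has_derivative_at_alt
proof (intro conjI allI impI)
 show "bounded_linear (%h::R3. SU j. h $ j*pd j f x)"
  by (intro bounded_linear_sum bounded_linear_mult_const bounded_linear_vec_nth)
next
 fix e :: real assume e: "e > 0"
 have "EX d > 0. ALL y. dist y x < d --> dist (pd j f y) (pd j f x) < e/3" for j
  using C1_cont_pd[OF f, of j] e unfolding continuous_on_iff by (metis UNIV_I divide_pos_pos zero_less_numeral)
 then obtain d where d: "!!j. d j > 0" "!!j y. dist y x < d j ==> dist (pd j f y) (pd j f x) < e/3" by metis
 define D where "D = Min (range d)"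
 have D: "D > 0" "!!j. D <= d j" unfolding D_def using d(1) by auto
 show "EX d > 0. ALL y. norm (y-x) < d --> norm (f y-f x-(SU j. (y-x) $ j*pd j f x)) <= e*norm (y-x)"
 proof (intro exI[of _ D] conjI allI impI)
  fix y assume y: "norm (y-x) < D"
  define h where "h = y-x"
  define F where "F a b c = f (x+vec3 a b c)" for a b c
  have near: "<|pd j f (x+vec3 a b c)-pd j f x|> <= e/3" if "<|a|> <= <|h $ 1|>" "<|b|> <= <|h $ 2|>" "<|c|> <= <|h $ 3|>" for j a b c
  proof -
   have "norm (vec3 a b c $ i) <= norm (h $ i)" for i using that exhaust_3[of i] by auto
   hence "norm (vec3 a b c) <= norm h" by (rule norm_le_componentwise_cart)
   hence "dist (x+vec3 a b c) x < d j" using y D(2)[of j] by (simp add: dist_norm h_def)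
   from d(2)[OF this] show ?thesis by (simp add: dist_real_def)
  qed
  have inc: "<|F (h $ 1) 0 0-F 0 0 0-h $ 1*pd 1 f x|> <= e/3*<|h $ 1|>"
   "<|F (h $ 1) (h $ 2) 0-F (h $ 1) 0 0-h $ 2*pd 2 f x|> <= e/3*<|h $ 2|>"
   "<|F (h $ 1) (h $ 2) (h $ 3)-F (h $ 1) (h $ 2) 0-h $ 3*pd 3 f x|> <= e/3*<|h $ 3|>"
   unfolding F_def using near
   by (intro C1_increment_bound[OF f, of "h $ 1" 1 "x+vec3 0 0 0", unfolded add.assoc vec3_add_axis add_0]
   C1_increment_bound[OF f, of "h $ 2" 2 "x+vec3 (h $ 1) 0 0", unfolded add.assoc vec3_add_axis add_0]
   C1_increment_bound[OF f, of "h $ 3" 3 "x+vec3 (h $ 1) (h $ 2) 0", unfolded add.assoc vec3_add_axis add_0]; simp)+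
  have "F (h $ 1) (h $ 2) (h $ 3) = f y" "F 0 0 0 = f x" unfolding F_def by (rule arg_cong[of _ _ f], simp add: h_def vec_eq_iff forall_3)+
  with inc have "<|f y-f x-(h $ 1*pd 1 f x+h $ 2*pd 2 f x+h $ 3*pd 3 f x)|> <= e/3*<|h $ 1|>+e/3*<|h $ 2|>+e/3*<|h $ 3|>"
   by linarith
  also have "... <= e/3*norm h+e/3*norm h+e/3*norm h" using e by (intro add_mono mult_left_mono component_le_norm_cart) auto
  finally show "norm (f y-f x-(SU j. (y-x) $ j*pd j f x)) <= e*norm (y-x)" by (simp add: sum_3 h_def)
 qed (use D in simp)
qed

abbreviation unit_cube :: "R3 set" where "unit_cube == cbox 0 One"

lemma integral_unit_cube:
 fixes g :: "scalar"
 assumes "continuous_on UNIV g"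
 shows "IB (%x. indicator unit_cube x*g x)" "integral unit_cube g = (LI x. indicator unit_cube x*g x)"
proof -
 have "IB (%x. indicator unit_cube x *\<^sub>R g x)" by (rule borel_integrable_compact) (auto intro: continuous_on_subset[OF assms])
 thus "IB (%x. indicator unit_cube x*g x)" "integral unit_cube g = (LI x. indicator unit_cube x*g x)"
  using set_borel_integral_eq_integral(2)[of unit_cube g] by (simp_all add: set_integrable_def set_lebesgue_integral_def)
qed

lemma unit_cube_power_mean:
 fixes g :: "scalar"
 assumes g: "continuous_on UNIV g" and i6: "IB (%x. g x^6)"
 shows "(LI x. indicator unit_cube x*<|g x|>)^6 <= (LI x. g x^6)"
proof -
 have [measurable]: "BM g" by (rule borel_measurable_continuous_onI[OF g])
 have i: "indicator unit_cube x^n = (indicator unit_cube x::real)" if "n > 0" for n x using that by (auto simp: indicator_def)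
 have q: "IB (indicator unit_cube::scalar)" "(LI x. indicator unit_cube x) = 1"
  using emeasure_lborel_cbox_finite[of 0 One] by (auto simp: content_unit)
 have h: "IB (%x. (indicator unit_cube x)^2*(g x)^2)"
  "(LI x. (indicator unit_cube x)^2*(g x)^2)^3 <= (LI x. indicator unit_cube x^3)^2*(LI x. g x^6)"
  by (rule Hoelder_3_6; use q i6 in "simp add: i")+
 have "(LI x. indicator unit_cube x*(indicator unit_cube x*<|g x|>))^2
  <= (LI x. (indicator unit_cube x)^2)*(LI x. (indicator unit_cube x*<|g x|>)^2)"
  by (rule Cauchy_Schwarz_mult(2)) (use q h in "auto simp: i power_mult_distrib")
 hence "((LI x. indicator unit_cube x*<|g x|>)^2)^3 <= (LI x. (indicator unit_cube x)^2*(g x)^2)^3"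
  using q by (intro power_mono) (simp_all add: i power_mult_distrib flip: mult.assoc power2_eq_square)
 also have "... <= (LI x. g x^6)" using h(2) q by (simp add: i)
 finally show ?thesis by (simp flip: power_mult)
qed

lemma unit_cube_average_le:
 fixes g :: "scalar"
 assumes g: "continuous_on UNIV g" and i6: "IB (%x. g x^6)" and N: "(LI x. g x^6) <= N^6" "N >= 0" and r: "r > 0"
 shows "(LI x. indicator unit_cube x*<|g (a+r *\<^sub>R x)|>) <= N/sqrt r"
proof -
 note sc = lborel_integral_affine[OF i6 r, of a]
 have "(LI x. indicator unit_cube x*<|g (a+r *\<^sub>R x)|>)^6 <= (LI x. g (a+r *\<^sub>R x)^6)"
  by (rule unit_cube_power_mean[OF _ sc(1)]) (intro continuous_intros continuous_on_compose2[OF g]; simp)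
 also have "... <= N^6/r^3" using sc(2) N(1) r by (simp add: field_simps power3_eq_cube)
 also have "... = (N/sqrt r)^6" using r power_mult[of "sqrt r" 2 3] by (simp add: power_divide)
 finally have "(LI x. indicator unit_cube x*<|g (a+r *\<^sub>R x)|>)^Suc 5 <= (N/sqrt r)^Suc 5" by simp
 thus ?thesis by (rule power_le_imp_le_base) (use N r in simp)
qed

definition dilated :: "scalar => R3 => real => scalar" where "dilated f a s x = f (a+s *\<^sub>R x)"
definition dilation_slope :: "scalar => R3 => real => scalar" where
 "dilation_slope f a s x = (SU j. x $ j*pd j f (a+s *\<^sub>R x))"

lemma dilation_slope_continuous:
 assumes f: "C1 f"
 shows "continuous_on (UNIV\<times>cbox 0 One) (%(s, x). dilation_slope f a s x)" "continuous_on UNIV (dilation_slope f a s)"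
 unfolding dilation_slope_def case_prod_unfold
 by (intro continuous_intros continuous_on_compose2[OF C1_cont_pd[OF f]]; auto intro!: continuous_intros)+

lemma dilated_integral_DERIV:
 assumes f: "C1 f"
 shows "((%s. integral unit_cube (dilated f a s)) has_real_derivative integral unit_cube (dilation_slope f a s)) (at s)"
proof -
 have "((%s. integral unit_cube (dilated f a s)) has_real_derivative integral unit_cube (dilation_slope f a s)) (at s within UNIV)"
 proof (rule leibniz_rule_field_derivative[OF _ _ dilation_slope_continuous(1)[OF f]])
  show "dilated f a t integrable_on unit_cube" for t
   unfolding dilated_def
   by (rule integrable_continuous) (intro continuous_intros continuous_on_compose2[OF C1_cont[OF f]]; auto intro!: continuous_intros)
  fix t and x :: R3
  have "((%s. a+s *\<^sub>R x) has_derivative (%h. h *\<^sub>R x)) (at t)" by (auto intro!: derivative_eq_intros)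
  from has_derivative_compose[OF this C1_has_derivative[OF f]]
  show "((%s. dilated f a s x) has_real_derivative dilation_slope f a t x) (at t within UNIV)"
   unfolding has_field_derivative_def dilation_slope_def dilated_def by (rule has_derivative_eq_rhs) (auto simp: fun_eq_iff sum_distrib_left mult_ac)
 qed auto
 thus ?thesis by simp
qed

lemma dilation_slope_bound:
 assumes f: "C1 f" and i6: "!!i. IB (%x. pd i f x^6)" and N: "!!i. (LI x. pd i f x^6) <= N^6" "N >= 0" and s: "s > 0"
 shows "<|integral unit_cube (dilation_slope f a s)|> <= 3*N/sqrt s"
proof -
 note ds = dilation_slope_continuous(2)[OF f]
 have cont: "continuous_on UNIV (%x. <|pd j f (a+s *\<^sub>R x)|>)" for j by (intro continuous_intros continuous_on_compose2[OF C1_cont_pd[OF f]]) auto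
 have bound: "<|indicator unit_cube x*dilation_slope f a s x|> <= (SU j. indicator unit_cube x*<|pd j f (a+s *\<^sub>R x)|>)" for x
 proof -
  have "(One::R3) $ j = 1" for j using inner_sum_left_Basis[of "axis j 1::R3" "%_. 1"] by (simp add: inner_axis axis_in_Basis_iff)
  hence "<|x $ j*p|> <= <|p|>" if "x:unit_cube" for j p
   using that by (simp add: mem_box_cart abs_mult mult_left_le_one_le del: sum_component)
  thus ?thesis unfolding dilation_slope_def sum_distrib_left[symmetric] by (auto simp: indicator_def intro!: order_trans[OF sum_abs sum_mono])
 qed
 have "<|integral unit_cube (dilation_slope f a s)|> <= (LI x. <|indicator unit_cube x*dilation_slope f a s x|>)"
  unfolding integral_unit_cube(2)[OF ds] by (rule integral_abs_bound)
 also have "... <= (LI x. SU j. indicator unit_cube x*<|pd j f (a+s *\<^sub>R x)|>)"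
  by (rule integral_mono[OF integrable_abs[OF integral_unit_cube(1)[OF ds]] integrable_sum bound]) (rule integral_unit_cube(1)[OF cont])
 also have "... = (SU j. LI x. indicator unit_cube x*<|pd j f (a+s *\<^sub>R x)|>)"
  by (rule integral_sum) (rule integral_unit_cube(1)[OF cont])
 also have "... <= (SU j::3. N/sqrt s)" by (intro sum_mono unit_cube_average_le[OF C1_cont_pd[OF f] i6 N s])
 finally show ?thesis by simp
qed

lemma Morrey_increment:
 assumes f: "C1 f" and i6: "!!i. IB (%x. pd i f x^6)" and N: "!!i. (LI x. pd i f x^6) <= N^6" "N >= 0" and r: "r > 0"
 shows "<|integral unit_cube (dilated f a r)-f a|> <= 6*N * sqrt r"
proof -
 define A where "A s = integral unit_cube (dilated f a s)" for s
 note dA = dilated_integral_DERIV[OF f, of a, folded A_def]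
 have "6*N * sqrt 0+c*A 0 <= 6*N * sqrt r+c*A r" if c: "c = 1 | c = -1" for c
 proof (rule DERIV_nonneg_imp_increasing_open[of 0 r "%s. 6*N * sqrt s+c*A s"])
  fix s assume s: "0 < s" "s < r"
  let ?D = "3*N/sqrt s+c*integral unit_cube (dilation_slope f a s)"
  have "((%s. 6*N * sqrt s+c*A s) has_real_derivative ?D) (at s)"
   using s by (auto intro!: derivative_eq_intros dA simp: field_simps)
  moreover have "0 <= ?D" using dilation_slope_bound[OF f i6 N s(1), of a] c by auto
  ultimately show "EX y. ((%s. 6*N * sqrt s+c*A s) has_real_derivative y) (at s) & 0 <= y" by blast
 next
  have "continuous_on {0..r} A" using dA by (meson DERIV_isCont continuous_at_imp_continuous_on)
  thus "continuous_on {0..r} (%s. 6*N * sqrt s+c*A s)" by (intro continuous_intros)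
 qed (use r in simp)
 from this[of 1] this[of "-1"] show ?thesis by (simp add: A_def dilated_def[abs_def] content_unit abs_le_iff)
qed

theorem Agmon:
 assumes f: "H1 f" and df: "!!i. H1 (pd i f)"
 shows "f a^4 <= 614656*(D1sq f*D2sq f)"
proof -
 define G H where "G = sqrt (D1sq f)" and "H = sqrt (D2sq f)"
 have GH: "0 <= G" "0 <= H" "G^2 = D1sq f" "H^2 = D2sq f" by (simp_all add: G_def H_def D1sq_nonneg D2sq_nonneg)
 have C: "C1 f" using f by (simp add: H1_def)
 have six: "(4 * sqrt x)^6 = 4096*x^3" if "0 <= x" for x using that power_mult[of "sqrt x" 2 3] by (simp add: power_mult_distrib)
 have N: "(LI x. pd i f x^6) <= (4*H)^6" for i
 proof -
  have "(LI x. pd i f x^6) <= 4096*D1sq (pd i f)^3" by (rule Sobolev_L6(2)[OF df])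
  also have "... <= (4*H)^6" unfolding H_def six[OF D2sq_nonneg] by (intro mult_left_mono power_mono D1sq_pd_le_D2sq) (auto simp: D1sq_nonneg)
  finally show ?thesis .
 qed
 have M: "(LI x. f x^6) <= (4*G)^6" using Sobolev_L6(2)[OF f] unfolding G_def six[OF D1sq_nonneg] .
 have r: "<|f a|> <= 4*G/sqrt r+24*H * sqrt r" if r: "r > 0" for r
 proof -
  have cont: "continuous_on UNIV (%x. f (a+r *\<^sub>R x))" by (intro continuous_intros continuous_on_compose2[OF C1_cont[OF C]]) auto
  have "<|integral unit_cube (%x. f (a+r *\<^sub>R x))|> <= (LI x. indicator unit_cube x*<|f (a+r *\<^sub>R x)|>)"
   unfolding integral_unit_cube(2)[OF cont] by (rule order_trans[OF integral_abs_bound]) (simp add: abs_mult)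
  also have "... <= 4*G/sqrt r" using GH r by (intro unit_cube_average_le[OF C1_cont[OF C] Sobolev_L6(1)[OF f] M]) auto
  finally show ?thesis using Morrey_increment[OF C Sobolev_L6(1)[OF df] N _ r, of a] GH by (simp add: dilated_def[abs_def])
 qed
 have e: "(f a)^2 <= 784*((G+e)*(H+e))" if e: "e > 0" for e
 proof -
  define p q where "p = sqrt (G+e)" and "q = sqrt (H+e)"
  have pq: "p > 0" "q > 0" "p^2 = G+e" "q^2 = H+e" using GH e by (auto simp: p_def q_def)
  have "sqrt ((p/q)^2) = p/q" using pq by simp
  hence "<|f a|> <= 4*G/(p/q)+24*H*(p/q)" using r[of "(p/q)^2"] pq by simp
  also have "... <= 4*p^2/(p/q)+24*q^2*(p/q)" using pq e by (intro add_mono divide_right_mono mult_right_mono) auto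
  also have "... = 28*(p*q)" using pq(1,2) by (simp add: field_simps power2_eq_square)
  finally have "<|f a|>^2 <= (28*(p*q))^2" by (intro power_mono) auto
  thus ?thesis by (simp add: power_mult_distrib pq)
 qed
 have "((%e. 784*((G+e)*(H+e))) \<longlongrightarrow> 784*((G+0)*(H+0))) (at_right 0)" by (intro tendsto_intros)
 hence "(f a)^2 <= 784*((G+0)*(H+0))"
  by (rule tendsto_lowerbound) (use e in "auto intro!: always_eventually simp: eventually_at_filter")
 hence "((f a)^2)^2 <= (784*(G*H))^2" by (intro power_mono) auto
 thus ?thesis by (simp add: power_mult_distrib GH flip: power_mult)
qed

definition Hs :: "nat => scalar => bool" where
 "Hs n f \<longleftrightarrow> C_inf f & (ALL is. length is <= n --> IB (%x. (pds is f x)^2))"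

lemma Hs_C_inf: "Hs n f ==> C_inf f" and Hs_C1: "Hs n f ==> C1 f" by (auto simp: Hs_def C_inf_C1)

lemma Hs_meas: "Hs n f ==> f:borel_measurable borel" using C1_meas(1) Hs_C1 by blast

lemma Hs_L2: "Hs n f ==> IB (%x. (f x)^2)" unfolding Hs_def by (metis le0 list.size(3) pds_Nil)

lemma Hs_mono: "Hs n f ==> k <= n ==> Hs k f" by (auto simp: Hs_def)

lemma Hs_pds: assumes "Hs (k+length js) f" shows "Hs k (pds js f)" unfolding Hs_def
proof (intro conjI allI impI)
 show "C_inf (pds js f)" using assms by (intro C_inf_pds Hs_C_inf)
 fix "is" :: "3 list" assume "length is <= k"
 thus "IB (%x. (pds is (pds js f) x)^2)" using assms unfolding Hs_def pds_append[symmetric] by auto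
qed

lemma Hs_pd: "Hs (Suc k) f ==> Hs k (pd i f)" using Hs_pds[of k "[i]" f] by (simp add: pds_Cons)

lemma Hs_H1: "Hs (Suc k) f ==> H1 f" unfolding H1_def using Hs_C1 Hs_L2 Hs_L2[OF Hs_pd] by auto

lemma square_add_le: "(a+b)^2 <= 2*a^2+2*(b::real)^2"
 using sum_squares_ge_zero[of "a-b" 0] by (simp add: power2_eq_square algebra_simps)

lemma square_integrable_add:
 fixes f g :: "'a => real"
 assumes "integrable M (%x. (f x)^2)" "integrable M (%x. (g x)^2)" "f:borel_measurable M" "g:borel_measurable M"
 shows "integrable M (%x. (f x+g x)^2)"
 by (rule integrable_bound[of _ "%x. 2*(f x)^2+2*(g x)^2"])
 (use assms square_add_le in "auto simp: abs_of_nonneg add_nonneg_nonneg")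

lemma Hs_add: assumes "Hs n f" "Hs n g" shows "Hs n (%x. f x+g x)"
proof -
 have C: "C_inf f" "C_inf g" using assms by (auto simp: Hs_def)
 show ?thesis unfolding Hs_def pds_add[OF C]
  using assms C C1_meas(1)[OF C_inf_C1s] by (auto simp: Hs_def intro!: C_inf_add square_integrable_add)
qed

lemma Hs_cmult: assumes "Hs n f" shows "Hs n (%x. c*f x)"
 using assms unfolding Hs_def by (auto simp: pds_cmult power_mult_distrib intro!: C_inf_cmult)

lemma Hs_diff: "Hs n f ==> Hs n g ==> Hs n (%x. f x-g x)" using Hs_add[OF _ Hs_cmult, of n f g "-1"] by simp

lemma Hs_zero: "Hs n (%x. 0)"
proof -
 have "pds is (%x. 0::real) = (%x. 0)" for "is" by (induction "is") (auto simp: pds_Cons pd_const)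
 thus ?thesis unfolding Hs_def by (simp add: C_inf_const)
qed

lemma Hs_sum: "(!!a. a:A ==> Hs n (f a)) ==> Hs n (%x. SUM a:A. f a x)"
 by (induction A rule: infinite_finite_induct) (auto intro!: Hs_add Hs_zero)

lemma Hs_Agmon: "Hs (Suc (Suc k)) f ==> f x^4 <= 614656*(D1sq f*D2sq f)" by (rule Agmon[OF Hs_H1 Hs_H1[OF Hs_pd]])

lemma Hs_bounded: assumes "Hs (Suc (Suc k)) f" obtains B where "B >= 0" "!!x. <|f x|> <= B"
proof (rule that[of "614656*(D1sq f*D2sq f)+1"])
 define A where "A = 614656*(D1sq f*D2sq f)"
 have A: "A >= 0" by (simp add: A_def D1sq_nonneg D2sq_nonneg)
 thus "0 <= 614656*(D1sq f*D2sq f)+1" by (simp add: A_def)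
 fix x
 have "<|f x|>^4 <= A" using Hs_Agmon[OF assms, of x] by (simp add: A_def)
 also have "A <= (A+1)^4" using A self_le_power[of "A+1" 4] by simp
 finally show "<|f x|> <= 614656*(D1sq f*D2sq f)+1"
  unfolding A_def[symmetric] using A by (intro power_le_imp_le_base[of "<|f x|>" 3 "A+1"]) (simp_all add: eval_nat_numeral)
qed

lemma Hs_mult_integrable:
 assumes "Hs a f" "Hs b g" shows "IB (%x. f x*g x)"
 using assms by (intro Cauchy_Schwarz_mult(1)) (auto simp: Hs_meas Hs_L2)

lemma Hs_mult_square_integrable:
 assumes f: "Hs a f" and g: "Hs b g" and ab: "a+b >= 2"
 shows "IB (%x. (f x*g x)^2)"
proof -
 have m [measurable]: "BM f" "BM g" using f g Hs_meas by auto
 have bnd: "IB (%x. (f x*g x)^2)" if f: "Hs (Suc (Suc k)) f" and g: "Hs b g"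
  and [measurable]: "BM f" "BM g" for f g :: "scalar" and k b
 proof -
  obtain B where B: "B >= 0" "!!x. <|f x|> <= B" using Hs_bounded[OF f] by blast
  show ?thesis
  proof (rule integrable_bound[of _ "%x. B^2*(g x)^2"])
   show "AE x in lborel. norm ((f x*g x)^2) <= norm (B^2*(g x)^2)"
    using B by (intro AE_I2) (auto simp: power_mult_distrib abs_le_square_iff[symmetric] intro!: mult_right_mono)
  qed (use Hs_L2[OF g] in auto)
 qed
 consider "a >= 2" | "b >= 2" | "a = 1" "b = 1" using ab by linarith
 thus ?thesis
 proof cases
  case 1
  then obtain k where "a = Suc (Suc k)" by (metis add_2_eq_Suc le_Suc_ex)
  thus ?thesis using bnd[of k f b g] f g by simp
 next
  case 2
  then obtain k where "b = Suc (Suc k)" by (metis add_2_eq_Suc le_Suc_ex)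
  thus ?thesis using bnd[of k g a f] f g by (simp add: mult.commute)
 next
  case 3 thus ?thesis using H1_product_L2(1)[OF Hs_H1[of 0 f] Hs_H1[of 0 g]] f g by (simp add: power_mult_distrib)
 qed
qed

lemma Hs_triple_integrable:
 assumes f: "Hs a f" and g: "Hs b g" and h: "Hs c h" and abc: "a+b+c >= 2"
 shows "IB (%x. f x*g x*h x)"
proof -
 have m [measurable]: "BM f" "BM g" "BM h" using f g h Hs_meas by auto
 consider "a+b >= 2" | "a+c >= 2" | "b+c >= 2" using abc by linarith
 thus ?thesis
 proof cases
  case 1
  thus ?thesis using Hs_mult_square_integrable[OF f g 1] Hs_L2[OF h] by (intro Cauchy_Schwarz_mult(1)) auto
 next
  case 2
  have "IB (%x. (f x*h x)*g x)" using Hs_mult_square_integrable[OF f h 2] Hs_L2[OF g] by (intro Cauchy_Schwarz_mult(1)) auto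
  thus ?thesis by (simp add: mult_ac)
 next
  case 3
  have "IB (%x. (g x*h x)*f x)" using Hs_mult_square_integrable[OF g h 3] Hs_L2[OF f] by (intro Cauchy_Schwarz_mult(1)) auto
  thus ?thesis by (simp add: mult_ac)
 qed
qed

lemma integral_pd_zero:
 assumes "C1 F" "IB F" "IB (pd i F)"
 shows "(LI x. pd i F x) = 0"
proof -
 let ?F = "%j. if j = i then F else (%x. 0)"
 have e: "(SU j. pd j (?F j) x) = pd i F x" for x
 proof -
  have "(SU j. pd j (?F j) x) = (SU j. if j = i then pd i F x else 0)" by (intro sum.cong) (auto simp: pd_const)
  thus ?thesis by simp
 qed
 have "(LI x. (SU j. pd j (?F j) x)) = 0" by (rule integral_divergence_zero) (use assms in "auto simp: C1_const e")
 thus ?thesis by (simp add: e)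
qed

definition T3 :: "scalar => scalar => scalar => real" where
 "T3 f g h = (LI x. f x*g x*h x)"

lemma T3_swap12: "T3 f g h = T3 g f h" and T3_swap23: "T3 f g h = T3 f h g" by (simp_all add: T3_def mult_ac)

lemma T3_ibp:
 assumes f: "Hs (Suc a) f" and g: "Hs (Suc b) g" and h: "Hs (Suc c) h"
 shows "T3 (pd i f) g h+T3 f (pd i g) h+T3 f g (pd i h) = 0"
proof -
 have C: "C1 f" "C1 g" "C1 h" using f g h by (auto intro: Hs_C1)
 have i: "IB (%x. pd i f x*g x*h x)" "IB (%x. f x*pd i g x*h x)" "IB (%x. f x*g x*pd i h x)"
  by (rule Hs_triple_integrable[OF Hs_pd[OF f] g h] Hs_triple_integrable[OF f Hs_pd[OF g] h] Hs_triple_integrable[OF f g Hs_pd[OF h]]; simp)+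
 have e: "pd i (%x. f x*g x*h x) = (%x. pd i f x*g x*h x+f x*pd i g x*h x+f x*g x*pd i h x)"
  by (simp add: pd_mult C1_mult C distrib_right)
 have "(LI x. pd i (%x. f x*g x*h x) x) = 0"
  by (rule integral_pd_zero) (use i Hs_triple_integrable[OF f g h] in "auto simp: e C1_mult C")
 thus ?thesis unfolding e T3_def using i by simp
qed

lemma fourth_power_Young:
 fixes X a b c e :: real
 assumes "X^4 <= c*a*b^3" "0 <= a" "0 <= b" "0 <= c" "e > 0"
 shows "X <= e*b+c/e^3*a"
proof -
 define p q where "p = e*b" and "q = c/e^3*a"
 have pq: "p >= 0" "q >= 0" using assms by (auto simp: p_def q_def)
 have "X^4 <= p^3*q" using assms by (simp add: p_def q_def power_mult_distrib mult_ac)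
 also have "... <= (p+q)^3*(p+q)" using pq by (intro mult_mono power_mono) auto
 also have "... = (p+q)^4" by (simp add: eval_nat_numeral)
 finally have "X^Suc 3 <= (p+q)^Suc 3" by (simp add: eval_nat_numeral)
 thus ?thesis unfolding p_def[symmetric] q_def[symmetric] by (rule power_le_imp_le_base) (use pq in auto)
qed

lemma square_Young:
 fixes X a b c e :: real
 assumes "X^2 <= c*a*b" "0 <= a" "0 <= b" "0 <= c" "e > 0"
 shows "X <= e*b+c/e*a"
proof -
 define p q where "p = e*b" and "q = c/e*a"
 have pq: "p >= 0" "q >= 0" using assms by (auto simp: p_def q_def)
 have "X^2 <= p*q" using assms by (simp add: p_def q_def mult_ac)
 also have "... <= (p+q)*(p+q)" using pq by (intro mult_mono) auto
 finally have "X^2 <= (p+q)^2" by (simp add: power2_eq_square)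
 thus ?thesis unfolding p_def[symmetric] q_def[symmetric] by (rule power2_le_imp_le) (use pq in auto)
qed

lemma L3_weight_Sobolev:
 assumes w: "BM w" "!!x. 0 <= w x" "IB (%x. w x^3)" and f: "H1 f"
 shows "IB (%x. (w x)^2*(f x)^2)" "(LI x. (w x)^2*(f x)^2)^3 <= 4096*(LI x. w x^3)^2*D1sq f^3" (is ?A)
proof -
 have m: "w:borel_measurable lborel" "f:borel_measurable lborel" using w f C1_meas by (auto simp: H1_def)
 note H = Hoelder_3_6[OF m w(2,3) Sobolev_L6(1)[OF f]]
 show "IB (%x. (w x)^2*(f x)^2)" by (rule H)
 show ?A using order_trans[OF H(2) mult_left_mono[OF Sobolev_L6(2)[OF f]]] by (simp add: mult_ac)
qed

definition peak :: "real => scalar => scalar" where "peak M V x = indicator {x. V x > M} x*V x"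
definition bulk :: "real => scalar => scalar" where "bulk M V x = indicator {x. V x <= M} x*V x"

lemma peak_bulk_measurable: "BM V ==> BM (peak M V)" "BM V ==> BM (bulk M V)"
 unfolding peak_def[abs_def] bulk_def[abs_def] by (intro borel_measurable_times borel_measurable_indicator; measurable; assumption?)+

lemma peak_bulk_nonneg: "0 <= V x ==> 0 <= peak M V x" "0 <= V x ==> 0 <= bulk M V x"
 and bulk_le: "0 <= M ==> bulk M V x <= M"
 by (simp_all add: peak_def bulk_def indicator_def)

lemma peak_bulk_split: "V x*c = peak M V x*c+bulk M V x*c" "(V x)^2*c = (peak M V x)^2*c+(bulk M V x)^2*c"
 by (auto simp: peak_def bulk_def indicator_def)

lemma bounded_weight_integral:
 assumes m: "BM V" and V: "!!x. 0 <= V x" "!!x. V x <= M" and f: "BM f" "IB (%x. (f x)^2)"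
 shows "IB (%x. V x*(f x)^2)" "(LI x. V x*(f x)^2) <= M * L2sq f"
proof -
 have b: "V x*(f x)^2 <= M*(f x)^2" for x using V by (intro mult_right_mono) auto
 have M: "0 <= M" using V order_trans by blast
 show i: "IB (%x. V x*(f x)^2)"
  by (rule integrable_bound[OF integrable_mult_right[OF f(2), of M]]) (use b V M m f in "auto simp: abs_mult")
 show "(LI x. V x*(f x)^2) <= M * L2sq f"
  unfolding L2sq_def using integral_mono[OF i integrable_mult_right[OF f(2), of M] b] by simp
qed

definition split_bound :: "scalar => real => bool" where
 "split_bound V M \<longleftrightarrow> V:borel_measurable borel & (ALL x. 0 <= V x) & M >= 1 &
 IB (%x. (peak M V x)^2) & (LI x. (peak M V x)^2) <= sqrt M &
 IB (%x. bulk M V x^3) & (LI x. bulk M V x^3) <= M * sqrt M"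

lemma L4_bound:
 assumes f: "H1 f"
 shows "IB (%x. ((f x)^2)^2)" "(LI x. ((f x)^2)^2)^2 <= 4096*D1sq f^3 * L2sq f"
 using H1_product_L2[OF f f] by (simp_all add: power2_eq_square power3_eq_cube mult_ac)

lemma potential_form_bound:
 assumes V: "split_bound V M" and f: "H1 f" and e: "\<epsilon> > 0"
 shows "IB (%x. V x*(f x)^2)"
 "(LI x. V x*(f x)^2) <= \<epsilon>*D1sq f+(1+4096/\<epsilon>^3)*M * L2sq f" (is ?A)
proof -
 have Vm: "BM V" and V0: "!!x. 0 <= V x" and M1: "M >= 1" using V by (auto simp: split_bound_def)
 note m [measurable] = peak_bulk_measurable[OF Vm]
 have [measurable]: "BM f" and f2: "IB (%x. (f x)^2)" using f C1_meas by (auto simp: H1_def)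
 note L4 = L4_bound[OF f]
 have i1: "IB (%x. peak M V x*(f x)^2)" using V L4 by (intro Cauchy_Schwarz_mult(1)) (auto simp: split_bound_def)
 define X where "X = (LI x. peak M V x*(f x)^2)"
 have "X^2 <= (LI x. (peak M V x)^2)*(LI x. ((f x)^2)^2)"
  unfolding X_def using V L4 by (intro Cauchy_Schwarz_mult(2)) (auto simp: split_bound_def)
 also have "... <= sqrt M*(LI x. ((f x)^2)^2)" using V by (intro mult_right_mono) (auto simp: split_bound_def)
 finally have "(X^2)^2 <= (sqrt M*(LI x. ((f x)^2)^2))^2" by (intro power_mono) auto
 also have "... = M*(LI x. ((f x)^2)^2)^2" using M1 by (simp add: power_mult_distrib)
 also have "... <= M*(4096*D1sq f^3 * L2sq f)" using L4 M1 by (intro mult_left_mono) auto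
 finally have "X^4 <= (4096*M) * L2sq f*D1sq f^3" by (simp add: mult_ac flip: power_mult)
 hence X: "X <= \<epsilon>*D1sq f+(4096*M)/\<epsilon>^3 * L2sq f" by (rule fourth_power_Young) (use M1 e in "auto simp: L2sq_nonneg D1sq_nonneg")
 have B: "IB (%x. bulk M V x*(f x)^2)" "(LI x. bulk M V x*(f x)^2) <= M * L2sq f"
  by (rule bounded_weight_integral[where M=M]; use m f2 V0 M1 peak_bulk_nonneg bulk_le in auto)+
 show "IB (%x. V x*(f x)^2)" unfolding peak_bulk_split(1)[of V _ _ M] using i1 B by auto
 have "(LI x. V x*(f x)^2) = X+(LI x. bulk M V x*(f x)^2)"
  unfolding peak_bulk_split(1)[of V _ _ M] X_def by (rule integral_add[OF i1 B(1)])
 thus ?A using X B by (simp add: algebra_simps)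
qed

lemma potential_square_bound:
 assumes V: "split_bound V M" and f: "Hs (Suc (Suc k)) f" and e: "\<epsilon> > 0"
 shows "IB (%x. (V x)^2*(f x)^2)"
 "(LI x. (V x)^2*(f x)^2) <= \<epsilon>*D2sq f+(16+614656/\<epsilon>)*M*D1sq f" (is ?A)
proof -
 have Vm: "BM V" and V0: "!!x. 0 <= V x" and M1: "M >= 1"
  and iV1: "IB (%x. (peak M V x)^2)" "(LI x. (peak M V x)^2) <= sqrt M"
  and iV2: "IB (%x. bulk M V x^3)" "(LI x. bulk M V x^3) <= M * sqrt M" using V by (auto simp: split_bound_def)
 note [measurable] = peak_bulk_measurable[OF Vm] Hs_meas[OF f]
 define s where "s = sqrt (614656*(D1sq f*D2sq f))"
 have s0: "s >= 0" by (simp add: s_def D1sq_nonneg D2sq_nonneg)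
 have "(f x)^2 <= s" for x unfolding s_def by (rule real_le_rsqrt) (use Hs_Agmon[OF f, of x] in "simp flip: power_mult")
 hence b: "(peak M V x)^2*(f x)^2 <= s*(peak M V x)^2" for x by (subst mult.commute) (intro mult_right_mono; simp)
 have i1: "IB (%x. (peak M V x)^2*(f x)^2)"
  by (rule integrable_bound[OF integrable_mult_right[OF iV1(1), of s]]) (use b s0 in "auto intro!: AE_I2 simp: abs_mult")
 define X where "X = (LI x. (peak M V x)^2*(f x)^2)"
 have "X <= s * sqrt M"
  using order_trans[OF integral_mono[OF i1 integrable_mult_right[OF iV1(1)] b]] mult_left_mono[OF iV1(2) s0] by (simp add: X_def)
 moreover have "X >= 0" by (simp add: X_def)
 ultimately have "X^2 <= (s * sqrt M)^2" by (intro power_mono) auto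
 also have "... = (614656*M)*D1sq f*D2sq f" using M1 by (simp add: s_def power_mult_distrib D1sq_nonneg D2sq_nonneg mult_ac)
 finally have X: "X <= \<epsilon>*D2sq f+(614656*M)/\<epsilon>*D1sq f" by (rule square_Young) (use M1 e in "auto simp: D1sq_nonneg D2sq_nonneg")
 note B = L3_weight_Sobolev[OF _ peak_bulk_nonneg(2)[OF V0] iV2(1) Hs_H1[OF f]]
 have "(LI x. (bulk M V x)^2*(f x)^2)^3 <= 4096*(M * sqrt M)^2*D1sq f^3"
  using iV2(2) V0 by (intro order_trans[OF B(2)] mult_mono power_mono) (auto simp: D1sq_nonneg peak_bulk_nonneg)
 also have "... = (16*M*D1sq f)^3" using M1 by (simp add: power_mult_distrib power2_eq_square power3_eq_cube)
 finally have "(LI x. (bulk M V x)^2*(f x)^2) <= 16*M*D1sq f" by (rule cube_le) (use M1 in "simp add: D1sq_nonneg")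
 moreover have "(LI x. (V x)^2*(f x)^2) = X+(LI x. (bulk M V x)^2*(f x)^2)"
  unfolding peak_bulk_split(2)[of V _ _ M] X_def by (rule integral_add[OF i1 B(1)]) simp
 ultimately show ?A using X by (simp add: algebra_simps)
 show "IB (%x. (V x)^2*(f x)^2)" unfolding peak_bulk_split(2)[of V _ _ M] using i1 B(1) by auto
qed

lemma Serrin_form_bound:
 assumes w: "BM w" "!!x. 0 <= w x" and M0: "M >= 0"
 and i3: "IB (%x. peak (sqrt M) w x^3)" and k: "(LI x. peak (sqrt M) w x^3) <= \<kappa>"
 and ke: "4096*\<kappa>^2 <= e^3" "e >= 0" and f: "H1 f"
 shows "IB (%x. (w x)^2*(f x)^2)"
 "(LI x. (w x)^2*(f x)^2) <= e*D1sq f+M * L2sq f" (is ?A)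
proof -
 note m [measurable] = peak_bulk_measurable[OF w(1)]
 have f2: "IB (%x. (f x)^2)" "BM f" using f C1_meas by (auto simp: H1_def)
 note P = L3_weight_Sobolev[OF _ peak_bulk_nonneg(1)[OF w(2)] i3 f]
 have "(LI x. (peak (sqrt M) w x)^2*(f x)^2)^3 <= 4096*\<kappa>^2*D1sq f^3"
  using k w by (intro order_trans[OF P(2)] mult_mono power_mono) (auto simp: D1sq_nonneg peak_bulk_nonneg)
 also have "... <= e^3*D1sq f^3" using ke by (intro mult_right_mono) (auto simp: D1sq_nonneg)
 finally have "(LI x. (peak (sqrt M) w x)^2*(f x)^2)^3 <= (e*D1sq f)^3" by (simp add: power_mult_distrib)
 hence X: "(LI x. (peak (sqrt M) w x)^2*(f x)^2) <= e*D1sq f" by (rule cube_le) (use ke in "simp add: D1sq_nonneg")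
 have "(bulk (sqrt M) w x)^2 <= M" for x
  using power_mono[of "bulk (sqrt M) w x" "sqrt M" 2] bulk_le[of "sqrt M" w x] peak_bulk_nonneg(2)[OF w(2)] M0 by simp
 hence B: "IB (%x. (bulk (sqrt M) w x)^2*(f x)^2)" "(LI x. (bulk (sqrt M) w x)^2*(f x)^2) <= M * L2sq f"
  by - (rule bounded_weight_integral[where M=M]; use m f2 in simp)+
 show "IB (%x. (w x)^2*(f x)^2)" unfolding peak_bulk_split(2)[of w _ _ "sqrt M"] using P(1) B by auto
 have "(LI x. (w x)^2*(f x)^2) = (LI x. (peak (sqrt M) w x)^2*(f x)^2)+(LI x. (bulk (sqrt M) w x)^2*(f x)^2)"
  unfolding peak_bulk_split(2)[of w _ _ "sqrt M"] by (rule integral_add[OF P(1) B(1)]) simp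
 thus ?A using X B by simp
qed

lemma self_mult_abs_DERIV: "((%y. y*<|y|>) has_real_derivative 2*<|y|>) (at (y::real))"
proof (cases "y = 0")
 case True
 have "(%h::real. <|h|>) \<midarrow>0\<rightarrow> 0" by (rule tendsto_rabs_zero) (rule tendsto_ident_at)
 hence "(%h::real. (0+h)*<|0+h|>/h) \<midarrow>0\<rightarrow> 0" by (rule Lim_transform_eventually) (auto simp: eventually_at_filter)
 thus ?thesis using True by (simp add: DERIV_def del: mult_eq_if)
next
 case False
 have "((%x. sgn y*x^2) has_real_derivative 2*<|y|>) (at y)" using False by (auto intro!: derivative_eq_intros simp: abs_sgn)
 thus ?thesis
 proof (rule has_field_derivative_transform_within_open[where S="{x. 0 < x*y}"])
  show "open {x. 0 < x*y}" by (intro open_Collect_less continuous_intros)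
 qed (use False in "auto simp: zero_less_mult_iff sgn_if power2_eq_square")
qed

lemma cubic_gradient_ibp:
 fixes k :: 3
 assumes f: "Hs 2 f"
 defines "g == pd k f" and "d == pd k (pd k f)"
 shows "IB (%x. <|g x|>^3)" "IB (%x. <|f x*g x*d x|>)"
 "(LI x. <|g x|>^3) <= 2*(LI x. <|f x*g x*d x|>)" (is ?A)
proof -
 have Hg: "Hs 1 g" and Hd: "Hs 0 d" using f Hs_pd[of 1 f] Hs_pd[of 0 "pd k f"] by (auto simp: g_def d_def numeral_2_eq_2)
 have C: "C1 f" "C1 g" using f Hg Hs_C1 by blast+
 have ab: "IB (%x. a x*<|h x|>*c x)" if "IB (%x. a x*h x*c x)" "BM a" "BM h" "BM c" for a h c :: "scalar"
  by (rule integrable_bound[OF that(1)]) (use that in "auto simp: abs_mult")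
 note m = Hs_meas[OF f] Hs_meas[OF Hg] Hs_meas[OF Hd]
 have i: "IB (%x. g x*<|g x|>*g x)" "IB (%x. f x*<|g x|>*g x)" "IB (%x. f x*<|g x|>*d x)"
  by (rule ab Hs_triple_integrable[OF Hg Hg Hg] Hs_triple_integrable[OF f Hg Hg] Hs_triple_integrable[OF f Hg Hd] m | simp)+
 have cube: "g x*<|g x|>*g x = <|g x|>^3" for x by (simp add: power3_eq_cube abs_if)
 show i3: "IB (%x. <|g x|>^3)" and "IB (%x. <|f x*g x*d x|>)"
  using i(1) integrable_abs[OF i(3)] by (simp_all add: cube abs_mult)
 have "C1 (%x. g x*<|g x|>)" "pd k (%x. g x*<|g x|>) = (%x. 2*<|g x|>*d x)"
  using C1_compose[OF C(2) self_mult_abs_DERIV continuous_on_mult_left[OF continuous_on_rabs[OF continuous_on_id]]] by (auto simp: d_def g_def)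
 hence F: "C1 (%x. f x*(g x*<|g x|>))" "pd k (%x. f x*(g x*<|g x|>)) = (%x. <|g x|>^3+2*(f x*<|g x|>*d x))"
  using C(1) by (auto simp: C1_mult pd_mult g_def[symmetric] power3_eq_cube abs_if fun_eq_iff)
 have "(LI x. pd k (%x. f x*(g x*<|g x|>)) x) = 0"
  by (rule integral_pd_zero[OF F(1)]) (use i i3 integrable_mult_right[OF i(3), of 2] in "auto simp: F(2) mult_ac")
 hence "(LI x. <|g x|>^3) = - 2*(LI x. f x*<|g x|>*d x)" unfolding F(2) using i i3 by simp
 also have "... <= 2*(LI x. <|f x*g x*d x|>)"
  using integral_norm_bound[of lborel "%x. f x*<|g x|>*d x"] by (simp add: abs_mult)
 finally show ?A .
qed

lemma L3_interpolation:
 assumes f: "Hs (Suc k) f"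
 shows "IB (%x. <|f x|>^3)" "(LI x. <|f x|>^3)^4 <= 4096*(L2sq f)^3*D1sq f^3" (is ?A)
proof -
 have H: "H1 f" by (rule Hs_H1[OF f])
 have [measurable]: "BM f" by (rule Hs_meas[OF f])
 have e: "<|f x|>*(f x)^2 = <|f x|>^3" for x by (simp add: power3_eq_cube power2_eq_square flip: abs_mult)
 note L4 = L4_bound[OF H]
 have i: "IB (%x. <|f x|>^2)" "IB (%x. ((f x)^2)^2)" using Hs_L2[OF f] L4 by auto
 show "IB (%x. <|f x|>^3)" using Cauchy_Schwarz_mult(1)[OF _ _ i] by (simp add: e)
 have "((LI x. <|f x|>^3)^2)^2 <= (L2sq f*(LI x. ((f x)^2)^2))^2"
  using Cauchy_Schwarz_mult(2)[OF _ _ i] by (intro power_mono) (simp_all add: e L2sq_def)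
 also have "... <= (L2sq f)^2*(4096*D1sq f^3 * L2sq f)" unfolding power_mult_distrib by (intro mult_left_mono L4) simp
 finally show ?A by (simp add: eval_nat_numeral mult_ac)
qed

lemma cubic_split_Young:
 fixes F G p q a :: real
 assumes n: "0 <= F" "0 <= G" "0 <= p" "0 <= q" and a: "a > 0"
 shows "2*(F*G*(p+q)) <= a*p^2+7/24*G^3+64/a^3*F^6+4/3*(F^3+q^3)"
proof -
 have "0 <= (a*p-F*G)^2/a" using a by simp
 also have "... = a*p^2+(F^2*G^2)/a-2*(F*G*p)" using a by (simp add: field_simps power2_eq_square)
 finally have first: "2*(F*G*p) <= a*p^2+(F^2*G^2)/a" by simp
 have "(G/2)^2*(2*F/sqrt a)^2 <= (G/2)^3+(2*F/sqrt a)^6" using n by (intro square_mult_square_le) auto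
 moreover have "sqrt a^6 = a^3" using a power_mult[of "sqrt a" 2 3] by simp
 ultimately have second: "(F^2*G^2)/a <= G^3/8+64/a^3*F^6" using a by (simp add: power_divide power_mult_distrib mult_ac)
 define r where "r = G/2"
 have "0 <= (F+r+q)*((F-r)^2+(r-q)^2+(q-F)^2)/2" using n by (simp add: r_def)
 also have "... = F^3+r^3+q^3-3*(F*r*q)" by (simp add: power3_eq_cube power2_eq_square field_simps)
 finally have "3*(F*(G/2)*q) <= F^3+(G/2)^3+q^3" by (simp add: r_def)
 hence "2*(F*G*q) <= G^3/6+4/3*(F^3+q^3)" by (simp add: power_divide add_divide_distrib algebra_simps)
 with first second show ?thesis by (simp add: distrib_left)
qed

lemma cubic_gradient_bound:
 assumes f: "Hs 2 f" and V: "split_bound V M" and dV: "!!x. <|pd k (pd k f) x|> <= V x"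
 defines "L == M+L2sq f+D1sq f"
 shows "(LI x. <|pd k f x|>^3) <= 400000*(L * sqrt L)"
proof -
 have Vm: "BM V" and V0: "!!x. 0 <= V x" and M1: "M >= 1"
  and iV1: "IB (%x. (peak M V x)^2)" "(LI x. (peak M V x)^2) <= sqrt M"
  and iV2: "IB (%x. bulk M V x^3)" "(LI x. bulk M V x^3) <= M * sqrt M" using V by (auto simp: split_bound_def)
 have LM: "M <= L" "L2sq f <= L" "D1sq f <= L" "L >= 1" using M1 by (auto simp: L_def L2sq_nonneg D1sq_nonneg add_increasing2 add_increasing)
 define a where "a = sqrt L"
 have a: "a >= 1" "a^2 = L" "a <= L" using LM real_sqrt_le_mono[of L "L^2"] self_le_power[of L 2] by (auto simp: a_def)
 have fS: "Hs (Suc 1) f" using f by (simp add: numeral_2_eq_2)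
 note cub = cubic_gradient_ibp[OF f, of k] and f6 = Sobolev_L6[OF Hs_H1[OF fS]] and f3 = L3_interpolation[OF fS]
 have "(LI x. <|f x|>^3)^4 <= 4096*L^3*L^3"
  using LM by (intro order_trans[OF f3(2)] mult_mono power_mono) (auto simp: L2sq_nonneg D1sq_nonneg)
 also have "... = (8*(L*a))^4" unfolding a(2)[symmetric] by (simp add: power_mult_distrib flip: power_mult power_add)
 finally have F3: "(LI x. <|f x|>^3) <= 8*(L*a)" using power_le_imp_le_base[of _ 3 "8*(L*a)"] a LM by (simp add: eval_nat_numeral)
 define S where "S = (LI x. <|pd k f x|>^3)"
 let ?b = "%x. a*(peak M V x)^2+7/24*<|pd k f x|>^3+64/a^3*f x^6+4/3*(<|f x|>^3+bulk M V x^3)"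
 have pw: "2*<|f x*pd k f x*pd k (pd k f) x|> <= ?b x" for x
 proof -
  have "<|pd k (pd k f) x|> <= peak M V x+bulk M V x" using dV[of x] peak_bulk_split(1)[of V x 1 M] by simp
  hence "2*<|f x*pd k f x*pd k (pd k f) x|> <= 2*(<|f x|>*<|pd k f x|>*(peak M V x+bulk M V x))"
   by (simp add: abs_mult mult_left_mono)
  also have "... <= ?b x" using cubic_split_Young[of "<|f x|>" "<|pd k f x|>" "peak M V x" "bulk M V x" a] a V0
   by (simp add: peak_bulk_nonneg power_even_abs)
  finally show ?thesis .
 qed
 have ib: "IB ?b" using iV1(1) iV2(1) cub(1) f6(1) f3(1) by auto
 have "S <= (LI x. 2*<|f x*pd k f x*pd k (pd k f) x|>)" using cub(3) by (simp add: S_def)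
 also have "... <= (LI x. ?b x)" by (rule integral_mono[OF integrable_mult_right[OF cub(2)] ib pw])
 also have "... = a*(LI x. (peak M V x)^2)+7/24*S+64/a^3*(LI x. f x^6)+4/3*((LI x. <|f x|>^3)+(LI x. bulk M V x^3))"
  unfolding S_def using iV1(1) iV2(1) cub(1) f6(1) f3(1) by simp
 also have "... <= a*a+7/24*S+64/a^3*(4096*L^3)+4/3*(8*(L*a)+L*a)"
 proof (intro add_mono mult_left_mono F3 order_refl)
  show "(LI x. (peak M V x)^2) <= a" using order_trans[OF iV1(2)] LM by (simp add: a_def)
  show "(LI x. f x^6) <= 4096*L^3" using f6(2) power_mono[OF LM(3), of 3] D1sq_nonneg[of f] by linarith
  show "(LI x. bulk M V x^3) <= L*a" unfolding a_def using LM M1 by (intro order_trans[OF iV2(2)] mult_mono) auto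
 qed (use a in auto)
 also have "64/a^3*(4096*L^3) = 262144*(L*a)" using a(1) unfolding a(2)[symmetric] by (simp add: eval_nat_numeral)
 also have "a*a <= L*a" using a by (intro mult_right_mono) auto
 finally have "17/24*S <= 262157*(L*a)" by (simp add: algebra_simps)
 moreover have "L*a >= 0" using LM a by simp
 ultimately show ?thesis unfolding S_def a_def by linarith
qed

lemma L3_weight_bound:
 assumes g: "BM g" "!!x. 0 <= g x" "IB (%x. g x^3)" and S: "(LI x. g x^3) <= 400000*(L * sqrt L)" and L1: "L >= 1"
 and p: "H1 p" and q: "BM q" "IB (%x. (q x)^2)" and e: "\<epsilon> > 0"
 shows "IB (%x. g x*<|p x|>*<|q x|>)"
 "(LI x. g x*<|p x|>*<|q x|>) <= \<epsilon>*D1sq p+88000/\<epsilon>*L * L2sq q" (is ?A)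
proof -
 have [measurable]: "BM g" "BM q" "BM p" using g q p C1_meas by (auto simp: H1_def)
 note P = L3_weight_Sobolev[OF g p]
 define X where "X = (LI x. (g x)^2*(p x)^2)"
 have "X^3 <= 4096*(400000*(L * sqrt L))^2*D1sq p^3"
  unfolding X_def by (intro order_trans[OF P(2)] mult_mono power_mono S) (auto intro!: integral_nonneg_AE simp: g D1sq_nonneg)
 also have "(400000*(L * sqrt L))^2 = 160000000000*L^3"
  using L1 by (simp add: power_mult_distrib power3_eq_cube power2_eq_square)
 also have "4096*(160000000000*L^3)*D1sq p^3 <= (88000*L*D1sq p)^3"
  using L1 by (simp add: power_mult_distrib D1sq_nonneg mult_right_mono)
 finally have X: "X <= 88000*L*D1sq p" by (rule cube_le) (use L1 in "simp add: D1sq_nonneg")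
 define T where "T = (LI x. (g x*<|p x|>)*<|q x|>)"
 show "IB (%x. g x*<|p x|>*<|q x|>)" using P(1) q by (intro Cauchy_Schwarz_mult(1)) (auto simp: power_mult_distrib)
 have "T^2 <= (LI x. (g x*<|p x|>)^2)*(LI x. <|q x|>^2)"
  unfolding T_def using P(1) q by (intro Cauchy_Schwarz_mult(2)) (auto simp: power_mult_distrib)
 also have "... = X * L2sq q" by (simp add: X_def L2sq_def power_mult_distrib)
 also have "... <= (88000*L*D1sq p) * L2sq q" using X by (intro mult_right_mono) (auto simp: L2sq_nonneg)
 finally have "T^2 <= (88000*L) * L2sq q*D1sq p" by (simp add: mult_ac)
 hence "T <= \<epsilon>*D1sq p+(88000*L)/\<epsilon> * L2sq q" by (rule square_Young) (use L1 e in "auto simp: L2sq_nonneg D1sq_nonneg")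
 thus ?A by (simp add: T_def)
qed

lemma dsts_Nil [simp]: "dsts [] u = u" and dsts_Cons: "dsts (d # ds) u = dst d (dsts ds u)"
 and dsts_append: "dsts (ds @ es) u = dsts ds (dsts es u)"
 by (auto simp: dsts_def)

lemma dst_Some: "dst (Some i) u = (%t. pd i (u t))" by (auto simp: dst_def fun_eq_iff)

lemma dst_None: "dst None u = (%t x. vector_derivative (%s. u s x) (at t))" by (auto simp: dst_def fun_eq_iff)

lemma dsts_map_Some: "dsts (map Some is) u = (%t. pds is (u t))" by (induction "is") (auto simp: dsts_Cons dst_Some pds_Cons)

lemma dsts_comp:
 fixes u :: "real => R3 => R3"
 assumes u: "smooth_slab T u" and t: "t:{0<..<T}"
 shows "dsts ds (%t x. u t x $ i) t x = dsts ds u t x $ i"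
 using t
proof (induction ds arbitrary: t x)
 case (Cons d ds)
 note bl = bounded_linear.has_vector_derivative[OF bounded_linear_vec_nth[of i]]
 show ?case
 proof (cases d)
  case None
  have "(%s. dsts ds u s x) differentiable (at t)" using u Cons.prems by (auto simp: smooth_slab_def)
  hence "((%s. dsts ds u s x) has_vector_derivative dsts (d # ds) u t x) (at t)"
   by (simp add: None dsts_Cons dst_None vector_derivative_works)
  from bl[OF this] have "((%s. dsts ds u s x $ i) has_vector_derivative dsts (d # ds) u t x $ i) (at t)" .
  hence "((%s. dsts ds (%t x. u t x $ i) s x) has_vector_derivative dsts (d # ds) u t x $ i) (at t)"
   by (rule has_vector_derivative_transform_within_open[where S="{0<..<T}"]) (use Cons in auto)
  thus ?thesis by (simp add: None dsts_Cons dst_None vector_derivative_at)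
 next
  case (Some j)
  have "(%s. dsts ds u t (x+s *\<^sub>R axis j 1)) differentiable (at 0)" using u Cons.prems by (auto simp: smooth_slab_def)
  hence "((%s. dsts ds u t (x+s *\<^sub>R axis j 1)) has_vector_derivative dsts (d # ds) u t x) (at 0)"
   by (simp add: Some dsts_Cons dst_Some pd_def vector_derivative_works)
  from bl[OF this] have "((%s. dsts ds (%t x. u t x $ i) t (x+s *\<^sub>R axis j 1)) has_vector_derivative dsts (d # ds) u t x $ i) (at 0)"
   using Cons.IH[OF Cons.prems] by simp
  thus ?thesis by (simp add: Some dsts_Cons dst_Some pd_def vector_derivative_at)
 qed
qed simp

lemma differentiable_component:
 fixes f :: "real => R3" shows "f differentiable F ==> (%s. f s $ i) differentiable F"
 unfolding differentiable_def using bounded_linear.has_derivative[OF bounded_linear_vec_nth] by blast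

lemma smooth_slab_component:
 fixes u :: "real => R3 => R3"
 assumes u: "smooth_slab T u" shows "smooth_slab T (%t x. u t x $ i)"
 unfolding smooth_slab_def
proof (intro allI conjI ballI)
 fix ds
 have "continuous_on (slab T) (%p. (case p of (t, x) => dsts ds u t x) $ i)"
  using u by (intro continuous_intros) (auto simp: smooth_slab_def)
 thus "continuous_on (slab T) (%(t, x). dsts ds (%t x. u t x $ i) t x)" by (rule continuous_on_eq) (auto simp: dsts_comp[OF u])
 fix t x assume t: "t:{0<..<T}"
 have "(%s. dsts ds u s x $ i) differentiable (at t)"
  by (rule differentiable_component) (use u t in "auto simp: smooth_slab_def")
 then obtain D where D: "((%s. dsts ds u s x $ i) has_derivative D) (at t)" by (auto simp: differentiable_def)
 have "((%s. dsts ds (%t x. u t x $ i) s x) has_derivative D) (at t)"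
  by (rule has_derivative_transform_within_open[OF D, of "{0<..<T}"]) (use t dsts_comp[OF u] in auto)
 thus "(%s. dsts ds (%t x. u t x $ i) s x) differentiable (at t)" by (rule differentiableI)
 fix j
 have "(%s. dsts ds u t (x+s *\<^sub>R axis j 1) $ i) differentiable (at 0)"
  by (rule differentiable_component) (use u t in "auto simp: smooth_slab_def")
 thus "(%s. dsts ds (%t x. u t x $ i) t (x+s *\<^sub>R axis j 1)) differentiable (at 0)" using dsts_comp[OF u t] by simp
qed

context
 fixes T :: real and f :: "real => scalar"
 assumes f: "smooth_slab T f"
begin

lemma slab_continuous: "continuous_on (slab T) (%(t, x). dsts ds f t x)" using f by (auto simp: smooth_slab_def)

lemma slab_C_inf: assumes t: "t:{0<..<T}" shows "C_inf (dsts ds f t)" unfolding C_inf_def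
proof (intro allI conjI)
 fix "is"
 have e: "pds is (dsts ds f t) = dsts (map Some is @ ds) f t" by (simp add: dsts_append dsts_map_Some)
 have "continuous_on UNIV (%x. (%(t, x). dsts (map Some is @ ds) f t x) (t, x))"
  by (rule continuous_on_compose2[OF slab_continuous]) (use t in "auto intro!: continuous_intros")
 thus "continuous_on UNIV (pds is (dsts ds f t))" by (simp add: e)
 show "(%s. pds is (dsts ds f t) (x+s *\<^sub>R axis i 1)) differentiable (at 0)" for i x
  unfolding e using f t by (auto simp: smooth_slab_def)
qed

lemma slab_time_deriv:
 assumes t: "t:{0<..<T}" shows "((%s. dsts ds f s x) has_real_derivative dst None (dsts ds f) t x) (at t)"
 using f t unfolding smooth_slab_def dst_None has_real_derivative_iff_has_vector_derivative
 by (auto simp: vector_derivative_works)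

lemma slab_axis_isCont:
 assumes t: "t:{0<..<T}"
 shows "isCont (%(s, r). dsts ds f (t+s) (x+r *\<^sub>R axis i 1)) (0, 0)"
proof -
 define box where "box = {-t<..<T-t}\<times>(UNIV::real set)"
 have "continuous_on box (%p. (%(t, x). dsts ds f t x) (t+fst p, x+snd p *\<^sub>R axis i 1))"
  by (rule continuous_on_compose2[OF slab_continuous]) (auto intro!: continuous_intros simp: box_def)
 moreover have "open box" "(0, 0):box" using t by (auto simp: box_def open_Times)
 ultimately have "isCont (%p. (%(t, x). dsts ds f t x) (t+fst p, x+snd p *\<^sub>R axis i 1)) (0, 0)"
  by (simp add: continuous_on_eq_continuous_at)
 thus ?thesis by (simp add: case_prod_unfold)
qed

lemma slab_time_space_commute:
 assumes t: "t:{0<..<T}"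
 shows "dsts (None # Some i # ds) f t x = dsts (Some i # None # ds) f t x"
proof -
 define \<delta> where "\<delta> = min t (T-t)"
 have d: "\<delta> > 0" and inn: "!!s. <|s|> < \<delta> ==> t+s:{0<..<T}" using t by (auto simp: \<delta>_def)
 define g where "g es s r = dsts es f (t+s) (x+r *\<^sub>R axis i 1)" for es s r
 have td: "((%s. g es s r) has_real_derivative g (None # es) s r) (at s)" if "<|s|> < \<delta>" for es s r
  using slab_time_deriv[OF inn[OF that], of es "x+r *\<^sub>R axis i 1"] DERIV_shift[of "%s. dsts es f s (x+r *\<^sub>R axis i 1)" _ s t]
  by (simp add: g_def dsts_Cons add.commute)
 have sd: "((%r. g es s r) has_real_derivative g (Some i # es) s r) (at r)" if "<|s|> < \<delta>" for es s r
  unfolding g_def dsts_Cons dst_Some by (rule C1_has_pd[OF C_inf_C1[OF slab_C_inf[OF inn[OF that]]]])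
 have "g (Some i # None # ds) 0 0 = g (None # Some i # ds) 0 0"
  by (rule mixed_derivatives_eq[OF d td sd sd td]) (assumption | ((unfold g_def)?, rule slab_axis_isCont[OF t]))+
 thus ?thesis by (simp add: g_def)
qed

lemma slab_pds_time:
 assumes t: "t:{0<..<T}"
 shows "dst None (%t. pds is (f t)) t = pds is (dst None f t)"
proof (induction "is")
 case (Cons i "is")
 have "dst None (%t. pds (i # is) (f t)) t = pd i (dst None (%t. pds is (f t)) t)"
  using slab_time_space_commute[OF t, of i "map Some is"] by (auto simp: dsts_Cons dsts_map_Some dst_Some pds_Cons fun_eq_iff)
 thus ?case by (simp add: Cons.IH pds_Cons)
qed simp

end

lemma has_time_deriv_pds:
 assumes f: "smooth_slab T f" shows "has_time_deriv T (%t. pds is (f t)) (%t. pds is (dst None f t))"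
 unfolding has_time_deriv_def
proof (intro conjI ballI allI)
 fix t x assume t: "t:{0<..<T}"
 show "((%s. pds is (f s) x) has_real_derivative pds is (dst None f t) x) (at t)"
  using slab_time_deriv[OF f t, of "map Some is" x] slab_pds_time[OF f t, of "is"] by (simp add: dsts_map_Some)
next
 show "continuous_on (slab T) (%(t, x). pds is (f t) x)"
  using slab_continuous[OF f, of "map Some is"] by (simp add: dsts_map_Some)
 show "continuous_on (slab T) (%(t, x). pds is (dst None f t) x)"
  using slab_continuous[OF f, of "map Some is @ [None]"] by (simp add: dsts_map_Some dsts_append dsts_Cons)
qed

lemma has_time_deriv_diff: "has_time_deriv T v v' ==> has_time_deriv T w w' ==> has_time_deriv T (%t x. v t x-w t x) (%t x. v' t x-w' t x)"
 unfolding has_time_deriv_def split_beta by (auto intro!: derivative_intros continuous_intros)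

lemma has_time_deriv_sum: "(!!a. a:A ==> has_time_deriv T (v a) (v' a)) ==> has_time_deriv T (%t x. SUM a:A. v a t x) (%t x. SUM a:A. v' a t x)"
 unfolding has_time_deriv_def split_beta by (auto intro!: DERIV_sum continuous_on_sum)

lemma has_time_deriv_weighted_square:
 assumes v: "has_time_deriv T v v'" and \<psi>: "continuous_on UNIV \<psi>"
 shows "has_time_deriv T (%t x. \<psi> x*(v t x)^2) (%t x. \<psi> x*(2 * v t x * v' t x))"
proof -
 have "continuous_on (slab T) (%p. \<psi> (snd p))" by (rule continuous_on_compose2[OF \<psi>]) (auto intro!: continuous_intros)
 thus ?thesis
  using v unfolding has_time_deriv_def split_beta by (auto intro!: derivative_eq_intros continuous_intros simp: algebra_simps)
qed

definition energy_flux :: "scalar => scalar => (3 => scalar) => scalar" where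
 "energy_flux e v h x = (SU l. 2*(e x)^2*pd l v x*(pd l v x+h l x)+4*e x*pd l e x * v x*(pd l v x+h l x))"

lemma energy_flux_balance:
 assumes chi: "test_fun e" and v: "C_inf v" and h: "!!l. C1 (h l)"
 and eq: "!!x. v' x = (SU l. pd l (pd l v) x)+(SU l. pd l (h l) x)"
 shows "IB (energy_flux e v h)" "(LI x. (e x)^2*(2 * v x * v' x)) = - (LI x. energy_flux e v h x)" (is ?A)
proof -
 obtain R where R: "!!x. norm x > R ==> e x = 0" using chi by (auto simp: test_fun_def)
 have C: "C1 e" "C1 v" "C1 (pd l v)" for l using test_fun_C1[OF chi] v by (auto intro: C_inf_C1 C_inf_pd)
 define W where "W l x = 2*((e x*e x)*(v x*(pd l v x+h l x)))" for l x
 have W: "C1 (W l)" for l unfolding W_def by (intro C1_cmult C1_mult C1_add C h)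
 have "pd l (W l) = (%x. 2*((pd l e x*e x+e x*pd l e x)*(v x*(pd l v x+h l x)) +
  (e x*e x)*(pd l v x*(pd l v x+h l x)+v x*(pd l (pd l v) x+pd l (h l) x))))" for l
  by (simp add: W_def[abs_def] pd_cmult pd_mult pd_add C1_mult C1_add C h)
 hence pW: "pd l (W l) x = (2*(e x)^2*pd l v x*(pd l v x+h l x)+4*e x*pd l e x * v x*(pd l v x+h l x))
  + (e x)^2*(2 * v x*(pd l (pd l v) x+pd l (h l) x))" for l x
  by (simp add: power2_eq_square algebra_simps)
 have divergence: "(SU l. pd l (W l) x) = energy_flux e v h x+(e x)^2*(2 * v x * v' x)" for x
  by (simp add: pW eq energy_flux_def sum.distrib sum_distrib_left distrib_left)
 have iW: "IB (pd l (W l))" and zW: "(LI x. pd l (W l) x) = 0" for l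
  by (rule integrable_compact_support[OF C1_cont_pd[OF W] pd_outside[where R=R]] integral_pd_compact_support[OF W, of R]; simp add: W_def R)+
 show i: "IB (energy_flux e v h)" unfolding energy_flux_def[abs_def]
  by (rule integrable_compact_support[of _ R]) (auto intro!: continuous_intros C1_cont[OF C(1)] C1_cont[OF C(2)] C1_cont[OF C(3)] C1_cont_pd[OF C(1)] C1_cont[OF h] simp: R)
 have "(LI x. (e x)^2*(2 * v x * v' x)) = (LI x. (SU l. pd l (W l) x)-energy_flux e v h x)" by (simp add: divergence)
 also have "... = (LI x. SU l. pd l (W l) x)-(LI x. energy_flux e v h x)"
  by (rule Bochner_Integration.integral_diff[OF integrable_sum i]) (rule iW)
 finally show ?A using iW zW by (simp add: integral_sum)
qed

definition L2_le :: "scalar => real => bool" where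
 "L2_le f K \<longleftrightarrow> f:borel_measurable borel & IB (%x. (f x)^2) & L2sq f <= K"

definition flux_majorant :: "real => scalar => (3 => scalar) => scalar" where
 "flux_majorant k v h x = (SU l. (2+4*k)*((v x)^2+3*(pd l v x)^2+2*(h l x)^2))"

lemma flux_majorant_integral:
 assumes v: "L2_le v K" "!!l. L2_le (pd l v) K" "!!l. L2_le (h l) K" and k: "0 <= k"
 shows "IB (flux_majorant k v h)" "(LI x. flux_majorant k v h x) <= 18*(2+4*k)*K" (is ?A)
proof -
 have i: "IB (%x. (v x)^2)" "IB (%x. (pd l v x)^2)" "IB (%x. (h l x)^2)" for l using v by (auto simp: L2_le_def)
 show "IB (flux_majorant k v h)" unfolding flux_majorant_def[abs_def] using i by (auto intro!: integrable_sum integrable_mult_right)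
 have "(LI x. flux_majorant k v h x) = (SU l. (2+4*k)*(L2sq v+3 * L2sq (pd l v)+2 * L2sq (h l)))"
  unfolding flux_majorant_def L2sq_def using i by (subst integral_sum) auto
 also have "... <= (SU l::3. (2+4*k)*(K+3*K+2*K))" using v k by (intro sum_mono mult_left_mono add_mono) (auto simp: L2_le_def)
 finally show ?A by (simp add: algebra_simps)
qed

lemma abs_mult_le_squares: "<|a*b|> <= a^2+(b::real)^2"
proof -
 have "2*(<|a|>*<|b|>) <= a^2+b^2" using sum_squares_bound[of "<|a|>" "<|b|>"] by simp
 moreover have "0 <= <|a|>*<|b|>" by simp
 ultimately show ?thesis unfolding abs_mult by linarith
qed

lemma energy_flux_le_majorant:
 assumes e: "0 <= \<eta> x" "\<eta> x <= 1" and pe: "!!l. <|pd l \<eta> x|> <= k"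
 shows "<|energy_flux \<eta> v h x|> <= flux_majorant k v h x"
 unfolding energy_flux_def flux_majorant_def
proof (rule order_trans[OF sum_abs sum_mono])
 fix l :: 3
 define p q where "p = pd l v x" and "q = pd l v x+h l x"
 have k: "0 <= k" using pe[of l] by linarith
 have "<|2*(\<eta> x)^2*p*q|> = 2*((\<eta> x)^2*<|p*q|>)" by (simp add: abs_mult)
 also have "... <= 2*(1*(p^2+q^2))" using abs_mult_le_squares[of p q] e by (intro mult_left_mono mult_mono power_le_one) auto
 finally have diffusive: "<|2*(\<eta> x)^2*p*q|> <= 2*(p^2+q^2)" by simp
 have "<|4*\<eta> x*pd l \<eta> x * v x*q|> = 4*(\<eta> x*(<|pd l \<eta> x|>*<|v x*q|>))" using e(1) by (simp add: abs_mult)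
 also have "... <= 4*(1*(k*((v x)^2+q^2)))"
  using abs_mult_le_squares[of "v x" q] e pe k by (intro mult_left_mono mult_mono) (auto intro!: mult_nonneg_nonneg)
 finally have "<|2*(\<eta> x)^2*p*q+4*\<eta> x*pd l \<eta> x * v x*q|> <= 2*(p^2+q^2)+4*k*((v x)^2+q^2)"
  using diffusive abs_triangle_ineq[of "2*(\<eta> x)^2*p*q" "4*\<eta> x*pd l \<eta> x * v x*q"] by linarith
 also have "... <= 2*((v x)^2+p^2+q^2)+4*k*((v x)^2+p^2+q^2)" using k by (intro add_mono mult_left_mono) auto
 also have "... = (2+4*k)*((v x)^2+p^2+q^2)" by (simp add: distrib_right)
 also have "... <= (2+4*k)*((v x)^2+3*p^2+2*(h l x)^2)"
  using square_add_le[of p "h l x"] k by (intro mult_left_mono) (auto simp: p_def q_def)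
 finally show "<|2*(\<eta> x)^2*pd l v x*(pd l v x+h l x)+4*\<eta> x*pd l \<eta> x * v x*(pd l v x+h l x)|>
  <= (2+4*k)*((v x)^2+3*(pd l v x)^2+2*(h l x)^2)" unfolding p_def q_def .
qed

lemma energy_flux_measurable:
 assumes "BM v" "!!l. BM (pd l v)" "!!l. BM (h l)" shows "BM (energy_flux (chi n) v h)"
 unfolding energy_flux_def using assms C1_meas[OF C1_chi]
 by (intro borel_measurable_sum borel_measurable_add borel_measurable_times borel_measurable_const borel_measurable_power) auto

definition local_energy :: "nat => scalar => real" where
 "local_energy n v = (LI x. (chi n x)^2*(v x)^2)"

definition local_loss :: "nat => scalar => (3 => scalar) => real" where
 "local_loss n v h = (LI x. energy_flux (chi n) v h x)"

lemma local_loss_bound: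
 obtains k where "0 <= k" "!!n v h K. L2_le v K ==> (!!l. L2_le (pd l v) K) ==> (!!l. L2_le (h l) K) ==> <|local_loss n v h|> <= 18*(2+4*k)*K"
proof -
 obtain k where k: "0 <= k" "!!n i x. <|pd i (chi n) x|> <= k" by (rule pd_chi_bound) blast
 show thesis
 proof (rule that[OF k(1)])
  fix n v h K assume v: "L2_le v K" "!!l. L2_le (pd l v) K" "!!l::3. L2_le (h l) K"
  note M = flux_majorant_integral[of v K h, OF v k(1)]
  have bound: "<|energy_flux (chi n) v h x|> <= flux_majorant k v h x" for x by (rule energy_flux_le_majorant[OF chi_bounds k(2)])
  have "BM (energy_flux (chi n) v h)" using v by (intro energy_flux_measurable) (auto simp: L2_le_def)
  hence "IB (energy_flux (chi n) v h)" by (intro integrable_bound[OF M(1)]) (auto intro!: AE_I2 order_trans[OF bound])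
  hence "<|local_loss n v h|> <= (LI x. flux_majorant k v h x)" unfolding local_loss_def real_norm_def[symmetric]
   by (rule Bochner_Integration.integral_norm_bound_integral[OF _ M(1)]) (simp add: bound)
  with M(2) show "<|local_loss n v h|> <= 18*(2+4*k)*K" by simp
 qed
qed

lemma local_loss_tendsto:
 assumes v: "L2_le v K" "!!l. L2_le (pd l v) K" "!!l. L2_le (h l) K"
 shows "(%n. local_loss n v h) ----> 2*(D1sq v+(SU l. LI x. h l x*pd l v x))"
proof -
 obtain k where k: "0 <= k" "!!n i x. <|pd i (chi n) x|> <= k" by (rule pd_chi_bound) blast
 have m [measurable]: "BM v" "BM (pd l v)" "BM (h l)" for l using v by (auto simp: L2_le_def)
 have i: "IB (%x. (pd l v x)^2)" "IB (%x. h l x*pd l v x)" for l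
  using v by (auto simp: L2_le_def intro!: Cauchy_Schwarz_mult(1))
 define L where "L x = (SU l. 2*((pd l v x)^2+h l x*pd l v x))" for x
 have "(%n. local_loss n v h) ----> (LI x. L x)" unfolding local_loss_def
 proof (rule integral_dominated_convergence[OF _ _ flux_majorant_integral(1)[OF v k(1)]])
  show "L:borel_measurable lborel" unfolding L_def by measurable
  show "energy_flux (chi n) v h:borel_measurable lborel" for n using energy_flux_measurable[OF m] by simp
  show "AE x in lborel. norm (energy_flux (chi n) v h x) <= flux_majorant k v h x" for n
   using energy_flux_le_majorant[OF chi_bounds k(2)] by simp
  have "(%n. energy_flux (chi n) v h x) ----> (SU l. 2*1^2*pd l v x*(pd l v x+h l x)+4*1*0 * v x*(pd l v x+h l x))" for x
   unfolding energy_flux_def by (intro tendsto_intros chi_tendsto pd_chi_tendsto)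
  thus "AE x in lborel. (%n. energy_flux (chi n) v h x) ----> L x" by (simp add: L_def power2_eq_square algebra_simps)
 qed
 moreover have "(LI x. L x) = 2*(D1sq v+(SU l. LI x. h l x*pd l v x))"
  unfolding L_def D1sq_def L2sq_def using i by (simp add: integral_sum sum.distrib sum_distrib_left distrib_left)
 ultimately show ?thesis by simp
qed

lemma bounded_convergence_Icc:
 fixes D :: "nat => real => real"
 assumes m: "!!n. (%r. indicator {s..t} r*D n r):borel_measurable lborel"
 and bound: "!!n r. r:{s..t} ==> <|D n r|> <= C" and lim: "!!r. r:{s..t} ==> (%n. D n r) ----> G r"
 shows "SIB {s..t} G"
 "(%n. SI {s..t} (D n)) ----> SI {s..t} G"
proof -
 have lim': "(%n. indicator {s..t} r*D n r) ----> indicator {s..t} r*G r" for r using lim by (cases "r:{s..t}") auto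
 have Gm: "(%r. indicator {s..t} r*G r):borel_measurable lborel" by (rule borel_measurable_LIMSEQ_real[OF lim' m])
 have ic: "IB (%r. C*indicator {s..t} r)" by (intro integrable_mult_right integrable_real_indicator) (auto simp: emeasure_lborel_Icc_eq)
 have pointwise: "AE r in lborel. norm (indicator {s..t} r*D n r) <= C*indicator {s..t} r" for n
  using bound by (auto simp: indicator_def)
 show "SIB {s..t} G"
  by (rule integrable_dominated_convergence[where s="%n r. indicator {s..t} r*D n r", OF Gm m ic _ pointwise]) (use lim' in auto)
 show "(%n. SI {s..t} (D n)) ----> SI {s..t} G"
  by (rule integral_dominated_convergence[where s="%n r. indicator {s..t} r*D n r", OF Gm m ic _ pointwise]) (use lim' in auto)
qed

locale flux_evolution =
 fixes T s t :: real and v v' :: "real => scalar" and h :: "real => 3 => scalar"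
 assumes time_derivative: "has_time_deriv T v v'" and times: "0 < s" "s <= t" "t < T"
 and smooth: "r:{s..t} ==> C_inf (v r)" and flux_C1: "r:{s..t} ==> C1 (h r l)"
 and equation: "r:{s..t} ==> v' r x = (SU l. pd l (pd l (v r)) x)+(SU l. pd l (h r l) x)"
 and square_integrable: "r:{s..t} ==> IB (%x. (v r x)^2)"
begin

lemma local_energy_DERIV:
 assumes r: "r:{0<..<T}"
 shows "((%t. local_energy n (v t)) has_real_derivative (LI x. (chi n x)^2*(2 * v r x * v' r x))) (at r)" (is ?A)
 and "continuous_on {0<..<T} (%t. LI x. (chi n x)^2*(2 * v t x * v' t x))" (is ?B)
proof -
 have "continuous_on UNIV (%x. (chi n x)^2)" by (intro continuous_intros C1_cont[OF C1_chi])
 note ev = has_time_deriv_weighted_square[OF time_derivative this]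
 show ?A unfolding local_energy_def by (rule param_integral_DERIV[OF ev, of "3*real (Suc n)"]) (use r chi_support in auto)
 show ?B by (rule param_integral_continuous[of _ _ "3*real (Suc n)"]) (use ev chi_support in "auto simp: has_time_deriv_def")
qed

lemma local_energy_increment:
 "SIB {s..t} (%r. local_loss n (v r) (h r))"
 "local_energy n (v t)-local_energy n (v s) = - SI {s..t} (%r. local_loss n (v r) (h r))"
proof -
 define D where "D r = (LI x. (chi n x)^2*(2 * v r x * v' r x))" for r
 have sub: "{s..t} \<subseteq> {0<..<T}" and s: "s:{0<..<T}" using times by auto
 note dD = local_energy_DERIV[where n=n, folded D_def]
 have loss: "indicator {s..t} r*local_loss n (v r) (h r) = - (indicator {s..t} r*D r)" for r unfolding D_def local_loss_def
  using energy_flux_balance(2)[OF test_fun_chi smooth flux_C1 equation] by (auto simp: indicator_def)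
 have iD: "SIB {s..t} D" using borel_integrable_compact[OF _ continuous_on_subset[OF dD(2)[OF s] sub]] by simp
 show "SIB {s..t} (%r. local_loss n (v r) (h r))" unfolding loss using iD by simp
 have "(LI r. D r*indicator {s..t} r) = local_energy n (v t)-local_energy n (v s)"
 proof (rule integral_FTC_Icc_real[OF times(2)])
  fix r assume r: "s <= r" "r <= t"
  show "((%t. local_energy n (v t)) has_real_derivative D r) (at r)" using r sub by (intro dD(1)) auto
  show "isCont D r" using dD(2)[OF s] r sub by (auto simp: continuous_on_eq_continuous_at)
 qed
 thus "local_energy n (v t)-local_energy n (v s) = - SI {s..t} (%r. local_loss n (v r) (h r))"
  unfolding loss by (simp add: mult.commute)
qed

lemma local_energy_tendsto: "r:{s..t} ==> (%n. local_energy n (v r)) ----> L2sq (v r)"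
 unfolding local_energy_def L2sq_def by (rule integral_chi_tendsto(2)[OF square_integrable])

theorem energy_identity:
 assumes L2: "!!r. r:{s..t} ==> L2_le (v r) K" "!!r l. r:{s..t} ==> L2_le (pd l (v r)) K" "!!r l. r:{s..t} ==> L2_le (h r l) K"
 defines "G == %r. 2*(D1sq (v r)+(SU l. LI x. h r l x*pd l (v r) x))"
 shows "SIB {s..t} G"
 "L2sq (v t)-L2sq (v s) = - SI {s..t} G"
proof -
 obtain k where k: "!!n v h K. L2_le v K ==> (!!l. L2_le (pd l v) K) ==> (!!l. L2_le (h l) K) ==> <|local_loss n v h|> <= 18*(2+4*k)*K"
  by (rule local_loss_bound) blast
 note lim = bounded_convergence_Icc[OF borel_measurable_integrable[OF local_energy_increment(1)] k[OF L2] local_loss_tendsto[OF L2]]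
 show "SIB {s..t} G" unfolding G_def by (rule lim(1))
 from lim(2) have "(%n. local_energy n (v t)-local_energy n (v s)) ----> - SI {s..t} G"
  unfolding local_energy_increment(2) G_def by (rule tendsto_minus)
 moreover have "(%n. local_energy n (v t)-local_energy n (v s)) ----> L2sq (v t)-L2sq (v s)"
  using times by (intro tendsto_diff local_energy_tendsto) auto
 ultimately show "L2sq (v t)-L2sq (v s) = - SI {s..t} G" using LIMSEQ_unique by blast
qed

end

lemma cross_term_Young:
 fixes d e z y w :: real
 assumes d: "d > 0"
 shows "- (4*(e*z*y*w)) <= d*(e^2*w^2)+4/d*(z^2*y^2)"
proof -
 have "0 <= (d*(e*w)+2*(z*y))^2/d" using d by simp
 also have "... = d*(e^2*w^2)+4/d*(z^2*y^2)+4*(e*z*y*w)" using d by (simp add: field_simps power2_eq_square)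
 finally show ?thesis by linarith
qed

lemma energy_flux_lower:
 assumes B: "0 <= B" and \<epsilon>: "!!l. (pd l e x)^2 <= \<epsilon>"
 shows "- energy_flux e v h x <= (SU l. - (7/4)*((e x)^2*(pd l v x)^2)-2*(e x)^2*(h l x*pd l v x)
 + 1/(4*(B+1))*((e x)^2*(h l x)^2)+16*(B+2)*\<epsilon>*(v x)^2)"
 unfolding energy_flux_def sum_negf[symmetric]
proof (rule sum_mono)
 fix l :: 3
 define p q z where "p = pd l v x" and "q = h l x" and "z = pd l e x"
 have y1: "- (4*(e x*z * v x*p)) <= 1/4*((e x)^2*p^2)+16*(z^2*(v x)^2)" using cross_term_Young[of "1/4"] by simp
 have y2: "- (4*(e x*z * v x*q)) <= 1/(4*(B+1))*((e x)^2*q^2)+16*(B+1)*(z^2*(v x)^2)"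
  using cross_term_Young[of "1/(4*(B+1))" "e x" z "v x" q] B by simp
 have "16*(B+2)*(z^2*(v x)^2) <= 16*(B+2)*(\<epsilon>*(v x)^2)" unfolding z_def using B by (intro mult_left_mono mult_right_mono \<epsilon>) auto
 moreover have "16*(z^2*(v x)^2)+16*(B+1)*(z^2*(v x)^2) = 16*(B+2)*(z^2*(v x)^2)" by (simp add: algebra_simps)
 moreover have "- (2*(e x)^2*p*(p+q)+4*e x*z * v x*(p+q))
  = - 2*((e x)^2*p^2)-2*(e x)^2*(q*p)+(- (4*(e x*z * v x*p)))+(- (4*(e x*z * v x*q)))"
  by (simp add: power2_eq_square algebra_simps)
 ultimately have "- (2*(e x)^2*p*(p+q)+4*e x*z * v x*(p+q))
  <= - (7/4)*((e x)^2*p^2)-2*(e x)^2*(q*p)+1/(4*(B+1))*((e x)^2*q^2)+16*(B+2)*\<epsilon>*(v x)^2"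
  using y1 y2 by (simp add: mult.assoc)
 thus "- (2*(e x)^2*pd l v x*(pd l v x+h l x)+4*e x*pd l e x * v x*(pd l v x+h l x))
  <= - (7/4)*((e x)^2*(pd l v x)^2)-2*(e x)^2*(h l x*pd l v x)+1/(4*(B+1))*((e x)^2*(h l x)^2)+16*(B+2)*\<epsilon>*(v x)^2"
  unfolding p_def q_def z_def .
qed

locale dissipative_family =
 fixes A :: "'i set" and T s t :: real and v v' :: "'i => real => scalar" and h :: "'i => real => 3 => scalar"
 and L :: "real => scalar" and La :: "real => real" and B K :: real
 assumes finite: "finite A" and member: "a:A ==> flux_evolution T s t (v a) (v' a) (h a)"
 and gradient_continuous: "a:A ==> continuous_on (slab T) (%(t, x). pd l (v a t) x)"
 and energy_le: "r:{s..t} ==> (SUM a:A. L2sq (v a r)) <= K"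
 and remainder: "r:{s..t} ==> IB (L r)" "0 <= L r x" "r:{s..t} ==> (LI x. L r x) <= La r"
 and La_continuous: "continuous_on {s..t} La" and times: "0 < s" "s <= t" "t < T" and B: "0 <= B"
 and flux_square_le:
 "r:{s..t} ==> (SUM a:A. SU l. (h a r l x)^2) <= B*(SUM a:A. SU l. (pd l (v a r) x)^2)+L r x"
 and flux_work_ge:
 "r:{s..t} ==> - (SUM a:A. SU l. h a r l x*pd l (v a r) x) <= 1/2*(SUM a:A. SU l. (pd l (v a r) x)^2)+L r x"
begin

definition dissipation :: "real => scalar" where
 "dissipation r x = (SUM a:A. SU l. (pd l (v a r) x)^2)"

definition local_dissipation :: "nat => real => real" where
 "local_dissipation n r = (LI x. (chi n x)^2*dissipation r x)"

lemma dissipation_nonneg: "0 <= dissipation r x" and local_dissipation_nonneg: "0 <= local_dissipation n r"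
proof -
 show d: "0 <= dissipation r x" for x unfolding dissipation_def by (intro sum_nonneg) auto
 show "0 <= local_dissipation n r" unfolding local_dissipation_def using d by (intro integral_nonneg_AE AE_I2 mult_nonneg_nonneg) auto
qed

lemma local_dissipation_continuous: "continuous_on {0<..<T} (local_dissipation n)"
 and local_dissipation_integrable: "r:{0<..<T} ==> IB (%x. (chi n x)^2*dissipation r x)"
proof -
 have "continuous_on (slab T) (%p. chi n (snd p))"
  by (rule continuous_on_compose2[OF C1_cont[OF C1_chi]]) (auto intro!: continuous_intros)
 moreover have "continuous_on (slab T) (%p. pd l (v a (fst p)) (snd p))" if "a:A" for a l
  using gradient_continuous[OF that] by (simp add: case_prod_unfold)
 ultimately have cont: "continuous_on (slab T) (%(r, x). (chi n x)^2*dissipation r x)"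
  unfolding dissipation_def case_prod_unfold by (intro continuous_intros)
 show "continuous_on {0<..<T} (local_dissipation n)"
  unfolding local_dissipation_def by (rule param_integral_continuous[OF cont, of "3*real (Suc n)"]) (use chi_support in auto)
 show "IB (%x. (chi n x)^2*dissipation r x)" if "r:{0<..<T}"
  by (rule integrable_compact_support[OF slab_continuous_slice[OF cont that], of "3*real (Suc n)"]) (use chi_support in auto)
qed

lemma total_flux_lower:
 assumes r: "r:{s..t}" and e: "!!l. (pd l (chi n) x)^2 <= e"
 shows "(SUM a:A. - energy_flux (chi n) (v a r) (h a r) x)
 <= - (1/2)*((chi n x)^2*dissipation r x)+3*L r x+48*(B+2)*e*(SUM a:A. (v a r x)^2)"
proof -
 define c \<delta> where "c = (chi n x)^2" and "\<delta> = 1/(4*(B+1))"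
 have c: "0 <= c" "c <= 1" unfolding c_def using chi_bounds by (auto intro: power_le_one)
 have d: "0 <= \<delta>" "\<delta> <= 1" "\<delta>*B <= 1/4" using B by (auto simp: \<delta>_def field_simps)
 define cut where "cut = 48*(B+2)*e*(SUM a:A. (v a r x)^2)"
 have "(SUM a:A. - energy_flux (chi n) (v a r) (h a r) x) <= (SUM a:A. SU l. - (7/4)*(c*(pd l (v a r) x)^2)
  - 2*c*(h a r l x*pd l (v a r) x)+\<delta>*(c*(h a r l x)^2)+16*(B+2)*e*(v a r x)^2)"
  unfolding c_def \<delta>_def by (intro sum_mono energy_flux_lower[OF B e])
 also have "... = - (7/4)*c*dissipation r x+2*c*(- (SUM a:A. SU l. h a r l x*pd l (v a r) x))
  + \<delta>*c*(SUM a:A. SU l. (h a r l x)^2)+cut"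
  unfolding dissipation_def cut_def by (simp add: sum.distrib sum_subtractf sum_distrib_left mult.assoc sum_negf)
  (intro sum.cong refl, simp add: algebra_simps)
 also have "... <= - (7/4)*c*dissipation r x+2*c*(1/2*dissipation r x+L r x)+\<delta>*c*(B*dissipation r x+L r x)+cut"
  using flux_square_le[OF r, of x] flux_work_ge[OF r, of x] c d unfolding dissipation_def[symmetric]
  by (intro add_mono mult_left_mono order_refl) auto
 also have "... = - (3/4)*(c*dissipation r x)+(\<delta>*B)*(c*dissipation r x)+(2+\<delta>)*(c*L r x)+cut" by (simp add: algebra_simps)
 also have "... <= - (3/4)*(c*dissipation r x)+(1/4)*(c*dissipation r x)+3*(1*L r x)+cut"
  using c d remainder(2) dissipation_nonneg by (intro add_mono order_refl mult_right_mono[OF d(3)] mult_mono) auto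
 finally show ?thesis by (simp add: c_def cut_def mult.commute[of "dissipation r x"])
qed

lemma local_loss_lower:
 assumes r: "r:{s..t}" and e: "!!l x. (pd l (chi n) x)^2 <= e" "0 <= e"
 shows "(SUM a:A. - local_loss n (v a r) (h a r)) <= - (1/2)*local_dissipation n r+3*La r+48*(B+2)*e*K"
proof -
 have flux: "IB (energy_flux (chi n) (v a r) (h a r))" and L2: "IB (%x. (v a r x)^2)" if "a:A" for a
 proof -
  interpret flux_evolution T s t "v a" "v' a" "h a" by (rule member[OF that])
  show "IB (energy_flux (chi n) (v a r) (h a r))"
   by (rule energy_flux_balance(1)[OF test_fun_chi smooth flux_C1 equation]) (rule r)+
  show "IB (%x. (v a r x)^2)" by (rule square_integrable[OF r])
 qed
 have diss: "IB (%x. (chi n x)^2*dissipation r x)" by (rule local_dissipation_integrable) (use r times in auto)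
 have "(SUM a:A. - local_loss n (v a r) (h a r)) = (LI x. (SUM a:A. - energy_flux (chi n) (v a r) (h a r) x))"
  unfolding local_loss_def using flux by (subst integral_sum) auto
 also have "... <= (LI x. - (1/2)*((chi n x)^2*dissipation r x)+3*L r x+48*(B+2)*e*(SUM a:A. (v a r x)^2))"
  by (rule integral_mono) (use flux diss remainder(1)[OF r] L2 total_flux_lower[OF r e(1)] in auto)
 also have "... = - (1/2)*local_dissipation n r+3*(LI x. L r x)+48*(B+2)*e*(SUM a:A. L2sq (v a r))"
  unfolding local_dissipation_def L2sq_def using diss remainder(1)[OF r] L2 by (simp add: integral_sum)
 also have "... <= - (1/2)*local_dissipation n r+3*La r+48*(B+2)*e*K"
  using remainder(3)[OF r] energy_le[OF r] B e(2) by (intro add_mono mult_left_mono order_refl) auto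
 finally show ?thesis .
qed

lemma continuous_integrable: "continuous_on {s..t} f ==> SIB {s..t} (%r. f r::real)"
 using borel_integrable_compact[of "{s..t}" f] by simp

lemma local_energy_inequality:
 assumes e: "!!l x. (pd l (chi n) x)^2 <= e" "0 <= e"
 shows "(SUM a:A. local_energy n (v a t))+1/2*SI {s..t} (local_dissipation n)
 <= (SUM a:A. local_energy n (v a s))+3*SI {s..t} La+48*(B+2)*e*K*(t-s)"
proof -
 note inc = flux_evolution.local_energy_increment[OF member]
 have iQ: "IB (%r. - (1/2)*(indicator {s..t} r*local_dissipation n r))"
  by (intro integrable_mult_right continuous_integrable continuous_on_subset[OF local_dissipation_continuous]) (use times in auto)
 have iL: "IB (%r. 3*(indicator {s..t} r*La r))" by (intro integrable_mult_right continuous_integrable La_continuous)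
 have ic: "IB (%r. 48*(B+2)*e*K*indicator {s..t} r)"
  by (intro integrable_mult_right integrable_real_indicator) (use times in "auto simp: emeasure_lborel_Icc_eq")
 have il: "IB (%r. SUM a:A. - (indicator {s..t} r*local_loss n (v a r) (h a r)))" using inc(1) by auto
 have "(SUM a:A. local_energy n (v a t))-(SUM a:A. local_energy n (v a s))
  = (LI r. SUM a:A. - (indicator {s..t} r*local_loss n (v a r) (h a r)))"
  using inc by (simp add: integral_sum flip: sum_subtractf)
 also have "... <= (LI r. - (1/2)*(indicator {s..t} r*local_dissipation n r)+3*(indicator {s..t} r*La r)+48*(B+2)*e*K*indicator {s..t} r)"
 proof (rule integral_mono[OF il integrable_add[OF integrable_add[OF iQ iL] ic]])
  fix r
  show "(SUM a:A. - (indicator {s..t} r*local_loss n (v a r) (h a r)))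
   <= - (1/2)*(indicator {s..t} r*local_dissipation n r)+3*(indicator {s..t} r*La r)+48*(B+2)*e*K*indicator {s..t} r"
   using local_loss_lower[OF _ e, of r] by (cases "r:{s..t}") auto
 qed
 also have "... = - (1/2)*SI {s..t} (local_dissipation n)+3*SI {s..t} La+48*(B+2)*e*K*(t-s)"
  using integral_add[OF integrable_add[OF iQ iL] ic] integral_add[OF iQ iL] times by simp
 finally show ?thesis by linarith
qed

lemma cutoff_error:
 obtains e where "!!n l x. (pd l (chi n) x)^2 <= e n" "!!n. 0 <= e n"
 "(%n. (SUM a:A. local_energy n (v a s))+3*SI {s..t} La+48*(B+2)*e n*K*(t-s))
 ----> (SUM a:A. L2sq (v a s))+3*SI {s..t} La"
proof -
 obtain k where k: "0 <= k" "!!n i x. <|pd i (chi n) x|> <= k*inverse (real (Suc n))" by (rule pd_chi_bound) blast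
 define e where "e n = (k*inverse (real (Suc n)))^2" for n
 have "(%n. (SUM a:A. local_energy n (v a s))+3*SI {s..t} La+48*(B+2)*e n*K*(t-s))
  ----> (SUM a:A. L2sq (v a s))+3*SI {s..t} La+48*(B+2)*(k*0)^2*K*(t-s)"
  unfolding e_def using times
  by (intro tendsto_intros LIMSEQ_inverse_real_of_nat flux_evolution.local_energy_tendsto[OF member]) auto
 moreover have "(pd l (chi n) x)^2 <= e n" for n l x
  using k(2)[of l n x] k(1) unfolding e_def by (intro abs_le_square_iff[THEN iffD1]) auto
 ultimately show thesis by (intro that) (auto simp: e_def)
qed

lemma energy_tendsto: "(%n. SUM a:A. local_energy n (v a t)) ----> (SUM a:A. L2sq (v a t))"
 using times by (intro tendsto_sum flux_evolution.local_energy_tendsto[OF member]) auto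

theorem energy_inequality: "(SUM a:A. L2sq (v a t)) <= (SUM a:A. L2sq (v a s))+3*SI {s..t} La"
proof -
 obtain e where e: "!!n l x. (pd l (chi n) x)^2 <= e n" "!!n. 0 <= e n"
  and lim: "(%n. (SUM a:A. local_energy n (v a s))+3*SI {s..t} La+48*(B+2)*e n*K*(t-s))
  ----> (SUM a:A. L2sq (v a s))+3*SI {s..t} La" by (rule cutoff_error) blast
 have nonneg: "0 <= SI {s..t} (local_dissipation n)" for n
  using local_dissipation_nonneg by (intro integral_nonneg_AE AE_I2 mult_nonneg_nonneg) auto
 have "(SUM a:A. local_energy n (v a t))
  <= (SUM a:A. local_energy n (v a s))+3*SI {s..t} La+48*(B+2)*e n*K*(t-s)" for n
  using local_energy_inequality[OF e, of n] nonneg[of n] by linarith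
 thus ?thesis using LIMSEQ_le[OF energy_tendsto lim] by blast
qed

theorem energy_dissipation_inequality:
 assumes G: "continuous_on {s..t} (%r. SUM a:A. D1sq (v a r))" "!!a r l. a:A ==> r:{s..t} ==> IB (%x. (pd l (v a r) x)^2)"
 shows "(SUM a:A. L2sq (v a t))+1/2*SI {s..t} (%r. SUM a:A. D1sq (v a r))
 <= (SUM a:A. L2sq (v a s))+3*SI {s..t} La"
proof -
 obtain e where e: "!!n l x. (pd l (chi n) x)^2 <= e n" "!!n. 0 <= e n"
  and lim: "(%n. (SUM a:A. local_energy n (v a s))+3*SI {s..t} La+48*(B+2)*e n*K*(t-s))
  ----> (SUM a:A. L2sq (v a s))+3*SI {s..t} La" by (rule cutoff_error) blast
 have d: "IB (dissipation r)" "(LI x. dissipation r x) = (SUM a:A. D1sq (v a r))" if "r:{s..t}" for r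
  unfolding dissipation_def D1sq_def L2sq_def using G(2)[OF _ that] by (auto simp: integral_sum)
 have cut: "(chi n x)^2*dissipation r x <= dissipation r x" for n r x
  using chi_bounds dissipation_nonneg by (intro mult_left_le_one_le power_le_one) auto
 have bound: "local_dissipation n r <= (SUM a:A. D1sq (v a r))" if "r:{s..t}" for n r
  using integral_mono[OF local_dissipation_integrable d(1) cut, of r n] that times
  unfolding local_dissipation_def by (auto simp: d(2))
 have "(%n. SI {s..t} (local_dissipation n)) ----> SI {s..t} (%r. SUM a:A. D1sq (v a r))"
 proof (rule integral_dominated_convergence[OF _ _ continuous_integrable[OF G(1)]])
  show "(%r. indicator {s..t} r*(SUM a:A. D1sq (v a r))):borel_measurable lborel" using continuous_integrable[OF G(1)] by auto
  have "SIB {s..t} (local_dissipation n)" for n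
   by (intro continuous_integrable continuous_on_subset[OF local_dissipation_continuous]) (use times in auto)
  thus "(%r. indicator {s..t} r*local_dissipation n r):borel_measurable lborel" for n by auto
  show "AE r in lborel. norm (indicator {s..t} r*local_dissipation n r) <= indicator {s..t} r*(SUM a:A. D1sq (v a r))" for n
   using bound local_dissipation_nonneg by (auto simp: indicator_def)
  have "(%n. local_dissipation n r) ----> (SUM a:A. D1sq (v a r))" if "r:{s..t}" for r
   using integral_chi_tendsto(2)[OF d(1)[OF that]] d(2)[OF that] by (simp add: local_dissipation_def)
  thus "AE r in lborel. (%n. indicator {s..t} r*local_dissipation n r) ----> indicator {s..t} r*(SUM a:A. D1sq (v a r))"
   by (auto simp: indicator_def)
 qed
 hence "(%n. (SUM a:A. local_energy n (v a t))+1/2*SI {s..t} (local_dissipation n)) ---->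
  (SUM a:A. L2sq (v a t))+1/2*SI {s..t} (%r. SUM a:A. D1sq (v a r))"
  by (intro tendsto_add tendsto_mult tendsto_const energy_tendsto)
 from LIMSEQ_le[OF this lim] show ?thesis using local_energy_inequality[OF e] by blast
qed

end

definition approach :: "real => real => nat => real" where
 "approach t0 T n = T-(T-t0)*inverse (real (Suc n))"

lemma approach_bounds: "t0 < T ==> t0 <= approach t0 T n" "t0 < T ==> approach t0 T n < T"
 and approach_tendsto: "approach t0 T ----> T"
proof -
 have "inverse (real (Suc n)) <= 1" "0 < inverse (real (Suc n))" by (simp_all add: inverse_le_1_iff)
 thus "t0 <= approach t0 T n" "approach t0 T n < T" if "t0 < T"
  using that mult_left_le[of "inverse (real (Suc n))" "T-t0"] mult_pos_pos[of "T-t0" "inverse (real (Suc n))"]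
  unfolding approach_def by linarith+
 have "approach t0 T ----> T-(T-t0)*0" unfolding approach_def by (intro tendsto_intros LIMSEQ_inverse_real_of_nat)
 thus "approach t0 T ----> T" by simp
qed

lemma integral_tail_small:
 fixes a :: "real => real"
 assumes tT: "t0 < T" and a: "SIB {t0..<T} a" and e: "e > 0"
 obtains t1 where "t0 <= t1" "t1 < T" "<|LI t. indicator {t1..<T} t*a t|> < e"
proof -
 let ?A = "%n. {approach t0 T n..<T}"
 have eq: "indicator (?A n) t*(indicator {t0..<T} t*a t) = indicator (?A n) t*a t" for n t
  using approach_bounds[OF tT, of n] by (auto simp: indicator_def)
 have "eventually (%n. indicator (?A n) t*a t = 0) sequentially" for t
 proof (cases "t < T")
  case True
  show ?thesis by (rule eventually_mono[OF order_tendstoD(1)[OF approach_tendsto[of t0 T] True]]) (simp add: indicator_def)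
 qed (simp add: indicator_def)
 hence lim: "(%n. indicator (?A n) t*a t) ----> 0" for t by (rule tendsto_eventually)
 have "(%n. LI t. indicator (?A n) t*(indicator {t0..<T} t*a t)) ----> (\<integral>t. 0 \<partial>(lborel::real measure))"
 proof (rule integral_dominated_convergence[where w="%t. norm (indicator {t0..<T} t*a t)"])
  show "AE t in lborel. (%n. indicator (?A n) t*(indicator {t0..<T} t*a t)) ----> 0" using lim by (simp add: eq)
 qed (use a in "auto simp: indicator_def")
 hence "(%n. LI t. indicator (?A n) t*a t) ----> 0" by (simp add: eq)
 hence "\<forall>\<^sub>F n in sequentially. <|LI t. indicator (?A n) t*a t|> < e" using e by (auto simp: tendsto_iff dist_real_def)
 then obtain n where "<|LI t. indicator (?A n) t*a t|> < e" by (meson eventually_sequentially order_refl)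
 thus thesis using that[of "approach t0 T n"] approach_bounds[OF tT] by auto
qed

text \<open>Only boundedness up to \<open>T\<close> is needed, so instead of Gronwall's exponential one starts at a time
after which the coefficient has integral at most one half and absorbs the supremum.\<close>
context
 fixes a E :: "real => real" and J :: "real => real => real" and t0 T :: real
 assumes tT: "t0 < T" and a: "SIB {t0..<T} a" and a0: "!!t. 0 <= a t"
 and E: "continuous_on {t0..<T} E" "!!t. 0 <= E t" and J0: "!!s t. 0 <= J s t"
 and increment: "!!s t S. t0 <= s ==> s <= t ==> t < T ==> (!!r. r:{s..t} ==> E r <= S) ==>
 E t+J s t <= E s+(1+S)*SI {s..t} a"
begin

lemma coefficient_integral_mono:
 assumes "A \<subseteq> B" "A:sets borel" "B:sets borel" "B \<subseteq> {t0..<T}"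
 shows "SI A a <= SI B a"
proof -
 have sub: "SIB A a" if "A:sets borel" "A \<subseteq> {t0..<T}" for A
  using integrable_mult_indicator[OF _ a, of A] that by (auto simp: indicator_inter_arith[symmetric] Int_absorb2 simp flip: mult.assoc)
 show ?thesis using assms a0 by (intro integral_mono sub) (auto simp: indicator_def)
qed

lemma late_energy_le:
 assumes t1: "t0 <= t1" "SI {t1..<T} a <= 1/2" and t: "t1 <= t" "t < T"
 shows "E t <= 2*E t1+1"
proof -
 have "EX r:{t1..t}. ALL s:{t1..t}. E s <= E r"
  by (rule continuous_attains_sup) (use t t1 in "auto intro!: continuous_on_subset[OF E(1)]")
 then obtain r where r: "r:{t1..t}" "!!s. s:{t1..t} ==> E s <= E r" by blast
 define Q where "Q = SI {t1..r} a"
 have "Q <= SI {t1..<T} a" unfolding Q_def using r t t1 by (intro coefficient_integral_mono) auto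
 hence "(1+E r)*Q <= (1+E r)*(1/2)" using t1(2) E(2)[of r] by (intro mult_left_mono) auto
 moreover have "E r+J t1 r <= E t1+(1+E r)*Q" unfolding Q_def using r t t1 by (intro increment) auto
 ultimately have "E r <= 2*E t1+1" using J0[of t1 r] by argo
 thus ?thesis using r(2)[of t] t by force
qed

lemma energy_bounded_up_to_end: "EX C. ALL t:{t0..<T}. E t <= C"
proof -
 obtain t1 where t1: "t0 <= t1" "t1 < T" "<|LI t. indicator {t1..<T} t*a t|> < 1/2"
  using integral_tail_small[OF tT a, of "1/2"] by auto
 have "compact (E ` {t0..t1})" by (intro compact_continuous_image continuous_on_subset[OF E(1)]) (use t1 in auto)
 then obtain C where "!!t. t:{t0..t1} ==> E t <= C" using compact_imp_bounded bounded_real by (metis abs_le_D1 image_eqI)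
 moreover have "E t <= 2*E t1+1" if "t1 <= t" "t < T" for t using late_energy_le[OF t1(1) _ that] t1(3) by auto
 ultimately have "E t <= max C (2*E t1+1)" if "t:{t0..<T}" for t using that by (cases "t <= t1") (auto intro: max.coboundedI1 max.coboundedI2)
 thus ?thesis by blast
qed

lemma Gronwall_absorbing: "EX C. ALL t:{t0..<T}. E t <= C & J t0 t <= C"
proof -
 obtain S where S: "!!t. t:{t0..<T} ==> E t <= S" using energy_bounded_up_to_end by blast
 have S0: "0 <= S" using S[of t0] E(2)[of t0] tT by force
 define I where "I = SI {t0..<T} a"
 have I0: "0 <= I" unfolding I_def using a0 by (intro integral_nonneg_AE) auto
 have "J t0 t <= S+(1+S)*I" if "t:{t0..<T}" for t
 proof -
  have "E t+J t0 t <= E t0+(1+S)*SI {t0..t} a" using that S by (intro increment) auto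
  moreover have "(1+S)*SI {t0..t} a <= (1+S)*I"
   unfolding I_def using S0 that by (intro mult_left_mono coefficient_integral_mono) auto
  ultimately show ?thesis using E(2)[of t] S[of t0] tT by force
 qed
 moreover have "E t <= S+(1+S)*I" if "t:{t0..<T}" for t using S[OF that] S0 I0 by (simp add: add_increasing2)
 ultimately show ?thesis by blast
qed

end

lemma test_fun_pd: assumes "test_fun \<phi>" shows "test_fun (pd i \<phi>)"
proof -
 obtain R where R: "!!x. norm x > R ==> \<phi> x = 0" using assms by (auto simp: test_fun_def)
 have "pd i \<phi> x = 0" if "norm x > R" for x by (rule pd_outside[of R]) (use R that in auto)
 thus ?thesis using assms unfolding test_fun_def by (auto intro: C_inf_pd)
qed

lemma test_fun_pds: "test_fun \<phi> ==> test_fun (pds is \<phi>)" by (induction "is") (auto simp: pds_Cons test_fun_pd)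

lemma integral_pds_test:
 assumes f: "C_inf f" and p: "test_fun \<phi>"
 shows "(LI x. pds is \<phi> x*f x) = (-1)^length is*(LI x. \<phi> x*pds is f x)"
 using f
proof (induction "is" arbitrary: f)
 case (Cons i "is")
 have "(LI x. pds (i # is) \<phi> x*f x) = - (LI x. pds is \<phi> x*pd i f x)"
  using integral_by_parts_test[OF test_fun_pds[OF p, of "is"] C_inf_C1[OF Cons.prems], of i] by (simp add: pds_Cons)
 thus ?case using Cons.IH[OF C_inf_pd[OF Cons.prems, of i]] by (simp add: pds_Cons pds_pd_commute[OF Cons.prems])
qed simp

definition alpha_word :: "(3 => nat) => 3 list" where
 "alpha_word a = replicate (a 1) 1 @ replicate (a 2) 2 @ replicate (a 3) 3"

lemma dalpha_word: "dalpha a f = pds (alpha_word a) f" by (simp add: dalpha_def alpha_word_def)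

lemma length_alpha_word: "length (alpha_word a) = sum a UNIV" by (simp add: alpha_word_def sum_3)

lemma pds_eq_dalpha: assumes "C_inf (f::scalar)" shows "pds is f = dalpha (count (mset is)) f" unfolding dalpha_word
proof (rule pds_mset[OF assms], rule multiset_eqI)
 fix j :: 3
 show "count (mset is) j = count (mset (alpha_word (count (mset is)))) j" using exhaust_3[of j] by (auto simp: alpha_word_def)
qed

lemma sum_count_mset: "sum (count (mset is)) (UNIV::3 set) = length is"
proof -
 have "sum (count (mset is)) UNIV = sum (count (mset is)) (set_mset (mset is))"
  by (rule sum.mono_neutral_right) (auto simp: count_eq_zero_iff)
 thus ?thesis by (simp add: size_multiset_overloaded_eq[symmetric] del: set_mset_mset)
qed

lemma AE_test_zero:
 fixes d :: "scalar"
 assumes m: "BM d" and loc: "!!a b. IB (%x. indicator (box a b) x*d x)"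
 and z: "!!\<phi>. test_fun \<phi> ==> (LI x. \<phi> x*d x) = 0"
 shows "AE x in lborel. d x = 0"
proof (rule AE_box_zero)
 fix a b
 have "(%n. LI x. box_bump n a b x*d x) ----> (LI x. indicator (box a b) x*d x)"
 proof (rule integral_dominated_convergence[where w="%x. norm (indicator (box a b) x*d x)"])
  have [measurable]: "BM (box_bump n a b)" for n using C1_meas(1)[OF C_inf_C1[OF C_inf_box_bump]] .
  note m [measurable]
  show "(%x. box_bump n a b x*d x):borel_measurable lborel" for n by measurable
  show "AE x in lborel. (%n. box_bump n a b x*d x) ----> indicator (box a b) x*d x"
   by (intro AE_I2 tendsto_mult box_bump_tendsto tendsto_const)
  show "AE x in lborel. norm (box_bump n a b x*d x) <= norm (indicator (box a b) x*d x)" for n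
  proof (rule AE_I2)
   fix x show "norm (box_bump n a b x*d x) <= norm (indicator (box a b) x*d x)"
    using box_bump_bounds[of n a b x] box_bump_support[of x a b n]
    by (cases "x:box a b") (auto simp: abs_mult mult_left_le_one_le)
  qed
 qed (use loc m in auto)
 thus "(LI x. indicator (box a b) x*d x) = 0" using z[OF test_fun_box_bump] by (simp add: LIMSEQ_const_iff)
qed (use m loc in auto)

definition smooth3 :: "(R3 => R3) => bool" where "smooth3 f \<longleftrightarrow> (ALL i. C_inf (%x. f x $ i))"

lemma continuous_compose: "(!!i. continuous_on UNIV (%x. f x $ i)) ==> continuous_on UNIV (f::R3 => R3)"
 using continuous_on_vec_lambda[of UNIV "%i x. f x $ i"] by (simp add: vec_lambda_eta)

lemma measurable_component: fixes g :: "R3 => R3" shows "BM g ==> BM (%x. g x $ i)"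
 using borel_measurable_inner[of g borel "%_. axis i 1"] by (simp add: inner_axis)

lemma L2_comp:
 fixes g :: "R3 => R3"
 assumes "L2 g" shows "BM (%x. g x $ i)" "IB (%x. (g x $ i)^2)"
proof -
 have i: "IB (%x. (norm (g x))^2)" using assms by (auto simp: L2_def)
 show "BM (%x. g x $ i)" using assms by (intro measurable_component) (simp add: L2_def)
 show "IB (%x. (g x $ i)^2)" by (rule integrable_bound[OF i])
  (use \<open>(%x. g x $ i) : borel_measurable borel\<close> component_le_norm_cart[of "g x" i for x] in "auto simp: abs_le_square_iff[symmetric]")
qed

definition locally_integrable :: "(R3 => R3) => bool" where
 "locally_integrable g \<longleftrightarrow> g:borel_measurable borel & (ALL a b. IB (%x. indicator (box a b) x *\<^sub>R g x))"

lemma L2_locally_integrable: assumes "L2 g" shows "locally_integrable g" unfolding locally_integrable_def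
proof (intro conjI allI)
 show m [measurable]: "BM g" using assms by (simp add: L2_def)
 fix a b :: R3
 have "IB (%x. indicator (box a b) x*norm (g x))"
 proof (rule Cauchy_Schwarz_mult(1))
  have "(%x. (indicator (box a b) x::real)^2) = indicator (box a b)" by (auto simp: indicator_def)
  thus "IB (%x. (indicator (box a b) x::real)^2)" using emeasure_bounded_finite[OF bounded_box[of a b]] by simp
 qed (use assms in "auto simp: L2_def")
 thus "IB (%x. indicator (box a b) x *\<^sub>R g x)" by (rule integrable_bound) (auto simp: abs_mult)
qed

lemma continuous_locally_integrable: assumes g: "continuous_on UNIV g" shows "locally_integrable g"
 unfolding locally_integrable_def
proof (intro conjI allI borel_measurable_continuous_onI[OF g])
 fix a b :: R3
 have "IB (%x. indicator (cbox a b) x *\<^sub>R g x)" by (rule borel_integrable_compact) (auto intro: continuous_on_subset[OF g])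
 from integrable_mult_indicator[OF _ this, of "box a b"]
 show "IB (%x. indicator (box a b) x *\<^sub>R g x)"
  using box_subset_cbox[of a b] by (simp add: indicator_inter_arith[symmetric] Int_absorb2)
qed

lemma test_fun_bounded: assumes "test_fun \<phi>" obtains B where "0 <= B" "!!x. <|\<phi> x|> <= B"
proof -
 obtain R where R: "!!x. norm x > R ==> \<phi> x = 0" using assms by (auto simp: test_fun_def)
 have "bounded (\<phi> ` cball 0 R)"
  by (intro compact_imp_bounded compact_continuous_image continuous_on_subset[OF C1_cont[OF test_fun_C1[OF assms]]]) auto
 then obtain B where B: "ALL x:cball 0 R. <|\<phi> x|> <= B" by (auto simp: bounded_iff)
 have "<|\<phi> x|> <= max 0 B" for x using B R[of x] by (cases "norm x <= R") force+
 thus thesis by (rule that[rotated]) simp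
qed

lemma test_fun_integrable:
 assumes g: "locally_integrable g" and p: "test_fun \<phi>"
 shows "IB (%x. \<phi> x *\<^sub>R g x)" "IB (%x. \<phi> x*g x $ i)" "(\<integral>x. \<phi> x *\<^sub>R g x \<partial>lborel) $ i = (LI x. \<phi> x*g x $ i)" (is ?A)
proof -
 obtain B where B: "0 <= B" "!!x. <|\<phi> x|> <= B" by (rule test_fun_bounded[OF p]) blast
 obtain R where R: "!!x. norm x > R ==> \<phi> x = 0" using p by (auto simp: test_fun_def)
 obtain a where a: "cball (0::R3) R \<subseteq> box (-a) a" using bounded_subset_box_symmetric[OF bounded_cball] by blast
 have [measurable]: "BM \<phi>" "BM g" using g C1_meas(1)[OF test_fun_C1[OF p]] by (auto simp: locally_integrable_def)
 show i: "IB (%x. \<phi> x *\<^sub>R g x)"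
 proof (rule integrable_bound[of _ "%x. B *\<^sub>R (indicator (box (-a) a) x *\<^sub>R g x)"])
  show "AE x in lborel. norm (\<phi> x *\<^sub>R g x) <= norm (B *\<^sub>R (indicator (box (-a) a) x *\<^sub>R g x))"
  proof (rule AE_I2)
   fix x show "norm (\<phi> x *\<^sub>R g x) <= norm (B *\<^sub>R (indicator (box (-a) a) x *\<^sub>R g x))"
    using a B R[of x] by (cases "norm x <= R") (auto simp: subset_iff intro!: mult_right_mono)
  qed
  show "IB (%x. B *\<^sub>R (indicator (box (-a) a) x *\<^sub>R g x))"
   using g by (intro integrable_scaleR_right) (simp add: locally_integrable_def)
 qed simp
 from integral_bounded_linear[OF bounded_linear_vec_nth[of i] i]
 show ?A by simp
 from integrable_bounded_linear[OF bounded_linear_vec_nth[of i] i] show "IB (%x. \<phi> x*g x $ i)" by simp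
qed

lemma weak_deriv_unique:
 assumes g: "locally_integrable g" "weak_deriv \<alpha> f g" and g': "locally_integrable g'" "weak_deriv \<alpha> f g'"
 shows "AE x in lborel. g x = g' x"
proof -
 have "AE x in lborel. g x $ i-g' x $ i = 0" for i
 proof (rule AE_test_zero)
  have i: "IB (%x. indicator (box a b) x*h x $ i)" if "locally_integrable h" for h a b
   using that integrable_bounded_linear[OF bounded_linear_vec_nth[of i], of lborel "%x. indicator (box a b) x *\<^sub>R h x"]
   by (simp add: locally_integrable_def)
  thus "IB (%x. indicator (box a b) x*(g x $ i-g' x $ i))" for a b using g g' by (simp add: right_diff_distrib)
  show "BM (%x. g x $ i-g' x $ i)"
   using g g' by (intro borel_measurable_diff measurable_component) (auto simp: locally_integrable_def)
  fix \<phi> assume p: "test_fun \<phi>"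
  have "(-1::real)^(sum \<alpha> UNIV) *\<^sub>R (\<integral>x. \<phi> x *\<^sub>R g x \<partial>lborel) = (-1)^(sum \<alpha> UNIV) *\<^sub>R (\<integral>x. \<phi> x *\<^sub>R g' x \<partial>lborel)"
   using g(2) g'(2) p by (simp add: weak_deriv_def)
  hence "(\<integral>x. \<phi> x *\<^sub>R g x \<partial>lborel) $ i = (\<integral>x. \<phi> x *\<^sub>R g' x \<partial>lborel) $ i" by simp
  thus "(LI x. \<phi> x*(g x $ i-g' x $ i)) = 0"
   using test_fun_integrable[OF g(1) p] test_fun_integrable[OF g'(1) p] by (simp add: right_diff_distrib)
 qed
 hence "AE x in lborel. ALL i:UNIV. g x $ i-g' x $ i = 0" by (subst AE_finite_all) auto
 thus ?thesis by eventually_elim (simp add: vec_eq_iff)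
qed

lemma smooth3_components: assumes "smooth3 f" shows "C_inf (%y. f y $ i)" "continuous_on UNIV f"
 and "continuous_on UNIV (%x. \<chi> i. dalpha a (%y. f y $ i) x)" (is ?A)
proof -
 show C: "C_inf (%y. f y $ i)" for i using assms by (simp add: smooth3_def)
 show "continuous_on UNIV f" by (rule continuous_compose) (rule C1_cont[OF C_inf_C1[OF C]])
 show ?A unfolding dalpha_word by (intro continuous_on_vec_lambda C1_cont[OF C_inf_C1s[OF C]])
qed

lemma weak_deriv_classical:
 assumes f: "smooth3 f" shows "weak_deriv a f (%x. \<chi> i. dalpha a (%y. f y $ i) x)"
 unfolding weak_deriv_def
proof (intro allI impI)
 fix \<phi> assume p: "test_fun \<phi>"
 have pa: "test_fun (dalpha a \<phi>)" unfolding dalpha_word by (rule test_fun_pds[OF p])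
 note I = test_fun_integrable(3)[OF continuous_locally_integrable[OF smooth3_components(2)[OF f]] pa]
  test_fun_integrable(3)[OF continuous_locally_integrable[OF smooth3_components(3)[OF f, of a]] p]
 show "(\<integral>x. dalpha a \<phi> x *\<^sub>R f x \<partial>lborel) = (-1)^(sum a UNIV) *\<^sub>R (\<integral>x. \<phi> x *\<^sub>R (\<chi> i. dalpha a (%y. f y $ i) x) \<partial>lborel)"
  using integral_pds_test[OF smooth3_components(1)[OF f] p, of "alpha_word a"]
  by (simp add: vec_eq_iff I) (simp add: dalpha_word length_alpha_word)
qed

lemma weak_deriv_smooth:
 assumes f: "smooth3 f" and g: "L2 g" "weak_deriv a f g"
 shows "AE x in lborel. g x $ i = dalpha a (%y. f y $ i) x"
 using weak_deriv_unique[OF L2_locally_integrable[OF g(1)] g(2)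
 continuous_locally_integrable[OF smooth3_components(3)[OF f]] weak_deriv_classical[OF f]]
 by eventually_elim simp

lemma norm_square_R3: "(norm (v::R3))^2 = (SU i. (v $ i)^2)" by (simp add: norm_vec_def L2_set_def sum_nonneg)

lemma in_Hm_Hs: assumes f: "smooth3 f" and H: "in_Hm m f" shows "Hs m (%x. f x $ i)" unfolding Hs_def
proof (intro conjI allI impI)
 show C: "C_inf (%x. f x $ i)" using f by (simp add: smooth3_def)
 fix "is" :: "3 list" assume len: "length is <= m"
 let ?a = "count (mset is)"
 have "sum ?a UNIV <= m" by (simp add: sum_count_mset len)
 then obtain g where g: "L2 g" "weak_deriv ?a f g" using H unfolding in_Hm_def by blast
 have "AE x in lborel. g x $ i = pds is (%y. f y $ i) x" unfolding pds_eq_dalpha[OF C] by (rule weak_deriv_smooth[OF f g])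
 hence "AE x in lborel. (g x $ i)^2 = (pds is (%y. f y $ i) x)^2" by eventually_elim simp
 with L2_comp(2)[OF g(1), of i] show "IB (%x. (pds is (%y. f y $ i) x)^2)"
  using integrable_cong_AE[of "%x. (g x $ i)^2" lborel "%x. (pds is (%y. f y $ i) x)^2"] L2_comp(1)[OF g(1), of i]
  C1_meas(1)[OF C_inf_C1s[OF C, of "is"]] by simp
qed

lemma smooth_has_weak_deriv:
 assumes f: "smooth3 f" and H: "!!i. Hs m (%x. f x $ i)" and a: "sum \<alpha> UNIV <= m"
 shows "EX g. L2 g & weak_deriv \<alpha> f g"
proof (intro exI conjI)
 show "weak_deriv \<alpha> f (%x. \<chi> i. dalpha \<alpha> (%y. f y $ i) x)" by (rule weak_deriv_classical[OF f])
 have "IB (%x. (dalpha \<alpha> (%y. f y $ i) x)^2)" for i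
  unfolding dalpha_word using H[of i] a by (auto simp: Hs_def length_alpha_word)
 thus "L2 (%x. \<chi> i. dalpha \<alpha> (%y. f y $ i) x)" unfolding L2_def norm_square_R3
  using borel_measurable_continuous_onI[OF smooth3_components(3)[OF f]] by simp
qed

lemma wd_L2_weak: "EX g. L2 g & weak_deriv a f g ==> L2 (wd a f) & weak_deriv a f (wd a f)"
 unfolding wd_def by (rule someI_ex[where P="%g. L2 g & weak_deriv a f g"])

lemma wd_norm_smooth:
 assumes f: "smooth3 f" and H: "!!i. Hs m (%x. f x $ i)" and a: "sum \<alpha> UNIV <= m"
 shows "(LI x. (norm (wd \<alpha> f x))^2) = (SU i. L2sq (dalpha \<alpha> (%y. f y $ i)))"
proof -
 have w: "L2 (wd \<alpha> f)" "weak_deriv \<alpha> f (wd \<alpha> f)" using wd_L2_weak[OF smooth_has_weak_deriv[OF f H a]] by auto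
 have "(LI x. (norm (wd \<alpha> f x))^2) = (SU i. LI x. (wd \<alpha> f x $ i)^2)" unfolding norm_square_R3 using L2_comp(2)[OF w(1)] by simp
 also have "... = (SU i. L2sq (dalpha \<alpha> (%y. f y $ i)))"
 proof (rule sum.cong[OF refl])
  fix i
  have "AE x in lborel. (wd \<alpha> f x $ i)^2 = (dalpha \<alpha> (%y. f y $ i) x)^2"
   using weak_deriv_smooth[OF f w, of i] by eventually_elim simp
  moreover have "C_inf (%y. f y $ i)" using f by (simp add: smooth3_def)
  ultimately show "(LI x. (wd \<alpha> f x $ i)^2) = L2sq (dalpha \<alpha> (%y. f y $ i))"
   unfolding L2sq_def using L2_comp(1)[OF w(1), of i] C1_meas(1)[OF C_inf_C1s]
   by (intro integral_cong_AE) (auto simp: dalpha_word)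
 qed
 finally show ?thesis .
qed

lemma finite_multi_indices: "finite {a::3 => nat. sum a UNIV <= m}"
proof (rule finite_subset)
 show "{a::3 => nat. sum a UNIV <= m} \<subseteq> PiE UNIV (%_. {..m})"
 proof
  fix a :: "3 => nat" assume "a:{a. sum a UNIV <= m}"
  hence "sum a UNIV <= m" by simp
  moreover have "a i <= sum a UNIV" for i by (rule member_le_sum) auto
  ultimately have "a i <= m" for i using order_trans by blast
  thus "a:PiE UNIV (%_. {..m})" by auto
 qed
 show "finite (PiE (UNIV::3 set) (%_. {..m}))" by (intro finite_PiE) auto
qed

lemma Hm_norm_square: "(Hm_norm m f)^2 = (SUM a:{a::3 => nat. sum a UNIV <= m}. LI x. (norm (wd a f x))^2)"
 unfolding Hm_norm_def by (simp add: sum_nonneg)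

lemma Hm_norm_nonneg: "0 <= Hm_norm m f" unfolding Hm_norm_def by (simp add: sum_nonneg)

lemma L2sq_pds_le_Hm:
 assumes f: "smooth3 f" and H: "!!i. Hs m (%x. f x $ i)" and len: "length is <= m"
 shows "L2sq (pds is (%y. f y $ i)) <= (Hm_norm m f)^2"
proof -
 let ?a = "count (mset is)"
 have a: "sum ?a UNIV <= m" using len by (simp add: sum_count_mset)
 have C: "C_inf (%y. f y $ i)" using f by (simp add: smooth3_def)
 have "L2sq (pds is (%y. f y $ i)) <= (SU i. L2sq (dalpha ?a (%y. f y $ i)))"
  unfolding pds_eq_dalpha[OF C] by (rule member_le_sum) (auto simp: L2sq_nonneg)
 also have "... = (LI x. (norm (wd ?a f x))^2)" by (rule wd_norm_smooth[OF f H a, symmetric])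
 also have "... <= (Hm_norm m f)^2" unfolding Hm_norm_square by (rule member_le_sum) (use a finite_multi_indices in auto)
 finally show ?thesis .
qed

lemma Hm_le_L2sq_pds:
 assumes f: "smooth3 f" and H: "!!i. Hs m (%x. f x $ i)"
 and b: "!!is i. length is <= m ==> L2sq (pds is (%y. f y $ i)) <= K"
 shows "(Hm_norm m f)^2 <= real (card {a::3 => nat. sum a UNIV <= m})*(3*K)"
proof -
 have "(Hm_norm m f)^2 = (SUM a:{a::3 => nat. sum a UNIV <= m}. SU i. L2sq (dalpha a (%y. f y $ i)))"
  unfolding Hm_norm_square by (intro sum.cong refl wd_norm_smooth[OF f H]) auto
 also have "... <= (SUM a:{a::3 => nat. sum a UNIV <= m}. SU i::3. K)"
  unfolding dalpha_word by (intro sum_mono b) (auto simp: length_alpha_word)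
 finally show ?thesis by simp
qed

lemma wd_diff:
 assumes f: "in_Hm m f" and g: "in_Hm m g" and a: "sum \<alpha> UNIV <= m"
 shows wd_diff_L2: "L2 (wd \<alpha> (%x. f x - g x))" and "AE x in lborel. wd \<alpha> (%x. f x - g x) x = wd \<alpha> f x - wd \<alpha> g x" (is ?A)
proof -
 have wf: "L2 (wd \<alpha> f)" "weak_deriv \<alpha> f (wd \<alpha> f)" and wg: "L2 (wd \<alpha> g)" "weak_deriv \<alpha> g (wd \<alpha> g)"
  using wd_L2_weak f g a by (auto simp: in_Hm_def)
 have fg: "L2 f" "L2 g" using f g by (auto simp: in_Hm_def)
 let ?d = "%x. wd \<alpha> f x - wd \<alpha> g x"
 have L: "L2 ?d" unfolding L2_def
 proof
  have [measurable]: "wd \<alpha> f:borel_measurable borel" "wd \<alpha> g : borel_measurable borel" using wf wg by (auto simp: L2_def)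
  show "?d : borel_measurable lborel" by simp
  have "integrable lborel (%x. (wd \<alpha> f x $ i + (- wd \<alpha> g x $ i))\<^sup>2)" for i
   using L2_comp[OF wf(1)] L2_comp[OF wg(1)] by (intro square_integrable_add) auto
  thus "integrable lborel (%x. (norm (?d x))\<^sup>2)" unfolding norm_square_R3 by simp
 qed
 have W: "weak_deriv \<alpha> (%x. f x - g x) ?d" unfolding weak_deriv_def
 proof (intro allI impI)
  fix \<phi> assume p: "test_fun \<phi>"
  have pa: "test_fun (dalpha \<alpha> \<phi>)" unfolding dalpha_word by (rule test_fun_pds[OF p])
  show "(\<integral>x. dalpha \<alpha> \<phi> x *\<^sub>R (f x - g x) \<partial>lborel) = (- 1) ^ sum \<alpha> UNIV *\<^sub>R (\<integral>x. \<phi> x *\<^sub>R ?d x \<partial>lborel)"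
   using wf(2) wg(2) p test_fun_integrable(1)[OF L2_locally_integrable pa] fg test_fun_integrable(1)[OF L2_locally_integrable p] wf(1) wg(1)
   unfolding weak_deriv_def by (simp add: scaleR_diff_right)
 qed
 have A: "L2 (wd \<alpha> (%x. f x - g x))" "weak_deriv \<alpha> (%x. f x - g x) (wd \<alpha> (%x. f x - g x))"
  using wd_L2_weak[of \<alpha> "%x. f x - g x"] L W by auto
 show "L2 (wd \<alpha> (%x. f x - g x))" by (rule A)
 show ?A by (rule weak_deriv_unique[OF L2_locally_integrable[OF A(1)] A(2) L2_locally_integrable[OF L] W])
qed

lemma Hm_norm_triangle:
 assumes f: "in_Hm m f" and g: "in_Hm m g"
 shows "(Hm_norm m f)^2 <= 2*(Hm_norm m (%x. f x-g x))^2+2*(Hm_norm m g)^2"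
proof -
 have "(LI x. (norm (wd \<alpha> f x))^2) <= 2*(LI x. (norm (wd \<alpha> (%x. f x-g x) x))^2)+2*(LI x. (norm (wd \<alpha> g x))^2)"
  if a: "sum \<alpha> UNIV <= m" for \<alpha>
 proof -
  have wf: "L2 (wd \<alpha> f)" "L2 (wd \<alpha> g)" using wd_L2_weak f g a by (auto simp: in_Hm_def)
  note D = wd_diff(2)[OF f g a]
  have i: "IB (%x. (norm (wd \<alpha> f x))^2)" "IB (%x. (norm (wd \<alpha> g x))^2)" using wf by (auto simp: L2_def)
  have [measurable]: "BM (wd \<alpha> f)" "BM (wd \<alpha> g)" using wf by (auto simp: L2_def)
  have nb: "(norm (a-b))^2 <= 2*(norm a)^2+2*(norm b)^2" for a b :: R3
  proof -
   have "(norm (a-b))^2 <= (norm a+norm b)^2" by (intro power_mono norm_triangle_ineq4) auto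
   thus ?thesis using square_add_le[of "norm a" "norm b"] by linarith
  qed
  have i3: "IB (%x. (norm (wd \<alpha> f x-wd \<alpha> g x))^2)"
   by (rule integrable_bound[of _ "%x. 2*(norm (wd \<alpha> f x))^2+2*(norm (wd \<alpha> g x))^2"])
   (use i nb in "auto intro!: AE_I2 simp: abs_of_nonneg add_nonneg_nonneg")
  have "(LI x. (norm (wd \<alpha> f x))^2) <= (LI x. 2*(norm (wd \<alpha> f x-wd \<alpha> g x))^2+2*(norm (wd \<alpha> g x))^2)"
   by (rule integral_mono) (use i i3 nb[of "wd \<alpha> f x-wd \<alpha> g x" "- wd \<alpha> g x" for x] in auto)
  also have "... = 2*(LI x. (norm (wd \<alpha> f x-wd \<alpha> g x))^2)+2*(LI x. (norm (wd \<alpha> g x))^2)" using i i3 by simp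
  also have "(LI x. (norm (wd \<alpha> f x-wd \<alpha> g x))^2) = (LI x. (norm (wd \<alpha> (%x. f x-g x) x))^2)"
  proof (rule integral_cong_AE)
   have "L2 (%x. wd \<alpha> f x-wd \<alpha> g x)" using i3 by (auto simp: L2_def)
   show "AE x in lborel. (norm (wd \<alpha> f x-wd \<alpha> g x))^2 = (norm (wd \<alpha> (%x. f x-g x) x))^2" using D by eventually_elim simp
   show "(%x. (norm (wd \<alpha> (%x. f x-g x) x))^2):borel_measurable lborel"
    using wd_diff_L2[OF f g a] unfolding L2_def by (auto dest: borel_measurable_integrable)
  qed simp
  finally show ?thesis .
 qed
 thus ?thesis unfolding Hm_norm_square by (simp add: sum_distrib_left flip: sum.distrib) (intro sum_mono, simp)
qed

definition words :: "nat => 3 list set" where "words k = {is. length is = k}"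

lemma finite_words: "finite (words k)" using finite_lists_length_eq[of "UNIV::3 set" k] by (simp add: words_def)

lemma words_Suc: "words (Suc k) = (%(i, is). i # is) ` (UNIV\<times>words k)" by (force simp: words_def length_Suc_conv image_iff)

lemma sum_words_Suc: "(SUM is:words (Suc k). f is) = (SU i. SUM is:words k. (f (i # is)::real))"
proof -
 have "inj_on (%(i::3, is). i # is) (UNIV\<times>words k)" by (auto simp: inj_on_def)
 thus ?thesis unfolding words_Suc by (simp add: sum.reindex sum.cartesian_product case_prod_unfold)
qed

lemma words_0: "words 0 = {[]}" by (auto simp: words_def)

fun splits :: "3 list => (3 list\<times>3 list) list" where
 "splits [] = [([], [])]"
 | "splits (i # is) = map (%(a, b). (i # a, b)) (splits is) @ map (%(a, b). (a, i # b)) (splits is)"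

fun proper_splits :: "3 list => (3 list\<times>3 list) list" where
 "proper_splits [] = []"
 | "proper_splits (i # is) = map (%(a, b). (i # a, b)) (splits is) @ map (%(a, b). (a, i # b)) (proper_splits is)"

lemma splits_length: "(a, b):set (splits is) ==> length a+length b = length is" by (induction "is" arbitrary: a b) auto

lemma proper_splits_length: "(a, b):set (proper_splits is) ==> length a+length b = length is & a ~= []"
 by (induction "is" arbitrary: a b) (auto dest: splits_length)

lemma C1_sum_list: "(!!a. a:set xs ==> C1 (f a)) ==> C1 (%x. \<Sum>a\<leftarrow>xs. f a x)"
 and pd_sum_list: "(!!a. a:set xs ==> C1 (f a)) ==> pd i (%x. \<Sum>a\<leftarrow>xs. f a x) = (%x. \<Sum>a\<leftarrow>xs. pd i (f a) x)"
proof (induction xs)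
 case (Cons a xs)
 { case 1 thus ?case using Cons by (auto intro!: C1_add) }
 { case 2 thus ?case using Cons by (simp add: pd_add) }
qed (auto simp: C1_const pd_const)

lemma pds_mult:
 assumes f: "C_inf (f::scalar)" and g: "C_inf g"
 shows "pds is (%x. f x*g x) = (%x. \<Sum>p\<leftarrow>splits is. pds (fst p) f x*pds (snd p) g x)"
proof (induction "is")
 case (Cons i "is")
 have C: "C1 (%x. pds (fst p) f x*pds (snd p) g x)" for p by (intro C1_mult C_inf_C1s f g)
 have "pds (i # is) (%x. f x*g x) = (%x. \<Sum>p\<leftarrow>splits is. pd i (%x. pds (fst p) f x*pds (snd p) g x) x)"
  unfolding pds_Cons Cons by (rule pd_sum_list) (rule C)
 also have "... = (%x. \<Sum>p\<leftarrow>splits is. pds (i # fst p) f x*pds (snd p) g x+pds (fst p) f x*pds (i # snd p) g x)"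
  by (simp add: pd_mult C_inf_C1s f g pds_Cons)
 also have "... = (%x. \<Sum>p\<leftarrow>splits (i # is). pds (fst p) f x*pds (snd p) g x)"
  by (simp add: sum_list_addf case_prod_unfold o_def)
 finally show ?case .
qed simp

lemma pds_mult_commutator:
 assumes f: "C_inf (f::scalar)" and g: "C_inf g"
 shows "pds is (%x. f x*g x) = (%x. f x*pds is g x+(\<Sum>p\<leftarrow>proper_splits is. pds (fst p) f x*pds (snd p) g x))"
proof -
 have "(\<Sum>p\<leftarrow>splits is. F (fst p) (snd p)) = F [] is+(\<Sum>p\<leftarrow>proper_splits is. (F (fst p) (snd p)::real))" for F "is"
  by (induction "is" arbitrary: F) (auto simp: case_prod_unfold o_def)
 from this[of "%a b. pds a f x*pds b g x" "is" for x] show ?thesis unfolding pds_mult[OF f g] by simp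
qed

lemma sum_square_le: "(SUM a:A. (f a::real))^2 <= real (card A)*(SUM a:A. (f a)^2)"
 using Cauchy_Schwarz_ineq_sum[of f "%_. 1" A] by (simp add: mult.commute)

lemma L2sq_diff_le:
 assumes "BM f" "BM g"
 and "IB (%x. (f x)^2)" "IB (%x. (g x)^2)"
 shows "<|L2sq f-L2sq g|> <= 2 * sqrt (L2sq g) * sqrt (L2sq (%x. f x-g x))+L2sq (%x. f x-g x)"
proof -
 have id: "IB (%x. (f x-g x)^2)" using square_integrable_add[of lborel f "%x. - g x"] assms by simp
 have ip: "IB (%x. g x*(f x-g x))" using assms id by (intro Cauchy_Schwarz_mult(1)) auto
 define I where "I = (LI x. g x*(f x-g x))"
 have "(f x)^2 = (g x)^2+(2*(g x*(f x-g x))+(f x-g x)^2)" for x by (simp add: power2_eq_square algebra_simps)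
 hence "L2sq f = (LI x. (g x)^2+(2*(g x*(f x-g x))+(f x-g x)^2))" by (simp add: L2sq_def)
 also have "... = L2sq g+(2*I+L2sq (%x. f x-g x))" unfolding L2sq_def I_def using assms(4) ip id by simp
 finally have expand: "L2sq f-L2sq g = 2*I+L2sq (%x. f x-g x)" by simp
 have "I^2 <= L2sq g * L2sq (%x. f x-g x)" unfolding I_def L2sq_def using assms id by (intro Cauchy_Schwarz_mult(2)) auto
 hence "<|I|> <= sqrt (L2sq g) * sqrt (L2sq (%x. f x-g x))" by (metis real_sqrt_abs real_sqrt_le_mono real_sqrt_mult)
 thus ?thesis using expand L2sq_nonneg[of "%x. f x-g x"] by (simp add: abs_le_iff)
qed

definition cyc :: "3 => 3" where "cyc i = (if i = 1 then 2 else if i = 2 then 3 else 1)"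

lemma cyc_simps [simp]: "cyc 1 = 2" "cyc 2 = 3" "cyc 3 = 1" by (auto simp: cyc_def)

locale hall_solution =
 fixes m :: nat and T :: real and u b :: "real => R3 => R3" and \<pi> :: "real => scalar"
 assumes m3: "m >= 3" and T0: "T > 0" and sol: "hall_mhd_local_smooth_solution m T (u 0) (b 0) u b \<pi>"
 and div0: "weakly_div_free (b 0)"
begin

lemma in_times: "0 < s ==> t < T ==> r:{s..t} ==> r:{0<..<T}" by auto

definition W :: "bool => 3 => real => scalar" where "W c i t x = (if c then u t x $ i else b t x $ i)"

abbreviation "U == W True"
abbreviation "B == W False"

lemma W_slab: "smooth_slab T (W c i)"
proof -
 have "W c i = (%t x. (if c then u else b) t x $ i)" by (auto simp: W_def fun_eq_iff)
 thus ?thesis using sol smooth_slab_component[of T "if c then u else b" i] by (auto simp: hall_mhd_local_smooth_solution_def)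
qed

lemma pi_slab: "smooth_slab T \<pi>" using sol by (simp add: hall_mhd_local_smooth_solution_def)

lemma W_C_inf: "t:{0<..<T} ==> C_inf (W c i t)" using slab_C_inf[OF W_slab, of t "[]"] by simp

lemma pi_C_inf: "t:{0<..<T} ==> C_inf (\<pi> t)" using slab_C_inf[OF pi_slab, of t "[]"] by simp

lemma smooth3_ub: "t:{0<..<T} ==> smooth3 (u t)" "t:{0<..<T} ==> smooth3 (b t)"
 using W_C_inf[of t True] W_C_inf[of t False] by (auto simp: smooth3_def W_def[abs_def])

lemma in_Hm_ub: "t:{0..<T} ==> in_Hm m (u t)" "t:{0..<T} ==> in_Hm m (b t)"
 using sol by (auto simp: hall_mhd_local_smooth_solution_def)

lemma W_Hs: assumes "t:{0<..<T}" shows "Hs m (W c i t)"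
proof -
 have t: "t:{0..<T}" using assms by auto
 have "Hs m (%x. u t x $ i)" "Hs m (%x. b t x $ i)"
  using in_Hm_Hs[OF smooth3_ub(1)[OF assms] in_Hm_ub(1)[OF t]] in_Hm_Hs[OF smooth3_ub(2)[OF assms] in_Hm_ub(2)[OF t]] by auto
 thus ?thesis by (cases c) (auto simp: W_def[abs_def])
qed

lemma W_pds_Hs: "t:{0<..<T} ==> k+length is <= m ==> Hs k (pds is (W c i t))" by (rule Hs_pds, rule Hs_mono[OF W_Hs]) auto

definition state :: "bool => real => R3 => R3" where "state c = (if c then u else b)"

lemma W_state: "W c i t = (%x. state c t x $ i)" by (auto simp: W_def state_def)

lemma state_increment_tendsto:
 assumes t: "t:{0<..<T}"
 shows "((%s. Hm_norm m (%x. state c s x-state c t x)) \<longlongrightarrow> 0) (at t)"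
proof -
 have "((%s. Hm_norm m (%x. state c s x-state c t x)) \<longlongrightarrow> 0) (at t within {0..<T})"
  using sol t by (auto simp: hall_mhd_local_smooth_solution_def state_def)
 hence "((%s. Hm_norm m (%x. state c s x-state c t x)) \<longlongrightarrow> 0) (at t within {0<..<T})" by (rule tendsto_within_subset) auto
 thus ?thesis using at_within_open[of t "{0<..<T}"] t by simp
qed

lemma L2sq_increment_le:
 fixes c :: bool
 assumes s: "s:{0<..<T}" and t: "t:{0<..<T}" and len: "length is <= m"
 defines "H == Hm_norm m (%x. state c s x-state c t x)"
 shows "<|L2sq (pds is (W c i s))-L2sq (pds is (W c i t))|> <= 2 * sqrt (L2sq (pds is (W c i t)))*H+H^2"
proof -
 define d where "d = L2sq (%x. pds is (W c i s) x-pds is (W c i t) x)"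
 have smooth: "smooth3 (%x. state c s x-state c t x)"
  using W_C_inf[OF s, of c] W_C_inf[OF t, of c] unfolding smooth3_def W_state by (auto intro!: C_inf_diff)
 have Hd: "Hs m (%x. (state c s x-state c t x) $ j)" for j
  using Hs_diff[OF W_Hs[OF s, of c j] W_Hs[OF t, of c j]] unfolding W_state by simp
 have "d = L2sq (pds is (%x. (state c s x-state c t x) $ i))"
  unfolding d_def using pds_diff[OF W_C_inf[OF s, of c i] W_C_inf[OF t, of c i], of "is"] unfolding W_state by simp
 also have "... <= H^2" unfolding H_def by (rule L2sq_pds_le_Hm[OF smooth Hd len])
 finally have d: "d <= H^2" "sqrt d <= H" by (auto simp: H_def Hm_norm_nonneg intro: real_le_lsqrt)
 have L: "Hs 0 (pds is (W c i s))" "Hs 0 (pds is (W c i t))" using W_pds_Hs[OF s, of 0] W_pds_Hs[OF t, of 0] len by auto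
 have "<|L2sq (pds is (W c i s))-L2sq (pds is (W c i t))|> <= 2 * sqrt (L2sq (pds is (W c i t))) * sqrt d+d"
  unfolding d_def by (rule L2sq_diff_le) (use Hs_meas[OF L(1)] Hs_meas[OF L(2)] Hs_L2[OF L(1)] Hs_L2[OF L(2)] in auto)
 also have "... <= 2 * sqrt (L2sq (pds is (W c i t)))*H+H^2" using d by (intro add_mono mult_left_mono) (auto simp: L2sq_nonneg)
 finally show ?thesis .
qed

lemma L2sq_W_continuous:
 assumes len: "length is <= m"
 shows "continuous_on {0<..<T} (%t. L2sq (pds is (W c i t)))"
proof (rule continuous_at_imp_continuous_on, rule ballI)
 fix t assume t: "t:{0<..<T}"
 define H where "H s = Hm_norm m (%x. state c s x-state c t x)" for s
 define A where "A = L2sq (pds is (W c i t))"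
 have "((%s. L2sq (pds is (W c i s))-A) \<longlongrightarrow> 0) (at t)"
 proof (rule Lim_null_comparison)
  have "\<forall>\<^sub>F s in at t. s:{0<..<T}" using t eventually_at_in_open'[of "{0<..<T}" t] by simp
  thus "\<forall>\<^sub>F s in at t. norm (L2sq (pds is (W c i s))-A) <= 2 * sqrt A*H s+(H s)^2"
   by eventually_elim (simp add: A_def H_def L2sq_increment_le[OF _ t len])
  have "((%s. 2 * sqrt A*H s+(H s)^2) \<longlongrightarrow> 2 * sqrt A*0+0^2) (at t)"
   unfolding H_def by (intro tendsto_intros state_increment_tendsto[OF t])
  thus "((%s. 2 * sqrt A*H s+(H s)^2) \<longlongrightarrow> 0) (at t)" by simp
 qed
 thus "isCont (%t. L2sq (pds is (W c i t))) t" by (simp add: isCont_def LIM_zero_iff A_def)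
qed

definition E :: "nat => real => real" where
 "E k t = (SU c. SU i. SUM is:words k. L2sq (pds is (W c i t)))"

definition F :: "nat => real => real" where "F k t = (SUM j<=k. E j t)"

lemma E_nonneg: "0 <= E k t" unfolding E_def by (intro sum_nonneg) (auto simp: L2sq_nonneg)
lemma F_nonneg: "0 <= F k t" unfolding F_def by (intro sum_nonneg E_nonneg)

lemma E_continuous: "k <= m ==> continuous_on {0<..<T} (E k)"
 unfolding E_def by (intro continuous_on_sum L2sq_W_continuous) (auto simp: words_def)

lemma F_continuous: "k <= m ==> continuous_on {0<..<T} (F k)" unfolding F_def by (intro continuous_on_sum E_continuous) auto

lemma term_le_level_sum:
 fixes f :: "bool => 3 => 3 list => real"
 assumes f: "!!c i is. 0 <= f c i is"
 shows "f c i is <= (SU c. SU i. SUM is:words (length is). f c i is)"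
proof -
 have "f c i is <= (SUM is:words (length is). f c i is)"
  by (rule member_le_sum[where f="f c i"]) (use f finite_words in "auto simp: words_def")
 also have "... <= (SU i. SUM is:words (length is). f c i is)"
  by (rule member_le_sum[where f="%i. SUM is:words (length is). f c i is"]) (use f in "auto intro!: sum_nonneg")
 also have "... <= (SU c. SU i. SUM is:words (length is). f c i is)"
  by (rule member_le_sum[where f="%c. SU i. SUM is:words (length is). f c i is"]) (use f in "auto intro!: sum_nonneg")
 finally show ?thesis .
qed

lemma L2sq_le_E: "L2sq (pds is (W c i t)) <= E (length is) t"
 unfolding E_def using term_le_level_sum[of "%c i is. L2sq (pds is (W c i t))"] by (simp add: L2sq_nonneg)

lemma E_le_F: "j <= k ==> E j t <= F k t" unfolding F_def by (rule member_le_sum) (auto simp: E_nonneg)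

lemma L2sq_le_F: "length is <= k ==> L2sq (pds is (W c i t)) <= F k t" using L2sq_le_E E_le_F order_trans by blast

lemma D1sq_le_F: "length is+1 <= k ==> D1sq (pds is (W c i t)) <= 3*F k t"
proof -
 assume a: "length is+1 <= k"
 have "D1sq (pds is (W c i t)) <= (SU j::3. F k t)"
  unfolding D1sq_def pds_Cons[symmetric] using a by (intro sum_mono L2sq_le_F) auto
 thus ?thesis by simp
qed

lemma D2sq_le_F: "length is+2 <= k ==> D2sq (pds is (W c i t)) <= 9*F k t"
proof -
 assume a: "length is+2 <= k"
 have "D2sq (pds is (W c i t)) <= (SU j::3. 3*F k t)"
  unfolding D2sq_def pds_Cons[symmetric] using a by (intro sum_mono D1sq_le_F) auto
 thus ?thesis by simp
qed

lemma sup_le_F: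
 assumes t: "t:{0<..<T}" and l: "length is+2 <= k" "k <= m"
 shows "(pds is (W c i t) x)^2 <= 9217*F k t"
proof (rule power2_le_imp_le)
 have "Hs (Suc (Suc 0)) (pds is (W c i t))" using l by (intro W_pds_Hs[OF t]) auto
 hence "(pds is (W c i t) x)^4 <= 614656*(D1sq (pds is (W c i t))*D2sq (pds is (W c i t)))" by (rule Hs_Agmon)
 also have "... <= 614656*((3*F k t)*(9*F k t))"
  using l by (intro mult_left_mono mult_mono D1sq_le_F D2sq_le_F) (auto simp: D1sq_nonneg D2sq_nonneg F_nonneg)
 also have "... <= (9217*F k t)^2" by (simp add: power2_eq_square mult_right_mono F_nonneg)
 finally show "((pds is (W c i t) x)^2)^2 <= (9217*F k t)^2" by (simp flip: power_mult)
qed (simp add: F_nonneg)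

lemma product_sup_bound:
 assumes t: "t:{0<..<T}" and k: "k <= m" and l: "length a+2 <= k" "length c <= k"
 shows "IB (%x. (pds a (W p i t) x*pds c (W q j t) x)^2)" (is ?A)
 "(LI x. (pds a (W p i t) x*pds c (W q j t) x)^2) <= 9217*(F k t)^2" (is ?B)
proof -
 have H: "Hs 2 (pds a (W p i t))" "Hs 0 (pds c (W q j t))" using l k by (intro W_pds_Hs[OF t]; simp)+
 show i: ?A by (rule Hs_mult_square_integrable[OF H]) simp
 have "(LI x. (pds a (W p i t) x*pds c (W q j t) x)^2) <= (LI x. 9217*F k t*(pds c (W q j t) x)^2)"
  unfolding power_mult_distrib
  by (intro integral_mono i[unfolded power_mult_distrib] integrable_mult_right Hs_L2[OF H(2)] mult_right_mono sup_le_F[OF t l(1) k]) auto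
 also have "... = 9217*F k t * L2sq (pds c (W q j t))" by (simp add: L2sq_def)
 also have "... <= 9217*F k t*F k t" using l by (intro mult_left_mono L2sq_le_F) (auto simp: F_nonneg)
 finally show ?B by (simp add: power2_eq_square)
qed

lemma product_H1_bound:
 assumes t: "t:{0<..<T}" and k: "k <= m" and l: "length a+1 <= k" "length c+1 <= k"
 shows "IB (%x. (pds a (W p i t) x*pds c (W q j t) x)^2)" (is ?A)
 "(LI x. (pds a (W p i t) x*pds c (W q j t) x)^2) <= 9217*(F k t)^2" (is ?B)
proof -
 have H: "H1 (pds a (W p i t))" "H1 (pds c (W q j t))" using l k by (intro Hs_H1[of 0] W_pds_Hs[OF t]; simp)+
 note P = H1_product_L2[OF H]
 show ?A using P(1) by (simp add: power_mult_distrib)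
 have "(LI x. (pds a (W p i t) x)^2*(pds c (W q j t) x)^2)^2 <= 4096*(D1sq (pds a (W p i t)))^2*(L2sq (pds c (W q j t))*D1sq (pds c (W q j t)))"
  by (rule P(2))
 also have "... <= 4096*(3*F k t)^2*(F k t*(3*F k t))"
  using l by (intro mult_mono power_mono L2sq_le_F D1sq_le_F order_refl) (auto simp: D1sq_nonneg L2sq_nonneg F_nonneg)
 also have "... <= (9217*(F k t)^2)^2"
  using zero_le_power[OF F_nonneg, of k t 4] by (simp add: power2_eq_square eval_nat_numeral mult_ac)
 finally have "(LI x. (pds a (W p i t) x)^2*(pds c (W q j t) x)^2) <= 9217*(F k t)^2" by (rule power2_le_imp_le) simp
 thus ?B by (simp add: power_mult_distrib)
qed

lemma product_L2_bound:
 assumes t: "t:{0<..<T}" and k: "k <= m"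
 and l: "(length a+2 <= k & length c <= k) | (length a <= k & length c+2 <= k) | (length a+1 <= k & length c+1 <= k)"
 shows "IB (%x. (pds a (W p i t) x*pds c (W q j t) x)^2)"
 "(LI x. (pds a (W p i t) x*pds c (W q j t) x)^2) <= 9217*(F k t)^2"
 using l product_sup_bound[OF t k, of a c p i q j] product_sup_bound[OF t k, of c a q j p i] product_H1_bound[OF t k, of a c p i q j]
 by (auto simp: mult.commute)

text \<open>The transport-type terms of both equations have the form \<open>adv s c i\<close>: the velocity equation is
driven by \<open>adv True True\<close> (advection of \<open>u\<close>) and \<open>adv False False\<close>, the magnetic one by the mixed pairs.\<close>
definition adv :: "bool => bool => 3 => real => scalar" where
 "adv s c i t x = (SU l. W s l t x*pd l (W c i t) x)"

definition nonlin :: "bool => 3 => real => scalar" where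
 "nonlin c i t x = adv False (~c) i t x-adv True c i t x"

definition J :: "3 => real => scalar" where
 "J i t x = pd (cyc i) (B (cyc (cyc i)) t) x-pd (cyc (cyc i)) (B (cyc i) t) x"

lemma adv_C_inf: "t:{0<..<T} ==> C_inf (adv s c i t)"
 unfolding adv_def[abs_def] by (intro C_inf_sum C_inf_mult W_C_inf C_inf_pd) auto

lemma nonlin_C_inf: "t:{0<..<T} ==> C_inf (nonlin c i t)"
 unfolding nonlin_def[abs_def] using adv_C_inf by (intro C_inf_diff) auto

lemma J_C_inf: "t:{0<..<T} ==> C_inf (J i t)" unfolding J_def[abs_def] using W_C_inf by (intro C_inf_diff C_inf_pd) auto

lemma W_eq: "W True i t = (%x. u t x $ i)" "W False i t = (%x. b t x $ i)" by (auto simp: W_def)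

lemma vec_pd_component:
 assumes y: "smooth_slab T (y::real => R3 => R3)" and t: "t:{0<..<T}"
 shows "pd l (y t) x $ i = pd l (%x. y t x $ i) x" "pd l (pd l (y t)) x $ i = pd l (pd l (%x. y t x $ i)) x" (is ?A)
proof -
 show "pd l (y t) x $ i = pd l (%x. y t x $ i) x" for x
  using dsts_comp[OF y t, of "[Some l]" i x] by (simp add: dsts_Cons dst_Some)
 show ?A using dsts_comp[OF y t, of "[Some l, Some l]" i x] by (simp add: dsts_Cons dst_Some)
qed

lemma time_component:
 assumes y: "smooth_slab T (y::real => R3 => R3)" and t: "t:{0<..<T}"
 shows "time_deriv y t x $ i = dst None (%t x. y t x $ i) t x"
 using dsts_comp[OF y t, of "[None]" i x] by (simp add: dsts_Cons dst_None time_deriv_def)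

lemma eq_u:
 assumes t: "t:{0<..<T}"
 shows "dst None (U i) t x = (SU l. pd l (pd l (U i t)) x)+nonlin True i t x-pd i (\<pi> t) x"
proof -
 have su: "smooth_slab T u" "smooth_slab T b" using sol by (auto simp: hall_mhd_local_smooth_solution_def)
 have "time_deriv u t x+conv (u t) (u t) x+grad (\<pi> t) x = lap (u t) x+conv (b t) (b t) x"
  using sol t by (auto simp: hall_mhd_local_smooth_solution_def)
 from arg_cong[OF this, of "%v. v $ i"] have "time_deriv u t x $ i+conv (u t) (u t) x $ i+grad (\<pi> t) x $ i = lap (u t) x $ i+conv (b t) (b t) x $ i"
  by (simp only: vector_add_component)
 thus ?thesis
  by (simp add: time_component[OF su(1) t] conv_def lap_def grad_def sum_component vec_pd_component[OF su(1) t] vec_pd_component[OF su(2) t]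
  nonlin_def adv_def W_eq W_def[abs_def] algebra_simps)
qed

lemma eq_b_raw:
 assumes t: "t:{0<..<T}"
 shows "dst None (B i) t x = (SU l. pd l (pd l (B i t)) x)+nonlin False i t x-curl (%y. cross3 (curl (b t) y) (b t y)) x $ i"
proof -
 have su: "smooth_slab T u" "smooth_slab T b" using sol by (auto simp: hall_mhd_local_smooth_solution_def)
 have "time_deriv b t x+conv (u t) (b t) x+curl (%y. cross3 (curl (b t) y) (b t y)) x = lap (b t) x+conv (b t) (u t) x"
  using sol t by (auto simp: hall_mhd_local_smooth_solution_def)
 from arg_cong[OF this, of "%v. v $ i"] have "time_deriv b t x $ i+conv (u t) (b t) x $ i+curl (%y. cross3 (curl (b t) y) (b t y)) x $ i
  = lap (b t) x $ i+conv (b t) (u t) x $ i"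
  by (simp only: vector_add_component)
 thus ?thesis
  by (simp add: time_component[OF su(2) t] conv_def lap_def sum_component vec_pd_component[OF su(1) t] vec_pd_component[OF su(2) t]
  nonlin_def adv_def W_eq W_def[abs_def] algebra_simps)
qed

lemma div_u: assumes t: "t:{0<..<T}" shows "(SU l. pd l (U l t) x) = 0"
 using sol t by (auto simp: hall_mhd_local_smooth_solution_def div3_def W_eq)

lemma curl_b_J: "curl (b t) x = vector [J 1 t x, J 2 t x, J 3 t x]" by (simp add: curl_def J_def W_eq)

lemma hall_divergence_form:
 assumes t: "t:{0<..<T}"
 shows "curl (%y. cross3 (curl (b t) y) (b t y)) x $ i = - (SU l. pd l (%x. B i t x*J l t x-B l t x*J i t x) x)"
proof -
 have C: "C1 (B l t)" "C1 (J l t)" for l using W_C_inf[OF t] J_C_inf[OF t] by (auto intro: C_inf_C1)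
 have cr: "(%y. cross3 (curl (b t) y) (b t y) $ 1) = (%x. J 2 t x*B 3 t x-J 3 t x*B 2 t x)"
  "(%y. cross3 (curl (b t) y) (b t y) $ 2) = (%x. J 3 t x*B 1 t x-J 1 t x*B 3 t x)"
  "(%y. cross3 (curl (b t) y) (b t y) $ 3) = (%x. J 1 t x*B 2 t x-J 2 t x*B 1 t x)"
  by (auto simp: cross3_def curl_b_J W_eq)
 have c: "curl (%y. cross3 (curl (b t) y) (b t y)) x = vector [
  pd 2 (%x. J 1 t x*B 2 t x-J 2 t x*B 1 t x) x-pd 3 (%x. J 3 t x*B 1 t x-J 1 t x*B 3 t x) x,
  pd 3 (%x. J 2 t x*B 3 t x-J 3 t x*B 2 t x) x-pd 1 (%x. J 1 t x*B 2 t x-J 2 t x*B 1 t x) x,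
  pd 1 (%x. J 3 t x*B 1 t x-J 1 t x*B 3 t x) x-pd 2 (%x. J 2 t x*B 3 t x-J 3 t x*B 2 t x) x]"
  unfolding curl_def[of "%y. cross3 (curl (b t) y) (b t y)"] cr ..
 have p: "pd l (%x. f x*g x-h x*k x) = (%x. pd l f x*g x+f x*pd l g x-(pd l h x*k x+h x*pd l k x))"
  if "C1 f" "C1 g" "C1 h" "C1 k" for l f g h k using that by (simp add: pd_diff pd_mult C1_mult)
 show ?thesis
  using exhaust_3[of i] unfolding c sum_3
  by (elim disjE; simp only: p[OF C(2) C(1) C(2) C(1)] p[OF C(1) C(2) C(1) C(2)] vector_3; simp add: algebra_simps)
qed

lemma eq_b:
 assumes t: "t:{0<..<T}"
 shows "dst None (B i) t x = (SU l. pd l (pd l (B i t)) x)+nonlin False i t x+(SU l. pd l (%x. B i t x*J l t x-B l t x*J i t x) x)"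
 using eq_b_raw[OF t] hall_divergence_form[OF t] by simp

lemma div_J: assumes t: "t:{0<..<T}" shows "(SU l. pd l (J l t) x) = 0"
proof -
 have C: "C1 (pd l (B i t))" for l i using W_C_inf[OF t] by (auto intro: C_inf_C1 C_inf_pd)
 show ?thesis
  unfolding J_def[abs_def] sum_3 using pd_commute[OF W_C_inf[OF t, of False 1], of 2 3] pd_commute[OF W_C_inf[OF t, of False 2], of 1 3]
  pd_commute[OF W_C_inf[OF t, of False 3], of 1 2] by (simp add: pd_diff C)
qed

end

text \<open>Radial potential: for divergence-free \<open>v\<close> the antisymmetric matrix \<open>K i * x$j - K j * x$i\<close> has
divergence \<open>v\<close>. The substitution \<open>\<sigma> = r\<^sup>2\<close> in the ray integral makes \<open>K\<close> square integrable by Cauchy-Schwarz.\<close>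
definition ray :: "scalar => real => scalar" where "ray v r x = 2*r^3 * v (r^2 *\<^sub>R x)"
definition rayint :: "scalar => scalar" where "rayint v x = SI {0..1} (%r. ray v r x)"

lemma rayint_eq: assumes v: "continuous_on UNIV v" shows "rayint v x = integral {0..1} (%r. ray v r x)"
proof -
 have cont: "continuous_on {0..1} (%r. ray v r x)"
  unfolding ray_def by (intro continuous_intros continuous_on_compose2[OF v]) auto
 have "set_integrable lborel {0..1} (%r. ray v r x)"
  unfolding set_integrable_def by (rule borel_integrable_compact[OF _ cont]) simp
 from set_borel_integral_eq_integral(2)[OF this] show ?thesis by (simp add: rayint_def set_lebesgue_integral_def)
qed

lemma rayint_continuous: assumes v: "continuous_on UNIV v" shows "continuous_on UNIV (rayint v)"
proof -
 have "continuous_on UNIV (%x. integral (cbox 0 1) (%r. ray v r x))"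
 proof (rule integral_continuous_on_param)
  have "continuous_on UNIV (%(x, r). ray v r x)"
   unfolding ray_def case_prod_unfold by (intro continuous_intros continuous_on_compose2[OF v]) auto
  thus "continuous_on (UNIV\<times>cbox 0 1) (%(x, r). ray v r x)" by (rule continuous_on_subset) auto
 qed
 thus ?thesis using rayint_eq[OF v] by (simp add: fun_eq_iff[symmetric] cong: continuous_on_cong)
qed

lemma rayint_square_le:
 assumes v: "continuous_on UNIV v"
 shows "ennreal ((rayint v x)^2) <= (NI r. indicator {0..1} r*ennreal ((ray v r x)^2))"
proof -
 have cont: "continuous_on {0..1} (%r. ray v r x)" "continuous_on {0..1} (%r. (ray v r x)^2)"
  unfolding ray_def by (intro continuous_intros continuous_on_compose2[OF v]; auto)+
 have i2: "SIB {0..1} (%r. (ray v r x)^2)" using borel_integrable_compact[OF _ cont(2)] by simp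
 have i1: "IB (%r. indicator {0..1::real} r::real)" by (intro integrable_real_indicator) (auto simp: emeasure_lborel_Icc_eq)
 have m: "(%r. indicator {0..1} r*ray v r x):borel_measurable lborel"
  using borel_integrable_compact[OF _ cont(1)] by (auto dest: borel_measurable_integrable)
 have "(rayint v x)^2 <= (LI r. indicator {0..1::real} r)*SI {0..1} (%r. (ray v r x)^2)"
  unfolding rayint_def by (rule Cauchy_Schwarz_integral(2)[OF i1 i2 m]) (auto simp: indicator_def)
 hence "ennreal ((rayint v x)^2) <= ennreal (SI {0..1} (%r. (ray v r x)^2))" by (intro ennreal_leI) simp
 also have "... = (NI r. ennreal (indicator {0..1} r*(ray v r x)^2))"
  by (rule nn_integral_eq_integral[symmetric, OF i2]) (auto simp: indicator_def)
 also have "... = (NI r. indicator {0..1} r*ennreal ((ray v r x)^2))" by (intro nn_integral_cong) (auto simp: indicator_def)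
 finally show ?thesis .
qed

lemma ray_square_integral:
 assumes v: "BM v" and i: "IB (%x. (v x)^2)" and r: "0 < r"
 shows "(NI x. ennreal ((ray v r x)^2)) = ennreal (4 * L2sq v)"
proof -
 note [measurable] = v
 have "(NI x. ennreal ((ray v r x)^2)) = (NI x. ennreal 4*(ennreal ((r^2)^3)*ennreal ((v (r^2 *\<^sub>R x))^2)))"
  unfolding ray_def by (intro nn_integral_cong, subst ennreal_mult[symmetric], simp, simp, subst ennreal_mult[symmetric], simp, simp)
  (simp add: power_mult_distrib flip: power_mult)
 also have "... = ennreal 4*(ennreal ((r^2)^3)*(NI x. ennreal ((v (0+r^2 *\<^sub>R x))^2)))" by (simp add: nn_integral_cmult)
 also have "... = ennreal 4*(NI x. ennreal ((v x)^2))" using r nn_integral_affine[of "%x. ennreal ((v x)^2)" "r^2" 0] by simp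
 also have "... = ennreal (4 * L2sq v)" unfolding L2sq_def by (subst nn_integral_eq_integral[OF i]) (auto simp: ennreal_mult)
 finally show ?thesis .
qed

lemma rayint_L2:
 assumes v: "continuous_on UNIV v" and i: "IB (%x. (v x)^2)"
 shows "IB (%x. (rayint v x)^2)"
proof -
 have [measurable]: "BM v" "BM (rayint v)" using borel_measurable_continuous_onI[OF v] borel_measurable_continuous_onI[OF rayint_continuous[OF v]] .
 have m: "(%(x, r). indicator {0..1} r*ennreal ((ray v r x)^2)):borel_measurable (lborel \<Otimes>\<^sub>M lborel)"
  unfolding ray_def case_prod_unfold by measurable
 have inner: "(NI x. indicator {0..1} r*ennreal ((ray v r x)^2)) <= indicator {0..1} r*ennreal (4 * L2sq v)" for r
  using ray_square_integral[OF _ i, of r] by (cases "r = 0") (auto simp: indicator_def ray_def)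
 have "(NI x. ennreal ((rayint v x)^2)) <= (NI x. NI r. indicator {0..1} r*ennreal ((ray v r x)^2))"
  by (intro nn_integral_mono rayint_square_le[OF v])
 also have "... = (NI r. NI x. indicator {0..1} r*ennreal ((ray v r x)^2))"
  using pair_sigma_finite.Fubini'[OF _ m] by (simp add: pair_sigma_finite_def sigma_finite_lborel)
 also have "... <= (NI r. indicator {0..1::real} r*ennreal (4 * L2sq v))" by (intro nn_integral_mono inner)
 also have "... < \<infinity>" by (simp add: nn_integral_multc nn_integral_cmult ennreal_mult_less_top emeasure_lborel_Icc_eq mult.commute)
 finally show ?thesis by (intro integrableI_nonneg) auto
qed

lemma Fubini_ray:
 fixes g :: "real => scalar"
 assumes g: "continuous_on UNIV (%(r, x). g r x)" and z: "!!r x. norm x > R ==> g r x = 0"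
 shows "(LI x. (SI {0..1} (%r. g r x))) = SI {0..1} (%r. LI x. g r x)"
 "SIB {0..1} (%r. LI x. g r x)"
proof -
 have "IB (%p. indicator ({0..1}\<times>cball 0 R) p *\<^sub>R (%(r, x). g r x) p)"
  by (rule borel_integrable_compact) (auto intro!: compact_Times continuous_on_subset[OF g])
 moreover have "(%p. indicator ({0..1}\<times>cball 0 R) p *\<^sub>R (%(r, x). g r x) p) = (%(r, x). indicator {0..1} r*g r x)"
  using z by (auto simp: fun_eq_iff indicator_def not_le)
 ultimately have i: "integrable (lborel \<Otimes>\<^sub>M lborel) (%(r, x). indicator {0..1} r*g r x)" by (simp add: lborel_prod)
 have ps: "pair_sigma_finite (lborel::real measure) (lborel::R3 measure)" by (simp add: pair_sigma_finite_def sigma_finite_lborel)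
 from pair_sigma_finite.Fubini_integral[OF ps i] lborel_pair.integrable_fst'[OF i] show
  "(LI x. (SI {0..1} (%r. g r x))) = SI {0..1} (%r. LI x. g r x)"
  "SIB {0..1} (%r. LI x. g r x)" by simp_all
qed

definition solenoidal_test :: "(3 => scalar) => nat => 3 => scalar" where
 "solenoidal_test v n i x = chi n x * v i x+(SU j. pd j (chi n) x*(rayint (v i) x*x $ j-rayint (v j) x*x $ i))"

lemma solenoidal_test_continuous:
 assumes "!!i. C_inf (v i)" shows "continuous_on UNIV (solenoidal_test v n i)"
 unfolding solenoidal_test_def
 by (intro continuous_intros C1_cont[OF C1_chi] C1_cont_pd[OF C1_chi] rayint_continuous C1_cont[OF C_inf_C1[OF assms]])

lemma chi_pd_support: "norm x > 3*real (Suc n) ==> pd j (chi n) x = 0"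
 by (rule pd_outside[of "3*real (Suc n)"]) (rule chi_support)

lemma solenoidal_test_support: "norm x > 3*real (Suc n) ==> solenoidal_test v n i x = 0"
 unfolding solenoidal_test_def by (simp add: chi_support chi_pd_support del: of_nat_Suc)

lemma antisymmetric_double_divergence_pairing:
 assumes p: "C_inf p" and M: "!!i j. C1 (M i j)" and anti: "!!i j x. M j i x = - M i j x"
 and z: "!!i j x. norm x > R ==> M i j x = 0"
 shows "IB (%x. pd i p x*pd j (M i j) x)" "(SU i. SU j. LI x. pd i p x*pd j (M i j) x) = 0" (is ?A)
proof -
 have Cp: "C1 (pd i p)" for i using p by (auto intro: C_inf_C1 C_inf_pd)
 have zp: "pd j (M i j) x = 0" if "norm x > R" for i j x by (rule pd_outside[of R]) (use z that in auto)
 show ii: "IB (%x. pd i p x*pd j (M i j) x)" for i j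
  by (rule integrable_compact_support[of _ R]) (auto intro!: continuous_intros C1_cont[OF Cp] C1_cont_pd[OF M] simp: zp)
 define I where "I i j = (LI x. pd j (pd i p) x*M i j x)" for i j
 have ibp: "(LI x. pd i p x*pd j (M i j) x) = - I i j" for i j
 proof -
  have "(LI x. pd j (%x. pd i p x*M i j x) x) = 0" by (rule integral_pd_compact_support[OF C1_mult[OF Cp M], of R]) (simp add: z)
  moreover have "IB (%x. pd j (pd i p) x*M i j x)"
   by (rule integrable_compact_support[of _ R]) (auto intro!: continuous_intros C1_cont_pd[OF Cp] C1_cont[OF M] simp: z)
  ultimately show ?thesis using ii[of i j] by (simp add: pd_mult[OF Cp M] I_def)
 qed
 have swap: "I j i = - I i j" for i j unfolding I_def using pd_commute[OF p, of i j] anti[of i j] by simp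
 have "(SU i. SU j. I j i) = (SU i. SU j. - I i j)" by (intro sum.cong refl swap)
 also have "... = - (SU i. SU j. I i j)" by (simp add: sum_negf)
 finally have "(SU i. SU j. I j i) = - (SU i. SU j. I i j)" .
 moreover have "(SU i. SU j. I j i) = (SU i. SU j. I i j)" by (rule sum.swap)
 ultimately show ?A by (simp add: ibp sum_negf)
qed

context
 fixes v :: "3 => scalar"
 assumes v: "!!i. C_inf (v i)"
begin

definition ray_matrix :: "real => 3 => 3 => scalar" where
 "ray_matrix r i j x = ray (v i) r x*x $ j-ray (v j) r x*x $ i"

definition ray_divergence :: "real => 3 => scalar" where
 "ray_divergence r i x = 4*r^3 * v i (r^2 *\<^sub>R x)+2*r^5*(SU j. x $ j*pd j (v i) (r^2 *\<^sub>R x))"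

lemma v_C1: "C1 (v i)" using v by (rule C_inf_C1)

lemma coordinate_C1: "C1 (%x. x $ j)" and pd_coordinate: "pd k (%x. x $ j) = (%x. if j = k then 1 else 0)"
 using C1_affine_component[of 0 1 j] pd_affine_component[of k 0 1 j] by auto

lemma ray_C1: "C1 (ray (v i) r)" and pd_ray: "pd k (ray (v i) r) = (%x. 2*r^3*(r^2*pd k (v i) (r^2 *\<^sub>R x)))"
 unfolding ray_def using C1_cmult[OF pd_scale(1)[OF v_C1]] pd_cmult[OF pd_scale(1)[OF v_C1]] pd_scale(2)[OF v_C1] by auto

lemma ray_matrix_C1: "C1 (ray_matrix r i j)" unfolding ray_matrix_def by (intro C1_diff C1_mult ray_C1 coordinate_C1)

lemma ray_matrix_divergence:
 assumes dv: "!!x. (SU l. pd l (v l) x) = 0"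
 shows "(SU j. pd j (ray_matrix r i j) x) = ray_divergence r i x"
proof -
 have "pd j (ray_matrix r i j) x = 2*r^3*(r^2*pd j (v i) (r^2 *\<^sub>R x))*x $ j+ray (v i) r x
  - (2*r^3*(r^2*pd j (v j) (r^2 *\<^sub>R x))*x $ i+ray (v j) r x*(if i = j then 1 else 0))" for j
  unfolding ray_matrix_def by (simp add: pd_diff pd_mult C1_mult ray_C1 pd_ray coordinate_C1 pd_coordinate)
 hence "(SU j. pd j (ray_matrix r i j) x) = (SU j. 2*r^3*(r^2*pd j (v i) (r^2 *\<^sub>R x))*x $ j+ray (v i) r x
  - (2*r^3*(r^2*pd j (v j) (r^2 *\<^sub>R x))*x $ i+ray (v j) r x*(if i = j then 1 else 0)))" by (simp only:)
 also have "... = (SU j. 2*r^3*(r^2*pd j (v i) (r^2 *\<^sub>R x))*x $ j)+3*ray (v i) r x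
  - (2*r^3*r^2*x $ i*(SU j. pd j (v j) (r^2 *\<^sub>R x))+ray (v i) r x)"
  unfolding sum_3 using exhaust_3[of i] by (elim disjE) (simp_all add: algebra_simps)
 finally show ?thesis unfolding dv by (simp add: ray_divergence_def ray_def sum_distrib_left algebra_simps eval_nat_numeral)
qed

lemma ray_continuous: "continuous_on UNIV (%(r, x). ray (v i) r x)"
 and ray_divergence_continuous: "continuous_on UNIV (%(r, x). ray_divergence r i x)"
 unfolding ray_def ray_divergence_def case_prod_unfold
 by (intro continuous_intros continuous_on_compose2[OF C1_cont[OF v_C1]] continuous_on_compose2[OF C1_cont_pd[OF v_C1]]; auto intro!: continuous_intros)+

lemma ray_integrable: "SIB {0..1} (%r. ray (v i) r x)"
 and ray_divergence_integrable: "SIB {0..1} (%r. ray_divergence r i x)"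
proof -
 have i: "SIB {0..1} (%r. g r x)" if "continuous_on UNIV (%(r, x). g r x)" for g :: "real => scalar"
  using borel_integrable_compact[of "{0..1}"
  "%r. g r x"] continuous_on_compose2[OF that continuous_on_Pair[OF continuous_on_id continuous_on_const[where c=x]], of "{0..1}"] by simp
 show "SIB {0..1} (%r. ray (v i) r x)" "SIB {0..1} (%r. ray_divergence r i x)"
  by (rule i ray_continuous ray_divergence_continuous)+
qed

lemma ray_divergence_integral: "SI {0..1} (%r. ray_divergence r i x) = v i x"
proof -
 have inner: "((%r. v i (r^2 *\<^sub>R x)) has_real_derivative 2*r*(SU j. x $ j*pd j (v i) (r^2 *\<^sub>R x))) (at r)" for r
 proof -
  have "((%r. r^2 *\<^sub>R x) has_derivative (%h. (2*r*h) *\<^sub>R x)) (at r)" by (auto intro!: derivative_eq_intros simp: algebra_simps)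
  from has_derivative_compose[OF this C1_has_derivative[OF v_C1]]
  have "((%r. v i (r^2 *\<^sub>R x)) has_derivative (%h. SU j. ((2*r*h) *\<^sub>R x) $ j*pd j (v i) (r^2 *\<^sub>R x))) (at r)" .
  thus ?thesis unfolding has_field_derivative_def
   by (rule has_derivative_eq_rhs) (auto simp: fun_eq_iff sum_distrib_left mult_ac)
 qed
 have "((%r. r^4 * v i (r^2 *\<^sub>R x)) has_real_derivative ray_divergence r i x) (at r)" for r
  by (rule DERIV_cong[OF DERIV_mult[OF DERIV_pow inner]]) (simp add: ray_divergence_def algebra_simps eval_nat_numeral)
 moreover have "continuous_on UNIV (%r. ray_divergence r i x)"
  using continuous_on_compose2[OF ray_divergence_continuous continuous_on_Pair[OF continuous_on_id continuous_on_const[where c=x]], of UNIV i] by simp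
 hence "isCont (%r. ray_divergence r i x) r" for r by (simp add: continuous_on_eq_continuous_at)
 ultimately have "(LI r. ray_divergence r i x*indicator {0..1} r) = 1^4 * v i (1^2 *\<^sub>R x)-0^4 * v i (0^2 *\<^sub>R x)"
  by (intro integral_FTC_Icc_real) auto
 thus ?thesis by (simp add: mult.commute)
qed

definition ray_test :: "nat => real => 3 => scalar" where
 "ray_test n r i x = chi n x*ray_divergence r i x+(SU j. pd j (chi n) x*ray_matrix r i j x)"

lemma ray_test_integral: "SI {0..1} (%r. ray_test n r i x) = solenoidal_test v n i x"
proof -
 have "indicator {0..1} r*ray_test n r i x = chi n x*(indicator {0..1} r*ray_divergence r i x) +
  (SU j. pd j (chi n) x*((indicator {0..1} r*ray (v i) r x)*x $ j-(indicator {0..1} r*ray (v j) r x)*x $ i))" for r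
  unfolding ray_test_def ray_matrix_def by (simp add: sum_distrib_left algebra_simps)
 thus ?thesis using ray_integrable ray_divergence_integrable
  by (simp add: ray_divergence_integral solenoidal_test_def rayint_def)
qed

lemma ray_test_orthogonal:
 assumes dv: "!!x. (SU l. pd l (v l) x) = 0" and p: "C_inf p"
 shows "(SU i. LI x. pd i p x*ray_test n r i x) = 0"
proof -
 define M where "M i j x = chi n x*ray_matrix r i j x" for i j x
 have M: "C1 (M i j)" "M j i x = - M i j x" "norm x > 3*real (Suc n) ==> M i j x = 0" for i j x
  unfolding M_def by (intro C1_mult C1_chi ray_matrix_C1, simp add: ray_matrix_def algebra_simps, simp add: chi_support del: of_nat_Suc)
 note P = antisymmetric_double_divergence_pairing[where M=M, OF p M]
 have "ray_test n r i x = (SU j. pd j (M i j) x)" for i x unfolding ray_test_def ray_matrix_divergence[OF dv, symmetric] M_def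
  by (simp add: pd_mult C1_chi ray_matrix_C1 sum.distrib sum_distrib_left add.commute)
 thus ?thesis using P by (simp add: sum_distrib_left integral_sum)
qed

lemma solenoidal_test_orthogonal:
 assumes dv: "!!x. (SU l. pd l (v l) x) = 0" and p: "C_inf p"
 shows "(SU i. LI x. pd i p x * solenoidal_test v n i x) = 0"
proof -
 define g where "g i r x = pd i p x*ray_test n r i x" for i r x
 have gc: "continuous_on UNIV (%(r, x). g i r x)" for i unfolding g_def ray_test_def ray_matrix_def case_prod_unfold
  using ray_divergence_continuous ray_continuous unfolding case_prod_unfold
  by (intro continuous_intros continuous_on_compose2[OF C1_cont_pd[OF C_inf_C1[OF p]]] continuous_on_compose2[OF C1_cont[OF C1_chi]] continuous_on_compose2[OF C1_cont_pd[OF C1_chi]]) auto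
 have gz: "g i r x = 0" if "norm x > 3*real (Suc n)" for i r x
  unfolding g_def ray_test_def using chi_support[OF that] chi_pd_support[OF that] by simp
 have pt: "SI {0..1} (%r. g i r x) = pd i p x * solenoidal_test v n i x" for i x
  using integral_mult_right_zero[of lborel "pd i p x" "%r. indicator {0..1} r*ray_test n r i x"]
  by (simp add: g_def ray_test_integral mult.left_commute)
 have "(SU i. LI x. pd i p x * solenoidal_test v n i x) = (SU i. LI r. indicator {0..1} r*(LI x. g i r x))"
  unfolding pt[symmetric] by (intro sum.cong refl Fubini_ray(1)[OF gc gz])
 also have "... = SI {0..1} (%r. SU i. LI x. g i r x)"
  unfolding sum_distrib_left by (rule integral_sum[symmetric], rule Fubini_ray(2)[OF gc gz])
 also have "... = 0" using ray_test_orthogonal[OF dv p] by (simp add: g_def)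
 finally show ?thesis .
qed

lemma solenoidal_test_bound:
 obtains K where "!!n i x. <|solenoidal_test v n i x|> <= <|v i x|>+(SU j. K*(<|rayint (v i) x|>+<|rayint (v j) x|>))"
proof -
 obtain K where K: "K >= 0" "!!n i x. norm x*<|pd i (chi n) x|> <= K" by (rule pd_chi_bound) blast
 show thesis
 proof (rule that)
  fix n i x
  have "<|pd j (chi n) x*(rayint (v i) x*x $ j-rayint (v j) x*x $ i)|> <= K*(<|rayint (v i) x|>+<|rayint (v j) x|>)" for j
  proof -
   have "<|rayint (v i) x*x $ j-rayint (v j) x*x $ i|> <= <|rayint (v i) x*x $ j|>+<|rayint (v j) x*x $ i|>" by (rule abs_triangle_ineq4)
   also have "... <= <|rayint (v i) x|>*norm x+<|rayint (v j) x|>*norm x"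
    unfolding abs_mult by (intro add_mono mult_left_mono component_le_norm_cart) auto
   finally have "<|pd j (chi n) x*(rayint (v i) x*x $ j-rayint (v j) x*x $ i)|>
    <= <|pd j (chi n) x|>*(norm x*(<|rayint (v i) x|>+<|rayint (v j) x|>))"
    unfolding abs_mult by (intro mult_left_mono) (auto simp: algebra_simps)
   also have "... = (norm x*<|pd j (chi n) x|>)*(<|rayint (v i) x|>+<|rayint (v j) x|>)" by simp
   also have "... <= K*(<|rayint (v i) x|>+<|rayint (v j) x|>)" by (intro mult_right_mono K(2)) auto
   finally show ?thesis .
  qed
  hence "<|SU j. pd j (chi n) x*(rayint (v i) x*x $ j-rayint (v j) x*x $ i)|> <= (SU j. K*(<|rayint (v i) x|>+<|rayint (v j) x|>))"
   by (intro order_trans[OF sum_abs sum_mono])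
  moreover have "<|chi n x * v i x|> <= <|v i x|>" using chi_bounds[of n x] by (simp add: abs_mult mult_left_le_one_le)
  ultimately show "<|solenoidal_test v n i x|> <= <|v i x|>+(SU j. K*(<|rayint (v i) x|>+<|rayint (v j) x|>))"
   unfolding solenoidal_test_def by linarith
 qed
qed

lemma solenoidal_test_limit:
 assumes i2: "!!i. IB (%x. (v i x)^2)"
 obtains D where "!!i. D i:borel_measurable borel" "!!i. IB (%x. (D i x)^2)"
 "!!n i x. <|solenoidal_test v n i x|> <= D i x" "!!i x. (%n. solenoidal_test v n i x) ----> v i x"
proof -
 obtain K where K: "!!n i x. <|solenoidal_test v n i x|> <= <|v i x|>+(SU j. K*(<|rayint (v i) x|>+<|rayint (v j) x|>))"
  by (rule solenoidal_test_bound) blast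
 have cv: "continuous_on UNIV (v i)" for i by (rule C1_cont[OF v_C1])
 define D where "D i x = <|v i x|>+(SU j. K*(<|rayint (v i) x|>+<|rayint (v j) x|>))" for i x
 have m [measurable]: "BM (v i)" "BM (rayint (v i))" for i
  using borel_measurable_continuous_onI[OF cv] borel_measurable_continuous_onI[OF rayint_continuous[OF cv]] by auto
 have r2: "IB (%x. <|rayint (v i) x|>^2)" for i using rayint_L2[OF cv i2] by simp
 have "IB (%x. (<|rayint (v i) x|>+<|rayint (v j) x|>)^2)" for i j by (rule square_integrable_add[OF r2 r2]) measurable
 hence "IB (%x. (K*(<|rayint (v i) x|>+<|rayint (v j) x|>))^2)" for i j by (simp add: power_mult_distrib)
 hence "IB (%x. (D i x)^2)" for i unfolding D_def sum_3 using m i2 by (intro square_integrable_add) auto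
 moreover have "BM (D i)" for i unfolding D_def by measurable
 moreover have "(%n. solenoidal_test v n i x) ----> v i x" for i x
 proof -
  have "(%n. solenoidal_test v n i x) ----> 1 * v i x+(SU j. 0*(rayint (v i) x*x $ j-rayint (v j) x*x $ i))"
   unfolding solenoidal_test_def by (intro tendsto_intros chi_tendsto pd_chi_tendsto)
  thus ?thesis by simp
 qed
 ultimately show thesis using K that[of D] by (simp add: D_def)
qed

end

lemma L2leI: "Hs n f ==> L2sq f <= K ==> L2_le f K" by (simp add: L2_le_def Hs_meas Hs_L2)

lemma L2_le_sum:
 assumes "!!a. a:A ==> L2_le (f a) K" and fin: "finite A"
 shows "L2_le (%x. SUM a:A. f a x) (real (card A)*(real (card A)*K))"
proof -
 have m [measurable]: "!!a. a:A ==> f a:borel_measurable borel" and i: "!!a. a:A ==> IB (%x. (f a x)^2)"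
  and bound: "!!a. a:A ==> L2sq (f a) <= K" using assms by (auto simp: L2_le_def)
 have I: "IB (%x. real (card A)*(SUM a:A. (f a x)^2))" using i by auto
 have i2: "IB (%x. (SUM a:A. f a x)^2)"
  by (rule integrable_bound[OF I]) (auto intro!: order_trans[OF sum_square_le] mult_left_mono)
 have "L2sq (%x. SUM a:A. f a x) <= (LI x. real (card A)*(SUM a:A. (f a x)^2))"
  unfolding L2sq_def by (rule integral_mono[OF i2 I sum_square_le])
 also have "... = real (card A)*(SUM a:A. L2sq (f a))" using i by (simp add: L2sq_def)
 also have "... <= real (card A)*(real (card A)*K)" using sum_mono[OF bound, of A "%a. a"] by (intro mult_left_mono) auto
 finally show ?thesis using i2 by (simp add: L2_le_def)
qed

lemma L2_le_cmult: "L2_le f K ==> L2_le (%x. c*f x) (c^2*K)"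
 by (auto simp: L2_le_def power_mult_distrib L2sq_def mult_left_mono)

lemma L2_le_add:
 assumes f: "L2_le f K" and g: "L2_le g K" shows "L2_le (%x. f x+g x) (4*K)"
 using L2_le_sum[of UNIV "%c. if c then f else g" K] f g by (auto simp: UNIV_bool add.commute split: if_splits)

lemma L2_le_diff: "L2_le f K ==> L2_le g K ==> L2_le (%x. f x-g x) (4*K)"
 using L2_le_add[of f K "%x. -1*g x"] L2_le_cmult[of g K "-1"] by simp

lemma L2_le_sum3: "(!!i. L2_le (f i) K) ==> L2_le (%x. SU i::3. f i x) (9*K)" using L2_le_sum[of UNIV f K] by simp

lemma L2_le_mono: "L2_le f K ==> K <= K' ==> L2_le f K'" by (auto simp: L2_le_def)

lemma L2_le_inner:
 assumes f: "L2_le f K" and g: "L2_le g L"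
 shows "IB (%x. f x*g x)" "<|LI x. f x*g x|> <= sqrt K * sqrt L"
proof -
 have "(LI x. f x*g x)^2 <= L2sq f * L2sq g"
  unfolding L2sq_def using f g by (intro Cauchy_Schwarz_mult(2)) (auto simp: L2_le_def)
 also have "... <= K*L" using f g by (intro mult_mono) (auto simp: L2_le_def L2sq_nonneg intro: order_trans[OF L2sq_nonneg])
 finally show "<|LI x. f x*g x|> <= sqrt K * sqrt L" by (metis real_sqrt_abs real_sqrt_le_mono real_sqrt_mult)
qed (use f g in "auto simp: L2_le_def intro: Cauchy_Schwarz_mult(1)")

lemma continuous_AE_zero:
 fixes f :: "scalar"
 assumes f: "continuous_on UNIV f" and z: "AE x in lborel. f x = 0" shows "f x = 0"
proof -
 have o: "open {x. f x ~= 0}" by (intro open_Collect_neq f continuous_intros)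
 hence "{x. f x ~= 0}:null_sets lborel" using z by (subst (asm) AE_iff_null) auto
 hence "negligible {x. f x ~= 0}" by (simp add: negligible_iff_null_sets null_sets_completionI)
 thus ?thesis using open_not_negligible[OF o] by auto
qed

lemma transport_zero:
 assumes w: "!!l. Hs (Suc a) (w l)" and d: "!!x. (SU l. pd l (w l) x) = 0" and g: "Hs (Suc n) g" and h: "Hs (Suc k) h"
 shows "(SU l. T3 (w l) (pd l g) h+T3 (w l) g (pd l h)) = 0"
proof -
 have "(SU l. T3 (w l) (pd l g) h+T3 (w l) g (pd l h)) = - (SU l. T3 (pd l (w l)) g h)"
  unfolding sum_negf[symmetric] using T3_ibp[OF w g h] by (intro sum.cong refl) (smt (verit))
 also have "(SU l. T3 (pd l (w l)) g h) = (LI x. (SU l. pd l (w l) x*g x*h x))"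
  unfolding T3_def by (rule integral_sum[symmetric])
  (rule Hs_triple_integrable[OF Hs_pd[OF w] g h], simp)
 also have "... = 0" using d by (simp flip: sum_distrib_right)
 finally show ?thesis by simp
qed

lemma L2_pairing_tendsto:
 assumes G: "L2_le G K" and D: "L2_le D K" and p: "!!n. BM (\<psi> n)" "!!n x. <|\<psi> n x|> <= D x"
 and lim: "!!x. (%n. \<psi> n x) ----> v x"
 shows "(%n. LI x. G x*\<psi> n x) ----> (LI x. G x * v x)" (is ?A) "<|LI x. G x*\<psi> n x|> <= K"
proof -
 have aG: "L2_le (%x. <|G x|>) K" using G by (auto simp: L2_le_def L2sq_def)
 note GD = L2_le_inner[OF aG D]
 have [measurable]: "BM v" by (rule borel_measurable_LIMSEQ_real[OF lim p(1)])
 have [measurable]: "BM G" "BM (\<psi> n)" for n using G p(1) by (auto simp: L2_le_def)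
 have bound: "<|G x*\<psi> n x|> <= <|G x|>*D x" for x n using p(2) by (auto simp: abs_mult intro: mult_left_mono)
 have D0: "0 <= D x" for x using p(2) abs_ge_zero order_trans by blast
 show ?A
  by (rule integral_dominated_convergence[where w="%x. <|G x|>*D x"]) (use GD(1) bound in "auto intro!: tendsto_intros lim")
 have i: "IB (%x. G x*\<psi> n x)" by (rule integrable_bound[OF GD(1)]) (use bound D0 in "auto simp: abs_mult")
 have "<|LI x. G x*\<psi> n x|> <= (LI x. <|G x|>*D x)"
  using Bochner_Integration.integral_norm_bound_integral[OF i GD(1)] bound by simp
 also have "... <= K" using GD(2) aG L2sq_nonneg[of "%x. <|G x|>"] by (simp add: L2_le_def)
 finally show "<|LI x. G x*\<psi> n x|> <= K" .
qed

lemma time_pairing: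
 fixes G :: "real => scalar"
 assumes G: "continuous_on (slab T) (%(t, x). G t x)" and st: "0 < s" "s <= t" "t < T"
 and GK: "!!r. r:{s..t} ==> L2_le (G r) K"
 and p: "!!n. continuous_on (slab T) (%(t, x). \<psi> n t x)" and R: "!!n r x. norm x > R n ==> \<psi> n r x = 0"
 and DK: "!!r. r:{s..t} ==> L2_le (D r) K" and pD: "!!n r x. r:{s..t} ==> <|\<psi> n r x|> <= D r x"
 and lim: "!!r x. r:{s..t} ==> (%n. \<psi> n r x) ----> v r x"
 shows "SIB {s..t} (%r. LI x. G r x * v r x)"
 "(%n. SI {s..t} (%r. LI x. G r x*\<psi> n r x)) ----> SI {s..t} (%r. LI x. G r x * v r x)"
proof -
 have sub: "{s..t} \<subseteq> {0<..<T}" using st by auto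
 have m: "(%r. indicator {s..t} r*(LI x. G r x*\<psi> n r x)):borel_measurable lborel" for n
 proof -
  have "continuous_on {0<..<T} (%r. LI x. G r x*\<psi> n r x)"
   by (rule param_integral_continuous[of _ _ "R n"]) (use G p[of n] R in "auto intro!: continuous_on_mult simp: case_prod_unfold")
  from borel_measurable_integrable[OF borel_integrable_compact[OF compact_Icc continuous_on_subset[OF this sub]]] show ?thesis by simp
 qed
 have pm: "BM (\<psi> n r)" if "r:{s..t}" for n r by (intro borel_measurable_continuous_onI slab_continuous_slice[OF p]) (use sub that in auto)
 note P = L2_pairing_tendsto[OF GK DK pm pD lim]
 show "SIB {s..t} (%r. LI x. G r x * v r x)"
  "(%n. SI {s..t} (%r. LI x. G r x*\<psi> n r x)) ----> SI {s..t} (%r. LI x. G r x * v r x)"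
  by (rule bounded_convergence_Icc[OF m P(2) P(1)]; assumption)+
qed

lemma quadratic_increment_constant:
 fixes H :: "real => real"
 assumes st: "s <= t" and q: "!!x y. s <= x ==> x <= y ==> y <= t ==> <|H y-H x|> <= K*(y-x)^2"
 shows "H t = H s"
proof -
 have q': "<|H y-H x|> <= K*(y-x)^2" if "x:{s..t}" "y:{s..t}" for x y
  using q[of x y] q[of y x] that by (cases "x <= y") (auto simp: abs_minus_commute power2_commute)
 have "(H has_field_derivative 0) (at x within {s..t})" if x: "x:{s..t}" for x unfolding has_field_derivative_iff
 proof (rule Lim_null_comparison)
  show "\<forall>\<^sub>F y in at x within {s..t}. norm ((H y-H x)/(y-x)) <= K*<|y-x|>" unfolding eventually_at_filter
  proof (rule always_eventually, intro allI impI)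
   fix y assume "y ~= x" "y:{s..t}"
   thus "norm ((H y-H x)/(y-x)) <= K*<|y-x|>"
    using q'[OF x, of y] by (simp add: divide_le_eq power2_eq_square mult.assoc flip: abs_mult)
  qed
  have "((%y. K*<|y-x|>) \<longlongrightarrow> K*<|x-x|>) (at x within {s..t})" by (intro tendsto_intros)
  thus "((%y. K*<|y-x|>) \<longlongrightarrow> 0) (at x within {s..t})" by simp
 qed
 then obtain c where "!!x. x:{s..t} ==> H x = c" using has_field_derivative_zero_constant[of "{s..t}" H] by auto
 thus ?thesis using st by simp
qed

definition unit_index :: "3 => 3 => nat" where "unit_index l = count (mset [l])"

lemma sum_unit_index: "sum (unit_index l) UNIV = 1" unfolding unit_index_def sum_count_mset by simp

lemma dalpha_unit_index: "C_inf f ==> dalpha (unit_index l) f = pd l (f::scalar)"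
 using pds_eq_dalpha[of f "[l]"] by (simp add: unit_index_def pds_Cons)

lemma weak_divergence_zero:
 assumes f: "L2 f" "weakly_div_free f" and g: "!!l. L2 (g l)" "!!l. weak_deriv (unit_index l) f (g l)"
 shows "AE x in lborel. (SU l. g l x $ l) = 0"
proof (rule AE_test_zero)
 show "BM (%x. SU l. g l x $ l)" using L2_comp(1)[OF g(1)] by (rule borel_measurable_sum)
 show "IB (%x. indicator (box a b) x*(SU l. g l x $ l))" for a b
 proof -
  have "IB (%x. indicator (box a b) x*g l x $ l)" for l
   using L2_locally_integrable[OF g(1)[of l]] integrable_bounded_linear[OF bounded_linear_vec_nth[of l], of lborel "%x. indicator (box a b) x *\<^sub>R g l x"]
   by (simp add: locally_integrable_def)
  thus ?thesis unfolding sum_distrib_left by (rule integrable_sum)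
 qed
 fix \<phi> assume p: "test_fun \<phi>"
 note I = test_fun_integrable[OF L2_locally_integrable]
 have parts: "(LI x. pd l \<phi> x*f x $ l) = - (LI x. \<phi> x*g l x $ l)" for l
 proof -
  have "(\<integral>x. dalpha (unit_index l) \<phi> x *\<^sub>R f x \<partial>lborel) = (-1)^1 *\<^sub>R (\<integral>x. \<phi> x *\<^sub>R g l x \<partial>lborel)"
   using g(2)[of l] p unfolding weak_deriv_def sum_unit_index by blast
  from arg_cong[OF this, of "%v. v $ l"] show ?thesis
   using I(3)[OF f(1) test_fun_pd[OF p], of l l] I(3)[OF g(1) p, of l l] p by (simp add: test_fun_def dalpha_unit_index)
 qed
 have "(SU l. LI x. pd l \<phi> x*f x $ l) = (LI x. SU l. pd l \<phi> x*f x $ l)"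
  by (rule integral_sum[symmetric]) (rule I(2)[OF f(1) test_fun_pd[OF p]])
 also have "... = 0" using f(2) p by (simp add: weakly_div_free_def)
 finally have "(SU l. LI x. \<phi> x*g l x $ l) = 0" unfolding parts by (simp add: sum_negf)
 thus "(LI x. \<phi> x*(SU l. g l x $ l)) = 0"
  unfolding sum_distrib_left using integral_sum[of UNIV lborel "%l x. \<phi> x*g l x $ l"] I(2)[OF g(1) p] by simp
qed

lemma L2_le_component_wd:
 assumes "L2 (wd a f)" "sum a UNIV <= m" shows "L2_le (%x. wd a f x $ l) ((Hm_norm m f)^2)"
proof -
 have i: "IB (%x. (norm (wd a f x))^2)" using assms by (simp add: L2_def)
 have "L2sq (%x. wd a f x $ l) <= (LI x. (norm (wd a f x))^2)"
  unfolding L2sq_def by (rule integral_mono[OF L2_comp(2)[OF assms(1)] i]) (metis abs_le_square_iff abs_norm_cancel component_le_norm_cart)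
 also have "... <= (Hm_norm m f)^2"
  unfolding Hm_norm_square by (rule member_le_sum) (use assms(2) in "auto simp: finite_multi_indices")
 finally show ?thesis using L2_comp[OF assms(1)] by (simp add: L2_le_def)
qed

lemma L2sq_cong_AE: "BM f ==> BM g ==> (AE x in lborel. f x = g x) ==> L2sq f = L2sq g"
 unfolding L2sq_def by (rule integral_cong_AE) auto

lemma antisymmetric_double_divergence:
 fixes A :: "3 => 3 => scalar"
 assumes A: "!!i l. C_inf (A i l)" and anti: "!!i l x. A i l x = - A l i x"
 shows "(SU i. SU l. pd i (pd l (A i l)) x) = 0"
proof -
 have swap: "pd i (pd l (A i l)) x = - pd l (pd i (A l i)) x" for i l
 proof -
  have "A i l = (%x. - A l i x)" using anti by blast
  hence "pd l (A i l) = (%x. - pd l (A l i) x)" using pd_uminus[OF C_inf_C1[OF A], of l l i] by simp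
  hence "pd i (pd l (A i l)) x = - pd i (pd l (A l i)) x" using pd_uminus[OF C_inf_C1[OF C_inf_pd[OF A]], of i l] by simp
  thus ?thesis unfolding pd_commute[OF A, of i l] .
 qed
 have "(SU i. SU l. pd i (pd l (A i l)) x) = - (SU i. SU l. pd l (pd i (A l i)) x)"
  unfolding sum_negf[symmetric] by (intro sum.cong refl swap)
 also have "(SU i. SU l. pd l (pd i (A l i)) x) = (SU i. SU l. pd i (pd l (A i l)) x)" by (rule sum.swap)
 finally show ?thesis by simp
qed

context hall_solution
begin

lemma W_pds_C1: "t:{0<..<T} ==> C1 (pds is (W c i t))" by (rule C_inf_C1s[OF W_C_inf])

lemma W_C1: "t:{0<..<T} ==> C1 (W c i t)" "t:{0<..<T} ==> C1 (pd l (W c i t))" "t:{0<..<T} ==> C1 (pd k (pd l (W c i t)))"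
 using W_pds_C1[of t "[]" c i] W_pds_C1[of t "[l]" c i] W_pds_C1[of t "[k, l]" c i] by (simp_all add: pds_Cons)

lemma pd_adv:
 assumes t: "t:{0<..<T}"
 shows "pd k (adv s c i t) x = (SU l. pd k (W s l t) x*pd l (W c i t) x+W s l t x*pd l (pd k (W c i t)) x)"
 unfolding adv_def[abs_def] using pd_commute[OF W_C_inf[OF t], of k] by (simp add: pd_sum C1_mult W_C1[OF t] pd_mult)

lemma F_bounded:
 assumes "0 < s" "s <= t" "t < T" "k <= m" obtains K where "K >= 1" "!!r. r:{s..t} ==> F k r <= K"
proof -
 have "compact (F k ` {s..t})" by (rule compact_continuous_image[OF continuous_on_subset[OF F_continuous]]) (use assms in auto)
 then obtain K where "!!y. y:F k ` {s..t} ==> <|y|> <= K" using compact_imp_bounded bounded_real by metis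
 thus thesis using that[of "max K 1"] by force
qed

lemma W_L2_le: "t:{0<..<T} ==> length is <= k ==> k <= m ==> L2_le (pds is (W c i t)) (F k t)"
 by (rule L2leI[OF W_pds_Hs[of t 0]]) (auto intro: L2sq_le_F)

lemma product_L2_le:
 assumes t: "t:{0<..<T}" and k: "k <= m"
 and l: "(length a+2 <= k & length c <= k) | (length a <= k & length c+2 <= k) | (length a+1 <= k & length c+1 <= k)"
 shows "L2_le (%x. pds a (W p i t) x*pds c (W q j t) x) (9217*(F k t)^2)"
proof -
 have "BM (pds a (W p i t))" "BM (pds c (W q j t))" using C1_meas(1)[OF W_pds_C1[OF t]] by auto
 thus ?thesis using product_L2_bound[OF t k l] by (simp add: L2_le_def L2sq_def)
qed

definition divb :: "real => scalar" where "divb t x = (SU l. pd l (B l t) x)"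

lemma L2sq_divb_le:
 assumes s: "s:{0<..<T}"
 shows "L2sq (divb s) <= 9*(Hm_norm m (%x. b s x-b 0 x))^2"
proof -
 have s': "s:{0..<T}" "0:{0..<T}" using s by auto
 have em: "sum (unit_index l) UNIV <= m" for l using m3 by (simp add: sum_unit_index)
 have wk: "L2 (wd (unit_index l) (b r))" "weak_deriv (unit_index l) (b r) (wd (unit_index l) (b r))" if "r:{0..<T}" for l r
  using wd_L2_weak[of "unit_index l" "b r"] in_Hm_ub(2)[OF that] em[of l] by (auto simp: in_Hm_def)
 define d where "d l = wd (unit_index l) (%x. b s x-b 0 x)" for l
 note wd = wd_diff[OF in_Hm_ub(2)[OF s'(1)] in_Hm_ub(2)[OF s'(2)] em, folded d_def]
 have "L2 (b 0)" using in_Hm_ub(2)[OF s'(2)] by (simp add: in_Hm_def)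
 note zero = weak_divergence_zero[OF this div0 wk[OF s'(2)]]
 have bs: "AE x in lborel. wd (unit_index l) (b s) x $ l = pd l (B l s) x" for l
  using weak_deriv_smooth[OF smooth3_ub(2)[OF s] wk[OF s'(1)], of l l] dalpha_unit_index[OF W_C_inf[OF s, of False l], of l] by (simp add: W_eq)
 have ae: "AE x in lborel. divb s x = (SU l. d l x $ l)"
  using zero bs[of 1] bs[of 2] bs[of 3] wd(2)[of 1] wd(2)[of 2] wd(2)[of 3] by eventually_elim (simp add: divb_def sum_3)
 have L: "L2_le (%x. SU l. d l x $ l) (9*(Hm_norm m (%x. b s x-b 0 x))^2)"
  using L2_le_sum3[OF L2_le_component_wd[OF wd(1)[unfolded d_def] em]] unfolding d_def .
 have "BM (divb s)" unfolding divb_def[abs_def] using C1_meas(1)[OF W_C1(2)[OF s]] by (rule borel_measurable_sum)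
 with L ae show ?thesis using L2sq_cong_AE[of "divb s" "%x. SU l. d l x $ l"] by (simp add: L2_le_def)
qed

lemma div_adv_difference:
 assumes t: "t:{0<..<T}"
 shows "(SU i. pd i (adv False True i t) x)-(SU i. pd i (adv True False i t) x) = - (SU l. U l t x*pd l (divb t) x)"
proof -
 note C = W_C1[OF t]
 have du: "(SU i. pd l (pd i (U i t)) x) = 0" for l
 proof -
  have "pd l (%x. SU i. pd i (U i t) x) x = 0" using div_u[OF t] by (simp add: pd_const)
  thus ?thesis by (simp add: pd_sum C)
 qed
 have expand: "(SU i. pd i (adv s c i t) x)
  = (SU i. SU l. pd i (W s l t) x*pd l (W c i t) x)+(SU l. W s l t x*(SU i. pd l (pd i (W c i t)) x))" for s c
  unfolding pd_adv[OF t] sum.distrib sum_distrib_left by (rule arg_cong2[of _ _ _ _ "(+)", OF refl sum.swap])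
 have swap: "(SU i. SU l. pd i (B l t) x*pd l (U i t) x) = (SU i. SU l. pd i (U l t) x*pd l (B i t) x)"
  by (subst sum.swap) (simp add: mult.commute)
 have "pd l (divb t) x = (SU i. pd l (pd i (B i t)) x)" for l unfolding divb_def[abs_def] by (simp add: pd_sum C)
 thus ?thesis unfolding expand du swap by simp
qed

lemma divb_eq:
 assumes t: "t:{0<..<T}"
 shows "(SU i. pd i (dst None (B i) t) x) = (SU l. pd l (pd l (divb t)) x)+(SU l. pd l (%x. - (U l t x*divb t x)) x)"
proof -
 note C = W_C1[OF t] and Ci = W_C_inf[OF t]
 define A where "A i l x = B i t x*J l t x-B l t x*J i t x" for i l x
 have CA: "C_inf (A i l)" for i l unfolding A_def by (intro C_inf_diff C_inf_mult Ci J_C_inf[OF t])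
 have Cd: "C1 (divb t)" unfolding divb_def[abs_def] by (intro C1_sum C)
 have d3: "C1 (pd l (pd l (pd i (B i t))))" "C1 (pd i (pd l (pd l (B i t))))" for i l
  using W_pds_C1[OF t, of "[l, l, i]" False i] W_pds_C1[OF t, of "[i, l, l]" False i] by (simp_all add: pds_Cons)
 have "pd l (divb t) = (%x. SU i. pd i (pd l (B i t)) x)" for l
  unfolding divb_def[abs_def] using pd_commute[OF Ci] by (simp add: pd_sum C)
 hence lap: "pd l (pd l (divb t)) x = (SU i. pd i (pd l (pd l (B i t))) x)" for l
  using pd_commute[OF C_inf_pd[OF Ci], of l] by (simp add: pd_sum C)
 have "dst None (B i) t = (%x. (SU l. pd l (pd l (B i t)) x)+(adv False True i t x-adv True False i t x)+(SU l. pd l (A i l) x))" for i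
  using eq_b[OF t] unfolding A_def nonlin_def by (auto simp: fun_eq_iff)
 hence "pd i (dst None (B i) t) x
  = (SU l. pd i (pd l (pd l (B i t))) x)+(pd i (adv False True i t) x-pd i (adv True False i t) x)+(SU l. pd i (pd l (A i l)) x)" for i
  using adv_C_inf[OF t] C_inf_pd[OF CA] by (simp add: pd_add pd_diff pd_sum C1_add C1_diff C1_sum C C_inf_C1)
 hence "(SU i. pd i (dst None (B i) t) x) = (SU i. SU l. pd i (pd l (pd l (B i t))) x)
  + ((SU i. pd i (adv False True i t) x)-(SU i. pd i (adv True False i t) x))+(SU i. SU l. pd i (pd l (A i l)) x)"
  by (simp add: sum.distrib sum_subtractf)
 moreover have "(SU i. SU l. pd i (pd l (A i l)) x) = 0" by (rule antisymmetric_double_divergence[OF CA]) (simp add: A_def)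
 moreover have "(SU l. pd l (%x. - (U l t x*divb t x)) x) = - (SU l. pd l (U l t) x*divb t x+U l t x*pd l (divb t) x)"
  unfolding sum_negf[symmetric] by (simp add: pd_uminus pd_mult C Cd C1_mult)
 moreover have "... = - (SU l. U l t x*pd l (divb t) x)"
  using div_u[OF t, of x] by (simp add: sum.distrib flip: sum_distrib_right)
 moreover have "(SU i. SU l. pd i (pd l (pd l (B i t))) x) = (SU l. pd l (pd l (divb t)) x)" unfolding lap by (rule sum.swap)
 ultimately show ?thesis unfolding div_adv_difference[OF t] by simp
qed

lemma divb_Hs: "s:{0<..<T} ==> Hs 2 (divb s)"
 unfolding divb_def[abs_def] using W_pds_Hs[of s 2 "[_]"] m3 by (intro Hs_sum) (auto simp: pds_Cons)

lemma divb_L2_le: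
 assumes t: "t:{0<..<T}" and K: "F 3 t <= K"
 shows "L2_le (divb t) (9*K)" "L2_le (pd k (divb t)) (9*K)" "L2_le (%x. - (U k t x*divb t x)) (9*(9217*K^2))" (is ?A)
proof -
 have "L2_le (pd i (B i t)) K" for i using W_L2_le[OF t, of "[i]" 3] K m3 by (auto simp: pds_Cons intro: L2_le_mono)
 thus "L2_le (divb t) (9*K)" unfolding divb_def[abs_def] by (intro L2_le_sum3)
 have "L2_le (pd k (pd i (B i t))) K" for i using W_L2_le[OF t, of "[k, i]" 3] K m3 by (auto simp: pds_Cons intro: L2_le_mono)
 thus "L2_le (pd k (divb t)) (9*K)" unfolding divb_def[abs_def] by (simp add: pd_sum W_C1[OF t] L2_le_sum3)
 have "9217*(F 3 t)^2 <= 9217*K^2" using K F_nonneg by (simp add: power_mono)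
 hence "L2_le (%x. U k t x*pd i (B i t) x) (9217*K^2)" for i
  using product_L2_le[OF t m3, of "[]" "[i]" True k False i] by (auto simp: pds_Cons intro: L2_le_mono)
 hence "L2_le (%x. SU i. U k t x*pd i (B i t) x) (9*(9217*K^2))" by (intro L2_le_sum3)
 from L2_le_cmult[OF this, of "-1"] show ?A unfolding divb_def by (simp add: sum_distrib_left sum_negf)
qed

lemma divb_flux_evolution:
 assumes st: "0 < s" "s <= t" "t < T"
 shows "flux_evolution T s t divb (%t x. SU i. pd i (dst None (B i) t) x) (%t l x. - (U l t x*divb t x))"
proof
 show "has_time_deriv T divb (%t x. SU i. pd i (dst None (B i) t) x)"
  unfolding divb_def[abs_def] using has_time_deriv_pds[OF W_slab, of "[_]"] by (intro has_time_deriv_sum) (auto simp: pds_Cons)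
 fix r assume "r:{s..t}"
 hence r: "r:{0<..<T}" using st by auto
 show "C_inf (divb r)" by (rule Hs_C_inf[OF divb_Hs[OF r]])
 thus "C1 (%x. - (U l r x*divb r x))" for l by (intro C1_uminus C1_mult W_C1 r C_inf_C1)
 show "(SU i. pd i (dst None (B i) r) x) = (SU l. pd l (pd l (divb r)) x)+(SU l. pd l (%x. - (U l r x*divb r x)) x)" for x
  by (rule divb_eq[OF r])
 show "IB (%x. (divb r x)^2)" by (rule Hs_L2[OF divb_Hs[OF r]])
qed (use st in auto)

lemma L2sq_divb_mono:
 assumes st: "0 < s" "s <= t" "t < T" shows "L2sq (divb t) <= L2sq (divb s)"
proof -
 interpret flux_evolution T s t divb "%t x. SU i. pd i (dst None (B i) t) x" "%t l x. - (U l t x*divb t x)"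
  by (rule divb_flux_evolution[OF st])
 note inT = in_times[OF st(1,3)]
 obtain K where K: "!!r. r:{s..t} ==> F 3 r <= K" using F_bounded[OF st m3] by blast
 define K' where "K' = max (9*K) (9*(9217*K^2))"
 have "L2_le (divb r) K'" "L2_le (pd l (divb r)) K'" "L2_le (%x. - (U l r x*divb r x)) K'" if "r:{s..t}" for r l
  unfolding K'_def using divb_L2_le[OF inT[OF that] K[OF that]] by (auto intro: L2_le_mono[OF _ max.cobounded1] L2_le_mono[OF _ max.cobounded2])
 note id = energy_identity(2)[OF this]
 have z: "(SU l. LI x. - (U l r x*divb r x)*pd l (divb r) x) = 0" if "r:{s..t}" for r
 proof -
  have dS: "Hs (Suc 1) (divb r)" using divb_Hs[OF inT[OF that]] by (simp add: numeral_2_eq_2)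
  have "Hs (Suc 0) (U l r)" for l by (rule Hs_mono[OF W_Hs[OF inT[OF that]]]) (use m3 in simp)
  from transport_zero[OF this div_u[OF inT[OF that]] dS dS]
  have "(SU l. T3 (U l r) (divb r) (pd l (divb r))) = 0" using T3_swap23[of _ "pd _ (divb r)" "divb r"] by (simp flip: sum_distrib_left)
  thus ?thesis by (simp add: T3_def sum_negf)
 qed
 have "SI {s..t} (%r. 2*(D1sq (divb r)+(SU l. LI x. - (U l r x*divb r x)*pd l (divb r) x)))
  = SI {s..t} (%r. 2*D1sq (divb r))"
  by (intro integral_cong refl) (use z in "auto simp: indicator_def")
 moreover have "0 <= SI {s..t} (%r. 2*D1sq (divb r))" by (auto intro!: integral_nonneg_AE simp: D1sq_nonneg)
 ultimately show ?thesis using id by simp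
qed

lemma div_b:
 assumes t: "t:{0<..<T}" shows "(SU l. pd l (B l t) x) = 0"
proof -
 define H where "H s = Hm_norm m (%x. b s x-b 0 x)" for s
 have "(H \<longlongrightarrow> 0) (at 0 within {0..<T})" using sol T0 by (auto simp: hall_mhd_local_smooth_solution_def H_def[abs_def])
 hence "((%s. 9*(H s)^2) \<longlongrightarrow> 9*0^2) (at 0 within {0..<T})" by (intro tendsto_intros)
 hence lim: "((%s. 9*(H s)^2) \<longlongrightarrow> 0) (at 0 within {0<..<T})"
  using tendsto_within_subset[of _ _ 0 "{0..<T}" "{0<..<T}"] by fastforce
 have "L2sq (divb t) <= 0"
 proof (rule tendsto_lowerbound[OF lim])
  have "\<forall>\<^sub>F s in at 0 within {0<..<T}. s:{0<..<T} & s < t"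
   unfolding eventually_at using t by (intro exI[of _ t]) (auto simp: dist_real_def)
  thus "\<forall>\<^sub>F s in at 0 within {0<..<T}. L2sq (divb t) <= 9*(H s)^2"
  proof eventually_elim
   case (elim s)
   thus ?case using L2sq_divb_mono[of s t] L2sq_divb_le[of s] t by (simp add: H_def)
  qed
 qed (use T0 in "simp add: at_within_eq_bot_iff")
 hence "L2sq (divb t) = 0" using L2sq_nonneg[of "divb t"] by simp
 hence "AE x in lborel. (divb t x)^2 = 0" unfolding L2sq_def using Hs_L2[OF divb_Hs[OF t]] by (simp add: integral_nonneg_eq_0_iff_AE)
 hence "AE x in lborel. divb t x = 0" by simp
 hence "divb t x = 0" using continuous_AE_zero[OF C1_cont[OF Hs_C1[OF divb_Hs[OF t]]]] by blast
 thus ?thesis by (simp add: divb_def)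
qed

end

lemma L2_le_sum_list:
 assumes "!!a. a:set xs ==> L2_le (f a) K"
 shows "L2_le (%x. \<Sum>a\<leftarrow>xs. f a x) (real (length xs)*(real (length xs)*K))"
 using L2_le_sum[of "{0..<length xs}" "%i. f (xs ! i)" K] assms by (simp add: sum_list_sum_nth)

lemma L2_ibp:
 assumes f: "Hs (Suc a) f" and g: "Hs (Suc c) g"
 shows "(LI x. pd l f x*g x) = - (LI x. f x*pd l g x)"
proof -
 have C: "C1 f" "C1 g" using f g Hs_C1 by auto
 note i = Hs_mult_integrable[OF Hs_pd[OF f] g] Hs_mult_integrable[OF f Hs_pd[OF g]]
 have "(LI x. pd l (%x. f x*g x) x) = 0"
  by (rule integral_pd_zero[OF C1_mult[OF C] Hs_mult_integrable[OF f g]]) (simp add: pd_mult C i)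
 thus ?thesis by (simp add: pd_mult C i)
qed

lemma LINT_Icc_bound:
 assumes i: "SIB {x..y} f" and xy: "x <= y" and c: "!!r. r:{x..y} ==> <|f r::real|> <= c"
 shows "<|LI r. indicator {x..y} r*f r|> <= c*(y-x)"
proof -
 have ic: "SIB {x..y} (%r. c)"
  by (intro integrable_mult_left integrable_real_indicator) (use xy in "auto simp: emeasure_lborel_Icc_eq")
 have "<|LI r. indicator {x..y} r*f r|> <= (LI r. <|indicator {x..y} r*f r|>)" by (rule integral_abs_bound)
 also have "... <= SI {x..y} (%r. c)" by (rule integral_mono[OF integrable_abs[OF i] ic]) (use c in "auto simp: indicator_def")
 also have "... = c*(y-x)" using xy by simp
 finally show ?thesis .
qed

lemma LINT_Icc_split:
 fixes s x y :: real
 assumes i: "SIB {s..y} (%r. f r::real)" and sxy: "s <= x" "x <= y"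
 shows "SI {s..y} f = SI {s..x} f+SI {x..y} f"
 "SIB {s..x} f" "SIB {x..y} f"
proof -
 let ?q0 = "LI r. indicator {s..y} r*f r"
 have sub: "SIB A f" if "A \<subseteq> {s..y}" "A:sets borel" for A
 proof -
  have "IB (%r. indicator A r *\<^sub>R (indicator {s..y} r*f r))" using that by (intro integrable_mult_indicator i) auto
  moreover have "(%r. indicator A r *\<^sub>R (indicator {s..y} r*f r)) = (%r. indicator A r*f r)"
   using that by (auto simp: indicator_def fun_eq_iff)
  ultimately show ?thesis by simp
 qed
 show a1: "SIB {s..x} f" by (rule sub) (use sxy in auto)
 show a2: "SIB {x..y} f" by (rule sub) (use sxy in auto)
 note a = a1 a2
 have "(?q0) = (LI r. indicator {s..x} r*f r+indicator {x..y} r*f r)"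
 proof (rule integral_cong_AE)
  show "AE r in lborel. indicator {s..y} r*f r = indicator {s..x} r*f r+indicator {x..y} r*f r"
   using AE_lborel_singleton[of x] by eventually_elim (use sxy in "auto simp: indicator_def")
 qed (use a i in "auto dest!: borel_measurable_integrable intro!: borel_measurable_add")
 thus "(?q0) = SI {s..x} f+SI {x..y} f" using a by simp
qed

context hall_solution
begin

lemma pds_product_L2_le:
 assumes t: "t:{0<..<T}" and k: "length w+1 <= k" "2 <= k" "k <= m"
 defines "N == real (length (splits w))"
 shows "L2_le (pds w (%x. W c i t x*pd l (W d j t) x)) (N*(N*(9217*(F k t)^2)))"
proof -
 have e: "pds w (%x. W c i t x*pd l (W d j t) x) = (%x. \<Sum>p\<leftarrow>splits w. pds (fst p) (W c i t) x*pds (snd p @ [l]) (W d j t) x)"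
  using pds_mult[OF W_C_inf[OF t] C_inf_pd[OF W_C_inf[OF t]], of w c i l d j] by (simp add: pds_append pds_Cons)
 show ?thesis unfolding e N_def
 proof (intro L2_le_sum_list product_L2_le[OF t k(3)])
  fix p assume "p:set (splits w)"
  hence "length (fst p)+length (snd p) = length w" using splits_length[of "fst p" "snd p"] by simp
  thus "length (fst p)+2 <= k & length (snd p @ [l]) <= k | length (fst p) <= k & length (snd p @ [l])+2 <= k | length (fst p)+1
   <= k & length (snd p @ [l])+1 <= k"
   using k by (cases "snd p") auto
 qed
qed

lemma pds_adv_L2_le:
 assumes t: "t:{0<..<T}" and k: "length w+1 <= k" "2 <= k" "k <= m"
 defines "N == real (length (splits w))"
 shows "L2_le (pds w (adv s c i t)) (9*(N*(N*(9217*(F k t)^2))))"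
proof -
 have "pds w (adv s c i t) = (%x. SU l. pds w (%x. W s l t x*pd l (W c i t) x) x)"
  unfolding adv_def[abs_def] by (rule pds_sum) (intro C_inf_mult C_inf_pd W_C_inf t)
 thus ?thesis unfolding N_def using L2_le_sum3[OF pds_product_L2_le[OF t k]] by simp
qed

lemma pds_nonlin_L2_le:
 assumes t: "t:{0<..<T}" and k: "length w+1 <= k" "2 <= k" "k <= m"
 defines "N == real (length (splits w))"
 shows "L2_le (pds w (nonlin c i t)) (4*(9*(N*(N*(9217*(F k t)^2)))))"
proof -
 have "pds w (nonlin c i t) = (%x. pds w (adv False (~c) i t) x-pds w (adv True c i t) x)"
  unfolding nonlin_def[abs_def] by (rule pds_diff[OF adv_C_inf adv_C_inf]) (use t in auto)
 thus ?thesis unfolding N_def using L2_le_diff[OF pds_adv_L2_le[OF t k] pds_adv_L2_le[OF t k]] by simp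
qed

lemma E_Suc: "E (Suc k) t = (SU c. SU i. SUM is:words k. D1sq (pds is (W c i t)))"
 unfolding E_def sum_words_Suc D1sq_def pds_Cons by (intro sum.cong refl sum.swap)

definition rhs_u :: "3 => real => scalar" where
 "rhs_u i t x = (SU l. pd l (pd l (U i t)) x)+nonlin True i t x"

lemma rhs_u_eq: "t:{0<..<T} ==> rhs_u i t x = dst None (U i) t x+pd i (\<pi> t) x" using eq_u[of t i x] by (simp add: rhs_u_def)

lemma rhs_u_continuous: "continuous_on (slab T) (%(t, x). rhs_u i t x)"
proof -
 have "continuous_on (slab T) (%(t, x). dst None (U i) t x)" "continuous_on (slab T) (%(t, x). pd i (\<pi> t) x)"
  using has_time_deriv_pds[OF W_slab, of "[]" True i] has_time_deriv_pds[OF pi_slab, of "[i]"] by (auto simp: has_time_deriv_def pds_Cons)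
 hence "continuous_on (slab T) (%p. dst None (U i) (fst p) (snd p)+pd i (\<pi> (fst p)) (snd p))"
  by (auto intro!: continuous_on_add simp: case_prod_unfold)
 thus ?thesis by (rule continuous_on_eq) (auto simp: rhs_u_eq)
qed

lemma rhs_u_L2_le:
 assumes t: "t:{0<..<T}" and K: "F 3 t <= K" "1 <= K"
 shows "L2_le (rhs_u i t) (1400000*K^2)"
proof -
 have K2: "(F 3 t)^2 <= K^2" "K <= K^2" using K F_nonneg[of 3 t] self_le_power[of K 2] by (auto intro!: power_mono)
 have "L2_le (pd l (pd l (U i t))) (F 3 t)" for l using W_L2_le[OF t, of "[l, l]" 3] m3 by (simp add: pds_Cons)
 hence laplacian: "L2_le (%x. SU l. pd l (pd l (U i t)) x) (350000*K^2)"
  by (rule L2_le_mono[OF L2_le_sum3]) (use K K2 in linarith)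
 have nonlinear: "L2_le (nonlin True i t) (350000*K^2)"
  using L2_le_mono[OF pds_nonlin_L2_le[OF t, of "[]" 3 True i], of "350000*K^2"] m3 K2(1) zero_le_power2[of K] by simp
 show ?thesis unfolding rhs_u_def[abs_def] using L2_le_add[OF laplacian nonlinear] by simp
qed

lemma rhs_u_pairing_DERIV:
 assumes cont: "!!i. continuous_on UNIV (\<psi> i)" and z: "!!i x. norm x > R ==> \<psi> i x = 0"
 and orth: "!!p. C_inf p ==> (SU i. LI x. pd i p x*\<psi> i x) = 0" and t: "t:{0<..<T}"
 shows "((%t. SU i. LI x. U i t x*\<psi> i x) has_real_derivative (SU i. LI x. rhs_u i t x*\<psi> i x)) (at t)"
proof -
 have ps: "continuous_on (slab T) (%(t, x). \<psi> i x)" for i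
  unfolding case_prod_unfold by (rule continuous_on_compose2[OF cont]) (auto intro: continuous_intros)
 have int: "IB (%x. f x*\<psi> i x)" if "continuous_on UNIV f" for f i
  by (rule integrable_compact_support[of _ R]) (use that cont z in "auto intro!: continuous_intros")
 have "has_time_deriv T (%t x. U i t x*\<psi> i x) (%t x. dst None (U i) t x*\<psi> i x)" for i
  using has_time_deriv_pds[OF W_slab, of "[]" True i] ps[of i]
  by (auto simp: has_time_deriv_def case_prod_unfold intro!: continuous_on_mult derivative_eq_intros)
 hence "((%t. SU i. LI x. U i t x*\<psi> i x) has_real_derivative (SU i. LI x. dst None (U i) t x*\<psi> i x)) (at t)"
  using t z by (intro DERIV_sum param_integral_DERIV[of _ _ _ R]) auto
 moreover have "(LI x. dst None (U i) t x*\<psi> i x) = (LI x. rhs_u i t x*\<psi> i x)-(LI x. pd i (\<pi> t) x*\<psi> i x)" for i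
 proof -
  have "dst None (U i) t x*\<psi> i x = rhs_u i t x*\<psi> i x-pd i (\<pi> t) x*\<psi> i x" for x
   using rhs_u_eq[OF t, of i x] by (simp add: algebra_simps)
  thus ?thesis using int[OF slab_continuous_slice[OF rhs_u_continuous t]] int[OF C1_cont_pd[OF C_inf_C1[OF pi_C_inf[OF t]]]] by simp
 qed
 ultimately show ?thesis using orth[OF pi_C_inf[OF t]] by (simp add: sum_subtractf)
qed

lemma rhs_u_pairing_increment:
 assumes st: "0 < s" "s <= t" "t < T" and c: "!!i. continuous_on UNIV (\<psi> i)" and z: "!!i x. norm x > R ==> \<psi> i x = 0"
 and orth: "!!p. C_inf p ==> (SU i. LI x. pd i p x*\<psi> i x) = 0"
 shows "(SU i. LI x. (U i t x-U i s x)*\<psi> i x) = (SU i. LI \<tau>. indicator {s..t} \<tau>*(LI x. rhs_u i \<tau> x*\<psi> i x))"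
proof -
 define g where "g i \<tau> = (LI x. rhs_u i \<tau> x*\<psi> i x)" for i \<tau>
 have sub: "{s..t} \<subseteq> {0<..<T}" using st by auto
 have "continuous_on (slab T) (%p. \<psi> i (snd p))" for i by (rule continuous_on_compose2[OF c]) (auto intro: continuous_intros)
 hence gc: "continuous_on {0<..<T} (g i)" for i unfolding g_def
  by (intro param_integral_continuous[of _ _ R]) (use rhs_u_continuous[of i] z in "auto intro!: continuous_on_mult simp: case_prod_unfold")
 have ig: "SIB {s..t} (g i)" for i using borel_integrable_compact[OF compact_Icc continuous_on_subset[OF gc sub]] by simp
 have "(LI \<tau>. (SU i. g i \<tau>)*indicator {s..t} \<tau>) = (SU i. LI x. U i t x*\<psi> i x)-(SU i. LI x. U i s x*\<psi> i x)"
 proof (rule integral_FTC_Icc_real[OF st(2)])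
  fix \<tau> assume "s <= \<tau>" "\<tau> <= t"
  hence \<tau>: "\<tau>:{0<..<T}" using st by auto
  show "((%t. SU i. LI x. U i t x*\<psi> i x) has_real_derivative (SU i. g i \<tau>)) (at \<tau>)"
   unfolding g_def by (rule rhs_u_pairing_DERIV[OF c z orth \<tau>])
  have "continuous_on {0<..<T} (%\<tau>. SU i. g i \<tau>)" by (intro continuous_on_sum gc)
  thus "isCont (%\<tau>. SU i. g i \<tau>) \<tau>" using \<tau> by (simp add: continuous_on_eq_continuous_at)
 qed
 moreover have "(LI \<tau>. (SU i. g i \<tau>)*indicator {s..t} \<tau>) = (SU i. LI \<tau>. indicator {s..t} \<tau>*g i \<tau>)"
  using integral_sum[OF ig, where I=UNIV] by (simp only: sum_distrib_left mult.commute)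
 moreover have "IB (%x. U i r x*\<psi> i x)" if "r:{s..t}" for i r
  by (rule integrable_compact_support[of _ R]) (use that sub c z C1_cont[OF W_C1(1)] in "auto intro!: continuous_intros")
 ultimately show ?thesis using st unfolding g_def by (simp add: left_diff_distrib sum_subtractf)
qed

lemma solenoidal_pairing:
 assumes st: "0 < s" "s <= t" "t < T" and v: "!!i. Hs n (v i)" and dv: "!!x. (SU l. pd l (v l) x) = 0"
 shows "SIB {s..t} (%r. SU i. LI x. rhs_u i r x * v i x)" (is ?A)
 "(SU i. LI x. (U i t x-U i s x) * v i x) = SI {s..t} (%r. SU i. LI x. rhs_u i r x * v i x)" (is ?B)
proof -
 note inT = in_times[OF st(1,3)]
 obtain K where K: "K >= 1" "!!r. r:{s..t} ==> F 3 r <= K" using F_bounded[OF st m3] by blast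
 have Cv: "C_inf (v i)" for i by (rule Hs_C_inf[OF v])
 obtain D where D: "!!i. D i:borel_measurable borel" "!!i. IB (%x. (D i x)^2)"
  "!!n i x. <|solenoidal_test v n i x|> <= D i x" "!!i x. (%n. solenoidal_test v n i x) ----> v i x"
  using solenoidal_test_limit[of v, OF Cv Hs_L2[OF v]] by metis
 note pc = solenoidal_test_continuous[of v, OF Cv]
 have ps: "continuous_on (slab T) (%(t, x). solenoidal_test v n i x)" for n i
  unfolding case_prod_unfold by (rule continuous_on_compose2[OF pc]) (auto intro: continuous_intros)
 define N where "N = max (max (1400000*K^2) (Max (range (%i. L2sq (D i))))) (Max (range (%i. L2sq (%x. U i t x-U i s x))))"
 have DN: "L2_le (D i) N" for i using D by (auto simp: L2_le_def N_def le_max_iff_disj)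
 have GN: "L2_le (rhs_u i r) N" if "r:{s..t}" for i r
  by (rule L2_le_mono[OF rhs_u_L2_le[OF inT[OF that] K(2)[OF that] K(1)]]) (simp add: N_def)
 have UN: "L2_le (%x. U i t x-U i s x) N" for i
  by (rule L2leI[OF Hs_diff[OF W_Hs W_Hs]]) (use st in "auto simp: N_def le_max_iff_disj")
 note time = time_pairing[where \<psi>="%n r. solenoidal_test v n i" and G="rhs_u i" and D="%_. D i" and v="%_. v i" for i,
  OF rhs_u_continuous st GN ps solenoidal_test_support DN D(3,4)]
 show ?A unfolding sum_distrib_left by (intro integrable_sum time(1))
 have increment: "(SU i. LI x. (U i t x-U i s x) * solenoidal_test v n i x)
  = (SU i. LI r. indicator {s..t} r*(LI x. rhs_u i r x * solenoidal_test v n i x))" for n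
  by (rule rhs_u_pairing_increment[OF st pc solenoidal_test_support solenoidal_test_orthogonal[of v, OF Cv dv]])
 have "(%n. SU i. LI x. (U i t x-U i s x) * solenoidal_test v n i x) ----> (SU i. LI x. (U i t x-U i s x) * v i x)"
  by (intro tendsto_sum L2_pairing_tendsto(1)[OF UN DN borel_measurable_continuous_onI[OF pc] D(3,4)])
 moreover have "(%n. SU i. LI x. (U i t x-U i s x) * solenoidal_test v n i x)
  ----> (SU i. LI r. indicator {s..t} r*(LI x. rhs_u i r x * v i x))"
  unfolding increment by (intro tendsto_sum time(2))
 ultimately have "(SU i. LI x. (U i t x-U i s x) * v i x) = (SU i. LI r. indicator {s..t} r*(LI x. rhs_u i r x * v i x))"
  by (rule LIMSEQ_unique)
 also have "... = (LI r. SU i. indicator {s..t} r*(LI x. rhs_u i r x * v i x))" by (rule integral_sum[OF time(1), symmetric])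
 finally show ?B unfolding sum_distrib_left .
qed

lemma velocity_combination:
 assumes x: "x:{0<..<T}" and y: "y:{0<..<T}"
 shows "Hs m (%z. U i y z+U i x z)" "Hs m (%z. U i y z-U i x z)"
 "(SU l. pd l (%z. U l y z+U l x z) z) = 0" "(SU l. pd l (%z. U l y z-U l x z) z) = 0"
 using Hs_add[OF W_Hs[OF y] W_Hs[OF x]] Hs_diff[OF W_Hs[OF y] W_Hs[OF x]] div_u[OF x] div_u[OF y] W_C1(1)[OF x] W_C1(1)[OF y]
 by (auto simp: pd_add pd_diff sum.distrib sum_subtractf)

lemma velocity_bounds:
 assumes st: "0 < s" "s <= t" "t < T"
 obtains K where "0 <= K" "!!i r. r:{s..t} ==> L2_le (rhs_u i r) K" "!!i r. r:{s..t} ==> L2_le (U i r) K"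
proof -
 note inT = in_times[OF st(1,3)]
 obtain K where K: "K >= 1" "!!r. r:{s..t} ==> F 3 r <= K" using F_bounded[OF st m3] by blast
 have "K <= K^2" "0 <= K^2" using K(1) by (auto simp: power2_eq_square)
 hence KK: "K <= 1400000*K^2" "0 <= 1400000*K^2" by linarith+
 show thesis
 proof (rule that[OF KK(2)])
  fix i r assume r: "r:{s..t}"
  show "L2_le (rhs_u i r) (1400000*K^2)" by (rule rhs_u_L2_le[OF inT[OF r] K(2)[OF r] K(1)])
  show "L2_le (U i r) (1400000*K^2)" using W_L2_le[OF inT[OF r], of "[]" 3 True i] K(2)[OF r] KK m3 by (auto intro: L2_le_mono)
 qed
qed

definition rhs_u_work :: "(3 => scalar) => real => real" where "rhs_u_work w r = (SU i. LI x. rhs_u i r x*w i x)"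

context
 fixes s t K :: real
 assumes st: "0 < s" "s <= t" "t < T" and K0: "0 <= K"
 and GK: "!!i r. r:{s..t} ==> L2_le (rhs_u i r) K" and UK: "!!i r. r:{s..t} ==> L2_le (U i r) K"
begin

lemma rhs_u_work_bound:
 assumes "r:{s..t}" "!!i. L2_le (w i) q" shows "<|rhs_u_work w r|> <= 3*(sqrt K * sqrt q)"
proof -
 have "<|rhs_u_work w r|> <= (SU i::3. sqrt K * sqrt q)" unfolding rhs_u_work_def
  by (rule order_trans[OF sum_abs sum_mono]) (rule L2_le_inner(2)[OF GK[OF assms(1)] assms(2)])
 thus ?thesis by simp
qed

lemma rhs_u_velocity_work_integrable: "SIB {s..t} (%r. rhs_u_work (%i. U i r) r)"
proof -
 have "SIB {s..t} (%r. LI x. rhs_u i r x*U i r x)" for i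
 proof (rule time_pairing(1)[OF rhs_u_continuous st GK, of "%n r x. chi n x*U i r x" "%n. 3*real (Suc n)" "%r x. <|U i r x|>"])
  have uc: "continuous_on (slab T) (%(t, x). U i t x)" using has_time_deriv_pds[OF W_slab, of "[]" True i] by (simp add: has_time_deriv_def)
  have cc: "continuous_on (slab T) (%p::real\<times>R3. chi n (snd p))" for n
   by (rule continuous_on_compose2[OF C1_cont[OF C1_chi]]) (auto intro: continuous_intros)
  show "continuous_on (slab T) (%(t, x). chi n x*U i t x)" for n
   using continuous_on_mult[OF cc uc[unfolded case_prod_unfold]] by (simp add: case_prod_unfold)
  show "chi n x*U i r x = 0" if "norm x > 3*real (Suc n)" for n r x using chi_support[OF that] by simp
  show "L2_le (%x. <|U i r x|>) K" if "r:{s..t}" for r using UK[OF that, of i] by (auto simp: L2_le_def L2sq_def)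
  show "<|chi n x*U i r x|> <= <|U i r x|>" for n r x using chi_bounds[of n x] by (simp add: abs_mult mult_left_le_one_le)
  show "(%n. chi n x*U i r x) ----> U i r x" for r x using tendsto_mult[OF chi_tendsto tendsto_const, of x "U i r x"] by simp
 qed
 thus ?thesis unfolding rhs_u_work_def sum_distrib_left by (intro integrable_sum)
qed

lemma velocity_Lipschitz:
 assumes xy: "s <= x" "x <= y" "y <= t"
 shows "L2_le (%z. U i y z-U i x z) ((3 * sqrt K*(y-x))^2)"
proof -
 have in': "x:{0<..<T}" "y:{0<..<T}" "0 < x" "y < T" using xy st by auto
 define q where "q = (SU i. L2sq (%z. U i y z-U i x z))"
 have q0: "0 <= q" unfolding q_def by (intro sum_nonneg L2sq_nonneg)
 have bound: "L2sq (%z. U i y z-U i x z) <= q" for i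
  unfolding q_def by (rule member_le_sum[where f="%i. L2sq (%z. U i y z-U i x z)"]) (auto simp: L2sq_nonneg)
 have Lq: "L2_le (%z. U i y z-U i x z) q" for i by (rule L2leI[OF velocity_combination(2)[OF in'(1,2)] bound])
 note pair = solenoidal_pairing[OF in'(3) xy(2) in'(4) velocity_combination(2,4)[OF in'(1,2)], folded rhs_u_work_def]
 have "q = SI {x..y} (rhs_u_work (%i z. U i y z-U i x z))"
  unfolding pair(2)[symmetric] q_def L2sq_def by (simp add: power2_eq_square)
 also have "... <= 3*(sqrt K * sqrt q)*(y-x)"
  using LINT_Icc_bound[OF pair(1) xy(2), of "3*(sqrt K * sqrt q)"] rhs_u_work_bound[OF _ Lq] xy by force
 finally have "sqrt q * sqrt q <= (3 * sqrt K*(y-x)) * sqrt q" using q0 by (simp add: mult_ac)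
 hence "sqrt q <= 3 * sqrt K*(y-x)" using q0 xy K0 by (cases "q = 0", simp, intro mult_right_le_imp_le[of "sqrt q" "sqrt q"]) auto
 hence "(sqrt q)^2 <= (3 * sqrt K*(y-x))^2" using q0 by (intro power_mono) auto
 thus ?thesis using L2_le_mono[OF Lq] q0 by simp
qed

lemma rhs_u_work_symmetric_increment:
 assumes xy: "s <= x" "x <= y" "y <= t" and \<tau>: "\<tau>:{x..y}"
 shows "<|rhs_u_work (%i z. U i y z+U i x z) \<tau>-2*rhs_u_work (%i. U i \<tau>) \<tau>|> <= 18*K*(y-x)"
proof -
 have in': "x:{s..t}" "y:{s..t}" "\<tau>:{s..t}" using xy \<tau> by auto
 have i: "IB (%z. rhs_u i \<tau> z*U i r z)" if "r:{s..t}" for i r by (rule L2_le_inner(1)[OF GK[OF in'(3)] UK[OF that]])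
 have L: "L2_le (%z. U i y z-U i \<tau> z) ((3 * sqrt K*(y-x))^2)" "L2_le (%z. U i \<tau> z-U i x z) ((3 * sqrt K*(y-x))^2)" for i
  by (rule L2_le_mono[OF velocity_Lipschitz]; use \<tau> xy K0 in "auto intro!: power_mono mult_left_mono")+
 have "rhs_u_work (%i z. U i y z+U i x z) \<tau>-2*rhs_u_work (%i. U i \<tau>) \<tau>
  = rhs_u_work (%i z. U i y z-U i \<tau> z) \<tau>-rhs_u_work (%i z. U i \<tau> z-U i x z) \<tau>"
  unfolding rhs_u_work_def using i[OF in'(1)] i[OF in'(2)] i[OF in'(3)] by (simp add: algebra_simps sum.distrib sum_subtractf)
 hence "<|rhs_u_work (%i z. U i y z+U i x z) \<tau>-2*rhs_u_work (%i. U i \<tau>) \<tau>|> <= 2*(3*(sqrt K * sqrt ((3 * sqrt K*(y-x))^2)))"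
  using rhs_u_work_bound[where w="%i z. U i y z-U i \<tau> z", OF in'(3) L(1)] rhs_u_work_bound[where w="%i z. U i \<tau> z-U i x z", OF in'(3) L(2)] by linarith
 also have "... = 18*(sqrt K * sqrt K)*(y-x)" using xy K0 by (simp add: abs_mult)
 finally show ?thesis using K0 by simp
qed

lemma velocity_energy_increment:
 assumes xy: "s <= x" "x <= y" "y <= t"
 shows "<|(SU i. L2sq (U i y))-(SU i. L2sq (U i x))-2*SI {x..y} (%\<tau>. rhs_u_work (%i. U i \<tau>) \<tau>)|> <= 18*K*(y-x)^2"
proof -
 have in': "x:{0<..<T}" "y:{0<..<T}" "0 < x" "y < T" using xy st by auto
 have "SIB {s..y} (%\<tau>. rhs_u_work (%i. U i \<tau>) \<tau>)"
  by (rule LINT_Icc_split(2)[OF rhs_u_velocity_work_integrable]) (use xy in auto)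
 note iu = integrable_mult_right[OF LINT_Icc_split(3)[OF this xy(1,2)], of 2]
 note pair = solenoidal_pairing[OF in'(3) xy(2) in'(4) velocity_combination(1,3)[OF in'(1,2)], folded rhs_u_work_def]
 have Hi: "IB (%z. (U i r z)^2)" if "r:{0<..<T}" for i r by (rule Hs_L2[OF W_Hs[OF that]])
 have "(SU i. L2sq (U i y))-(SU i. L2sq (U i x)) = (SU i. LI z. (U i y z-U i x z)*(U i y z+U i x z))"
  unfolding L2sq_def sum_subtractf[symmetric] using Hi[OF in'(1)] Hi[OF in'(2)]
  by (intro sum.cong refl) (simp add: algebra_simps flip: power2_eq_square)
 hence "(SU i. L2sq (U i y))-(SU i. L2sq (U i x))-2*SI {x..y} (%\<tau>. rhs_u_work (%i. U i \<tau>) \<tau>)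
  = (LI \<tau>. indicator {x..y} \<tau>*rhs_u_work (%i z. U i y z+U i x z) \<tau>-2*(indicator {x..y} \<tau>*rhs_u_work (%i. U i \<tau>) \<tau>))"
  unfolding integral_diff[OF pair(1) iu] using pair(2) by simp
 also have "... = SI {x..y} (%\<tau>. rhs_u_work (%i z. U i y z+U i x z) \<tau>-2*rhs_u_work (%i. U i \<tau>) \<tau>)" by (simp add: algebra_simps)
 finally show ?thesis
  using LINT_Icc_bound[OF _ xy(2) rhs_u_work_symmetric_increment[OF xy]] integrable_diff[OF pair(1) iu] by (simp add: algebra_simps power2_eq_square)
qed

lemma velocity_energy_identity:
 "(SU i. L2sq (U i t))-(SU i. L2sq (U i s)) = 2*SI {s..t} (%r. rhs_u_work (%i. U i r) r)"
proof -
 define I where "I x y = SI {x..y} (%r. rhs_u_work (%i. U i r) r)" for x y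
 define H where "H y = (SU i. L2sq (U i y))-2*I s y" for y
 have "H t = H s"
 proof (rule quadratic_increment_constant[OF st(2)])
  fix x y assume xy: "s <= x" "x <= y" "y <= t"
  have "SIB {s..y} (%r. rhs_u_work (%i. U i r) r)"
   by (rule LINT_Icc_split(2)[OF rhs_u_velocity_work_integrable]) (use xy in auto)
  from LINT_Icc_split(1)[OF this xy(1,2)] have "I s y = I s x+I x y" by (simp add: I_def)
  thus "<|H y-H x|> <= (18*K)*(y-x)^2" using velocity_energy_increment[OF xy] by (simp add: H_def I_def algebra_simps)
 qed
 moreover have "I s s = 0" unfolding I_def using LINT_Icc_split(1)[OF rhs_u_velocity_work_integrable order_refl st(2)] by simp
 ultimately show ?thesis unfolding H_def I_def by simp
qed

end

lemma energy_u_0: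
 assumes st: "0 < s" "s <= t" "t < T"
 shows "SIB {s..t} (%r. SU i. LI x. rhs_u i r x*U i r x)" (is ?A)
 "(SU i. L2sq (U i t))-(SU i. L2sq (U i s)) = 2*SI {s..t} (%r. SU i. LI x. rhs_u i r x*U i r x)" (is ?B)
proof -
 obtain K where "0 <= K" "!!i r. r:{s..t} ==> L2_le (rhs_u i r) K" "!!i r. r:{s..t} ==> L2_le (U i r) K"
  by (rule velocity_bounds[OF st]) blast
 note K = this
 show ?A unfolding rhs_u_work_def[symmetric] by (rule rhs_u_velocity_work_integrable) (use st K in auto)
 show ?B unfolding rhs_u_work_def[symmetric] by (rule velocity_energy_identity) (use st K in auto)
qed

definition hall_flux :: "3 => 3 => real => scalar" where "hall_flux i l t x = B i t x*J l t x-B l t x*J i t x"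

lemma hall_flux_C_inf: "t:{0<..<T} ==> C_inf (hall_flux i l t)"
 unfolding hall_flux_def[abs_def] by (intro C_inf_diff C_inf_mult W_C_inf J_C_inf)

definition induction_flux :: "3 => real => 3 => scalar" where
 "induction_flux i t l x = B l t x*U i t x-U l t x*B i t x+hall_flux i l t x"

lemma induction_flux_C1: "t:{0<..<T} ==> C1 (induction_flux i t l)"
 unfolding induction_flux_def[abs_def] by (intro C1_add C1_diff C1_mult W_C1 C_inf_C1[OF hall_flux_C_inf])

lemma induction_equation:
 assumes t: "t:{0<..<T}"
 shows "dst None (B i) t x = (SU l. pd l (pd l (B i t)) x)+(SU l. pd l (induction_flux i t l) x)"
proof -
 note C = W_C1[OF t]
 have "pd l (induction_flux i t l) x = (pd l (B l t) x*U i t x+B l t x*pd l (U i t) x-(pd l (U l t) x*B i t x+U l t x*pd l (B i t) x))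
  + pd l (hall_flux i l t) x" for l
  unfolding induction_flux_def[abs_def]
  by (subst pd_add) (auto intro!: C1_diff C1_mult C C_inf_C1[OF hall_flux_C_inf[OF t]] simp: pd_diff pd_mult C1_mult C)
 hence "(SU l. pd l (induction_flux i t l) x)
  = ((SU l. pd l (B l t) x)*U i t x+adv False True i t x-((SU l. pd l (U l t) x)*B i t x+adv True False i t x))
  + (SU l. pd l (hall_flux i l t) x)"
  by (simp add: adv_def sum.distrib sum_subtractf sum_distrib_right)
 thus ?thesis unfolding eq_b[OF t] hall_flux_def[abs_def] using div_u[OF t, of x] div_b[OF t, of x] by (simp add: nonlin_def)
qed

lemma low_order_product_L2_le:
 assumes t: "t:{0<..<T}" and K: "F 3 t <= K"
 shows "L2_le (%x. W c i t x*W d l t x) (9217*K^2)" "L2_le (%x. W c i t x*pd k (W d l t) x) (9217*K^2)"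
 "L2_le (hall_flux i l t) (4*(4*(9217*K^2)))" "L2_le (induction_flux i t l) (4*(4*(4*(9217*K^2))))" (is ?A)
proof -
 have "9217*(F 3 t)^2 <= 9217*K^2" using K F_nonneg by (simp add: power_mono)
 thus p: "L2_le (%x. W c i t x*W d l t x) (9217*K^2)" "L2_le (%x. W c i t x*pd k (W d l t) x) (9217*K^2)" for c d i l k
  using product_L2_le[OF t m3, of "[]" "[]" c i d l] product_L2_le[OF t m3, of "[]" "[k]" c i d l] by (auto simp: pds_Cons intro: L2_le_mono)
 show h: "L2_le (hall_flux i l t) (4*(4*(9217*K^2)))" for i l
  unfolding hall_flux_def[abs_def] J_def right_diff_distrib by (intro L2_le_diff p)
 have "L2_le (%x. B l t x*U i t x-U l t x*B i t x) (4*(4*(9217*K^2)))" by (intro L2_le_diff L2_le_mono[OF p(1)]) simp_all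
 thus ?A unfolding induction_flux_def[abs_def] by (intro L2_le_add h)
qed

lemma transport_self_zero:
 assumes t: "t:{0<..<T}" shows "(SU l. T3 (U l t) (W c i t) (pd l (W c i t))) = 0"
proof -
 have H: "Hs (Suc 0) (W c i t)" for c i using W_pds_Hs[OF t, of "Suc 0" "[]" c i] m3 by simp
 show ?thesis
  using transport_zero[where w="%l. U l t" and g="W c i t" and h="W c i t", OF H div_u[OF t] H H] T3_swap23[of _ "pd _ (W c i t)"
  "W c i t"] by (simp flip: sum_distrib_left)
qed

lemma induction_flux_work:
 assumes t: "t:{0<..<T}"
 shows "(SU i. SU l. LI x. induction_flux i t l x*pd l (B i t) x) = (SU i. SU l. T3 (B l t) (U i t) (pd l (B i t)))"
proof -
 note L = low_order_product_L2_le[OF t order_refl]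
 have D: "L2_le (pd l (B i t)) (F 3 t)" for i l using W_L2_le[OF t, of "[l]" 3 False i] m3 by (simp add: pds_Cons)
 have int: "IB (%x. (W c l t x*W d i t x)*pd l (B i t) x)" "IB (%x. hall_flux i l t x*pd l (B i t) x)" for c d i l
  by (rule L2_le_inner(1)[OF L(1) D] L2_le_inner(1)[OF L(3) D])+
 have "(SU i. SU l. hall_flux i l t x*pd l (B i t) x) = 0" for x
  unfolding sum_3 hall_flux_def J_def cyc_simps by (simp add: algebra_simps)
 hence "(LI x. (SU i. SU l. hall_flux i l t x*pd l (B i t) x)) = 0" by simp
 hence hall: "(SU i. SU l. LI x. hall_flux i l t x*pd l (B i t) x) = 0" using int(2) by (simp add: integral_sum integrable_sum)
 have "(LI x. induction_flux i t l x*pd l (B i t) x)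
  = T3 (B l t) (U i t) (pd l (B i t))-T3 (U l t) (B i t) (pd l (B i t))+(LI x. hall_flux i l t x*pd l (B i t) x)" for i l
  unfolding induction_flux_def T3_def distrib_right left_diff_distrib using int by (simp only: integral_add integral_diff integrable_diff)
 thus ?thesis using hall transport_self_zero[OF t] by (simp add: sum.distrib sum_subtractf)
qed

lemma energy_b_0:
 assumes st: "0 < s" "s <= t" "t < T"
 defines "G == %r. SU i. D1sq (B i r)+(SU l. T3 (B l r) (U i r) (pd l (B i r)))"
 shows "SIB {s..t} G"
 "(SU i. L2sq (B i t))-(SU i. L2sq (B i s)) = - 2*SI {s..t} G" (is ?A)
proof -
 note inT = in_times[OF st(1,3)]
 obtain K where K: "K >= 1" "!!r. r:{s..t} ==> F 3 r <= K" using F_bounded[OF st m3] by blast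
 define K' where "K' = 4*(4*(4*(9217*K^2)))"
 have "K <= K^2" using K(1) by (simp add: power2_eq_square)
 hence KK: "K <= K'" unfolding K'_def using zero_le_power2[of K] by linarith
 have ev: "flux_evolution T s t (B i) (%t. dst None (B i) t) (induction_flux i)" for i
  using has_time_deriv_pds[OF W_slab, of "[]" False i] st induction_equation[OF inT] Hs_L2[OF W_Hs[OF inT]] W_C_inf[OF inT] induction_flux_C1[OF inT]
  by unfold_locales auto
 have L: "L2_le (B i r) K'" "L2_le (pd l (B i r)) K'" "L2_le (induction_flux i r l) K'" if "r:{s..t}" for i r l
  using W_L2_le[OF inT[OF that], of "[]" 3 False i] W_L2_le[OF inT[OF that], of "[l]" 3 False i] K(2)[OF that] KK m3
  low_order_product_L2_le(4)[OF inT[OF that] K(2)[OF that]] by (auto simp: pds_Cons K'_def intro: L2_le_mono)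
 define R where "R i r = 2*(D1sq (B i r)+(SU l. LI x. induction_flux i r l x*pd l (B i r) x))" for i r
 have id: "SIB {s..t} (R i)" "L2sq (B i t)-L2sq (B i s) = - SI {s..t} (R i)" for i
  unfolding R_def by (rule flux_evolution.energy_identity[OF ev L]; assumption)+
 have "(SU i. R i r) = 2*G r" if "r:{s..t}" for r
  unfolding R_def G_def sum.distrib sum_distrib_left[symmetric] induction_flux_work[OF inT[OF that]] ..
 hence G: "indicator {s..t} r*G r = (SU i. 1/2*(indicator {s..t} r*R i r))" for r
  by (cases "r:{s..t}") (simp_all flip: sum_divide_distrib)
 show "SIB {s..t} G" unfolding G by (intro integrable_sum integrable_mult_right id(1))
 show ?A unfolding G using id by (simp add: integral_sum sum_distrib_left sum_negf flip: sum_subtractf)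
qed

lemma rhs_u_velocity_work:
 assumes t: "t:{0<..<T}"
 shows "(LI x. rhs_u i t x*U i t x) = - D1sq (U i t)+(SU l. T3 (B l t) (U i t) (pd l (B i t)))"
proof -
 have H: "Hs (Suc 1) (W c i t)" "Hs (Suc 0) (pd l (W c i t))" "Hs 0 (pd k (pd l (W c i t)))" for c i k l
  using W_pds_Hs[OF t, of "Suc 1" "[]" c i] W_pds_Hs[OF t, of "Suc 0" "[l]" c i] W_pds_Hs[OF t, of 0 "[k, l]" c i] m3 by (auto simp: pds_Cons)
 have tri: "IB (%x. W s l t x*pd l (W c i t) x*U i t x)" for s c l i by (rule Hs_triple_integrable[OF H(1) H(2) H(1)]) simp
 have z: "(SU l. T3 (U l t) (pd l (U i t)) (U i t)) = 0" for i
  using transport_self_zero[OF t, of True i] T3_swap23[of _ "U i t" "pd _ (U i t)"] by simp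
 have "rhs_u i t x*U i t x
  = (SU l. pd l (pd l (U i t)) x*U i t x)+((SU l. B l t x*pd l (B i t) x*U i t x)-(SU l. U l t x*pd l (U i t) x*U i t x))" for i x
  unfolding rhs_u_def nonlin_def adv_def by (simp add: algebra_simps sum_distrib_left sum_distrib_right)
 hence "(LI x. rhs_u i t x*U i t x)
  = (SU l. LI x. pd l (pd l (U i t)) x*U i t x)+((SU l. T3 (B l t) (pd l (B i t)) (U i t))-(SU l. T3 (U l t) (pd l (U i t)) (U i t)))" for i
  unfolding T3_def using tri[of _ _ _ i] Hs_mult_integrable[OF H(3) H(1)] by simp
 moreover have "(LI x. pd l (pd l (U i t)) x*U i t x) = - L2sq (pd l (U i t))" for i l
  unfolding L2sq_def using L2_ibp[OF H(2) H(1), of l l True i True i] by (simp add: power2_eq_square)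
 ultimately show ?thesis using z by (simp add: D1sq_def sum_negf T3_swap23[of _ "pd _ (B i t)"])
qed

lemma energy_equality_0:
 assumes st: "0 < s" "s <= t" "t < T"
 shows "SIB {s..t} (E 1)" "E 0 t+2*SI {s..t} (E 1) = E 0 s"
proof -
 note inT = in_times[OF st(1,3)]
 have "continuous_on {s..t} (E 1)" by (rule continuous_on_subset[OF E_continuous]) (use st m3 in auto)
 from borel_integrable_compact[OF _ this] show "SIB {s..t} (E 1)" by simp
 define P where "P r = (SU i. LI x. rhs_u i r x*U i r x)" for r
 define Q where "Q r = (SU i. D1sq (B i r)+(SU l. T3 (B l r) (U i r) (pd l (B i r))))" for r
 note u = energy_u_0[OF st, folded P_def] and b = energy_b_0[OF st, folded Q_def]
 have "E 1 r = (SU i. D1sq (U i r))+(SU i. D1sq (B i r))" for r using E_Suc[of 0 r] by (simp add: words_0 UNIV_bool)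
 hence "E 1 r = Q r-P r" if "r:{s..t}" for r
  unfolding P_def Q_def rhs_u_velocity_work[OF inT[OF that]] by (simp add: sum.distrib sum_negf sum_subtractf)
 hence "indicator {s..t} r*E 1 r = indicator {s..t} r*Q r-indicator {s..t} r*P r" for r by (cases "r:{s..t}") auto
 hence "SI {s..t} (E 1) = SI {s..t} Q-SI {s..t} P" using integral_diff[OF b(1) u(1)] by simp
 moreover have "E 0 t-E 0 s = ((SU i. L2sq (U i t))-(SU i. L2sq (U i s)))+((SU i. L2sq (B i t))-(SU i. L2sq (B i s)))"
  by (simp add: E_def words_0 UNIV_bool)
 ultimately show "E 0 t+2*SI {s..t} (E 1) = E 0 s" using u(2) b(2) by simp
qed

end

lemma sum_delta_mult: "(SU l::3. (if l = i then 1 else 0)*g l) = (g i::real)" using exhaust_3[of i] unfolding sum_3 by auto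

lemma sum_rotate: "(SUM i:A. SUM j:B. SUM l:C. g i j l) = (SUM l:C. SUM i:A. SUM j:B. (g i j l::real))"
proof -
 have "(SUM j:B. SUM l:C. g i j l) = (SUM l:C. SUM j:B. g i j l)" for i by (rule sum.swap)
 thus ?thesis by (simp only:) (rule sum.swap)
qed

lemma L2sq_diff_expand:
 assumes f: "IB (%x. (f x)^2)" "BM f" and g: "IB (%x. (g x)^2)" "BM g"
 shows "L2sq (%x. f x-g x) = L2sq f+L2sq g-2*(LI x. f x*g x)"
proof -
 have i: "IB (%x. f x*g x)" using f g by (intro Cauchy_Schwarz_mult(1)) auto
 have "L2sq (%x. f x-g x) = (LI x. (f x)^2+(g x)^2-2*(f x*g x))"
  unfolding L2sq_def by (simp add: power2_eq_square algebra_simps)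
 thus ?thesis using f g i by (simp add: L2sq_def)
qed

lemma curl_energy:
 assumes f: "!!j. Hs (Suc 0) (f j)" and d: "!!x. (SU l. pd l (f l) x) = 0"
 shows "(SU i. SU j. L2sq (%x. pd i (f j) x-pd j (f i) x)) = 2*(SU i. SU j. L2sq (pd i (f j)))"
proof -
 have p: "IB (%x. (pd i (f j) x)^2)" "BM (pd i (f j))" for i j using Hs_pd[OF f] Hs_L2 Hs_meas by blast+
 have ip: "IB (%x. pd i (f j) x*pd k (f l) x)" for i j k l using p by (intro Cauchy_Schwarz_mult(1)) auto
 have C: "C1 (f j)" "C1 (pd i (f j))" "C_inf (f j)" for i j using f by (auto intro: Hs_C1 Hs_C_inf C_inf_C1 C_inf_pd)
 define V where "V i x = (SU j. f j x*pd j (f i) x)" for i x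
 have dV: "(SU i. pd i (V i) x) = (SU i. SU j. pd i (f j) x*pd j (f i) x)" for x
 proof -
  have "pd j (%x. SU i. pd i (f i) x) x = 0" for j using d by (simp add: pd_const)
  hence z: "(SU i. pd j (pd i (f i)) x) = 0" for j by (simp add: pd_sum C)
  have "(SU i. pd i (V i) x) = (SU i. SU j. pd i (f j) x*pd j (f i) x)+(SU i. SU j. f j x*pd j (pd i (f i)) x)"
   unfolding V_def[abs_def] using pd_commute[OF C(3)] by (simp add: pd_sum pd_mult C C1_mult sum.distrib)
  also have "(SU i. SU j. f j x*pd j (pd i (f i)) x) = (SU j. f j x*(SU i. pd j (pd i (f i)) x))"
   unfolding sum_distrib_left by (rule sum.swap)
  finally show ?thesis unfolding z by simp
 qed
 have iV: "IB (V i)" for i unfolding V_def[abs_def] by (intro integrable_sum Hs_mult_integrable[OF f Hs_pd[OF f]])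
 have CV: "C1 (V i)" for i unfolding V_def[abs_def] by (intro C1_sum C1_mult C)
 have "IB (%x. SU i. pd i (V i) x)" unfolding dV by (intro integrable_sum ip)
 from integral_divergence_zero[OF CV iV this] have "(LI x. (SU i. pd i (V i) x)) = 0" .
 hence z: "(SU i. SU j. LI x. pd i (f j) x*pd j (f i) x) = 0" unfolding dV using ip by (simp add: integral_sum integrable_sum)
 have "(SU i. SU j. L2sq (%x. pd i (f j) x-pd j (f i) x)) = (SU i. SU j. L2sq (pd i (f j))+L2sq (pd j (f i))-2*(LI x. pd i (f j) x*pd j (f i) x))"
  by (simp only: L2sq_diff_expand[OF p p])
 also have "... = (SU i. SU j. L2sq (pd i (f j)))+(SU i. SU j. L2sq (pd j (f i)))"
  using z by (simp add: sum.distrib sum_subtractf flip: sum_distrib_left)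
 also have "(SU i. SU j. L2sq (pd j (f i))) = (SU i. SU j. L2sq (pd i (f j)))" by (rule sum.swap)
 finally show ?thesis by simp
qed

context hall_solution
begin

definition part_energy :: "bool => nat => real => real" where
 "part_energy c k t = (SU i. SUM w:words k. L2sq (pds w (W c i t)))"

lemma E_split: "E k t = part_energy True k t+part_energy False k t" by (simp add: E_def part_energy_def UNIV_bool)

lemma part_energy_nonneg: "0 <= part_energy c k t" unfolding part_energy_def by (intro sum_nonneg) (simp add: L2sq_nonneg)

definition mode :: "label => real => scalar" where
 "mode = (%(c, w, i, j) t x. if c then pds (w @ [i]) (U j t) x-pds (w @ [j]) (U i t) x else pds (j # w) (B i t) x)"

definition mode_dt :: "label => real => scalar" where
 "mode_dt = (%(c, w, i, j) t x. if c then pds (w @ [i]) (dst None (U j) t) x-pds (w @ [j]) (dst None (U i) t) x else pds (j # w) (dst None (B i) t) x)"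

definition flux :: "label => real => 3 => scalar" where
 "flux = (%(c, w, i, j) t l x. if c then (if l = i then 1 else 0)*pds w (nonlin True j t) x-(if l = j then 1 else 0)*pds w (nonlin True i t) x
 else (if l = j then 1 else 0)*pds w (nonlin False i t) x+pds (j # w) (hall_flux i l t) x)"

definition modes :: "nat => (label) set" where "modes n = UNIV\<times>words n\<times>UNIV\<times>UNIV"

lemma finite_modes: "finite (modes n)" unfolding modes_def by (intro finite_cartesian_product finite_words) auto

lemma sum_modes: "(SUM a:modes n. f a) = (SUM w:words n. SU i. SU j. (f (True, w, i, j)::real))+(SUM w:words n. SU i. SU j. f (False, w, i, j))"
proof -
 have "(SUM a:modes n. f a) = (SU c. SUM w:words n. SU i. SU j. f (c, w, i, j))"
  unfolding modes_def by (simp only: sum.cartesian_product case_prod_unfold) (auto intro!: sum.cong)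
 thus ?thesis by (simp add: UNIV_bool)
qed

lemma mode_True: "t:{0<..<T} ==> mode (True, w, i, j) t = (%x. pd i (pds w (U j t)) x-pd j (pds w (U i t)) x)"
 by (simp add: mode_def pds_append pds_Cons pds_pd_commute W_C_inf)

lemma mode_False: "mode (False, w, i, j) t = pds (j # w) (B i t)" by (simp add: mode_def)

lemma pd_mode: assumes t: "t:{0<..<T}" shows "pd l (mode (c, w, i, j) t) = mode (c, l # w, i, j) t"
proof (cases c)
 case True
 thus ?thesis unfolding mode_def by (simp add: pd_diff W_pds_C1[OF t] pds_Cons)
next
 case False
 have "pd l (pd j (pds w (B i t))) = pd j (pd l (pds w (B i t)))" by (rule pd_commute[OF C_inf_pds[OF W_C_inf[OF t]]])
 with False show ?thesis by (simp add: mode_False pds_Cons)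
qed

lemma mode_C_inf: "t:{0<..<T} ==> C_inf (mode a t)"
proof (cases a)
 case (fields c w i j)
 assume "t:{0<..<T}"
 thus ?thesis unfolding fields by (cases c) (auto simp: mode_def intro!: C_inf_diff C_inf_pds W_C_inf)
qed

lemma mode_has_time_deriv: "has_time_deriv T (mode a) (mode_dt a)"
proof (cases a)
 case (fields c w i j)
 have t: "mode (True, w, i, j) = (%t x. pds (w @ [i]) (U j t) x-pds (w @ [j]) (U i t) x)" "mode (False, w, i, j) = (%t. pds (j # w) (B i t))"
  "mode_dt (True, w, i, j) = (%t x. pds (w @ [i]) (dst None (U j) t) x-pds (w @ [j]) (dst None (U i) t) x)"
  "mode_dt (False, w, i, j) = (%t. pds (j # w) (dst None (B i) t))"
  by (auto simp: mode_def mode_dt_def)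
 show ?thesis unfolding fields
  by (cases c) (simp_all only: t has_time_deriv_diff[OF has_time_deriv_pds[OF W_slab] has_time_deriv_pds[OF W_slab]] has_time_deriv_pds[OF W_slab])
qed

lemma flux_C1: "t:{0<..<T} ==> C1 (flux a t l)"
proof (cases a)
 case (fields c v i j)
 assume "t:{0<..<T}"
 hence NH: "C1 (pds w (nonlin c i t))" "C1 (pds w (hall_flux i l t))" for w c i by (auto intro!: C_inf_C1s nonlin_C_inf hall_flux_C_inf)
 show ?thesis unfolding fields flux_def by (cases c; simp only: prod.case if_True if_False simp_thms; intro C1_diff C1_add C1_cmult NH)
qed

lemma mode_L2_le:
 assumes t: "t:{0<..<T}" and n: "length w+1 <= k" "k <= m" shows "L2_le (mode (c, w, i, j) t) (4*F k t)"
proof (cases c)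
 case True
 thus ?thesis unfolding mode_def using n by (simp, intro L2_le_diff W_L2_le[OF t]) auto
next
 case False
 thus ?thesis unfolding mode_def using n F_nonneg[of k t] by (simp, intro L2_le_mono[OF W_L2_le[OF t, of _ k]]) auto
qed

lemma pds_laplacian:
 assumes "C_inf (f::scalar)" shows "pds w (%x. SU l. pd l (pd l f) x) = (%x. SU l. pd l (pd l (pds w f)) x)"
 using assms by (subst pds_sum) (auto intro!: C_inf_pd simp: pds_pd_commute C_inf_pd)

lemma mode_eq_velocity:
 assumes t: "t:{0<..<T}"
 shows "mode_dt (True, v, i, j) t x = (SU l. pd l (pd l (mode (True, v, i, j) t)) x)+(SU l. pd l (flux (True, v, i, j) t l) x)"
proof -
 have CW: "C_inf (%x. SU l. pd l (pd l (U i t)) x)" for i by (intro C_inf_sum C_inf_pd W_C_inf t)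
 have CN: "C_inf (nonlin True i t)" and Cp: "C_inf (pd i (\<pi> t))" for i by (rule nonlin_C_inf[OF t], intro C_inf_pd pi_C_inf t)
 have "dst None (U k) t = (%x. (SU l. pd l (pd l (U k t)) x)+nonlin True k t x-pd k (\<pi> t) x)" for k using eq_u[OF t] by (simp add: fun_eq_iff)
 hence du: "pds w (dst None (U k) t) x = (SU l. pd l (pd l (pds w (U k t))) x)+pds w (nonlin True k t) x-pds w (pd k (\<pi> t)) x" for w k
  by (simp add: pds_diff pds_add C_inf_add CW CN Cp pds_laplacian W_C_inf[OF t])
 have pressure: "pds (v @ [i]) (pd j (\<pi> t)) = pds (v @ [j]) (pd i (\<pi> t))"
  using pd_commute[OF pi_C_inf[OF t], of i j] by (simp add: pds_append pds_Cons)
 have nonlinear: "pds (v @ [k]) (nonlin True l t) = pd k (pds v (nonlin True l t))" for k l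
  by (simp add: pds_append pds_Cons pds_pd_commute CN)
 have lap: "pd l (pd l (mode (True, v, i, j) t)) x = pd l (pd l (pds (v @ [i]) (U j t))) x-pd l (pd l (pds (v @ [j]) (U i t))) x" for l
  unfolding mode_def using W_pds_C1[OF t, of "v @ [_]"] W_pds_C1[OF t, of "l # v @ [_]"] by (simp add: pd_diff pds_Cons)
 have "pd l (flux (True, v, i, j) t l) x
  = (if l = i then 1 else 0)*pd l (pds v (nonlin True j t)) x-(if l = j then 1 else 0)*pd l (pds v (nonlin True i t)) x" for l
  unfolding flux_def by (simp only: prod.case if_True pd_diff C1_cmult C_inf_C1s[OF CN] pd_cmult)
 hence "(SU l. pd l (flux (True, v, i, j) t l) x) = pd i (pds v (nonlin True j t)) x-pd j (pds v (nonlin True i t)) x"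
  by (simp only: sum_subtractf sum_delta_mult)
 thus ?thesis using du[of "v @ [i]" j] du[of "v @ [j]" i] by (simp add: mode_dt_def pressure nonlinear lap sum_subtractf)
qed

lemma mode_eq_magnetic:
 assumes t: "t:{0<..<T}"
 shows "mode_dt (False, w, i, j) t x = (SU l. pd l (pd l (mode (False, w, i, j) t)) x)+(SU l. pd l (flux (False, w, i, j) t l) x)"
proof -
 note CH = hall_flux_C_inf[OF t] and CN = nonlin_C_inf[OF t]
 have C: "C_inf (%x. SU l. pd l (pd l (B i t)) x)" "C_inf (%x. SU l. pd l (hall_flux i l t) x)"
  by (intro C_inf_sum C_inf_pd W_C_inf hall_flux_C_inf t)+
 have "pds (j # w) (%x. SU l. pd l (hall_flux i l t) x) = (%x. SU l. pd l (pds (j # w) (hall_flux i l t)) x)"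
  by (subst pds_sum) (auto intro!: C_inf_pd CH simp: pds_pd_commute CH)
 moreover have "pds (j # w) (nonlin False i t) = pd j (pds w (nonlin False i t))" by (simp add: pds_Cons)
 moreover have "dst None (B i) t = (%x. (SU l. pd l (pd l (B i t)) x)+nonlin False i t x+(SU l. pd l (hall_flux i l t) x))"
  using eq_b[OF t] by (simp add: fun_eq_iff hall_flux_def[abs_def])
 ultimately have "pds (j # w) (dst None (B i) t) x
  = (SU l. pd l (pd l (pds (j # w) (B i t))) x)+pd j (pds w (nonlin False i t)) x+(SU l. pd l (pds (j # w) (hall_flux i l t)) x)"
  by (simp add: pds_add C_inf_add C CN pds_laplacian W_C_inf[OF t])
 moreover have "pd l (flux (False, w, i, j) t l) x
  = (if l = j then 1 else 0)*pd l (pds w (nonlin False i t)) x+pd l (pds (j # w) (hall_flux i l t)) x" for l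
  unfolding flux_def by (simp only: prod.case if_False pd_add C1_cmult C_inf_C1s[OF CN] pd_cmult C_inf_C1s[OF CH] simp_thms)
 hence "(SU l. pd l (flux (False, w, i, j) t l) x) = pd j (pds w (nonlin False i t)) x+(SU l. pd l (pds (j # w) (hall_flux i l t)) x)"
  by (simp only: sum.distrib sum_delta_mult)
 ultimately show ?thesis by (simp add: mode_dt_def mode_False)
qed

lemma mode_flux_evolution:
 assumes st: "0 < s" "s <= t" "t < T" and a: "a:modes n" "Suc n <= m"
 shows "flux_evolution T s t (mode a) (mode_dt a) (flux a)"
proof
 obtain c w i j where ae: "a = (c, w, i, j)" "length w = n" using a by (auto simp: modes_def words_def)
 fix r assume "r:{s..t}"
 hence r: "r:{0<..<T}" using st by auto
 show "C_inf (mode a r)" by (rule mode_C_inf[OF r])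
 show "C1 (flux a r l)" for l by (rule flux_C1[OF r])
 show "mode_dt a r x = (SU l. pd l (pd l (mode a r)) x)+(SU l. pd l (flux a r l) x)" for x
  unfolding ae(1) using mode_eq_velocity[OF r] mode_eq_magnetic[OF r] by (cases c) auto
 show "IB (%x. (mode a r x)^2)" using mode_L2_le[OF r, of w m c i j] ae a(2) by (simp add: L2_le_def)
qed (use st mode_has_time_deriv in auto)

lemma div_pds:
 assumes t: "t:{0<..<T}" shows "(SU l. pd l (pds w (W c l t)) x) = 0"
proof -
 have "(%x. SU l. pd l (W c l t) x) = (%x. 0)" using div_u[OF t] div_b[OF t] by (cases c) auto
 hence "pds w (%x. SU l. pd l (W c l t) x) x = pds w (%x. 0::real) x" by simp
 also have "pds w (%x. 0::real) = (%x. 0)" by (induction w) (auto simp: pds_Cons pd_const)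
 also have "pds w (%x. SU l. pd l (W c l t) x) = (%x. SU l. pd l (pds w (W c l t)) x)"
  by (subst pds_sum) (auto intro!: C_inf_pd W_C_inf t simp: pds_pd_commute W_C_inf[OF t])
 finally show ?thesis by simp
qed

lemma mode_energy:
 assumes t: "t:{0<..<T}" and n: "Suc n <= m"
 shows "(SUM w:words n. SU i. SU j. L2sq (mode (True, w, i, j) t)) = 2*part_energy True (Suc n) t"
 "(SUM w:words n. SU i. SU j. L2sq (mode (False, w, i, j) t)) = part_energy False (Suc n) t" (is ?A)
proof -
 let ?curl = "SUM w:words n. SU i. SU j. L2sq (mode (True, w, i, j) t)"
 let ?gradient = "SUM w:words n. SU i. SU j. L2sq (pds (i # w) (U j t))"
 have "(SU i. SU j. L2sq (mode (True, w, i, j) t)) = 2*(SU i. SU j. L2sq (pds (i # w) (U j t)))" if "w:words n" for w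
  unfolding mode_True[OF t] pds_Cons by (rule curl_energy[OF W_pds_Hs[OF t] div_pds[OF t]]) (use that n in "auto simp: words_def")
 hence "?curl = 2*?gradient" by (simp add: sum_distrib_left)
 also have "?gradient = part_energy True (Suc n) t" unfolding part_energy_def sum_words_Suc
  by (subst sum_rotate) (intro sum.cong refl, rule sum.swap)
 finally show "?curl = 2*part_energy True (Suc n) t" .
 show ?A unfolding part_energy_def sum_words_Suc mode_False by (rule trans[OF sum.swap]) (intro sum.cong refl, rule sum.swap)
qed

lemma mode_gradient_energy:
 assumes t: "t:{0<..<T}" and n: "Suc (Suc n) <= m"
 shows "(SUM w:words n. SU i. SU j. D1sq (mode (True, w, i, j) t)) = 2*part_energy True (Suc (Suc n)) t" (is ?A)
 "(SUM w:words n. SU i. SU j. D1sq (mode (False, w, i, j) t)) = part_energy False (Suc (Suc n)) t"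
proof -
 have "(SUM w:words n. SU i. SU j. D1sq (mode (c, w, i, j) t)) = (SUM w:words (Suc n). SU i. SU j. L2sq (mode (c, w, i, j) t))" for c
 proof -
  have "(SU i. SU j. D1sq (mode (c, w, i, j) t)) = (SU l. SU i. SU j. L2sq (mode (c, l # w, i, j) t))" for w
   unfolding D1sq_def pd_mode[OF t] by (rule sum_rotate)
  thus ?thesis unfolding sum_words_Suc by (simp only:) (rule sum.swap)
 qed
 thus ?A
  "(SUM w:words n. SU i. SU j. D1sq (mode (False, w, i, j) t)) = part_energy False (Suc (Suc n)) t"
  using mode_energy[OF t n] by simp_all
qed

lemma pds_hall_flux_L2_le:
 assumes t: "t:{0<..<T}" and k: "length w+1 <= k" "2 <= k" "k <= m"
 defines "N == real (length (splits w))"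
 shows "L2_le (pds w (hall_flux i l t)) (4*(4*(N*(N*(9217*(F k t)^2)))))"
proof -
 have C: "C_inf (%x. B i t x*pd k (B j t) x)" for i j k by (intro C_inf_mult C_inf_pd W_C_inf t)
 have "pds w (%x. B i t x*J l t x)
  = (%x. pds w (%x. B i t x*pd (cyc l) (B (cyc (cyc l)) t) x) x-pds w (%x. B i t x*pd (cyc (cyc l)) (B (cyc l) t) x) x)" for i l
  unfolding J_def right_diff_distrib by (rule pds_diff[OF C C])
 hence product: "L2_le (pds w (%x. B i t x*J l t x)) (4*(N*(N*(9217*(F k t)^2))))" for i l
  unfolding N_def using L2_le_diff[OF pds_product_L2_le[OF t k] pds_product_L2_le[OF t k]] by simp
 have CJ: "C_inf (%x. B i t x*J l t x)" for i l by (intro C_inf_mult J_C_inf W_C_inf t)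
 show ?thesis unfolding hall_flux_def[abs_def] pds_diff[OF CJ CJ] by (rule L2_le_diff[OF product product])
qed

definition transport_work :: "3 list => real => real" where
 "transport_work w t = (SU c. SU j. LI x. pds w (nonlin c j t) x*(SU l. pds (l # l # w) (W c j t) x))"

definition hall_work :: "3 list => real => real" where
 "hall_work w t = (SU i. SU l. LI x. pds w (hall_flux i l t) x*pds (l # w) (B i t) x)"

lemma flux_True_sum:
 assumes t: "t:{0<..<T}"
 shows "(SU i. SU j. SU l. flux (True, w, i, j) t l x*pd l (mode (True, w, i, j) t) x)
 = 2*(SU j. pds w (nonlin True j t) x*(SU l. pds (l # l # w) (U j t) x))"
proof -
 define N where "N j = pds w (nonlin True j t) x" for j
 define D where "D l i j = pd l (pd i (pds w (U j t))) x" for l i j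
 have C: "C_inf (pds w (U j t))" for j by (intro C_inf_pds W_C_inf t)
 have "pd l (mode (True, w, i, j) t) x = D l i j-D l j i" for l i j
  unfolding mode_True[OF t] D_def by (simp add: pd_diff C_inf_C1 C_inf_pd C)
 hence "flux (True, w, i, j) t l x*pd l (mode (True, w, i, j) t) x
  = (if l = i then 1 else 0)*(N j*(D l i j-D l j i))-(if l = j then 1 else 0)*(N i*(D l i j-D l j i))" for i j l
  unfolding flux_def N_def by auto
 hence "(SU i. SU j. SU l. flux (True, w, i, j) t l x*pd l (mode (True, w, i, j) t) x)
  = (SU i. SU j. N j*(D i i j-D i j i))+(SU i. SU j. N i*(D j j i-D j i j))"
  by (simp only: sum_subtractf sum_delta_mult) (simp add: sum.distrib sum_subtractf algebra_simps)
 also have "(SU i. SU j. N i*(D j j i-D j i j)) = (SU i. SU j. N j*(D i i j-D i j i))" by (rule sum.swap)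
 also have "(SU i. SU j. N j*(D i i j-D i j i)) = (SU j. N j*(SU i. D i i j-D i j i))"
  unfolding sum_distrib_left by (rule sum.swap)
 finally have work: "(SU i. SU j. SU l. flux (True, w, i, j) t l x*pd l (mode (True, w, i, j) t) x)
  = 2*(SU j. N j*(SU i. D i i j-D i j i))" by simp
 have "(SU i. D i i j-D i j i) = (SU l. pds (l # l # w) (U j t) x)" for j
 proof -
  have "pd j (%x. SU i. pd i (pds w (U i t)) x) x = 0" using div_pds[OF t] by (simp add: pd_const)
  hence "(SU i. pd j (pd i (pds w (U i t))) x) = 0" by (simp add: pd_sum C_inf_C1 C_inf_pd C)
  thus ?thesis unfolding D_def using pd_commute[OF C, of _ j] by (simp add: sum_subtractf pds_Cons)
 qed
 thus ?thesis unfolding work N_def by simp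
qed

lemma flux_False_sum:
 assumes t: "t:{0<..<T}"
 shows "(SU i. SU j. SU l. flux (False, w, i, j) t l x*pd l (mode (False, w, i, j) t) x)
 = (SU i. pds w (nonlin False i t) x*(SU l. pds (l # l # w) (B i t) x))+(SU j. SU i. SU l. pds (j # w) (hall_flux i l t) x*pds (l # j # w) (B i t) x)"
proof -
 have "flux (False, w, i, j) t l x*pd l (mode (False, w, i, j) t) x
  = (if l = j then 1 else 0)*(pds w (nonlin False i t) x*pds (l # j # w) (B i t) x)+pds (j # w) (hall_flux i l t) x*pds (l # j # w) (B i t) x" for i j l
  unfolding mode_False flux_def by (auto simp: pds_Cons algebra_simps)
 hence "(SU l. flux (False, w, i, j) t l x*pd l (mode (False, w, i, j) t) x)
  = pds w (nonlin False i t) x*pds (j # j # w) (B i t) x+(SU l. pds (j # w) (hall_flux i l t) x*pds (l # j # w) (B i t) x)" for i j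
  by (simp only: sum.distrib sum_delta_mult)
 thus ?thesis by (simp add: sum.distrib sum_distrib_left) (rule sum.swap)
qed

lemma flux_L2_le:
 assumes t: "t:{0<..<T}" and n: "length w+2 <= k" "k <= m"
 defines "N == real (length (splits w))"
 shows "L2_le (flux (c, w, i, j) t l) (64*9*(2*N*(2*N*(9217*(F k t)^2))))"
proof -
 define Q where "Q = 9217*(F k t)^2"
 have Q0: "0 <= N*(N*Q)" "N*(N*Q) >= 0" unfolding Q_def N_def by auto
 have nonlin: "L2_le (%x. (if P then 1 else 0)*pds w (nonlin c i t) x) (16*9*(2*N*(2*N*Q)))" for P c i
 proof -
  have "L2_le (pds w (nonlin c i t)) (4*(9*(N*(N*Q))))" unfolding N_def Q_def by (rule pds_nonlin_L2_le[OF t _ _ n(2)]) (use n in auto)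
  from L2_le_cmult[OF this, of "if P then 1 else 0"] show ?thesis by (rule L2_le_mono) (use Q0 in auto)
 qed
 have hall_flux: "L2_le (pds (j # w) (hall_flux i l t)) (16*9*(2*N*(2*N*Q)))"
 proof -
  have e: "real (length (splits (j # w))) = 2*N" unfolding N_def by simp
  have "L2_le (pds (j # w) (hall_flux i l t)) (4*(4*((2*N)*((2*N)*Q))))" unfolding e[symmetric] Q_def
   by (rule pds_hall_flux_L2_le[OF t _ _ n(2)]) (use n in auto)
  thus ?thesis by (rule L2_le_mono) (use Q0 in auto)
 qed
 have e: "flux (True, w, i, j) t l = (%x. (if l = i then 1 else 0)*pds w (nonlin True j t) x-(if l = j then 1 else 0)*pds w (nonlin True i t) x)"
  "flux (False, w, i, j) t l = (%x. (if l = j then 1 else 0)*pds w (nonlin False i t) x+pds (j # w) (hall_flux i l t) x)"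
  by (auto simp: flux_def)
 show ?thesis using L2_le_diff[OF nonlin nonlin] L2_le_add[OF nonlin hall_flux] unfolding Q_def[symmetric]
  by (cases c) (simp_all only: e, simp_all add: mult.assoc)
qed

lemma mode_flux_L2_le:
 assumes st: "0 < s" "s <= t" "t < T" and a: "a:modes n" "Suc (Suc n) <= m"
 obtains K where "!!r. r:{s..t} ==> L2_le (mode a r) K" "!!r l. r:{s..t} ==> L2_le (pd l (mode a r)) K"
 "!!r l. r:{s..t} ==> L2_le (flux a r l) K"
proof -
 note inT = in_times[OF st(1,3)]
 obtain K where K: "!!r. r:{s..t} ==> F m r <= K" using F_bounded[OF st order_refl] by blast
 obtain c w i j where ae: "a = (c, w, i, j)" and len: "length w = n" using a by (auto simp: modes_def words_def)
 define N where "N = real (length (splits w))"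
 have L: "L2_le (mode a r) (4*K)" "L2_le (pd l (mode a r)) (4*K)" "L2_le (flux a r l) (64*9*(2*N*(2*N*(9217*K^2))))" if r: "r:{s..t}" for r l
 proof -
  show "L2_le (mode a r) (4*K)" "L2_le (pd l (mode a r)) (4*K)"
   using L2_le_mono[OF mode_L2_le[OF inT[OF r], of w m c i j]] L2_le_mono[OF mode_L2_le[OF inT[OF r], of "l # w" m c i j]] K[OF r] len a
   by (auto simp: ae pd_mode[OF inT[OF r]])
  have "(F m r)^2 <= K^2" using K[OF r] F_nonneg by (intro power_mono) auto
  thus "L2_le (flux a r l) (64*9*(2*N*(2*N*(9217*K^2))))"
   unfolding ae N_def using len a by (intro L2_le_mono[OF flux_L2_le[OF inT[OF r], of w m]] mult_left_mono) auto
 qed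
 show thesis
  by (rule that[OF L2_le_mono[OF L(1) max.cobounded1] L2_le_mono[OF L(2) max.cobounded1] L2_le_mono[OF L(3) max.cobounded2]])
qed

definition mode_work :: "label => real => real" where
 "mode_work a t = (SU l. LI x. flux a t l x*pd l (mode a t) x)"

lemma mode_energy_identity:
 assumes st: "0 < s" "s <= t" "t < T" and a: "a:modes n" "Suc (Suc n) <= m"
 shows "SIB {s..t} (%r. 2*(D1sq (mode a r)+mode_work a r))" (is ?A)
 "L2sq (mode a t)-L2sq (mode a s) = - SI {s..t} (%r. 2*(D1sq (mode a r)+mode_work a r))"
proof -
 interpret flux_evolution T s t "mode a" "mode_dt a" "flux a" by (rule mode_flux_evolution[OF st a(1)]) (use a in simp)
 obtain K where K: "!!r. r:{s..t} ==> L2_le (mode a r) K" "!!r l. r:{s..t} ==> L2_le (pd l (mode a r)) K"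
  "!!r l. r:{s..t} ==> L2_le (flux a r l) K" by (rule mode_flux_L2_le[OF st a]) blast
 show ?A
  "L2sq (mode a t)-L2sq (mode a s) = - SI {s..t} (%r. 2*(D1sq (mode a r)+mode_work a r))"
  unfolding mode_work_def by (rule energy_identity[OF K]; assumption)+
qed

lemma mode_work_sum:
 assumes t: "t:{0<..<T}" and w: "w:words n" and n: "Suc (Suc n) <= m"
 shows "(SU i. SU j. mode_work (True, w, i, j) t) = 2*(SU j. LI x. pds w (nonlin True j t) x*(SU l. pds (l # l # w) (U j t) x))" (is ?A)
 "(SU i. SU j. mode_work (False, w, i, j) t)
 = (SU j. LI x. pds w (nonlin False j t) x*(SU l. pds (l # l # w) (B j t) x))+(SU j. hall_work (j # w) t)" (is ?B)
proof -
 define N N' where "N = real (length (splits w))" and "N' j = real (length (splits (j # w)))" for j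
 have len: "length w = n" using w by (simp add: words_def)
 have L: "L2_le (pds w (nonlin c i t)) (4*(9*(N*(N*(9217*(F m t)^2)))))" "L2_le (pds (l # j # w) (W c i t)) (F m t)"
  "L2_le (pds (j # w) (hall_flux i l t)) (4*(4*(N' j*(N' j*(9217*(F m t)^2)))))" for c i j l
  unfolding N_def N'_def by (rule pds_nonlin_L2_le[OF t] pds_hall_flux_L2_le[OF t] W_L2_le[OF t]; use len n in simp)+
 have fi: "IB (%x. flux (c, w, i, j) t l x*pd l (mode (c, w, i, j) t) x)" for c i j l
  using L2_le_inner(1)[OF flux_L2_le[OF t, of w m] mode_L2_le[OF t, of "l # w" m]] len n by (simp add: pd_mode[OF t])
 have ni: "IB (%x. pds w (nonlin c j t) x*(SU l. pds (l # l # w) (W c j t) x))" for c j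
  by (rule L2_le_inner(1)[OF L(1) L2_le_sum3[OF L(2)]])
 have hi: "IB (%x. pds (j # w) (hall_flux i l t) x*pds (l # j # w) (B i t) x)" for i j l by (rule L2_le_inner(1)[OF L(3) L(2)])
 have work: "(SU i. SU j. mode_work (c, w, i, j) t) = (LI x. (SU i. SU j. SU l. flux (c, w, i, j) t l x*pd l (mode (c, w, i, j) t) x))" for c
  unfolding mode_work_def using fi by (simp add: integral_sum integrable_sum)
 show ?A unfolding work flux_True_sum[OF t] using ni by (simp add: integral_sum)
 show ?B unfolding work flux_False_sum[OF t] hall_work_def using ni hi by (simp add: integral_sum integrable_sum integral_add)
qed

text \<open>Weight one half on the velocity members: the antisymmetric curl counts every gradient entry twice.\<close>
definition mode_weight :: "label => real" where "mode_weight a = (if fst a then 1/2 else 1)"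

lemma sum_mode_weight:
 "(SUM a:modes n. mode_weight a*f a) = 1/2*(SUM w:words n. SU i. SU j. f (True, w, i, j))+(SUM w:words n. SU i. SU j. f (False, w, i, j))"
 unfolding sum_modes mode_weight_def by (simp add: sum_distrib_left)

lemma weighted_energy:
 assumes "t:{0<..<T}" "Suc n <= m" shows "(SUM a:modes n. mode_weight a * L2sq (mode a t)) = E (Suc n) t"
 unfolding sum_mode_weight mode_energy[OF assms] E_split by simp

lemma weighted_rate:
 assumes t: "t:{0<..<T}" and n: "Suc (Suc n) <= m"
 shows "(SUM a:modes n. mode_weight a*(D1sq (mode a t)+mode_work a t))
 = E (Suc (Suc n)) t+(SUM v:words n. transport_work v t)+(SUM w:words (Suc n). hall_work w t)"
proof -
 define S where "S c v = (SU i. SU j. mode_work (c, v, i, j) t)" for c v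
 have "1/2*S True v+S False v = transport_work v t+(SU j. hall_work (j # v) t)" if "v:words n" for v
  unfolding S_def mode_work_sum[OF t that n] transport_work_def by (simp add: UNIV_bool)
 hence "1/2*(SUM v:words n. S True v)+(SUM v:words n. S False v) = (SUM v:words n. transport_work v t+(SU j. hall_work (j # v) t))"
  unfolding sum_distrib_left sum.distrib[symmetric] by (rule sum.cong[OF refl])
 also have "... = (SUM v:words n. transport_work v t)+(SUM w:words (Suc n). hall_work w t)"
  unfolding sum.distrib sum_words_Suc by (subst (2) sum.swap) simp
 finally show ?thesis unfolding S_def sum_mode_weight sum.distrib mode_gradient_energy[OF t n] E_split by (simp add: add_divide_distrib)
qed

theorem level_identity:
 assumes st: "0 < s" "s <= t" "t < T" and n: "Suc (Suc n) <= m"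
 defines "G == %r. E (Suc (Suc n)) r+(SUM v:words n. transport_work v r)+(SUM w:words (Suc n). hall_work w r)"
 shows "SIB {s..t} G"
 "E (Suc n) t-E (Suc n) s = - 2*SI {s..t} G"
proof -
 note inT = in_times[OF st(1,3)]
 define R where "R a r = D1sq (mode a r)+mode_work a r" for a r
 note id = mode_energy_identity[OF st _ n, folded R_def]
 have iR: "SIB {s..t} (R a)" if "a:modes n" for a using integrable_mult_right[OF id(1)[OF that], of "1/2"] by simp
 have "indicator {s..t} r*G r = (SUM a:modes n. mode_weight a*(indicator {s..t} r*R a r))" for r
 proof (cases "r:{s..t}")
  case True
  thus ?thesis using weighted_rate[OF inT[OF True] n, folded R_def] by (simp add: G_def)
 qed simp
 note G = this
 show "SIB {s..t} G" unfolding G by (intro integrable_sum integrable_mult_right iR)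
 have "E (Suc n) t-E (Suc n) s = (SUM a:modes n. mode_weight a*(L2sq (mode a t)-L2sq (mode a s)))"
  using weighted_energy[OF inT[of t], of n] weighted_energy[OF inT[of s], of n] st n by (simp add: right_diff_distrib sum_subtractf)
 also have "... = - (SUM a:modes n. mode_weight a*(2*SI {s..t} (R a)))"
  unfolding sum_negf[symmetric] by (intro sum.cong refl) (simp add: id(2) mult.left_commute[of _ 2])
 also have "... = - 2*SI {s..t} G"
  unfolding G using iR by (simp add: integral_sum sum_distrib_left sum_negf mult.left_commute[of _ 2])
 finally show "E (Suc n) t-E (Suc n) s = - 2*SI {s..t} G" .
qed

end

lemma T3_diff3:
 assumes "Hs a f" "Hs b g" "Hs c h" "Hs c k" "a+b+c >= 2"
 shows "T3 f g (%x. h x-k x) = T3 f g h-T3 f g k" "T3 f (%x. h x-k x) g = T3 f h g-T3 f k g"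
proof -
 show "T3 f g (%x. h x-k x) = T3 f g h-T3 f g k"
  unfolding T3_def right_diff_distrib using Hs_triple_integrable[OF assms(1,2,3,5)] Hs_triple_integrable[OF assms(1,2,4,5)] by simp
 thus "T3 f (%x. h x-k x) g = T3 f h g-T3 f k g" by (simp only: T3_swap23[of f _ g])
qed

definition det3 :: "(3 => real) => (3 => real) => (3 => real) => real" where
 "det3 a c q = a 1*c 2*q 3-a 1*c 3*q 2+a 2*c 3*q 1-a 2*c 1*q 3+a 3*c 1*q 2-a 3*c 2*q 1"

definition int_det :: "(3 => scalar) => (3 => scalar) => (3 => scalar) => real" where
 "int_det a b c = T3 (a 1) (b 2) (c 3)-T3 (a 1) (b 3) (c 2)+T3 (a 2) (b 3) (c 1)-T3 (a 2) (b 1) (c 3)+T3 (a 3) (b 1) (c 2)-T3 (a 3) (b 2) (c 1)"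

lemma int_det_det3:
 assumes "!!i j r. IB (%x. a i x*c j x*q r x)"
 shows "IB (%x. det3 (%i. a i x) (%i. c i x) (%i. q i x))" "(LI x. det3 (%i. a i x) (%i. c i x) (%i. q i x)) = int_det a c q"
 unfolding det3_def int_det_def T3_def using assms by simp_all

lemma hall_algebra:
 assumes "q 1 = e 2 3-e 3 2" "q 2 = e 3 1-e 1 3" "q 3 = e 1 2-e 2 1"
 shows "(SU i. SU r. (a i*c r-a r*c i)*e r i) = - det3 a c q"
 unfolding sum_3 assms det3_def by (simp add: algebra_simps)

lemma T3_rotate: "T3 f g h = T3 h f g" by (simp add: T3_def mult_ac)

lemma T3_ibp_bound:
 assumes H: "Hs (Suc a) f" "Hs (Suc b) g" "Hs (Suc c) h" and bound: "<|T3 (pd i f) g h|> <= X" "<|T3 f (pd i g) h|> <= X"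
 shows "<|T3 f g (pd i h)|> <= 2*X"
 using T3_ibp[OF H, of i] bound by linarith

lemma weighted_Young: "\<delta> > 0 ==> 2 * v *<|p|>*<|h|> <= \<delta>*h^2+(v^2*p^2)/(\<delta>::real)"
proof -
 assume d: "\<delta> > 0"
 have "0 <= (\<delta>*<|h|>-v *<|p|>)^2/\<delta>" using d by simp
 also have "... = \<delta>*h^2+(v^2*p^2)/\<delta>-2 * v *<|p|>*<|h|>" using d by (simp add: power2_diff power_mult_distrib field_simps power2_eq_square)
 finally show ?thesis by simp
qed

context hall_solution
begin

lemma D1sq_le_E: "D1sq (pds is (W c i t)) <= E (Suc (length is)) t"
 unfolding E_Suc using term_le_level_sum[of "%c i is. D1sq (pds is (W c i t))"] by (simp add: D1sq_nonneg)

definition hess_bh :: "real => scalar" where "hess_bh t x = norm (hess (%y. horiz (b t y)) x)"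
definition norm_uh :: "real => scalar" where "norm_uh t x = norm (horiz (u t x))"

lemma norm_uh_ge: "h ~= 3 ==> <|U h t x|> <= norm_uh t x"
 using exhaust_3[of h] component_le_norm_cart[of "horiz (u t x)" h] by (auto simp: norm_uh_def horiz_def W_def)

lemma hess_bh_ge:
 assumes t: "t:{0<..<T}" and h: "h ~= 3" shows "<|pd i (pd j (B h t)) x|> <= hess_bh t x"
proof -
 define g where "g y = horiz (b t y)" for y
 note dB = C1_has_pd0[OF W_C1(1)[OF t]] C1_has_pd0[OF W_C1(2)[OF t]]
 have ve: "vector [p, q, 0] = p *\<^sub>R axis 1 1+q *\<^sub>R (axis 2 1::R3)" for p q :: real by (simp add: vec_eq_iff forall_3 axis_def)
 have g1: "pd l g y = vector [pd l (B 1 t) y, pd l (B 2 t) y, 0]" for l y unfolding pd_def[of l g] g_def horiz_def ve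
  by (rule vector_derivative_at) (use dB(1)[of False] in "auto simp: W_eq intro!: derivative_eq_intros")
 have g2: "pd l (pd j g) y = vector [pd l (pd j (B 1 t)) y, pd l (pd j (B 2 t)) y, 0]" for l y
  unfolding pd_def[of l "pd j g"] unfolding g1 ve
  by (rule vector_derivative_at) (use dB(2)[of _ False] in "auto intro!: derivative_eq_intros")
 have "<|pd i (pd j (B h t)) x|> = <|pd i (pd j g) x $ h|>" using exhaust_3[of h] h by (auto simp: g2)
 also have "... <= norm (pd i (pd j g) x)" by (rule component_le_norm_cart)
 also have "... = norm (hess g x $ i $ j)" by (simp add: hess_def)
 also have "... <= norm (hess g x)" by (rule order_trans[OF Finite_Cartesian_Product.norm_nth_le Finite_Cartesian_Product.norm_nth_le])
 finally show ?thesis by (simp add: hess_bh_def g_def[abs_def])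
qed

end

locale hall_slice = hall_solution +
 fixes t M :: real
 assumes t: "t:{0<..<T}" and V: "split_bound (hess_bh t) M"
 and S: "IB (%x. peak (sqrt M) (norm_uh t) x^3)" "(LI x. peak (sqrt M) (norm_uh t) x^3) <= 1/10^14"
begin

lemma M_ge_1: "M >= 1" and hess_bh_nonneg: "0 <= hess_bh t x" and hess_bh_measurable: "BM (hess_bh t)" using V by (auto simp: split_bound_def)

definition order1 :: "scalar => bool" where "order1 p \<longleftrightarrow> Hs 2 p & L2sq p <= 4*E 1 t & D1sq p <= 4*E 2 t & D2sq p <= 12*E 3 t"
definition order2 :: "scalar => bool" where "order2 p \<longleftrightarrow> Hs 1 p & L2sq p <= 4*E 2 t & D1sq p <= 12*E 3 t"
definition order3 :: "scalar => bool" where "order3 p \<longleftrightarrow> Hs 0 p & L2sq p <= 12*E 3 t"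
definition hess_bh_dominated :: "scalar => bool" where "hess_bh_dominated f \<longleftrightarrow> f:borel_measurable borel & (ALL x. <|f x|> <= 2*hess_bh t x)"

lemma D2sq_pd_le_E: "D2sq (pd i (W c j t)) <= 3*E 3 t"
proof -
 have "D1sq (pd l (pd i (W c j t))) <= E 3 t" for l using D1sq_le_E[of "[l, i]" c j t] by (simp add: pds_Cons numeral_3_eq_3)
 hence "D2sq (pd i (W c j t)) <= (SU l::3. E 3 t)" unfolding D2sq_def by (intro sum_mono)
 thus ?thesis by simp
qed

lemma order1_W: "order1 (pd i (W c j t))"
 unfolding order1_def using D2sq_pd_le_E[of i c j] W_pds_Hs[OF t, of 2 "[i]" c j] m3 L2sq_le_E[of "[i]" c j t] D1sq_le_E[of "[i]" c j t] E_nonneg[of 1 t] E_nonneg[of 2 t] E_nonneg[of 3 t]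
 by (auto simp: pds_Cons numeral_2_eq_2)

lemma order1_pd: "order1 p ==> order2 (pd k p)" and order2_pd: "order2 p ==> order3 (pd k p)"
 unfolding order1_def order2_def order3_def using Hs_pd[of 1 p k] Hs_pd[of 0 p k] L2sq_pd_le_D1sq[of k p] D1sq_pd_le_D2sq[of k p]
 by (auto simp: numeral_2_eq_2)

lemma order1_J: "order1 (J i t)"
proof -
 define f where "f = pd (cyc i) (B (cyc (cyc i)) t)"
 define g where "g = pd (cyc (cyc i)) (B (cyc i) t)"
 have Je: "J i t = (%x. f x-g x)" by (auto simp: J_def f_def g_def)
 have bound: "L2sq (%x. p x-q x) <= 2 * L2sq p+2 * L2sq q" if "Hs 0 p" "Hs 0 q" for p q
 proof -
  have i: "IB (%x. 2*(p x)^2+2*(q x)^2)" using Hs_L2[OF that(1)] Hs_L2[OF that(2)] by simp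
  have "L2sq (%x. p x-q x) <= (LI x. 2*(p x)^2+2*(q x)^2)"
   unfolding L2sq_def by (rule integral_mono[OF Hs_L2[OF Hs_diff[OF that]] i]) (use square_add_le[of "p _" "- q _"] in simp)
  thus ?thesis using Hs_L2[OF that(1)] Hs_L2[OF that(2)] by (simp add: L2sq_def)
 qed
 have H: "Hs 2 f" "Hs 2 g" and C: "C1 f" "C1 g" "C1 (pd k f)" "C1 (pd k g)" and H1: "Hs 1 (pd k f)" "Hs 1 (pd k g)" for k
  using order1_W order1_pd[OF order1_W] unfolding f_def g_def order1_def order2_def by (auto simp: W_C1[OF t])
 have H0: "Hs 0 f" "Hs 0 g" "Hs 0 (pd k f)" "Hs 0 (pd k g)" "Hs 0 (pd l (pd k f))" "Hs 0 (pd l (pd k g))" for k l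
  using H H1 by (auto intro: Hs_mono Hs_pd)
 have gs: "D1sq (%x. p x-q x) <= 2*D1sq p+2*D1sq q" if "C1 p" "C1 q" "!!k. Hs 0 (pd k p)" "!!k. Hs 0 (pd k q)" for p q
  unfolding D1sq_def sum_distrib_left sum.distrib[symmetric] using that by (intro sum_mono) (simp add: pd_diff bound)
 have "D2sq (J i t) <= 2*D2sq f+2*D2sq g"
  unfolding Je D2sq_def sum_distrib_left sum.distrib[symmetric] using C H0 by (intro sum_mono) (simp add: pd_diff gs)
 thus ?thesis using Hs_diff[OF H] bound[OF H0(1,2)] gs[OF C(1,2) H0(3,4)] order1_W[of "cyc i" False "cyc (cyc i)"] order1_W[of "cyc (cyc i)" False "cyc i"] m3
  unfolding order1_def Je[symmetric] f_def[symmetric] g_def[symmetric]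
  using L2sq_le_E[of "[cyc i]" False "cyc (cyc i)" t] L2sq_le_E[of "[cyc (cyc i)]" False "cyc i" t] D1sq_le_E[of "[cyc i]" False "cyc (cyc i)" t] D1sq_le_E[of "[cyc (cyc i)]" False "cyc i" t]
  D2sq_pd_le_E[of "cyc i" False "cyc (cyc i)"] D2sq_pd_le_E[of "cyc (cyc i)" False "cyc i"] by (auto simp: pds_Cons f_def g_def numeral_2_eq_2)
qed

lemma hess_bh_dominated_T3_le:
 assumes f: "hess_bh_dominated f" and m: "BM p" "BM q"
 and i: "IB g" and bound: "!!x. 2*hess_bh t x*<|p x|>*<|q x|> <= g x" and R: "(LI x. g x) <= R"
 shows "<|T3 f p q|> <= R"
proof -
 have pt: "<|f x*p x*q x|> <= g x" for x
 proof -
  have "<|f x*p x*q x|> <= 2*hess_bh t x*<|p x|>*<|q x|>" unfolding abs_mult using f by (intro mult_right_mono) (auto simp: hess_bh_dominated_def)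
  thus ?thesis using bound[of x] by simp
 qed
 have it: "IB (%x. f x*p x*q x)"
  by (rule integrable_bound[OF i]) (use f m pt in "auto simp: hess_bh_dominated_def intro: order_trans[OF _ abs_ge_self]")
 have "<|T3 f p q|> <= (LI x. <|f x*p x*q x|>)" unfolding T3_def by (rule integral_abs_bound)
 also have "... <= (LI x. g x)" by (rule integral_mono[OF integrable_abs[OF it] i pt])
 finally show ?thesis using R by simp
qed

lemma potential_pair:
 assumes f: "hess_bh_dominated f" and H: "H1 p" "H1 q" and a: "L2sq p <= a" "L2sq q <= a" and c: "D1sq p <= c" "D1sq q <= c" and d: "\<delta> > 0"
 shows "<|T3 f p q|> <= 2*(\<delta>*c+(1+4096/\<delta>^3)*(M*a))"
 unfolding mult.assoc[of "1+4096/\<delta>^3" M a, symmetric]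
proof (rule hess_bh_dominated_T3_le[OF f, where g="%x. hess_bh t x*(p x)^2+hess_bh t x*(q x)^2"])
 note b = potential_form_bound[OF V H(1) d] potential_form_bound[OF V H(2) d]
 show "IB (%x. hess_bh t x*(p x)^2+hess_bh t x*(q x)^2)" using b by simp
 show "BM p" "BM q" using H C1_meas(1) by (auto simp: H1_def)
 show "2*hess_bh t x*<|p x|>*<|q x|> <= hess_bh t x*(p x)^2+hess_bh t x*(q x)^2" for x
 proof -
  have "2*<|p x|>*<|q x|> <= (p x)^2+(q x)^2" using sum_squares_bound[of "<|p x|>" "<|q x|>"] by simp
  from mult_left_mono[OF this hess_bh_nonneg[of x]] show ?thesis by (simp add: algebra_simps)
 qed
 have k: "0 <= (1+4096/\<delta>^3)*M" using d M_ge_1 by (intro mult_nonneg_nonneg add_nonneg_nonneg) auto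
 have "(LI x. hess_bh t x*(p x)^2) <= \<delta>*c+(1+4096/\<delta>^3)*M*a" "(LI x. hess_bh t x*(q x)^2) <= \<delta>*c+(1+4096/\<delta>^3)*M*a"
  using d k a c by (auto intro!: order_trans[OF b(2)] order_trans[OF b(4)] add_mono mult_left_mono)
 thus "(LI x. hess_bh t x*(p x)^2+hess_bh t x*(q x)^2) <= 2*(\<delta>*c+(1+4096/\<delta>^3)*M*a)" using b by simp
qed

definition hall_bound1 :: real where "hall_bound1 = E 2 t/125+10^14*M*E 1 t"
definition hall_bound2 :: real where "hall_bound2 = E 3 t/1600+10^21*M*E 2 t"

lemma M_E_nonneg: "0 <= M*E k t" using M_ge_1 E_nonneg[of k t] by simp

lemma T3_O11: assumes "hess_bh_dominated f" "order1 p" "order1 q" shows "<|T3 f p q|> <= hall_bound1"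
proof -
 have H: "H1 p" "H1 q" using assms by (auto simp: order1_def numeral_2_eq_2 intro: Hs_H1)
 have "<|T3 f p q|> <= 2*(1/1000*(4*E 2 t)+(1+4096/(1/1000)^3)*(M*(4*E 1 t)))"
  by (rule potential_pair[OF assms(1) H]) (use assms in "auto simp: order1_def")
 also have "... <= hall_bound1"
 proof -
  have "0 <= e ==> 0 <= x ==> 2*(1/1000*(4*e)+(1+4096/(1/1000)^3)*(4*x)) <= e/125+10^14*x" for e x :: real by (simp add: power_divide)
  from this[OF E_nonneg M_E_nonneg] show ?thesis by (simp only: hall_bound1_def mult.left_commute[of M] mult.assoc)
 qed
 finally show ?thesis .
qed

lemma T3_O22: assumes "hess_bh_dominated f" "order2 p" "order2 q" shows "<|T3 f p q|> <= hall_bound2"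
proof -
 have H: "H1 p" "H1 q" using assms by (auto simp: order2_def intro: Hs_H1)
 have "<|T3 f p q|> <= 2*(1/40000*(12*E 3 t)+(1+4096/(1/40000)^3)*(M*(4*E 2 t)))"
  by (rule potential_pair[OF assms(1) H]) (use assms in "auto simp: order2_def")
 also have "... <= hall_bound2"
 proof -
  have "0 <= e ==> 0 <= x ==> 2*(1/40000*(12*e)+(1+4096/(1/40000)^3)*(4*x)) <= e/1600+10^21*x" for e x :: real by (simp add: power_divide)
  from this[OF E_nonneg M_E_nonneg] show ?thesis by (simp only: hall_bound2_def mult.left_commute[of M] mult.assoc)
 qed
 finally show ?thesis .
qed

lemma T3_O13: assumes f: "hess_bh_dominated f" and p: "order1 p" and h: "order3 h" shows "<|T3 f p h|> <= hall_bound2" "<|T3 f h p|> <= hall_bound2"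
proof -
 define \<delta> :: real where "\<delta> = 1/40000"
 define Q where "Q = (LI x. (hess_bh t x)^2*(p x)^2)"
 have d: "\<delta> > 0" by (simp add: \<delta>_def)
 have H: "Hs (Suc (Suc 0)) p" using p by (simp add: order1_def numeral_2_eq_2)
 have d2: "\<delta>^2 > 0" using d by simp
 note b = potential_square_bound[OF V H d2]
 have "Q <= \<delta>^2*D2sq p+(16+614656/\<delta>^2)*M*D1sq p" unfolding Q_def by (rule b(2))
 also have "... <= \<delta>^2*(12*E 3 t)+(16+614656/\<delta>^2)*M*(4*E 2 t)"
  using p M_ge_1 by (intro add_mono mult_left_mono) (auto simp: order1_def)
 finally have Q: "Q <= \<delta>^2*(12*E 3 t)+(16+614656/\<delta>^2)*M*(4*E 2 t)" .
 show "<|T3 f p h|> <= hall_bound2"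
 proof (rule hess_bh_dominated_T3_le[OF f, where g="%x. \<delta>*(h x)^2+((hess_bh t x)^2*(p x)^2)/\<delta>"])
  show "BM p" "BM h" using p h by (auto simp: order1_def order3_def Hs_meas)
  have h2: "IB (%x. (h x)^2)" using h by (auto simp: order3_def Hs_L2)
  show "IB (%x. \<delta>*(h x)^2+((hess_bh t x)^2*(p x)^2)/\<delta>)" using h2 b(1) by simp
  show "2*hess_bh t x*<|p x|>*<|h x|> <= \<delta>*(h x)^2+((hess_bh t x)^2*(p x)^2)/\<delta>" for x by (rule weighted_Young[OF d])
  have "(LI x. \<delta>*(h x)^2+((hess_bh t x)^2*(p x)^2)/\<delta>) = \<delta> * L2sq h+Q/\<delta>" using h2 b(1) by (simp add: L2sq_def Q_def)
  also have "... <= \<delta>*(12*E 3 t)+(\<delta>^2*(12*E 3 t)+(16+614656/\<delta>^2)*M*(4*E 2 t))/\<delta>"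
   using h Q d by (intro add_mono mult_left_mono divide_right_mono) (auto simp: order3_def)
  also have "... <= hall_bound2" unfolding hall_bound2_def \<delta>_def using M_E_nonneg[of 2] M_ge_1 E_nonneg[of 2 t] E_nonneg[of 3 t]
   by (simp add: power_divide field_simps)
  finally show "(LI x. \<delta>*(h x)^2+((hess_bh t x)^2*(p x)^2)/\<delta>) <= hall_bound2" .
 qed
 thus "<|T3 f h p|> <= hall_bound2" by (simp add: T3_swap23)
qed

lemma hess_bh_dominated_B: "h ~= 3 ==> hess_bh_dominated (pd i (pd j (B h t)))"
proof -
 assume "h ~= 3"
 hence "<|pd i (pd j (B h t)) x|> <= 2*hess_bh t x" for x using hess_bh_ge[OF t, of h i j x] hess_bh_nonneg[of x] by linarith
 thus ?thesis unfolding hess_bh_dominated_def using C1_meas(1)[OF W_C1(3)[OF t]] by auto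
qed

lemma J_eq: "J 1 t = (%x. pd 2 (B 3 t) x-pd 3 (B 2 t) x)" "J 2 t = (%x. pd 3 (B 1 t) x-pd 1 (B 3 t) x)" "J 3 t = (%x. pd 1 (B 2 t) x-pd 2 (B 1 t) x)"
 by (auto simp: J_def fun_eq_iff)

lemma pd_J: "pd k (J 1 t) = (%x. pd k (pd 2 (B 3 t)) x-pd k (pd 3 (B 2 t)) x)" "pd k (J 2 t) = (%x. pd k (pd 3 (B 1 t)) x-pd k (pd 1 (B 3 t)) x)"
 "pd k (J 3 t) = (%x. pd k (pd 1 (B 2 t)) x-pd k (pd 2 (B 1 t)) x)"
 unfolding J_eq by (simp_all add: pd_diff W_C1[OF t])

lemma hess_bh_dominated_J3: "hess_bh_dominated (pd k (J 3 t))"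
proof -
 have "<|pd k (J 3 t) x|> <= 2*hess_bh t x" for x
  unfolding pd_J using hess_bh_ge[OF t, of 2 k 1 x] hess_bh_ge[OF t, of 1 k 2 x] by (simp add: abs_le_iff)
 thus ?thesis unfolding hess_bh_dominated_def using C1_meas(2)[OF C_inf_C1[OF J_C_inf[OF t]]] by auto
qed

lemma Hs_W: "Hs (Suc (Suc (Suc 0))) (W c i t)" "Hs (Suc (Suc 0)) (pd j (W c i t))" "Hs (Suc 0) (pd k (pd j (W c i t)))"
 "Hs 0 (pd l (pd k (pd j (W c i t))))"
 using W_pds_Hs[OF t, of "Suc (Suc (Suc 0))" "[]" c i] W_pds_Hs[OF t, of "Suc (Suc 0)" "[j]" c i] W_pds_Hs[OF t, of "Suc 0"
 "[k, j]" c i] W_pds_Hs[OF t, of 0 "[l, k, j]" c i] m3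
 by (auto simp: pds_Cons)

lemma Hs_J: "Hs (Suc (Suc 0)) (J i t)" "Hs (Suc 0) (pd k (J i t))" "Hs 0 (pd l (pd k (J i t)))"
proof -
 show "Hs (Suc (Suc 0)) (J i t)" using order1_J[of i] by (simp add: order1_def numeral_2_eq_2)
 thus "Hs (Suc 0) (pd k (J i t))" "Hs 0 (pd l (pd k (J i t)))" by (auto intro: Hs_pd)
qed

lemma stretch_J:
 assumes p: "Hs (Suc 0) p" shows "T3 p (J 1 t) (pd 1 p)+T3 p (J 2 t) (pd 2 p) = 1/2*T3 (pd 3 (J 3 t)) p p"
proof -
 have "(SU l. T3 (J l t) (pd l p) p+T3 (J l t) p (pd l p)) = 0" by (rule transport_zero[OF Hs_J(1) div_J[OF t] p p])
 hence "(SU l. T3 p (J l t) (pd l p)) = 0"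
  using T3_swap12[of "J _ t" p "pd _ p"] T3_swap23[of "J _ t" "pd _ p" p] by (simp flip: sum_distrib_left)
 moreover have "T3 (pd 3 (J 3 t)) p p+T3 (J 3 t) (pd 3 p) p+T3 (J 3 t) p (pd 3 p) = 0" by (rule T3_ibp[OF Hs_J(1) p p])
 ultimately show ?thesis using T3_swap12[of "J 3 t" p "pd 3 p"] T3_swap23[of "J 3 t" "pd 3 p" p] unfolding sum_3 by linarith
qed

lemma pds_hall_flux_1: "pds [k] (hall_flux i r t) x = (pd k (B i t) x*J r t x-pd k (B r t) x*J i t x)+(B i t x*pd k (J r t) x-B r t x*pd k (J i t) x)"
 unfolding hall_flux_def[abs_def] using W_C1[OF t] C_inf_C1[OF J_C_inf[OF t]] by (simp add: pds_Cons pd_diff pd_mult C1_mult)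

lemma hall_work_1: "hall_work [k] t = - int_det (%i. pd k (B i t)) (%i. J i t) (%i. pd k (J i t))"
proof -
 define q where "q i = pd k (J i t)" for i
 have i: "IB (%x. pds [k] (hall_flux i l t) x*pds (l # [k]) (B i t) x)" for i l
  by (rule L2_le_inner(1)[OF pds_hall_flux_L2_le[OF t, of _ 3] W_L2_le[OF t, of _ 3]]) (use m3 in auto)
 have commute: "pds (l # [k]) (B i t) = pd k (pd l (B i t))" for l i using pd_commute[OF W_C_inf[OF t]] by (simp add: pds_Cons)
 have pointwise: "(SU i. SU l. pds [k] (hall_flux i l t) x*pds (l # [k]) (B i t) x) = - det3 (%i. pd k (B i t) x) (%i. J i t x) (%i. q i x)" for x
 proof -
  define e where "e l i = pd k (pd l (B i t)) x" for l i
  have q: "q 1 x = e 2 3-e 3 2" "q 2 x = e 3 1-e 1 3" "q 3 x = e 1 2-e 2 1" unfolding q_def pd_J e_def by auto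
  note H = hall_algebra[of "%i. q i x" e, OF q]
  have "(SU i. SU l. pds [k] (hall_flux i l t) x*pds (l # [k]) (B i t) x)
   = (SU i. SU l. (pd k (B i t) x*J l t x-pd k (B l t) x*J i t x)*e l i)+(SU i. SU l. (B i t x*q l x-B l t x*q i x)*e l i)"
   unfolding commute pds_hall_flux_1 e_def q_def by (simp add: distrib_right sum.distrib)
  also have "... = - det3 (%i. pd k (B i t) x) (%i. J i t x) (%i. q i x)" unfolding H by (simp add: det3_def)
  finally show ?thesis .
 qed
 have "hall_work [k] t = (LI x. SU i. SU l. pds [k] (hall_flux i l t) x*pds (l # [k]) (B i t) x)"
  unfolding hall_work_def using i by (simp add: integral_sum integrable_sum)
 also have "... = - int_det (%i. pd k (B i t)) (%i. J i t) q"
  unfolding pointwise q_def using int_det_det3[OF Hs_triple_integrable[OF Hs_W(2) Hs_J(1) Hs_J(2), of k False]] by simp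
 finally show ?thesis unfolding q_def .
qed

lemma hall_work_1_bound: "<|hall_work [k] t|> <= 9*hall_bound1"
proof -
 define P where "P i = pd k (B i t)" for i
 have OP: "order1 (P i)" and HP: "Hs (Suc (Suc 0)) (P i)" for i unfolding P_def by (rule order1_W Hs_W)+
 have vP: "h ~= 3 ==> hess_bh_dominated (pd l (P h))" for h l unfolding P_def by (rule hess_bh_dominated_B)
 have vertical: "<|T3 (P 1) (J 2 t) (pd k (J 3 t))|> <= hall_bound1" "<|T3 (P 2) (J 1 t) (pd k (J 3 t))|> <= hall_bound1"
  unfolding T3_rotate[of _ _ "pd k (J 3 t)"] by (rule T3_O11[OF hess_bh_dominated_J3 OP order1_J])+
 have horizontal: "<|T3 (P h) (J 3 t) (pd k (J i t))|> <= 2*hall_bound1" if "h ~= 3" for h i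
 proof (rule T3_ibp_bound[OF HP Hs_J(1) Hs_J(1)])
  show "<|T3 (pd k (P h)) (J 3 t) (J i t)|> <= hall_bound1" by (rule T3_O11[OF vP[OF that] order1_J order1_J])
  show "<|T3 (P h) (pd k (J 3 t)) (J i t)|> <= hall_bound1" unfolding T3_swap12[of "P h"] by (rule T3_O11[OF hess_bh_dominated_J3 OP order1_J])
 qed
 have commute: "pd k (pd l (B 3 t)) = pd l (P 3)" for l unfolding P_def by (rule pd_commute[OF W_C_inf[OF t]])
 have J2: "T3 (P 3) (J 1 t) (pd k (J 2 t)) = T3 (P 3) (J 1 t) (pd k (pd 3 (B 1 t)))-T3 (P 3) (J 1 t) (pd 1 (P 3))"
  unfolding pd_J commute by (rule T3_diff3[OF HP Hs_J(1) Hs_W(3) Hs_pd[OF Hs_mono[OF HP, of "Suc (Suc 0)"]]]) auto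
 have J1: "T3 (P 3) (J 2 t) (pd k (J 1 t)) = T3 (P 3) (J 2 t) (pd 2 (P 3))-T3 (P 3) (J 2 t) (pd k (pd 3 (B 2 t)))"
  unfolding pd_J commute by (rule T3_diff3[OF HP Hs_J(1) Hs_pd[OF Hs_mono[OF HP, of "Suc (Suc 0)"]] Hs_W(3)]) auto
 have hessian: "<|T3 (P 3) (J i t) (pd k (pd 3 (B h t)))|> <= hall_bound1" if "h ~= 3" for i h
  unfolding T3_rotate[of _ _ "pd k (pd 3 (B h t))"] by (rule T3_O11[OF hess_bh_dominated_B[OF that] OP order1_J])
 have stretch: "T3 (P 3) (J 1 t) (pd 1 (P 3))+T3 (P 3) (J 2 t) (pd 2 (P 3)) = 1/2*T3 (pd 3 (J 3 t)) (P 3) (P 3)"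
  by (rule stretch_J[OF Hs_mono[OF HP]]) simp
 have "<|T3 (pd 3 (J 3 t)) (P 3) (P 3)|> <= hall_bound1" by (rule T3_O11[OF hess_bh_dominated_J3 OP OP])
 with stretch show ?thesis unfolding hall_work_1 int_det_def P_def[symmetric] J1 J2
  using vertical horizontal[of 1 2] horizontal[of 2 1] hessian[of 1 1] hessian[of 2 2] by (simp add: abs_le_iff)
qed

lemma norm_uh_measurable: "BM (norm_uh t)"
proof -
 have "norm_uh t x = sqrt ((U 1 t x)^2+(U 2 t x)^2)" for x
  by (simp add: norm_uh_def horiz_def W_def norm_eq_sqrt_inner inner_vec_def sum_3 power2_eq_square)
 thus ?thesis using C1_meas(1)[OF W_C1(1)[OF t, of True]] by (simp add: fun_eq_iff[symmetric] cong: measurable_cong)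
qed

lemma T3_velocity_bound:
 assumes h: "h ~= 3" and f: "order2 f" and g: "order1 g" and d: "\<delta> > 0" "4096*(1/10^14)^2 <= (\<delta>^2)^3"
 shows "<|T3 (U h t) f g|> <= 4*\<delta>*E 2 t+2*M/\<delta>*E 1 t"
proof -
 define Q where "Q = (LI x. (norm_uh t x)^2*(g x)^2)"
 have Hg: "H1 g" using g by (auto simp: order1_def numeral_2_eq_2 intro: Hs_H1)
 have u0: "0 <= norm_uh t x" for x by (simp add: norm_uh_def)
 note s = Serrin_form_bound[OF norm_uh_measurable u0 _ S d(2) _ Hg]
 have "Q <= \<delta>^2*D1sq g+M * L2sq g" unfolding Q_def by (rule s(2)) (use M_ge_1 in auto)
 also have "... <= \<delta>^2*(4*E 2 t)+M*(4*E 1 t)" using g M_ge_1 by (intro add_mono mult_left_mono) (auto simp: order1_def)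
 finally have Q: "Q <= \<delta>^2*(4*E 2 t)+M*(4*E 1 t)" .
 have i: "IB (%x. (f x)^2)" "IB (%x. (norm_uh t x)^2*(g x)^2)" using f s(1) M_ge_1 by (auto simp: order2_def Hs_L2)
 have ib: "IB (%x. 1/2*(\<delta>*(f x)^2+((norm_uh t x)^2*(g x)^2)/\<delta>))" using i by simp
 have pt: "<|U h t x*f x*g x|> <= 1/2*(\<delta>*(f x)^2+((norm_uh t x)^2*(g x)^2)/\<delta>)" for x
 proof -
  have "<|U h t x*f x*g x|> = <|U h t x|>*(<|g x|>*<|f x|>)" by (simp add: abs_mult mult_ac)
  also have "... <= norm_uh t x*(<|g x|>*<|f x|>)" by (rule mult_right_mono[OF norm_uh_ge[OF h]]) simp
  finally show ?thesis using weighted_Young[OF d(1), of "norm_uh t x" "g x" "f x"] by simp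
 qed
 have "BM f" "BM g" using f g Hs_meas by (auto simp: order1_def order2_def)
 hence "IB (%x. U h t x*f x*g x)"
  by (intro integrable_bound[OF ib]) (use C1_meas(1)[OF W_C1(1)[OF t, of True h]] pt in "auto intro: order_trans[OF _ abs_ge_self]")
 hence "<|T3 (U h t) f g|> <= (LI x. 1/2*(\<delta>*(f x)^2+((norm_uh t x)^2*(g x)^2)/\<delta>))"
  unfolding T3_def real_norm_def[symmetric] by (rule Bochner_Integration.integral_norm_bound_integral[OF _ ib]) (use pt in simp)
 also have "... = 1/2*(\<delta> * L2sq f+Q/\<delta>)" using i by (simp add: L2sq_def Q_def)
 also have "... <= 1/2*(\<delta>*(4*E 2 t)+(\<delta>^2*(4*E 2 t)+M*(4*E 1 t))/\<delta>)"
  using f Q d by (intro mult_left_mono add_mono divide_right_mono) (auto simp: order2_def)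
 also have "... = 4*\<delta>*E 2 t+2*M/\<delta>*E 1 t" using d by (simp add: field_simps power2_eq_square)
 finally show ?thesis .
qed

definition transport_bound :: real where "transport_bound = E 2 t/1000+2816*10^6*(M+F 1 t)*E 1 t"

lemma T3_velocity_gradient:
 assumes h: "h ~= 3" and p: "order1 p" and q: "order1 q"
 shows "<|T3 (pd k (U h t)) p q|> <= transport_bound"
proof -
 define \<delta> :: real where "\<delta> = 1/8000"
 have d: "\<delta> > 0" "4096*(1/10^14)^2 <= (\<delta>^2)^3" by (simp_all add: \<delta>_def power_divide)
 define X where "X = 4*\<delta>*E 2 t+2*M/\<delta>*E 1 t"
 have "T3 (pd k (U h t)) p q+T3 (U h t) (pd k p) q+T3 (U h t) p (pd k q) = 0"
  by (rule T3_ibp[OF Hs_W(1) Hs_mono Hs_mono]) (use p q in "auto simp: order1_def")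
 moreover have "<|T3 (U h t) (pd k p) q|> <= X" unfolding X_def by (rule T3_velocity_bound[OF h order1_pd[OF p] q d])
 moreover have "<|T3 (U h t) p (pd k q)|> <= X"
  unfolding X_def T3_swap23[of "U h t" p] by (rule T3_velocity_bound[OF h order1_pd[OF q] p d])
 ultimately have "<|T3 (pd k (U h t)) p q|> <= 2*X" by linarith
 also have "... = E 2 t/1000+32000*M*E 1 t" by (simp add: X_def \<delta>_def)
 also have "... <= transport_bound" unfolding transport_bound_def
  using M_ge_1 F_nonneg[of 1 t] E_nonneg[of 1 t] by (intro add_left_mono mult_right_mono) auto
 finally show ?thesis .
qed

lemma T3_magnetic_gradient:
 assumes h: "h ~= 3" and p: "order1 p" and q: "order1 q"
 shows "<|T3 (pd k (B h t)) p q|> <= transport_bound"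
proof -
 define L where "L = M+L2sq (B h t)+D1sq (B h t)"
 have L1: "L >= 1" unfolding L_def using M_ge_1 L2sq_nonneg[of "B h t"] D1sq_nonneg[of "B h t"] by linarith
 have LF: "L <= M+F 1 t" unfolding L_def F_def using L2sq_le_E[of "[]" False h t] D1sq_le_E[of "[]" False h t] by simp
 have cg: "(LI x. <|pd k (B h t) x|>^3) <= 400000*(L * sqrt L)"
  unfolding L_def by (rule cubic_gradient_bound[OF _ V hess_bh_ge[OF t h]]) (use Hs_mono[OF Hs_W(1)] in "simp add: numeral_2_eq_2")
 have pm: "BM (pd k (B h t))" by (rule C1_meas(1)[OF W_C1(2)[OF t]])
 have i3: "IB (%x. <|pd k (B h t) x|>^3)"
  using integrable_abs[OF Hs_triple_integrable[OF Hs_W(2) Hs_W(2) Hs_W(2), of k False h k False h k False h]]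
  by (simp add: abs_mult power3_eq_cube mult_ac)
 have qm: "BM q" "IB (%x. (q x)^2)" "BM p" using q p by (auto simp: order1_def Hs_meas Hs_L2)
 have Hp: "H1 p" using p by (auto simp: order1_def numeral_2_eq_2 intro: Hs_H1)
 note w = L3_weight_bound[where g="%x. <|pd k (B h t) x|>" and p=p and q=q and L=L and \<epsilon>="1/8000"]
 have "<|T3 (pd k (B h t)) p q|> <= (LI x. <|pd k (B h t) x|>*<|p x|>*<|q x|>)"
  unfolding T3_def using integral_norm_bound[of lborel "%x. pd k (B h t) x*p x*q x"] by (simp add: abs_mult)
 also have "... <= 1/8000*D1sq p+88000/(1/8000)*L * L2sq q" using w qm i3 cg L1 Hp pm by auto
 also have "... <= 1/8000*(8*E 2 t)+88000/(1/8000)*(M+F 1 t)*(4*E 1 t)"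
  using p q LF L1 E_nonneg[of 2 t] L2sq_nonneg D1sq_nonneg[of p] by (intro add_mono mult_mono mult_nonneg_nonneg) (auto simp: order1_def)
 also have "... = transport_bound" unfolding transport_bound_def by (simp add: algebra_simps)
 finally show ?thesis .
qed

lemma T3_horizontal_gradient: "h ~= 3 ==> order1 p ==> order1 q ==> <|T3 (pd k (W c h t)) p q|> <= transport_bound"
 using T3_velocity_gradient T3_magnetic_gradient by (cases c) auto

lemma div_W: "(SU l. pd l (W c l t) x) = 0" using div_pds[OF t, of "[]" c x] by simp

text \<open>Horizontal gradient components are controlled directly; a purely vertical triple is reduced to
them by incompressibility of the middle field.\<close>
lemma gradient_triple_bound: "<|T3 (pd k (W c l t)) (pd l (W d i t)) (pd k (W e i t))|> <= 2*transport_bound"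
proof -
 have Z0: "0 <= transport_bound" unfolding transport_bound_def using E_nonneg[of 1 t] E_nonneg[of 2 t] F_nonneg[of 1 t] M_ge_1
  by (intro add_nonneg_nonneg mult_nonneg_nonneg) auto
 note g = T3_horizontal_gradient[OF _ order1_W order1_W]
 consider "l ~= 3" | "i ~= 3" | "l = 3" "i = 3" by blast
 thus ?thesis
 proof cases
  case 1 thus ?thesis using g[of l k c l d i k e i] Z0 by simp
 next
  case 2 thus ?thesis using g[of i k e k c l l d i] Z0 unfolding T3_rotate[of _ _ "pd k (W e i t)"] by simp
 next
  case 3
  define p q where "p = pd k (W c 3 t)" and "q = pd k (W e 3 t)"
  have "pd 3 (W d 3 t) = (%x. - pd 1 (W d 1 t) x-pd 2 (W d 2 t) x)" using div_W[of d] unfolding sum_3 by (auto simp: fun_eq_iff) (smt (verit))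
  hence "T3 p (pd 3 (W d 3 t)) q = (LI x. - (pd 1 (W d 1 t) x*p x*q x)-pd 2 (W d 2 t) x*p x*q x)"
   unfolding T3_def by (simp add: algebra_simps)
  also have "... = - T3 (pd 1 (W d 1 t)) p q-T3 (pd 2 (W d 2 t)) p q"
   unfolding T3_def p_def q_def using Hs_triple_integrable[OF Hs_W(2) Hs_W(2) Hs_W(2)] by simp
  finally show ?thesis using g[of 1 1 d k c 3 k e 3] g[of 2 2 d k c 3 k e 3] 3 unfolding p_def q_def by simp
 qed
qed

definition transport_lap :: "bool => scalar => scalar => real" where
 "transport_lap s f g = (SU k. SU l. T3 (W s l t) (pd l f) (pd k (pd k g)))"

lemma transport_lap_sym:
 assumes f: "Hs (Suc (Suc (Suc 0))) f" and g: "Hs (Suc (Suc (Suc 0))) g"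
 shows "transport_lap s f g+transport_lap s g f = - (SU k. SU l. T3 (pd k (W s l t)) (pd l f) (pd k g)+T3 (pd k (W s l t)) (pd l g) (pd k f))"
proof -
 have ib: "T3 (W s l t) (pd l p) (pd k (pd k q))
  = - T3 (pd k (W s l t)) (pd l p) (pd k q)-T3 (W s l t) (pd l (pd k p)) (pd k q)" if "Hs (Suc (Suc (Suc 0))) p" "Hs (Suc (Suc (Suc 0))) q" for k l p q
  using T3_ibp[OF Hs_W(1)[of s l] Hs_pd[OF that(1), of l] Hs_pd[OF that(2), of k], of k] pd_commute[OF Hs_C_inf[OF that(1)], of k l] by simp
 have tz: "(SU l. T3 (W s l t) (pd l (pd k f)) (pd k g)+T3 (W s l t) (pd l (pd k g)) (pd k f)) = 0" for k
  using transport_zero[OF Hs_W(1) div_W Hs_pd[OF f, of k] Hs_pd[OF g, of k]] unfolding T3_swap23[of _ "pd k f"] .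
 have "transport_lap s f g+transport_lap s g f = (SU k. SU l. - (T3 (pd k (W s l t)) (pd l f) (pd k g)+T3 (pd k (W s l t)) (pd l g) (pd k f)))
  - (SU k. SU l. T3 (W s l t) (pd l (pd k f)) (pd k g)+T3 (W s l t) (pd l (pd k g)) (pd k f))"
  unfolding transport_lap_def ib[OF f g] ib[OF g f] sum.distrib[symmetric] sum_subtractf[symmetric] by (intro sum.cong refl) simp
 thus ?thesis unfolding tz sum_negf by simp
qed

lemma transport_lap_sym_bound: "<|transport_lap s (W c j t) (W d j t)+transport_lap s (W d j t) (W c j t)|> <= 36*transport_bound"
proof -
 have "<|transport_lap s (W c j t) (W d j t)+transport_lap s (W d j t) (W c j t)|> <= (SU k::3. SU l::3. 4*transport_bound)"
  unfolding transport_lap_sym[OF Hs_W(1) Hs_W(1)] abs_minus_cancel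
 proof (rule order_trans[OF sum_abs sum_mono], rule order_trans[OF sum_abs sum_mono])
  fix k l
  show "<|T3 (pd k (W s l t)) (pd l (W c j t)) (pd k (W d j t))+T3 (pd k (W s l t)) (pd l (W d j t)) (pd k (W c j t))|> <= 4*transport_bound"
   using gradient_triple_bound[of k s l c j d] gradient_triple_bound[of k s l d j c] by linarith
 qed
 thus ?thesis by simp
qed

lemma transport_lap_eq:
 shows "(LI x. adv s c j t x*(SU k. pd k (pd k (W d i t)) x)) = transport_lap s (W c j t) (W d i t)" (is ?A)
 and "IB (%x. adv s c j t x*(SU k. pd k (pd k (W d i t)) x))" (is ?B)
proof -
 have e: "adv s c j t x*(SU k. pd k (pd k (W d i t)) x) = (SU k. SU l. W s l t x*pd l (W c j t) x*pd k (pd k (W d i t)) x)" for x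
  unfolding adv_def sum_distrib_left sum_distrib_right by (rule refl)
 have i: "IB (%x. W s l t x*pd l (W c j t) x*pd k (pd k (W d i t)) x)" for k l
  by (rule Hs_triple_integrable[OF Hs_W(1) Hs_W(2) Hs_W(3)]) simp
 show ?A unfolding e transport_lap_def T3_def using i by (simp add: integral_sum integrable_sum)
 show ?B unfolding e using i by (intro integrable_sum)
qed

lemma transport_work_0_bound: "<|transport_work [] t|> <= 216*transport_bound"
proof -
 define X where "X s c d j = transport_lap s (W c j t) (W d j t)+transport_lap s (W d j t) (W c j t)" for s c d j
 have "(LI x. nonlin c j t x*(SU k. pd k (pd k (W c j t)) x))
  = transport_lap False (W (~c) j t) (W c j t)-transport_lap True (W c j t) (W c j t)" for c j
  unfolding nonlin_def left_diff_distrib using transport_lap_eq[of _ _ j c j] by simp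
 hence "transport_work [] t = (SU j. X False False True j-1/2*X True True True j-1/2*X True False False j)"
  unfolding transport_work_def X_def by (simp add: UNIV_bool pds_Cons sum.distrib sum_subtractf)
 also have "<|...|> <= (SU j::3. 72*transport_bound)"
 proof (rule order_trans[OF sum_abs sum_mono])
  fix j
  have "<|X s c d j|> <= 36*transport_bound" for s c d unfolding X_def by (rule transport_lap_sym_bound)
  from this[of False False True] this[of True True True] this[of True False False]
  show "<|X False False True j-1/2*X True True True j-1/2*X True False False j|> <= 72*transport_bound" by linarith
 qed
 finally show ?thesis by simp
qed

lemma level_1_rate: "- 2*(E 2 t+(SUM v:words 0. transport_work v t)+(SUM w:words (Suc 0). hall_work w t)) <= - E 2 t+10^17*(M+F 1 t)*E 1 t"
proof -
 let ?hall = "SUM w:words (Suc 0). hall_work w t"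
 have "<|SUM w:words (Suc 0). hall_work w t|> <= (SU k::3. 9*hall_bound1)"
 proof -
  have "?hall = (SU k. hall_work [k] t)" by (simp add: sum_words_Suc words_0)
  thus ?thesis by (simp only:) (rule order_trans[OF sum_abs sum_mono[OF hall_work_1_bound]])
 qed
 hence h: "<|SUM w:words (Suc 0). hall_work w t|> <= 27*hall_bound1" by simp
 have "- 2*(E 2 t+(SUM v:words 0. transport_work v t)+?hall) <= - 2*E 2 t+432*transport_bound+54*hall_bound1"
  using h transport_work_0_bound by (simp add: words_0 abs_le_iff)
 also have "... = - 2*E 2 t+432*(E 2 t/1000+2816*10^6*(M*E 1 t+F 1 t*E 1 t))+54*(E 2 t/125+10^14*(M*E 1 t))"
  unfolding transport_bound_def hall_bound1_def by (simp add: algebra_simps)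
 also have "... <= - E 2 t+10^17*(M*E 1 t+F 1 t*E 1 t)"
 proof -
  have "0 <= e ==> 0 <= x ==> 0 <= y ==> - 2*e+432*(e/1000+2816*10^6*(x+y))+54*(e/125+10^14*x) <= - e+10^17*(x+y)" for e x y :: real by simp
  from this[OF E_nonneg M_E_nonneg] show ?thesis using F_nonneg[of 1 t] E_nonneg[of 1 t] by (meson mult_nonneg_nonneg)
 qed
 also have "... = - E 2 t+10^17*(M+F 1 t)*E 1 t" by (simp add: algebra_simps)
 finally show ?thesis .
qed

definition defect :: "3 => 3 => real" where
 "defect k l = T3 (pd k (B 3 t)) (pd 1 (pd l (B 3 t))) (pd k (pd 2 (pd l (B 3 t))))-T3 (pd k (B 3 t)) (pd 2 (pd l (B 3 t))) (pd k (pd 1 (pd l (B 3 t))))"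

lemma defect_sum: "(SU k. SU l. defect k l) = 0"
proof -
 define c where "c = B 3 t"
 have C: "C_inf c" "C_inf (pd l c)" for l unfolding c_def using W_C_inf[OF t] C_inf_pd by auto
 define N where "N k l = T3 (pd 1 (pd k c)) (pd 2 (pd l c)) (pd k (pd l c))" for k l
 have "defect k l = N k l-N l k" for k l
 proof -
  define g where "g = pd k (pd l c)"
  have g: "pd k (pd i (pd l c)) = pd i g" for i unfolding g_def by (rule pd_commute[OF C(2)])
  have H: "Hs (Suc (Suc 0)) (pd k c)" "Hs (Suc 0) (pd i (pd l c))" "Hs (Suc 0) g" for i unfolding c_def g_def by (rule Hs_W)+
  have first: "T3 (pd 2 (pd k c)) (pd 1 (pd l c)) g+T3 (pd k c) (pd 2 (pd 1 (pd l c))) g+T3 (pd k c) (pd 1 (pd l c)) (pd 2 g) = 0"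
   by (rule T3_ibp[OF H(1) H(2) H(3)])
  have second: "T3 (pd 1 (pd k c)) (pd 2 (pd l c)) g+T3 (pd k c) (pd 1 (pd 2 (pd l c))) g+T3 (pd k c) (pd 2 (pd l c)) (pd 1 g) = 0"
   by (rule T3_ibp[OF H(1) H(2) H(3)])
  have swap: "pd 2 (pd 1 (pd l c)) = pd 1 (pd 2 (pd l c))" by (rule pd_commute[OF C(2)])
  have flip: "N l k = T3 (pd 2 (pd k c)) (pd 1 (pd l c)) g" unfolding N_def g_def pd_commute[OF C(1), of l k] by (rule T3_swap12)
  show ?thesis unfolding defect_def c_def[symmetric] g flip using first second unfolding swap N_def g_def[symmetric] by linarith
 qed
 hence "(SU k. SU l. defect k l) = (SU k. SU l. N k l)-(SU k. SU l. N l k)" by (simp add: sum_subtractf)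
 also have "(SU k. SU l. N l k) = (SU k. SU l. N k l)" by (rule sum.swap)
 finally show ?thesis by simp
qed

lemma order2_W: "order2 (pd k (pd l (W c i t)))" and order3_W: "order3 (pd j (pd k (pd l (W c i t))))" and order2_J: "order2 (pd k (J i t))"
 and order3_J: "order3 (pd l (pd k (J i t)))"
 using order1_pd[OF order1_W] order2_pd[OF order1_pd[OF order1_W]] order1_pd[OF order1_J] order2_pd[OF order1_pd[OF order1_J]] by auto

text \<open>The part of the determinant in which two vertical derivatives of \<open>B 3\<close> meet is not controlled
by the horizontal Hessian; it equals \<open>defect\<close>, which sums to zero.\<close>
lemma int_det_mid: "<|int_det (%i. pd k (B i t)) (%i. pd l (J i t)) (%i. pd k (pd l (J i t)))-defect k l|> <= 12*hall_bound2"
proof -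
 define p where "p i = pd k (B i t)" for i
 define r where "r i = pd l (J i t)" for i
 define a where "a i = pd i (pd l (B 3 t))" for i
 define h where "h i = pd l (pd 3 (B i t))" for i
 have Op: "order1 (p i)" "order2 (pd k (p i))" and Or: "order2 (r i)" "order3 (pd k (r i))" and Oa: "order2 (a i)" "order3 (pd k (a i))" for i
  unfolding p_def r_def a_def using order1_W order2_W order3_W order2_J order3_J by auto
 have vr: "hess_bh_dominated (r 3)" and vh: "i ~= 3 ==> hess_bh_dominated (h i)" for i unfolding r_def h_def
  using hess_bh_dominated_J3 hess_bh_dominated_B by auto
 have Hp: "Hs (Suc (Suc 0)) (p i)" and Hr: "Hs (Suc 0) (r i)" and Ha: "Hs (Suc 0) (a i)" and Hh: "Hs (Suc 0) (h i)" for i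
  unfolding p_def r_def a_def h_def using Hs_W Hs_J by auto
 have by_parts: "<|T3 (p i) f (pd k g)|> <= 2*hall_bound2" if f: "order2 f" "order3 (pd k f)" "Hs (Suc 0) f"
  and g: "hess_bh_dominated g" "Hs (Suc 0) g" for i f g
 proof (rule T3_ibp_bound[OF Hp f(3) g(2)])
  show "<|T3 (pd k (p i)) f g|> <= hall_bound2" unfolding T3_rotate[of _ _ g] by (rule T3_O22[OF g(1) Op(2) f(1)])
  show "<|T3 (p i) (pd k f) g|> <= hall_bound2" unfolding T3_rotate[of _ _ g] by (rule T3_O13(1)[OF g(1) Op(1) f(2)])
 qed
 have direct: "<|T3 (p i) f (pd k (r j))|> <= hall_bound2" if "hess_bh_dominated f" for i j f
  unfolding T3_swap12[of "p i"] by (rule T3_O13(1)[OF that Op(1) Or(2)])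
 have commute: "pd l (pd i (B 3 t)) = a i" for i unfolding a_def by (rule pd_commute[OF W_C_inf[OF t]])
 have r1: "r 1 = (%x. a 2 x-h 2 x)" and r2: "r 2 = (%x. h 1 x-a 1 x)" using pd_J(1,2)[of l] unfolding r_def commute by (simp_all add: h_def)
 have q1: "pd k (r 1) = (%x. pd k (a 2) x-pd k (h 2) x)" and q2: "pd k (r 2) = (%x. pd k (h 1) x-pd k (a 1) x)"
  unfolding r1 r2 using Hs_C1[OF Ha] Hs_C1[OF Hh] by (simp_all add: pd_diff)
 have H0: "Hs 0 (pd k (r i))" "Hs 0 (pd k (a i))" "Hs 0 (pd k (h i))" for i using Hr Ha Hh Hs_pd by blast+
 have r12: "T3 (p 3) (r 1) (pd k (r 2)) = T3 (p 3) (a 2) (pd k (h 1))-T3 (p 3) (a 2) (pd k (a 1))-T3 (p 3) (h 2) (pd k (r 2))"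
  using T3_diff3(2)[OF Hp[of 3] H0(1)[of 2] Ha[of 2] Hh[of 2]] T3_diff3(1)[OF Hp[of 3] Ha[of 2] H0(3)[of 1] H0(2)[of 1]]
  unfolding r1[symmetric] q2[symmetric] by simp
 have r21: "T3 (p 3) (r 2) (pd k (r 1)) = T3 (p 3) (h 1) (pd k (r 1))-(T3 (p 3) (a 1) (pd k (a 2))-T3 (p 3) (a 1) (pd k (h 2)))"
  using T3_diff3(2)[OF Hp[of 3] H0(1)[of 1] Hh[of 1] Ha[of 1]] T3_diff3(1)[OF Hp[of 3] Ha[of 1] H0(2)[of 2] H0(3)[of 2]]
  unfolding r2[symmetric] q1[symmetric] by simp
 have "defect k l = T3 (p 3) (a 1) (pd k (a 2))-T3 (p 3) (a 2) (pd k (a 1))" by (simp add: defect_def p_def a_def)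
 hence "int_det p r (%i. pd k (r i))-defect k l
  = T3 (p 1) (r 2) (pd k (r 3))-T3 (p 1) (r 3) (pd k (r 2))+T3 (p 2) (r 3) (pd k (r 1))-T3 (p 2) (r 1) (pd k (r 3))
  + (T3 (p 3) (a 2) (pd k (h 1))-T3 (p 3) (h 2) (pd k (r 2)))-(T3 (p 3) (h 1) (pd k (r 1))+T3 (p 3) (a 1) (pd k (h 2)))"
  unfolding int_det_def r12 r21 by simp
 hence "<|int_det p r (%i. pd k (r i))-defect k l|> <= 12*hall_bound2"
  using by_parts[OF Or Hr vr Hr, of 1 2] by_parts[OF Or Hr vr Hr, of 2 1] direct[OF vr, of 1 2] direct[OF vr, of 2 1]
  by_parts[OF Oa Ha vh[of 1] Hh, of 3 2] by_parts[OF Oa Ha vh[of 2] Hh, of 3 1] direct[OF vh, of 2 3 2] direct[OF vh, of 1 3 1]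
  by (simp add: abs_le_iff)
 thus ?thesis unfolding p_def r_def .
qed

lemma int_det_top: "<|int_det (%i. pd k (pd l (B i t))) (%i. J i t) (%i. pd k (pd l (J i t)))|> <= 9*hall_bound2"
proof -
 define P where "P i = pd k (pd l (B i t))" for i
 define Q where "Q i = pd k (pd l (J i t))" for i
 define h where "h i = pd l (pd 3 (B i t))" for i
 have OP: "order2 (P i)" "order3 (pd j (P i))" and OQ: "order3 (Q i)" for i j unfolding P_def Q_def using order2_W order3_W order3_J by auto
 have vP: "i ~= 3 ==> hess_bh_dominated (P i)" and vh: "i ~= 3 ==> hess_bh_dominated (h i)" for i unfolding P_def h_def using hess_bh_dominated_B
  by auto
 have HP: "Hs (Suc 0) (P i)" and Hh: "Hs (Suc 0) (h i)" for i unfolding P_def h_def using Hs_W by auto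
 have direct: "<|T3 (P i) (J j t) (Q n)|> <= hall_bound2" if "i ~= 3" for i j n by (rule T3_O13(1)[OF vP[OF that] order1_J OQ])
 have commute: "pd k (pd l (pd i (B 3 t))) = pd i (P 3)" for i
  unfolding P_def pd_commute[OF W_C_inf[OF t], of l i] by (rule pd_commute[OF C_inf_pd[OF W_C_inf[OF t]]])
 have Q1: "Q 1 = (%x. pd 2 (P 3) x-pd k (h 2) x)" and Q2: "Q 2 = (%x. pd k (h 1) x-pd 1 (P 3) x)"
  unfolding Q_def pd_J commute[symmetric] h_def using W_C1(3)[OF t] by (simp_all add: pd_diff)
 have by_parts: "<|T3 (P 3) (J j t) (pd k (h i))|> <= 2*hall_bound2" if "i ~= 3" for i j
 proof (rule T3_ibp_bound[OF HP Hs_J(1) Hh])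
  show "<|T3 (pd k (P 3)) (J j t) (h i)|> <= hall_bound2" unfolding T3_rotate[of _ _ "h i"] by (rule T3_O13(2)[OF vh[OF that] order1_J OP(2)])
  show "<|T3 (P 3) (pd k (J j t)) (h i)|> <= hall_bound2" unfolding T3_rotate[of _ _ "h i"] by (rule T3_O22[OF vh[OF that] OP(1) order2_J])
 qed
 have H0: "Hs 0 (pd j (P i))" "Hs 0 (pd k (h i))" for i j using HP Hh Hs_pd by blast+
 have J1Q2: "T3 (P 3) (J 1 t) (Q 2) = T3 (P 3) (J 1 t) (pd k (h 1))-T3 (P 3) (J 1 t) (pd 1 (P 3))"
  unfolding Q2 by (rule T3_diff3(1)[OF HP Hs_J(1) H0(2) H0(1)]) simp
 have J2Q1: "T3 (P 3) (J 2 t) (Q 1) = T3 (P 3) (J 2 t) (pd 2 (P 3))-T3 (P 3) (J 2 t) (pd k (h 2))"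
  unfolding Q1 by (rule T3_diff3(1)[OF HP Hs_J(1) H0(1) H0(2)]) simp
 have "<|T3 (pd 3 (J 3 t)) (P 3) (P 3)|> <= hall_bound2" by (rule T3_O22[OF hess_bh_dominated_J3 OP(1) OP(1)])
 hence "<|int_det P (%i. J i t) Q|> <= 9*hall_bound2" unfolding int_det_def J1Q2 J2Q1
  using direct[of 1 2 3] direct[of 1 3 2] direct[of 2 3 1] direct[of 2 1 3] by_parts[of 1 1] by_parts[of 2 2] stretch_J[OF HP, of 3]
  by (simp add: abs_le_iff)
 thus ?thesis unfolding P_def Q_def .
qed

lemma pds_hall_flux_2:
 "pds [k, l] (hall_flux i r t) x = (pd k (pd l (B i t)) x*J r t x-pd k (pd l (B r t)) x*J i t x)
 + (pd l (B i t) x*pd k (J r t) x-pd l (B r t) x*pd k (J i t) x)+(pd k (B i t) x*pd l (J r t) x-pd k (B r t) x*pd l (J i t) x)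
 + (B i t x*pd k (pd l (J r t)) x-B r t x*pd k (pd l (J i t)) x)"
proof -
 have e: "pds [l] (hall_flux i r t) = (%x. (pd l (B i t) x*J r t x-pd l (B r t) x*J i t x)+(B i t x*pd l (J r t) x-B r t x*pd l (J i t) x))"
  using pds_hall_flux_1[of l i r] by auto
 have "pds [k, l] (hall_flux i r t) = pd k (pds [l] (hall_flux i r t))" by (simp add: pds_Cons)
 thus ?thesis unfolding e using W_C1[OF t] C_inf_C1[OF J_C_inf[OF t]] C_inf_C1[OF C_inf_pd[OF J_C_inf[OF t]]]
  by (simp add: pd_diff pd_add pd_mult C1_mult C1_diff)
qed

lemma pds_hall_flux_2_det3:
 "(SU i. SU r. pds [k, l] (hall_flux i r t) x*pds (r # [k, l]) (B i t) x)
 = - (det3 (%i. pd k (pd l (B i t)) x) (%i. J i t x) (%i. pd k (pd l (J i t)) x)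
 + det3 (%i. pd l (B i t) x) (%i. pd k (J i t) x) (%i. pd k (pd l (J i t)) x)
 + det3 (%i. pd k (B i t) x) (%i. pd l (J i t) x) (%i. pd k (pd l (J i t)) x))"
proof -
 define q where "q i = pd k (pd l (J i t)) x" for i
 define e where "e r i = pd k (pd l (pd r (B i t))) x" for r i
 have commute: "pds (r # [k, l]) (B i t) x = e r i" for r i
  using pds_pd_commute[OF W_C_inf[OF t], of "[k, l]" r False i] by (simp add: pds_Cons e_def)
 have "q 1 = e 2 3-e 3 2" "q 2 = e 3 1-e 1 3" "q 3 = e 1 2-e 2 1"
  unfolding q_def pd_J e_def using W_C1(3)[OF t] by (simp_all add: pd_diff)
 note H = hall_algebra[of q e, OF this]
 have "(SU i. SU r. pds [k, l] (hall_flux i r t) x*pds (r # [k, l]) (B i t) x) =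
  (SU i. SU r. (pd k (pd l (B i t)) x*J r t x-pd k (pd l (B r t)) x*J i t x)*e r i)+(SU i. SU r. (pd l (B i t) x*pd k (J r t) x-pd l (B r t) x*pd k (J i t) x)*e r i)
  + (SU i. SU r. (pd k (B i t) x*pd l (J r t) x-pd k (B r t) x*pd l (J i t) x)*e r i)+(SU i. SU r. (B i t x*q r-B r t x*q i)*e r i)"
  unfolding commute pds_hall_flux_2 q_def[symmetric] by (simp only: distrib_right sum.distrib)
 also have "(SU i. SU r. (B i t x*q r-B r t x*q i)*e r i) = 0" unfolding H by (simp add: det3_def)
 finally show ?thesis unfolding H q_def by simp
qed

lemma hall_work_2: "hall_work [k, l] t
 = - (int_det (%i. pd k (pd l (B i t))) (%i. J i t) (%i. pd k (pd l (J i t)))+int_det (%i. pd l (B i t)) (%i. pd k (J i t)) (%i. pd k (pd l (J i t)))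
 + int_det (%i. pd k (B i t)) (%i. pd l (J i t)) (%i. pd k (pd l (J i t))))"
proof -
 define q where "q i = pd k (pd l (J i t))" for i
 have i: "IB (%x. pds [k, l] (hall_flux i r t) x*pds (r # [k, l]) (B i t) x)" for i r
  by (rule L2_le_inner(1)[OF pds_hall_flux_L2_le[OF t, of _ 3] W_L2_le[OF t, of _ 3]]) (use m3 in auto)
 have top: "IB (%x. pd k (pd l (B i t)) x*J j t x*q r x)" for i j r
  unfolding q_def by (rule Hs_triple_integrable[OF Hs_W(3) Hs_J(1) Hs_J(3)]) simp
 have mid: "IB (%x. pd n (B i t) x*pd n' (J j t) x*q r x)" for i j r n n'
  unfolding q_def by (rule Hs_triple_integrable[OF Hs_W(2) Hs_J(2) Hs_J(3)]) simp
 have "hall_work [k, l] t = (LI x. SU i. SU r. pds [k, l] (hall_flux i r t) x*pds (r # [k, l]) (B i t) x)"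
  unfolding hall_work_def using i by (simp add: integral_sum integrable_sum)
 also have "... = - (int_det (%i. pd k (pd l (B i t))) (%i. J i t) q+int_det (%i. pd l (B i t)) (%i. pd k (J i t)) q+int_det (%i. pd k (B i t)) (%i. pd l (J i t)) q)"
  unfolding pds_hall_flux_2_det3 q_def[symmetric] using int_det_det3[OF top] int_det_det3[OF mid[of l _ k]] int_det_det3[OF mid[of k _ l]] by simp
 finally show ?thesis unfolding q_def .
qed

lemma hall_work_2_sum: "<|SUM w:words (Suc 1). hall_work w t|> <= 297*hall_bound2"
proof -
 define R where "R k l = int_det (%i. pd k (B i t)) (%i. pd l (J i t)) (%i. pd k (pd l (J i t)))" for k l
 have "(SUM w:words (Suc 1). hall_work w t) = (SU k. SU l. hall_work [k, l] t)" by (simp add: sum_words_Suc words_0 One_nat_def)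
 also have "... = (SU k. SU l. (hall_work [k, l] t+defect l k+defect k l)-(defect l k+defect k l))" by simp
 also have "... = (SU k. SU l. hall_work [k, l] t+defect l k+defect k l)-((SU k. SU l. defect l k)+(SU k. SU l. defect k l))"
  by (simp only: sum_subtractf sum.distrib)
 also have "(SU k. SU l. defect l k) = (SU k. SU l. defect k l)" by (rule sum.swap)
 finally have "<|SUM w:words (Suc 1). hall_work w t|> = <|SU k. SU l. hall_work [k, l] t+defect l k+defect k l|>" unfolding defect_sum by simp
 also have "... <= (SU k::3. SU l::3. 33*hall_bound2)"
 proof (rule order_trans[OF sum_abs sum_mono], rule order_trans[OF sum_abs sum_mono])
  fix k l
  have cm: "pd k (pd l (J i t)) = pd l (pd k (J i t))" for i by (rule pd_commute[OF J_C_inf[OF t]])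
  have "hall_work [k, l] t = - (int_det (%i. pd k (pd l (B i t))) (%i. J i t) (%i. pd k (pd l (J i t)))+R l k+R k l)"
   unfolding hall_work_2 R_def by (simp only: cm[symmetric])
  thus "<|hall_work [k, l] t+defect l k+defect k l|> <= 33*hall_bound2"
   using int_det_top[of k l] int_det_mid[of k l] int_det_mid[of l k] unfolding R_def[symmetric] by (simp add: abs_le_iff)
 qed
 finally show ?thesis by simp
qed

lemma transport_work_1_bound: "w:words 1 ==> <|transport_work w t|> <= E 3 t/60+10^10*(F 2 t)^2"
proof -
 let ?Q = "1327248*(F 2 t)^2"
 assume b: "w:words 1"
 then obtain l where bl: "w = [l]" by (auto simp: words_def length_Suc_conv)
 have N: "L2_le (pds w (nonlin c j t)) ?Q" for c j using pds_nonlin_L2_le[OF t, of w 2 c j] m3 unfolding bl by simp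
 have L: "L2_le (%x. SU l. pds (l # l # w) (W c j t) x) (9*E 3 t)" for c j
  by (rule L2_le_sum3, rule L2leI[OF W_pds_Hs[OF t, of 0]]) (use m3 L2sq_le_E[of "_ # _ # w" c j t] in "auto simp: bl numeral_3_eq_3")
 have pairing: "<|LI x. pds w (nonlin c j t) x*(SU l. pds (l # l # w) (W c j t) x)|> <= E 3 t/400+1194523200*(F 2 t)^2" for c j
 proof -
  have "<|LI x. pds w (nonlin c j t) x*(SU l. pds (l # l # w) (W c j t) x)|> <= sqrt ?Q * sqrt (9*E 3 t)" by (rule L2_le_inner(2)[OF N L])
  also have "... <= (1/1800*(sqrt (9*E 3 t))^2+(1^2*(sqrt ?Q)^2)/(1/1800))/2"
   using weighted_Young[of "1/1800" 1 "sqrt ?Q" "sqrt (9*E 3 t)"] E_nonneg[of 3 t] F_nonneg[of 2 t] by simp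
  also have "... = E 3 t/400+1194523200*(F 2 t)^2" using E_nonneg[of 3 t] by simp
  finally show ?thesis .
 qed
 have "<|transport_work w t|> <= (SU c::bool. SU j::3. E 3 t/400+1194523200*(F 2 t)^2)"
  unfolding transport_work_def by (rule order_trans[OF sum_abs sum_mono], rule order_trans[OF sum_abs sum_mono], rule pairing)
 also have "... = 6*(E 3 t/400+1194523200*(F 2 t)^2)" by simp
 also have "... <= E 3 t/60+10^10*(F 2 t)^2"
 proof -
  have "0 <= e ==> 0 <= y ==> 6*(e/400+1194523200*y) <= e/60+10^10*y" for e y :: real by simp
  from this[OF E_nonneg zero_le_power2] show ?thesis .
 qed
 finally show ?thesis .
qed

lemma level_2_rate: "- 2*(E 3 t+(SUM v:words 1. transport_work v t)+(SUM w:words (Suc 1). hall_work w t)) <= - E 3 t+10^24*(M+F 2 t)*F 2 t"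
proof -
 have c: "card (words 1) = 3" using sum_words_Suc[of "%_. 1" 0] by (simp add: words_0)
 have "<|SUM v:words 1. transport_work v t|> <= (SUM v:words 1. E 3 t/60+10^10*(F 2 t)^2)"
  by (rule order_trans[OF sum_abs sum_mono[OF transport_work_1_bound]])
 hence p: "<|SUM v:words 1. transport_work v t|> <= E 3 t/20+3*10^10*(F 2 t)^2" unfolding sum_constant c by simp
 have h: "<|SUM w:words (Suc 1). hall_work w t|> <= 297*hall_bound2" by (rule hall_work_2_sum)
 have ME: "M*E 2 t <= M*F 2 t" using M_ge_1 E_le_F[of 2 2 t] by (intro mult_left_mono) auto
 have "- 2*(E 3 t+(SUM v:words 1. transport_work v t)+(SUM w:words (Suc 1). hall_work w t))
  <= - 2*E 3 t+2*(E 3 t/20+3*10^10*(F 2 t)^2)+594*hall_bound2"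
  using h p by (simp add: abs_le_iff)
 also have "... <= - E 3 t+10^24*(M*F 2 t+(F 2 t)^2)"
 proof -
  have "0 <= e ==> 0 <= x ==> x <= y ==> 0 <= f ==> - 2*e+2*(e/20+3*10^10*f)+594*(e/1600+10^21*x) <= - e+10^24*(y+f)" for e x y f :: real by simp
  from this[OF E_nonneg M_E_nonneg ME zero_le_power2] show ?thesis by (simp only: hall_bound2_def mult.assoc)
 qed
 also have "... = - E 3 t+10^24*(M+F 2 t)*F 2 t" by (simp add: algebra_simps power2_eq_square)
 finally show ?thesis .
qed

end

lemma length_splits: "length (splits w) = 2^length w" by (induction w) auto
lemma length_proper_splits: "length (proper_splits w) <= 2^length w" by (induction w) (auto simp: length_splits)

context hall_solution
begin

definition top_hall :: "3 list => 3 => 3 => real => scalar" where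
 "top_hall w i l t x = B i t x*pds w (J l t) x-B l t x*pds w (J i t) x"

definition lower_hall :: "3 list => 3 => 3 => real => scalar" where
 "lower_hall w i l t x = (\<Sum>p\<leftarrow>proper_splits w. pds (fst p) (B i t) x*pds (snd p) (J l t) x-pds (fst p) (B l t) x*pds (snd p) (J i t) x)"

definition lower_flux :: "label => real => 3 => scalar" where
 "lower_flux = (%(c, w, i, j) t l x. if c then flux (c, w, i, j) t l x else (if l = j then 1 else 0)*pds w (nonlin False i t) x+lower_hall (j # w) i l t x)"

definition top_flux :: "label => real => 3 => scalar" where
 "top_flux = (%(c, w, i, j) t l x. if c then 0 else top_hall (j # w) i l t x)"

lemma flux_split:
 assumes t: "t:{0<..<T}" shows "flux a t l x = lower_flux a t l x+top_flux a t l x"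
proof -
 have C: "C_inf (B i t)" "C_inf (J i t)" "C_inf (%x. B i t x*J l t x)" for i l by (intro C_inf_mult W_C_inf J_C_inf t)+
 have "pds w (hall_flux i l t) x = top_hall w i l t x+lower_hall w i l t x" for w i
  unfolding hall_flux_def[abs_def] pds_diff[OF C(3) C(3)] pds_mult_commutator[OF C(1,2)] top_hall_def lower_hall_def
  by (simp only: sum_list_subtractf)
 thus ?thesis by (cases a) (auto simp: lower_flux_def top_flux_def flux_def)
qed

lemma pds_J: "t:{0<..<T} ==> pds w (J l t) = (%x. pds (w @ [cyc l]) (B (cyc (cyc l)) t) x-pds (w @ [cyc (cyc l)]) (B (cyc l) t) x)"
 unfolding J_def[abs_def] by (subst pds_diff) (auto intro!: C_inf_pd W_C_inf simp: pds_append pds_Cons)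

lemma lower_hall_L2_le:
 assumes t: "t:{0<..<T}" and k: "k = length w" "3 <= k" "k <= m"
 shows "L2_le (lower_hall w i l t) (16*9*(2^k*(2^k*(9217*(F k t)^2))))"
proof -
 define Q where "Q = 9217*(F k t)^2"
 define n where "n = real (length (proper_splits w))"
 define N :: real where "N = 2^k"
 have "n <= real (2^length w)" unfolding n_def by (rule of_nat_mono[OF length_proper_splits])
 hence n: "0 <= n" "n <= N" unfolding N_def n_def k(1) by simp_all
 have product: "L2_le (%x. pds a (B i t) x*pds e (J l t) x) (4*Q)" if "(a, e):set (proper_splits w)" for a e i l
 proof -
  have "length a+length e = k & a ~= []" using proper_splits_length[OF that] k by simp
  hence l: "length a+length e = k" "length a >= 1" by (auto simp: Suc_le_eq)
  have "L2_le (%x. pds a (B i t) x*pds (e @ [n]) (B r t) x) Q" for n r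
   unfolding Q_def by (rule product_L2_le[OF t k(3)]) (use l k in auto)
  thus ?thesis unfolding pds_J[OF t] right_diff_distrib by (intro L2_le_diff)
 qed
 have "L2_le (lower_hall w i l t) (n*(n*(4*(4*Q))))"
  unfolding lower_hall_def[abs_def] n_def by (intro L2_le_sum_list L2_le_diff product) auto
 moreover have "n*(n*(4*(4*Q))) <= N*(N*(16*9*Q))" using n by (intro mult_mono[OF n(2) mult_mono[OF n(2)]]) (auto simp: Q_def)
 ultimately show ?thesis unfolding N_def Q_def by (rule L2_le_mono[OF _ order_trans]) simp
qed

lemma lower_flux_L2_le:
 assumes t: "t:{0<..<T}" and k: "k = Suc (length w)" "3 <= k" "k <= m"
 shows "L2_le (lower_flux (c, w, i, j) t l) (64*9*(2^k*(2^k*(9217*(F k t)^2))))"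
proof -
 define Q where "Q = 9217*(F k t)^2"
 define N :: real where "N = 2^k"
 have N: "real (length (splits w)) <= N" by (simp add: N_def k(1) length_splits)
 have NQ: "0 <= N*(N*Q)" unfolding Q_def N_def by auto
 have nonlinear: "L2_le (%x. (if P then 1 else 0)*pds w (nonlin c i t) x) (16*9*(N*(N*Q)))" for P c i
 proof -
  have "L2_le (pds w (nonlin c i t)) (4*(9*(real (length (splits w))*(real (length (splits w))*Q))))"
   unfolding Q_def by (rule pds_nonlin_L2_le[OF t _ _ k(3)]) (use k in auto)
  moreover have "real (length (splits w))*(real (length (splits w))*Q) <= N*(N*Q)" using N by (intro mult_mono) (auto simp: Q_def)
  ultimately have "L2_le (pds w (nonlin c i t)) (4*(9*(N*(N*Q))))" by (auto intro: L2_le_mono)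
  from L2_le_cmult[OF this, of "if P then 1 else 0"] show ?thesis by (rule L2_le_mono) (use NQ in auto)
 qed
 have lower: "L2_le (lower_hall (j # w) i l t) (16*9*(N*(N*Q)))"
  unfolding N_def Q_def by (rule lower_hall_L2_le[OF t]) (use k in auto)
 have e: "lower_flux (True, w, i, j) t l = (%x. (if l = i then 1 else 0)*pds w (nonlin True j t) x-(if l = j then 1 else 0)*pds w (nonlin True i t) x)"
  "lower_flux (False, w, i, j) t l = (%x. (if l = j then 1 else 0)*pds w (nonlin False i t) x+lower_hall (j # w) i l t x)"
  by (auto simp: lower_flux_def flux_def)
 have "L2_le (lower_flux (c, w, i, j) t l) (4*(16*9*(N*(N*Q))))"
  using L2_le_diff[OF nonlinear nonlinear] L2_le_add[OF nonlinear lower] by (cases c) (simp_all only: e)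
 thus ?thesis by (simp add: N_def Q_def)
qed

definition grad_density :: "nat => real => scalar" where
 "grad_density n t x = (SUM a:modes n. SU l. (pd l (mode a t) x)^2)"

lemma pd_mode_pair_le:
 assumes "a:modes n" "a':modes n" "a ~= a'"
 shows "(pd r (mode a t) x)^2+(pd r' (mode a' t) x)^2 <= grad_density n t x"
proof -
 have single: "(pd r (mode a t) x)^2 <= (SU l. (pd l (mode a t) x)^2)" for r a by (rule member_le_sum[where f="%l. (pd l (mode a t) x)^2"]) auto
 have "(SUM a:{a, a'}. SU l. (pd l (mode a t) x)^2) <= grad_density n t x" unfolding grad_density_def
  by (rule sum_mono2[OF finite_modes]) (use assms in "auto intro: sum_nonneg")
 thus ?thesis using add_mono[OF single[of r a] single[of r' a']] assms(3) by simp
qed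

lemma pd_mode_magnetic: "t:{0<..<T} ==> pd l (mode (False, w, i, j) t) x = pds (j # w @ [l]) (B i t) x"
 unfolding mode_False using pds_pd_commute[OF W_C_inf, of t "j # w" l False i] by (simp add: pds_append pds_Cons)

lemma pds_J_square_le:
 assumes t: "t:{0<..<T}" and w: "w:words n" shows "(pds (j # w) (J l t) x)^2 <= 2*grad_density n t x"
proof -
 define a a' where "a = (False, w, cyc (cyc l), j)" and "a' = (False, w, cyc l, j)"
 have "cyc (cyc l) ~= cyc l" using exhaust_3[of l] by auto
 hence aa': "a:modes n" "a':modes n" "a ~= a'" using w by (auto simp: a_def a'_def modes_def)
 have "pds (j # w) (J l t) x = pd (cyc l) (mode a t) x+- pd (cyc (cyc l)) (mode a' t) x"
  unfolding pds_J[OF t] a_def a'_def pd_mode_magnetic[OF t] by simp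
 hence "(pds (j # w) (J l t) x)^2 <= 2*((pd (cyc l) (mode a t) x)^2+(pd (cyc (cyc l)) (mode a' t) x)^2)"
  using square_add_le[of "pd (cyc l) (mode a t) x" "- pd (cyc (cyc l)) (mode a' t) x"] by simp
 also have "... <= 2*grad_density n t x" by (intro mult_left_mono pd_mode_pair_le aa') simp
 finally show ?thesis .
qed

lemma top_flux_square_le:
 assumes t: "t:{0<..<T}" and a: "a:modes n" and K: "!!i. (B i t x)^2 <= K"
 shows "(top_flux a t l x)^2 <= 8*K*grad_density n t x"
proof -
 obtain d w i j where ae: "a = (d, w, i, j)" "w:words n" using a unfolding modes_def by (cases a) auto
 have K0: "0 <= K" using K[of 1] zero_le_power2 order_trans by blast
 have "(B i t x*pds (j # w) (J l t) x)^2 <= K*(2*grad_density n t x)" for i l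
  unfolding power_mult_distrib by (intro mult_mono K pds_J_square_le[OF t ae(2)] K0) simp
 from this[of i l] this[of l i] have "(top_hall (j # w) i l t x)^2 <= 8*K*grad_density n t x"
  using square_add_le[of "B i t x*pds (j # w) (J l t) x" "- (B l t x*pds (j # w) (J i t) x)"] by (simp add: top_hall_def)
 moreover have "0 <= grad_density n t x" unfolding grad_density_def by (intro sum_nonneg) auto
 ultimately show ?thesis using K0 by (simp add: ae(1) top_flux_def)
qed

lemma top_flux_work_zero:
 assumes t: "t:{0<..<T}" shows "(SUM a:modes n. SU l. top_flux a t l x*pd l (mode a t) x) = 0"
proof -
 have "(SU i. SU l. top_flux (False, w, i, j) t l x*pd l (mode (False, w, i, j) t) x) = 0" for w j
 proof -
  define e where "e l i = pds (j # w @ [l]) (B i t) x" for l i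
  define q where "q i = pds (j # w) (J i t) x" for i
  have "q 1 = e 2 3-e 3 2" "q 2 = e 3 1-e 1 3" "q 3 = e 1 2-e 2 1" unfolding q_def pds_J[OF t] e_def by auto
  from hall_algebra[OF this, of "%i. B i t x" q]
  show ?thesis by (simp add: top_flux_def top_hall_def pd_mode_magnetic[OF t] det3_def flip: e_def q_def)
 qed
 hence "(SU i. SU j. SU l. top_flux (False, w, i, j) t l x*pd l (mode (False, w, i, j) t) x) = 0" for w
  by (subst sum.swap) simp
 thus ?thesis unfolding sum_modes by (simp add: top_flux_def)
qed

definition level_energy :: "nat => real => real" where "level_energy k t = (if k < 3 then E k t else 2*part_energy True k t+part_energy False k t)"

lemma level_energy_bounds: "E k t <= level_energy k t" "level_energy k t <= 2*E k t" "0 <= level_energy k t"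
 unfolding level_energy_def E_split using part_energy_nonneg[of True k t] part_energy_nonneg[of False k t] by auto

lemma level_energy_continuous: "k <= m ==> continuous_on {0<..<T} (level_energy k)"
 unfolding level_energy_def[abs_def] part_energy_def by (cases "k < 3") (auto intro!: E_continuous continuous_intros L2sq_W_continuous simp: words_def)

lemma sum_mode_energy:
 assumes "t:{0<..<T}" "2 <= n"
 shows "Suc n <= m ==> (SUM a:modes n. L2sq (mode a t)) = level_energy (Suc n) t"
 "Suc (Suc n) <= m ==> (SUM a:modes n. D1sq (mode a t)) = level_energy (Suc (Suc n)) t"
 using mode_energy[OF assms(1)] mode_gradient_energy[OF assms(1)] assms(2) by (simp_all add: sum_modes level_energy_def)

definition lower_density :: "nat => real => scalar" where
 "lower_density n t x = (SUM a:modes n. SU l. 2*(lower_flux a t l x)^2)"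

definition lower_rate :: "nat => real => real" where
 "lower_rate n t = real (card (modes n))*6*(64*9*(2^Suc n*(2^Suc n*(9217*(F (Suc n) t)^2))))"

lemma lower_density_integral:
 assumes t: "t:{0<..<T}" and n: "2 <= n" "Suc n <= m"
 shows "IB (lower_density n t)" "(LI x. lower_density n t x) <= lower_rate n t" (is ?A)
proof -
 define K where "K = 64*9*(2^Suc n*(2^Suc n*(9217*(F (Suc n) t)^2)))"
 have L: "L2_le (lower_flux a t l) K" if aF: "a:modes n" for a l
 proof -
  obtain d w i j where a: "a = (d, w, i, j)" "length w = n" using aF unfolding modes_def words_def by (cases a) auto
  show ?thesis unfolding a(1) K_def by (rule lower_flux_L2_le[OF t]) (use a n in auto)
 qed
 show "IB (lower_density n t)" unfolding lower_density_def[abs_def] using L by (intro integrable_sum integrable_mult_right) (auto simp: L2_le_def)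
 have "(LI x. lower_density n t x) = (SUM a:modes n. SU l. 2 * L2sq (lower_flux a t l))"
  unfolding lower_density_def L2sq_def using L by (simp add: integral_sum integrable_sum L2_le_def)
 also have "... <= (SUM a:modes n. SU l::3. 2*K)" using L by (intro sum_mono mult_left_mono) (auto simp: L2_le_def)
 finally show ?A by (simp add: lower_rate_def K_def)
qed

lemma flux_square_le:
 assumes t: "t:{0<..<T}" and K: "!!i. (B i t x)^2 <= K"
 shows "(SUM a:modes n. SU l. (flux a t l x)^2) <= real (card (modes n))*3*(2*(8*K))*grad_density n t x+lower_density n t x"
proof -
 have "(SUM a:modes n. SU l. (flux a t l x)^2) <= (SUM a:modes n. SU l. 2*(lower_flux a t l x)^2+2*(8*K*grad_density n t x))"
  unfolding flux_split[OF t] using top_flux_square_le[OF t _ K] by (intro sum_mono order_trans[OF square_add_le] add_mono mult_left_mono) auto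
 also have "... = lower_density n t x+real (card (modes n))*(3*(2*(8*K*grad_density n t x)))" unfolding lower_density_def sum.distrib by simp
 finally show ?thesis by (simp add: mult_ac)
qed

text \<open>The top-order Hall term is pointwise orthogonal to the gradient, so only the remainder does work.\<close>
lemma flux_work_ge:
 assumes t: "t:{0<..<T}"
 shows "- (SUM a:modes n. SU l. flux a t l x*pd l (mode a t) x) <= 1/2*grad_density n t x+lower_density n t x"
proof -
 have Young: "- (r*p) <= 1/2*p^2+2*r^2" for r p :: real
  using zero_le_power2[of "p+r"] zero_le_power2[of r] unfolding power2_sum mult.assoc mult.commute[of r p] by linarith
 have "- (SUM a:modes n. SU l. flux a t l x*pd l (mode a t) x) = (SUM a:modes n. SU l. - (lower_flux a t l x*pd l (mode a t) x))"
  unfolding flux_split[OF t] distrib_right sum.distrib top_flux_work_zero[OF t] by (simp add: sum_negf)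
 also have "... <= (SUM a:modes n. SU l. 1/2*(pd l (mode a t) x)^2+2*(lower_flux a t l x)^2)" by (intro sum_mono Young)
 also have "... = 1/2*grad_density n t x+lower_density n t x" unfolding grad_density_def lower_density_def sum.distrib sum_distrib_left ..
 finally show ?thesis .
qed

lemma level_dissipative_family:
 assumes st: "0 < s" "s <= t" "t < T" and n: "2 <= n" "Suc n <= m"
 obtains L K where "dissipative_family (modes n) T s t mode mode_dt flux (lower_density n) (lower_rate n) L K"
proof -
 note inT = in_times[OF st(1,3)]
 obtain K where K: "K >= 1" "!!r. r:{s..t} ==> F (Suc n) r <= K" using F_bounded[OF st n(2)] by blast
 have B: "(B i r x)^2 <= 9217*K" if "r:{s..t}" for i r x
  using sup_le_F[OF inT[OF that], of "[]" "Suc n" False i x] K(2)[OF that] n by simp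
 show thesis
 proof (rule that[of "real (card (modes n))*3*(2*(8*(9217*K)))" "2*K"], rule dissipative_family.intro)
  show "flux_evolution T s t (mode a) (mode_dt a) (flux a)" if "a:modes n" for a by (rule mode_flux_evolution[OF st that n(2)])
  show "continuous_on (slab T) (%(t, x). pd l (mode a t) x)" for a l
  proof (cases a)
   case (fields d w i j)
   have "continuous_on (slab T) (%(t, x). mode (d, l # w, i, j) t x)" using mode_has_time_deriv by (simp add: has_time_deriv_def)
   thus ?thesis by (rule continuous_on_eq) (auto simp: fields pd_mode)
  qed
  have "continuous_on {s..t} (F (Suc n))" by (rule continuous_on_subset[OF F_continuous]) (use st n in auto)
  thus "continuous_on {s..t} (lower_rate n)" unfolding lower_rate_def by (intro continuous_intros)
  show "0 <= lower_density n r x" for r x unfolding lower_density_def by (intro sum_nonneg) auto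
  show "0 <= real (card (modes n))*3*(2*(8*(9217*K)))" using K by simp
  fix r assume r: "r:{s..t}"
  show "(SUM a:modes n. L2sq (mode a r)) <= 2*K"
   unfolding sum_mode_energy(1)[OF inT[OF r] n] using level_energy_bounds(2)[of "Suc n" r] E_le_F[of "Suc n" "Suc n" r] K(2)[OF r] by simp
  show "IB (lower_density n r)" "(LI x. lower_density n r x) <= lower_rate n r" by (rule lower_density_integral[OF inT[OF r] n])+
  fix x
  show "(SUM a:modes n. SU l. (flux a r l x)^2)
   <= real (card (modes n))*3*(2*(8*(9217*K)))*(SUM a:modes n. SU l. (pd l (mode a r) x)^2)+lower_density n r x"
   using flux_square_le[OF inT[OF r] B[OF r]] unfolding grad_density_def .
  show "- (SUM a:modes n. SU l. flux a r l x*pd l (mode a r) x) <= 1/2*(SUM a:modes n. SU l. (pd l (mode a r) x)^2)+lower_density n r x"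
   using flux_work_ge[OF inT[OF r]] unfolding grad_density_def .
 qed (use st finite_modes in auto)
qed

definition dissipated :: "nat => real => real => real" where
 "dissipated k s t = SI {s..t} (%r. if k < m then E (Suc k) r else 0)"

lemma dissipated_nonneg: "0 <= dissipated k s t" unfolding dissipated_def using E_nonneg by (intro integral_nonneg_AE) auto

lemma continuous_Icc_integrable:
 fixes f :: "real => real"
 assumes "continuous_on {0<..<T} f" "0 < s" "t < T" shows "SIB {s..t} f"
proof -
 have "continuous_on {s..t} f" by (rule continuous_on_subset[OF assms(1)]) (use assms in auto)
 from borel_integrable_compact[OF compact_Icc this] show ?thesis by simp
qed

lemma level_k_inequality:
 assumes st: "0 < s" "s <= t" "t < T" and n: "2 <= n" "Suc n <= m"
 shows "level_energy (Suc n) t+1/2*dissipated (Suc n) s t <= level_energy (Suc n) s+3*SI {s..t} (lower_rate n)"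
proof -
 note inT = in_times[OF st(1,3)]
 obtain L K where "dissipative_family (modes n) T s t mode mode_dt flux (lower_density n) (lower_rate n) L K"
  by (rule level_dissipative_family[OF st n])
 then interpret dissipative_family "modes n" T s t mode mode_dt flux "lower_density n" "lower_rate n" L K .
 have ends: "(SUM a:modes n. L2sq (mode a r)) = level_energy (Suc n) r" if "r:{s..t}" for r by (rule sum_mode_energy(1)[OF inT[OF that] n])
 show ?thesis
 proof (cases "Suc n < m")
  case False
  thus ?thesis using energy_inequality ends[of s] ends[of t] st by (simp add: dissipated_def)
 next
  case True
  have k: "Suc (Suc n) <= m" using True by simp
  have G: "(SUM a:modes n. D1sq (mode a \<tau>)) = level_energy (Suc (Suc n)) \<tau>" if "\<tau>:{s..t}" for \<tau> by (rule sum_mode_energy(2)[OF inT[OF that] n(1) k])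
  have cont: "continuous_on {s..t} (level_energy (Suc (Suc n)))" by (rule continuous_on_subset[OF level_energy_continuous[OF k]]) (use inT in auto)
  hence "continuous_on {s..t} (%\<tau>. SUM a:modes n. D1sq (mode a \<tau>))" by (rule continuous_on_eq) (simp add: G)
  moreover have "IB (%x. (pd l (mode a \<tau>) x)^2)" if "a:modes n" "\<tau>:{s..t}" for a \<tau> l
   using that mode_L2_le[OF inT[OF that(2)], of "l # _" m] k by (auto simp: modes_def words_def L2_le_def pd_mode[OF inT[OF that(2)]])
  ultimately have "level_energy (Suc n) t+1/2*SI {s..t} (%\<tau>. SUM a:modes n. D1sq (mode a \<tau>))
   <= level_energy (Suc n) s+3*SI {s..t} (lower_rate n)"
   using energy_dissipation_inequality ends[of s] ends[of t] st by simp
  moreover have "dissipated (Suc n) s t <= SI {s..t} (level_energy (Suc (Suc n)))"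
   unfolding dissipated_def using True level_energy_bounds(1)
   by (simp, intro integral_mono continuous_Icc_integrable E_continuous level_energy_continuous k st) (auto intro: mult_left_mono)
  moreover have "SI {s..t} (%\<tau>. SUM a:modes n. D1sq (mode a \<tau>)) = SI {s..t} (level_energy (Suc (Suc n)))"
   by (intro integral_cong refl) (use G in "auto simp: indicator_def")
  ultimately show ?thesis by linarith
 qed
qed

end

lemma integrable_from_bounded:
 fixes f :: "real => real"
 assumes tT: "t0 < T" and f: "continuous_on {t0..<T} f" "!!t. 0 <= f t"
 and C: "!!t. t:{t0..<T} ==> SI {t0..t} f <= C"
 shows "SIB {t0..<T} f"
proof (rule integral_Fatou_bound(1))
 note s = approach_bounds[OF tT]
 have "continuous_on {t0..approach t0 T n} f" for n by (rule continuous_on_subset[OF f(1)]) (use s(2)[of n] in auto)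
 from borel_integrable_compact[OF compact_Icc this] show "SIB {t0..approach t0 T n} f" for n by simp
 show "0 <= indicator {t0..approach t0 T n} r*f r" for n r using f(2) by simp
 show "SI {t0..approach t0 T n} f <= C" for n using s[of n] by (intro C) auto
 fix r
 show "(%n. indicator {t0..approach t0 T n} r*f r) ----> indicator {t0..<T} r*f r"
 proof (cases "r < T")
  case True
  have "\<forall>\<^sub>F n in sequentially. r < approach t0 T n" by (rule order_tendstoD(1)[OF approach_tendsto True])
  hence "\<forall>\<^sub>F n in sequentially. indicator {t0..approach t0 T n} r*f r = indicator {t0..<T} r*f r"
   by eventually_elim (use True in "auto simp: indicator_def")
  thus ?thesis by (rule tendsto_eventually)
 next
  case False
  have "~r <= approach t0 T n" for n using False s(2)[of n] by linarith
  thus ?thesis using False by (simp add: indicator_def)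
 qed
qed (rule tendsto_const)

context hall_solution
begin

context
 fixes M :: "real => real"
 assumes Mi: "SIB {0<..<T} M" and M0: "!!t. 0 <= M t"
 and sl: "AE t in lborel. t:{0<..<T} --> hall_slice m T u b \<pi> t (M t)"
begin

definition rate :: "nat => real => real" where "rate k t = (M t+F k t)*F k t"

lemma rate_integrable:
 assumes st: "0 < s" "s <= t" "t < T" and k: "k <= m"
 shows "SIB {s..t} (rate k)"
proof -
 obtain K where K: "K >= 1" "!!r. r:{s..t} ==> F k r <= K" using F_bounded[OF st k] by blast
 have i: "SIB {s..t} (F k)" "SIB {s..t} (%r. (F k r)^2)"
  by (intro continuous_Icc_integrable continuous_on_power F_continuous k st)+
 have e: "indicator {s..t} r*rate k r = (indicator {0<..<T} r*M r)*(indicator {s..t} r*F k r)+indicator {s..t} r*(F k r)^2" for r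
  using st by (auto simp: rate_def indicator_def algebra_simps power2_eq_square)
 have "IB (%r. (indicator {0<..<T} r*M r)*(indicator {s..t} r*F k r))"
 proof (rule integrable_bound[OF integrable_mult_right[OF Mi, of K]])
  show "(%r. (indicator {0<..<T} r*M r)*(indicator {s..t} r*F k r)):borel_measurable lborel"
   using borel_measurable_integrable[OF Mi] borel_measurable_integrable[OF i(1)] by (rule borel_measurable_times)
  have "<|indicator {s..t} r*F k r|> <= K" for r using K F_nonneg[of k r] by (auto simp: indicator_def)
  from mult_right_mono[OF this abs_ge_zero]
  have "<|x|>*<|indicator {s..t} r*F k r|> <= <|K|>*<|x|>" for x r using K(1) by (simp only: mult.commute abs_of_nonneg order_trans[OF zero_le_one])
  thus "AE r in lborel. norm ((indicator {0<..<T} r*M r)*(indicator {s..t} r*F k r)) <= norm (K*(indicator {0<..<T} r*M r))"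
   unfolding real_norm_def abs_mult[of "indicator {0<..<T} _*M _"] abs_mult[of K] by (intro AE_I2)
 qed
 thus ?thesis unfolding e using i(2) by simp
qed

lemma critical_step:
 assumes st: "0 < s" "s <= t" "t < T" and n: "Suc (Suc n) <= m"
 and step: "!!r. hall_slice m T u b \<pi> r (M r) ==>
 - 2*(E (Suc (Suc n)) r+(SUM v:words n. transport_work v r)+(SUM w:words (Suc n). hall_work w r)) <= - E (Suc (Suc n)) r+C*rate (Suc n) r"
 shows "E (Suc n) t+1/2*dissipated (Suc n) s t <= E (Suc n) s+C*SI {s..t} (rate (Suc n))"
proof -
 define G where "G r = E (Suc (Suc n)) r+(SUM v:words n. transport_work v r)+(SUM w:words (Suc n). hall_work w r)" for r
 note I = level_identity[OF st n, folded G_def]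
 have ri: "SIB {s..t} (rate (Suc n))" by (rule rate_integrable[OF st]) (use n in simp)
 have iE: "SIB {s..t} (E (Suc (Suc n)))" by (intro continuous_Icc_integrable E_continuous n st)
 have "E (Suc n) t-E (Suc n) s = (LI r. - 2*(indicator {s..t} r*G r))" unfolding I(2) by simp
 also have "... <= (LI r. - (indicator {s..t} r*E (Suc (Suc n)) r)+C*(indicator {s..t} r*rate (Suc n) r))"
 proof (rule integral_mono_AE[OF integrable_mult_right[OF I(1)]])
  show "IB (%r. - (indicator {s..t} r*E (Suc (Suc n)) r)+C*(indicator {s..t} r*rate (Suc n) r))" using iE ri by simp
  show "AE r in lborel. - 2*(indicator {s..t} r*G r) <= - (indicator {s..t} r*E (Suc (Suc n)) r)+C*(indicator {s..t} r*rate (Suc n) r)"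
   using sl
  proof eventually_elim
   case (elim r)
   thus ?case using step[of r, folded G_def] st by (cases "r:{s..t}") auto
  qed
 qed
 also have "... = - dissipated (Suc n) s t+C*SI {s..t} (rate (Suc n))" using iE ri n by (simp add: dissipated_def)
 finally show ?thesis using dissipated_nonneg[of "Suc n" s t] by linarith
qed

lemma high_level_step:
 assumes st: "0 < s" "s <= t" "t < T" and n: "2 <= n" "Suc n <= m"
 defines "D == real (card (modes n))*6*(64*9*(2^Suc n*(2^Suc n*9217)))"
 shows "level_energy (Suc n) t+1/2*dissipated (Suc n) s t <= level_energy (Suc n) s+3*D*SI {s..t} (rate (Suc n))"
proof -
 have i2: "SIB {s..t} (%r. (F (Suc n) r)^2)" by (intro continuous_Icc_integrable continuous_on_power F_continuous n st)
 have "SI {s..t} (lower_rate n) = (LI r. D*(indicator {s..t} r*(F (Suc n) r)^2))"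
  by (intro integral_cong refl) (simp only: lower_rate_def D_def mult_ac)
 also have "... = D*SI {s..t} (%r. (F (Suc n) r)^2)" by simp
 also have "... <= D*SI {s..t} (rate (Suc n))"
 proof (rule mult_left_mono[OF integral_mono[OF i2 rate_integrable[OF st n(2)]]])
  show "indicator {s..t} r*(F (Suc n) r)^2 <= indicator {s..t} r*rate (Suc n) r" for r
   unfolding power2_eq_square rate_def using M0[of r] F_nonneg[of "Suc n" r] by (intro mult_left_mono mult_right_mono) auto
 qed (simp add: D_def)
 finally show ?thesis using level_k_inequality[OF st n] by linarith
qed

lemma level_step:
 assumes k: "Suc n <= m"
 shows "EX C>=0. ALL s t. 0 < s --> s <= t --> t < T --> level_energy (Suc n) t+1/2*dissipated (Suc n) s t
 <= level_energy (Suc n) s+C*SI {s..t} (rate (Suc n))"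
proof -
 consider "n = 0" | "n = 1" | "n >= 2" by linarith
 thus ?thesis
 proof cases
  case 1
  have "- 2*(E (Suc (Suc 0)) r+(SUM v:words 0. transport_work v r)+(SUM w:words (Suc 0). hall_work w r))
   <= - E (Suc (Suc 0)) r+10^17*rate (Suc 0) r" if "hall_slice m T u b \<pi> r (M r)" for r
  proof -
   have bound: "10^17*((M r+F 1 r)*E 1 r) <= 10^17*((M r+F 1 r)*F 1 r)" using M0[of r] F_nonneg[of 1 r] E_le_F[of 1 1 r] by (intro mult_left_mono) auto
   from hall_slice.level_1_rate[OF that] have "- 2*(E 2 r+(SUM v:words 0. transport_work v r)+(SUM w:words (Suc 0). hall_work w r))
    <= - E 2 r+10^17*((M r+F 1 r)*E 1 r)"
    by (simp only: mult.assoc)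
   from order_trans[OF this add_left_mono[OF bound]] show ?thesis unfolding rate_def numeral_2_eq_2 One_nat_def .
  qed
  note step = this
  show ?thesis using critical_step[of _ _ 0 "10^17", OF _ _ _ _ step] m3 1 by (intro exI[of _ "10^17"]) (auto simp: level_energy_def)
 next
  case 2
  have "- 2*(E (Suc (Suc 1)) r+(SUM v:words 1. transport_work v r)+(SUM w:words (Suc 1). hall_work w r))
   <= - E (Suc (Suc 1)) r+10^24*rate (Suc 1) r" if "hall_slice m T u b \<pi> r (M r)" for r
   using hall_slice.level_2_rate[OF that] unfolding rate_def mult.assoc numeral_2_eq_2 numeral_3_eq_3 One_nat_def .
  note step = this
  show ?thesis using critical_step[of _ _ 1 "10^24", OF _ _ _ _ step] m3 2 by (intro exI[of _ "10^24"]) (auto simp: level_energy_def)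
 next
  case 3
  show ?thesis using high_level_step[OF _ _ _ 3 k] by (intro exI[of _ "3*(real (card (modes n))*6*(64*9*(2^Suc n*(2^Suc n*9217))))"]) auto
 qed
qed

context
 fixes t0 K C :: real and n :: nat
 assumes t0: "0 < t0" "t0 < T" and n: "Suc n <= m" and K0: "0 <= K" and C0: "0 <= C"
 and lower: "!!t. t:{t0..<T} ==> F n t <= K"
 and lower_dissipation: "!!t. t:{t0..<T} ==> dissipated n t0 t <= K"
begin

definition absorbing_rate :: "real => real" where "absorbing_rate t = C*(K+1)*(M t+K+E (Suc n) t)"

lemma absorbing_rate_nonneg: "0 <= absorbing_rate t"
 unfolding absorbing_rate_def using C0 K0 M0[of t] E_nonneg[of "Suc n" t] by simp

lemma absorbing_rate_integrable: "SIB {t0..<T} absorbing_rate"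
proof -
 have "IB (%t. indicator {t0..<T} t *\<^sub>R (indicator {0<..<T} t*M t))" by (rule integrable_mult_indicator[OF _ Mi]) simp
 moreover have "(%t. indicator {t0..<T} t *\<^sub>R (indicator {0<..<T} t*M t)) = (%t. indicator {t0..<T} t*M t)" using t0
  by (auto simp: fun_eq_iff indicator_def)
 ultimately have iM: "SIB {t0..<T} M" by simp
 have iK: "SIB {t0..<T} (%t. K)" by (intro integrable_mult_left integrable_real_indicator) (use t0 in auto)
 have "continuous_on {t0..<T} (E (Suc n))" by (rule continuous_on_subset[OF E_continuous[OF n]]) (use t0 in auto)
 hence iE: "SIB {t0..<T} (E (Suc n))"
  by (rule integrable_from_bounded[OF t0(2) _ E_nonneg]) (use lower_dissipation n in "auto simp: dissipated_def")
 have "indicator {t0..<T} t*absorbing_rate t = C*(K+1)*(indicator {t0..<T} t*M t+indicator {t0..<T} t*K+indicator {t0..<T} t*E (Suc n) t)" for t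
  unfolding absorbing_rate_def by (simp add: indicator_def)
 thus ?thesis using iM iK iE by simp
qed

lemma rate_le_absorbing:
 assumes t: "t:{t0..<T}" and S: "E (Suc n) t <= S" "0 <= S" shows "C*rate (Suc n) t <= (1+S)*absorbing_rate t"
proof -
 have F: "F (Suc n) t <= K+E (Suc n) t" using lower[OF t] by (simp add: F_def)
 moreover have "K+S <= (K+1)*(1+S)" using K0 S by (simp add: algebra_simps)
 ultimately have "F (Suc n) t <= (K+1)*(1+S)" using S by linarith
 hence "rate (Suc n) t <= (M t+K+E (Suc n) t)*((K+1)*(1+S))"
  unfolding rate_def using F M0[of t] K0 F_nonneg[of "Suc n" t] E_nonneg[of "Suc n" t] by (intro mult_mono) auto
 from mult_left_mono[OF this C0] show ?thesis by (simp add: absorbing_rate_def mult_ac)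
qed

lemma rate_integral_absorbed:
 assumes st: "t0 <= s" "s <= t" "t < T" and S: "!!r. r:{s..t} ==> E (Suc n) r <= S" "0 <= S"
 shows "C*SI {s..t} (rate (Suc n)) <= (1+S)*SI {s..t} absorbing_rate"
proof -
 have "IB (%r. indicator {s..t} r *\<^sub>R (indicator {t0..<T} r*absorbing_rate r))"
  by (rule integrable_mult_indicator[OF _ absorbing_rate_integrable]) simp
 moreover have "(%r. indicator {s..t} r *\<^sub>R (indicator {t0..<T} r*absorbing_rate r)) = (%r. indicator {s..t} r*absorbing_rate r)" using st
  by (auto simp: fun_eq_iff indicator_def)
 ultimately have ia: "SIB {s..t} absorbing_rate" by simp
 have ir: "SIB {s..t} (rate (Suc n))" by (rule rate_integrable) (use t0 st n in auto)
 have "(LI r. C*(indicator {s..t} r*rate (Suc n) r)) <= (LI r. (1+S)*(indicator {s..t} r*absorbing_rate r))"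
  by (rule integral_mono[OF integrable_mult_right[OF ir] integrable_mult_right[OF ia]])
  (use rate_le_absorbing[OF _ S(1)] S(2) st in "auto simp: indicator_def")
 thus ?thesis by simp
qed

end

lemma next_level_bounded:
 assumes t0: "0 < t0" "t0 < T" and n: "Suc n <= m" and K0: "0 <= K"
 and lower: "!!t. t:{t0..<T} ==> F n t <= K" "!!t. t:{t0..<T} ==> dissipated n t0 t <= K"
 shows "EX C. ALL t:{t0..<T}. F (Suc n) t <= C & dissipated (Suc n) t0 t <= C"
proof -
 obtain C where C: "C >= 0" "!!s t. 0 < s ==> s <= t ==> t < T ==> level_energy (Suc n) t+1/2*dissipated (Suc n) s t
  <= level_energy (Suc n) s+C*SI {s..t} (rate (Suc n))" using level_step[OF n] by blast
 note ctx = t0 n K0 C(1) lower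
 have "EX C. ALL t:{t0..<T}. level_energy (Suc n) t <= C & 1/2*dissipated (Suc n) t0 t <= C"
 proof (rule Gronwall_absorbing[OF t0(2) absorbing_rate_integrable[OF ctx]])
  show "0 <= absorbing_rate K C n t" for t by (rule absorbing_rate_nonneg[OF ctx])
  show "continuous_on {t0..<T} (level_energy (Suc n))" by (rule continuous_on_subset[OF level_energy_continuous[OF n]]) (use t0 in auto)
  show "0 <= level_energy (Suc n) t" for t by (rule level_energy_bounds)
  show "0 <= 1/2*dissipated (Suc n) s t" for s t using dissipated_nonneg by simp
  fix s t S assume st: "t0 <= s" "s <= t" "t < T" and S: "!!r. r:{s..t} ==> level_energy (Suc n) r <= S"
  have "E (Suc n) r <= S" if "r:{s..t}" for r using S[OF that] level_energy_bounds(1)[of "Suc n" r] by simp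
  moreover have "0 <= S" using S[of s] level_energy_bounds(3)[of "Suc n" s] st by simp
  ultimately have "C*SI {s..t} (rate (Suc n)) <= (1+S)*SI {s..t} (absorbing_rate K C n)"
   using rate_integral_absorbed[OF ctx st, of S] by blast
  thus "level_energy (Suc n) t+1/2*dissipated (Suc n) s t <= level_energy (Suc n) s+(1+S)*SI {s..t} (absorbing_rate K C n)"
   using C(2)[of s t] st t0 by linarith
 qed
 then obtain D where D: "!!t. t:{t0..<T} ==> level_energy (Suc n) t <= D & 1/2*dissipated (Suc n) t0 t <= D" by blast
 have "F (Suc n) t <= K+2*D & dissipated (Suc n) t0 t <= K+2*D" if "t:{t0..<T}" for t
  using lower(1)[OF that] D[OF that] level_energy_bounds[of "Suc n" t] K0 by (auto simp: F_def)
 thus ?thesis by blast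
qed

lemma levels_bounded:
 assumes t0: "0 < t0" "t0 < T"
 shows "k <= m ==> EX C. ALL t:{t0..<T}. F k t <= C & dissipated k t0 t <= C"
proof (induction k)
 case 0
 have "F 0 t <= E 0 t0 & dissipated 0 t0 t <= E 0 t0" if "t:{t0..<T}" for t
  using energy_equality_0(2)[of t0 t] dissipated_nonneg[of 0 t0 t] t0 that E_nonneg[of 0 t] m3 by (simp add: F_def dissipated_def)
 thus ?case by blast
next
 case (Suc n)
 then obtain C where C: "!!t. t:{t0..<T} ==> F n t <= C & dissipated n t0 t <= C" by fastforce
 show ?case by (rule next_level_bounded[OF t0 Suc.prems, of "max C 0"]) (use C in "auto simp: le_max_iff_disj")
qed

lemma Hm_bounded:
 assumes t0: "0 < t0" "t0 < T"
 shows "EX C. ALL t:{t0..<T}. (Hm_norm m (u t))^2 <= C & (Hm_norm m (b t))^2 <= C"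
proof -
 obtain C where C: "!!t. t:{t0..<T} ==> F m t <= C" using levels_bounded[OF t0 order_refl] by blast
 define N where "N = real (card {a::3 => nat. sum a UNIV <= m})*(3*C)"
 have "(Hm_norm m (u t))^2 <= N & (Hm_norm m (b t))^2 <= N" if t: "t:{t0..<T}" for t
 proof -
  have tT: "t:{0<..<T}" using t t0 by auto
  have "L2sq (pds w (W c i t)) <= C" if "length w <= m" for w c i using order_trans[OF L2sq_le_F[OF that] C[OF t]] .
  from this[of _ True] this[of _ False] show ?thesis unfolding N_def
   using W_Hs[OF tT, of True] W_Hs[OF tT, of False] unfolding W_eq by (intro conjI Hm_le_L2sq_pds smooth3_ub tT)
 qed
 thus ?thesis by blast
qed

end

lemma Hm_bounded_near_0:
 obtains t0 C where "0 < t0" "t0 < T" "!!t. t:{0..<t0} ==> (Hm_norm m (u t))^2 <= C & (Hm_norm m (b t))^2 <= C"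
proof -
 define Hu where "Hu s = Hm_norm m (%x. u s x-u 0 x)" for s
 define Hb where "Hb s = Hm_norm m (%x. b s x-b 0 x)" for s
 have "(Hu \<longlongrightarrow> 0) (at 0 within {0..<T})" "(Hb \<longlongrightarrow> 0) (at 0 within {0..<T})"
  using sol T0 by (auto simp: hall_mhd_local_smooth_solution_def Hu_def[abs_def] Hb_def[abs_def])
 from this[THEN order_tendstoD(2), of 1] have "\<forall>\<^sub>F s in at 0 within {0..<T}. Hu s < 1 & Hb s < 1"
  by (auto intro: eventually_conj)
 then obtain d where d: "d > 0" "!!s. s:{0..<T} ==> s ~= 0 ==> <|s|> < d ==> Hu s < 1 & Hb s < 1"
  unfolding eventually_at by (auto simp: dist_real_def)
 define D where "D = 2+2*(Hm_norm m (u 0))^2+2*(Hm_norm m (b 0))^2"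
 show thesis
 proof (rule that[of "min d T/2" D])
  fix t assume "t:{0..<min d T/2}"
  hence t: "t:{0..<T}" "t < d" by auto
  have z: "0:{0..<T}" using T0 by simp
  have "0 <= (Hm_norm m (u 0))^2" "0 <= (Hm_norm m (b 0))^2" by simp_all
  moreover have "(Hu t)^2 <= 1" "(Hb t)^2 <= 1" if "t ~= 0"
   using d(2)[OF t(1) that] t that Hm_norm_nonneg by (simp_all add: power_le_one Hu_def Hb_def)
  ultimately show "(Hm_norm m (u t))^2 <= D & (Hm_norm m (b t))^2 <= D"
   using Hm_norm_triangle[OF in_Hm_ub(1)[OF t(1)] in_Hm_ub(1)[OF z]] Hm_norm_triangle[OF in_Hm_ub(2)[OF t(1)] in_Hm_ub(2)[OF z]]
   unfolding D_def Hu_def Hb_def by (cases "t = 0") (simp, linarith)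
 qed (use d T0 in auto)
qed

end

lemma powr_split:
 fixes v M p a :: real
 assumes "0 <= v" "0 < M" and "(v <= M & p <= a) | (M <= v & a <= p)"
 shows "v powr a <= M powr (a-p) * v powr p"
proof (cases "v = 0")
 case False
 hence v: "v > 0" using assms by simp
 have "v powr (a-p) <= M powr (a-p)" using assms v powr_mono2[of "a-p" v M] powr_mono2'[of "a-p" M v] by auto
 hence "v powr (a-p) * v powr p <= M powr (a-p) * v powr p" by (intro mult_right_mono) auto
 thus ?thesis using v by (simp flip: powr_add)
qed simp

lemma trunc_power:
 fixes V :: "scalar" and X :: "R3 set"
 assumes V: "BM V" "!!x. 0 <= V x" and i: "IB (%x. V x powr p)" and N: "N > 0"
 and X: "X:sets borel" "!!x. x:X ==> (V x <= N & p <= real n) | (N <= V x & real n <= p)" and n: "n > 0"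
 shows "IB (%x. (indicator X x*V x)^n)" "(LI x. (indicator X x*V x)^n) <= N powr (real n-p)*(LI x. V x powr p)" (is ?A)
proof -
 have bound: "(indicator X x*V x)^n <= N powr (real n-p)*V x powr p" for x
 proof (cases "x:X")
  case True
  have "V x^n = V x powr real n" using V(2)[of x] n by (simp add: powr_realpow')
  thus ?thesis using powr_split[OF V(2) N X(2)[OF True]] True by simp
 qed (use n in "simp add: zero_power")
 have [measurable]: "BM V" "X:sets borel" by (rule V X)+
 show a: "IB (%x. (indicator X x*V x)^n)"
  by (rule integrable_bound[OF integrable_mult_right[OF i, of "N powr (real n-p)"]]) (use bound V(2) in auto)
 show ?A using integral_mono[OF a integrable_mult_right[OF i] bound] by simp
qed

lemma split_bound_Lp:
 fixes h :: "R3 => 'b::real_normed_vector"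
 assumes h: "in_Lp lborel (ereal p) h" and p: "2 <= p" "p <= 3" and M: "M >= 1"
 and N: "<|Lp_norm lborel (ereal p) h|> powr (2*p/(2*p-3)) <= M"
 shows "split_bound (%x. norm (h x)) M"
proof -
 define V where "V x = norm (h x)" for x
 have V: "BM V" "!!x. 0 <= V x" "IB (%x. V x powr p)" using h by (auto simp: in_Lp_def V_def[abs_def])
 note [measurable] = V(1)
 define A where "A = (LI x. V x powr p)"
 have A0: "A >= 0" unfolding A_def by simp
 have M0: "M > 0" using M by simp
 have exponent: "1/p*(2*p/(2*p-3))*(p-3/2) = 1" using p by (simp add: field_simps)
 have "A = ((A powr (1/p)) powr (2*p/(2*p-3))) powr (p-3/2)" unfolding powr_powr exponent using A0 by simp
 also have "... <= M powr (p-3/2)" using N p by (intro powr_mono2) (auto simp: Lp_norm_def A_def V_def)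
 finally have AM: "A <= M powr (p-3/2)" .
 have "M powr (2-p)*A <= M powr (2-p)*M powr (p-3/2)" by (intro mult_left_mono AM) simp
 also have "... = sqrt M" using M0 by (simp add: powr_half_sqrt flip: powr_add)
 finally have two: "M powr (2-p)*A <= sqrt M" .
 have "M powr (3-p)*A <= M powr (3-p)*M powr (p-3/2)" by (intro mult_left_mono AM) simp
 also have "... = M powr (1+1/2)" by (simp flip: powr_add)
 also have "... = M * sqrt M" using M0 unfolding powr_add by (simp add: powr_half_sqrt)
 finally have three: "M powr (3-p)*A <= M * sqrt M" .
 note trunc = trunc_power[OF V M0, folded A_def]
 have "IB (%x. peak M V x^2)" "(LI x. peak M V x^2) <= M powr (real 2-p)*A" "IB (%x. bulk M V x^3)" "(LI x. bulk M V x^3) <= M powr (real 3-p)*A"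
  unfolding peak_def bulk_def by (rule trunc; use p in auto)+
 thus ?thesis unfolding split_bound_def V_def[symmetric] using V M two three by auto
qed

lemma powr_le_one_add:
 fixes a q p :: real assumes "0 <= a" "0 < q" "q <= p" shows "a powr q <= 1+a powr p"
proof (cases "a <= 1")
 case True
 hence "a powr q <= 1 powr q" using assms by (intro powr_mono2) auto
 thus ?thesis by (simp add: add_increasing2)
next
 case False
 hence "a powr q <= a powr p" using assms by (intro powr_mono) auto
 thus ?thesis by simp
qed

lemma Lp_time_power:
 fixes N :: "real => real"
 assumes N: "in_Lp (restrict_space lborel {0<..<T}) r N" and q: "q > 0" "ereal q <= r"
 shows "SIB {0<..<T} (%t. <|N t|> powr q)"
proof -
 have ms: "{0<..<T} \<inter> space lborel:sets lborel" by simp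
 have "emeasure lborel {0<..<T} < \<infinity>" by (rule emeasure_bounded_finite) simp
 hence const: "SIB {0<..<T} (%t. c)" for c :: real by (intro integrable_mult_left integrable_real_indicator) auto
 have "(%t. indicator {0<..<T} t *\<^sub>R N t):borel_measurable lborel"
  using N borel_measurable_restrict_space_iff[OF ms, of N] by (simp add: in_Lp_def)
 hence "(%t. indicator {0<..<T} t*<|indicator {0<..<T} t *\<^sub>R N t|> powr q):borel_measurable lborel" by measurable
 moreover have "(%t. indicator {0<..<T} t*<|indicator {0<..<T} t *\<^sub>R N t|> powr q) = (%t. indicator {0<..<T} t*<|N t|> powr q)"
  by (auto simp: indicator_def fun_eq_iff)
 ultimately have m: "(%t. indicator {0<..<T} t*<|N t|> powr q):borel_measurable lborel" by simp
 show ?thesis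
 proof (cases "r = \<infinity>")
  case True
  then obtain C where "AE t in restrict_space lborel {0<..<T}. norm (N t) <= C" using N by (auto simp: in_Lp_def)
  hence "AE t in lborel. t:{0<..<T} --> norm (N t) <= C" by (subst (asm) AE_restrict_space_iff[OF ms])
  hence "AE t in lborel. norm (indicator {0<..<T} t*<|N t|> powr q) <= norm (indicator {0<..<T} t*C powr q)"
   by eventually_elim (use q in "auto simp: indicator_def intro!: powr_mono2")
  thus ?thesis by (rule integrable_bound[OF const m])
 next
  case False
  then obtain p where p: "r = ereal p" "q <= p" using q by (cases r) auto
  have "integrable (restrict_space lborel {0<..<T}) (%t. norm (N t) powr p)" using N p False by (simp add: in_Lp_def)
  hence i: "IB (%t. indicator {0<..<T} t *\<^sub>R (norm (N t) powr p))" by (subst (asm) integrable_restrict_space[OF ms])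
  show ?thesis by (rule integrable_bound[OF integrable_add[OF const[of 1] i] m])
   (use powr_le_one_add[OF _ q(1) p(2)] in "auto simp: indicator_def add_nonneg_nonneg")
 qed
qed

lemma Serrin_exponent_le:
 fixes c p :: real and r :: ereal
 assumes e: "3/ereal p+2/r <= ereal c" "1 <= r" and p: "0 < p" "3 < c*p"
 shows "ereal (2*p/(c*p-3)) <= r"
proof (cases r)
 case (real r')
 have r': "r' >= 1" using e real by simp
 have "3/p+2/r' <= c" using e(1) p r' unfolding real by simp
 hence "2*p <= r'*(c*p-3)" using p r' by (simp add: field_simps)
 thus ?thesis unfolding real using p by (simp add: divide_le_eq)
qed (use e in auto)

lemma Serrin_peak_finite:
 fixes g :: "R3 => R3"
 assumes g: "in_Lp lborel (ereal p) g" and p: "3 < p" and k: "\<kappa> > 0" and M: "1 <= M"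
 "(1/\<kappa>) powr (2/(p-3))*<|Lp_norm lborel (ereal p) g|> powr (2*p/(p-3)) <= M"
 shows "IB (%x. peak (sqrt M) (%x. norm (g x)) x^3)" "(LI x. peak (sqrt M) (%x. norm (g x)) x^3) <= \<kappa>" (is ?A)
proof -
 define A c q where "A = (LI x. norm (g x) powr p)" and "c = (1/\<kappa>) powr (2/(p-3))" and "q = 2*p/(p-3)"
 have A0: "A >= 0" unfolding A_def by simp
 have gm [measurable]: "BM (%x. norm (g x))" and i: "IB (%x. norm (g x) powr p)" using g by (auto simp: in_Lp_def)
 have N: "Lp_norm lborel (ereal p) g = A powr (1/p)" unfolding Lp_norm_def A_def by simp
 have e: "2/(p-3)*((p-3)/2) = 1" "1/p*q*((p-3)/2) = 1" unfolding q_def using p by simp_all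
 have "(c*(A powr (1/p)) powr q) powr ((p-3)/2) = c powr ((p-3)/2)*A powr (1/p*q*((p-3)/2))"
  by (simp only: powr_mult powr_powr powr_ge_zero c_def mult.assoc)
 hence "1/\<kappa>*A = (c*(A powr (1/p)) powr q) powr ((p-3)/2)" unfolding e(2) c_def powr_powr e(1) using k A0 by simp
 also have "... <= M powr ((p-3)/2)"
  using M(2) p unfolding N c_def[symmetric] q_def[symmetric] by (intro powr_mono2) (auto simp: c_def)
 finally have AM: "A <= \<kappa>*M powr ((p-3)/2)" using k by (simp add: field_simps)
 have s0: "sqrt M > 0" using M by simp
 note trunc = trunc_power[OF gm _ i s0, of "{x. norm (g x) > sqrt M}" 3, folded A_def]
 show "IB (%x. peak (sqrt M) (%x. norm (g x)) x^3)" unfolding peak_def by (rule trunc(1)) (use p in auto)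
 have "(LI x. peak (sqrt M) (%x. norm (g x)) x^3) <= sqrt M powr (real 3-p)*A" unfolding peak_def by (rule trunc(2)) (use p in auto)
 also have "... <= sqrt M powr (real 3-p)*(\<kappa>*M powr ((p-3)/2))" by (intro mult_left_mono AM) simp
 also have "... = \<kappa>*(M powr (1/2*(3-p))*M powr ((p-3)/2))" using M by (simp add: powr_powr flip: powr_half_sqrt)
 also have "... = \<kappa>" using M by (simp add: field_simps flip: powr_add)
 finally show ?A .
qed

lemma AE_norm_le_Lp_infinity:
 fixes g :: "R3 => R3"
 assumes g: "in_Lp lborel \<infinity> g" shows "AE x in lborel. norm (g x) <= Lp_norm lborel \<infinity> g"
proof -
 have [measurable]: "BM (%x. norm (g x))" using g by (auto simp: in_Lp_def)
 define S where "S = esssup lborel (%x. ereal (norm (g x)))"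
 obtain C where C: "AE x in lborel. norm (g x) <= C" using g by (auto simp: in_Lp_def)
 have SC: "S <= ereal C" unfolding S_def by (rule esssup_I) (use C in auto)
 have AS: "AE x in lborel. ereal (norm (g x)) <= S" unfolding S_def by (rule esssup_AE)
 have "S ~= -\<infinity>"
 proof
  assume "S = -\<infinity>"
  hence "AE x in (lborel::R3 measure). False" using AS by auto
  thus False by (simp add: eventually_False ae_filter_eq_bot_iff)
 qed
 hence S: "S = ereal (real_of_ereal S)" using SC by (cases S) auto
 from AS show ?thesis
 proof eventually_elim
  case (elim x)
  hence "ereal (norm (g x)) <= ereal (real_of_ereal S)" by (subst S[symmetric])
  thus ?case by (simp add: Lp_norm_def S_def)
 qed
qed

lemma Serrin_peak_infinite:
 fixes g :: "R3 => R3"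
 assumes g: "in_Lp lborel \<infinity> g" and M: "<|Lp_norm lborel \<infinity> g|> powr 2 <= M"
 shows "IB (%x. peak (sqrt M) (%x. norm (g x)) x^3)" "(LI x. peak (sqrt M) (%x. norm (g x)) x^3) = 0" (is ?A)
proof -
 have "Lp_norm lborel \<infinity> g <= sqrt M" using M by (intro real_le_rsqrt) simp
 hence z: "AE x in lborel. peak (sqrt M) (%x. norm (g x)) x^3 = 0"
  using AE_norm_le_Lp_infinity[OF g] by (auto simp: peak_def elim!: eventually_mono)
 have m: "(%x. peak (sqrt M) (%x. norm (g x)) x^3):borel_measurable lborel"
  using peak_bulk_measurable(1)[of "%x. norm (g x)"] g by (auto simp: in_Lp_def)
 show "IB (%x. peak (sqrt M) (%x. norm (g x)) x^3)" using z m by (subst integrable_cong_AE[of _ _ "%x. 0"]) auto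
 show ?A using integral_cong_AE[OF m _ z] by simp
qed

lemma Serrin_truncation:
 assumes p: "3 < p" and k: "\<kappa> > 0" and exps: "3/p+2/r <= 1" "1 <= r"
 obtains c q :: real where "c >= 0" "q > 0" "ereal q <= r"
 "!!(g::R3 => R3) M. in_Lp lborel p g ==> 1 <= M ==> c*<|Lp_norm lborel p g|> powr q <= M ==>
 IB (%x. peak (sqrt M) (%x. norm (g x)) x^3) & (LI x. peak (sqrt M) (%x. norm (g x)) x^3) <= \<kappa>"
proof (cases p)
 case (real p')
 have p': "3 < p'" using p real by simp
 show thesis
 proof (rule that[of "(1/\<kappa>) powr (2/(p'-3))" "2*p'/(p'-3)"])
  show "ereal (2*p'/(p'-3)) <= r" using Serrin_exponent_le[of p' r 1] exps p' by (simp add: real one_ereal_def)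
 qed (use p' k Serrin_peak_finite in "auto simp: real")
next
 case PInf
 have "ereal 2 <= r"
 proof (cases r)
  case (real r')
  have "2/r' <= 1" "r' >= 1" using exps unfolding PInf real by auto
  thus ?thesis unfolding real by (simp add: divide_le_eq)
 qed (use exps in auto)
 thus thesis using Serrin_peak_infinite k by (intro that[of 1 2]) (auto simp: PInf less_imp_le)
qed (use p in auto)

context hall_solution
begin

lemma hall_slices:
 assumes exps1: "3 < p1" "1 <= r1" "3/p1+2/r1 <= 1" and exps2: "2 <= p2" "p2 <= 3" "1 <= r2" "3/p2+2/r2 <= 2"
 and uh: "LrLp r1 p1 T (%t x. horiz (u t x))" and bh: "LrLp r2 p2 T (%t. hess (%x. horiz (b t x)))"
 obtains M where "SIB {0<..<T} M" "!!t. 0 <= M t"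
 "AE t in lborel. t:{0<..<T} --> hall_slice m T u b \<pi> t (M t)"
proof -
 obtain p where p: "p2 = ereal p" "2 <= p" "p <= 3" using exps2 by (cases p2) auto
 define q2 where "q2 = 2*p/(2*p-3)"
 have q2: "q2 > 0" "ereal q2 <= r2" unfolding q2_def using Serrin_exponent_le[of p r2 2] exps2 p by auto
 obtain c q1 :: real where c: "c >= 0" "q1 > 0" "ereal q1 <= r1"
  and S: "!!(g::R3 => R3) M. in_Lp lborel p1 g ==> 1 <= M ==> c*<|Lp_norm lborel p1 g|> powr q1 <= M ==>
  IB (%x. peak (sqrt M) (%x. norm (g x)) x^3) & (LI x. peak (sqrt M) (%x. norm (g x)) x^3) <= 1/10^14"
  by (rule Serrin_truncation[OF exps1(1) _ exps1(3,2), of "1/10^14"]) auto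
 define N1 where "N1 t = <|Lp_norm lborel p1 (%x. horiz (u t x))|> powr q1" for t
 define N2 where "N2 t = <|Lp_norm lborel p2 (hess (%x. horiz (b t x)))|> powr q2" for t
 define M where "M t = 1+c*N1 t+N2 t" for t
 have M: "M t >= 1" "c*N1 t <= M t" "N2 t <= M t" for t unfolding M_def N1_def N2_def using c(1) by auto
 have "SIB {0<..<T} N1" "SIB {0<..<T} N2"
  unfolding N1_def N2_def using uh bh c q2 by (auto simp: LrLp_def intro!: Lp_time_power)
 moreover have "IB (%t. indicator {0<..<T} t::real)" using T0 by (intro integrable_real_indicator) (auto simp: emeasure_lborel_Ioo)
 moreover have "indicator {0<..<T} t*M t = indicator {0<..<T} t+c*(indicator {0<..<T} t*N1 t)+indicator {0<..<T} t*N2 t" for t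
  unfolding M_def by (simp add: algebra_simps)
 ultimately have Mi: "SIB {0<..<T} M" by simp
 have "AE t in lborel. t:{0<..<T} --> in_Lp lborel p1 (%x. horiz (u t x))" "AE t in lborel. t:{0<..<T} --> in_Lp lborel p2 (hess (%x. horiz (b t x)))"
  using uh bh unfolding LrLp_def by (auto simp: AE_restrict_space_iff)
 hence "AE t in lborel. t:{0<..<T} --> hall_slice m T u b \<pi> t (M t)"
 proof eventually_elim
  case (elim t)
  show ?case
  proof
   assume t: "t:{0<..<T}"
   have "split_bound (hess_bh t) (M t)"
    unfolding hess_bh_def[abs_def] using elim t M p by (intro split_bound_Lp[of p]) (auto simp: N2_def q2_def)
   thus "hall_slice m T u b \<pi> t (M t)" using S[of "%x. horiz (u t x)" "M t"] elim t M unfolding N1_def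
    by (intro hall_slice.intro hall_slice_axioms.intro hall_solution_axioms) (auto simp: norm_uh_def[abs_def])
  qed
 qed
 moreover have "0 <= M t" for t using M(1)[of t] by simp
 ultimately show thesis using Mi by (intro that)
qed

end

theorem theorem2p1:
  fixes m :: nat and T :: real
    and uin bin :: "R3 \<Rightarrow> R3"
    and u b :: "real \<Rightarrow> R3 \<Rightarrow> R3" and \<pi> :: "real \<Rightarrow> R3 \<Rightarrow> real"
    and p1 r1 p2 r2 :: ereal
  assumes m: "real m > 5 / 2"
    and T: "T > 0"
    and init: "in_Hm m uin" "in_Hm m bin" "weakly_div_free uin" "weakly_div_free bin"
    and sol: "hall_mhd_local_smooth_solution m T uin bin u b \<pi>"
    and exps1: "3 < p1" "1 \<le> r1" "3 / p1 + 2 / r1 \<le> 1"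
    and exps2: "2 \<le> p2" "p2 \<le> 3" "1 \<le> r2" "3 / p2 + 2 / r2 \<le> 2"
    and uh: "LrLp r1 p1 T (\<lambda>t x. horiz (u t x))"
    and bh: "LrLp r2 p2 T (\<lambda>t. hess (\<lambda>x. horiz (b t x)))"
  shows "\<exists>C. \<forall>t\<in>{0..<T}. Hm_norm m (u t) + Hm_norm m (b t) \<le> C"
proof -
 have "u 0 = uin" "b 0 = bin" using sol by (auto simp: hall_mhd_local_smooth_solution_def)
 then interpret hall_solution m T u b \<pi> by unfold_locales (use m T sol init(4) in auto)
 obtain M where M: "SIB {0<..<T} M" "!!t. 0 <= M t"
  "AE t in lborel. t:{0<..<T} --> hall_slice m T u b \<pi> t (M t)"
  using hall_slices[OF exps1 exps2 uh bh] by blast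
 obtain t0 C where t0: "0 < t0" "t0 < T" and early: "!!t. t:{0..<t0} ==> (Hm_norm m (u t))^2 <= C & (Hm_norm m (b t))^2 <= C"
  using Hm_bounded_near_0 by blast
 obtain D where late: "!!t. t:{t0..<T} ==> (Hm_norm m (u t))^2 <= D & (Hm_norm m (b t))^2 <= D"
  using Hm_bounded[OF M t0] by blast
 have "(Hm_norm m (u t))^2 <= max C D & (Hm_norm m (b t))^2 <= max C D" if "t:{0..<T}" for t
  using that early[of t] late[of t] by (cases "t < t0") (auto simp: le_max_iff_disj)
 hence "Hm_norm m (u t)+Hm_norm m (b t) <= sqrt (max C D)+sqrt (max C D)" if "t:{0..<T}" for t
  using that by (intro add_mono real_le_rsqrt) auto
 thus ?thesis by blast
qed

end
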